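(* Let $\mathcal P_1=\{3,3,3\}$, $\mathcal P_2=\{3,3,4\}$, $\mathcal P_3=\{3,3,5\}$, $\mathcal P_4=\{3,4,3\}$, $\mathcal P_5=\{4,3,3\}$, $\mathcal P_6=\{5,3,3\}$ be the regular convex $4$-polytopes, and for $I=\{i_1,\dots,i_k\}\subseteq\{1,\dots,6\}$ let $\mathcal P_I=\mathcal P_{i_1}\diamond\cdots\diamond\mathcal P_{i_k}$. Let $f_j$ be the number of $j$-faces and $g$ the number of flags of $\mathcal P_I$. For $|I|\in\{2,3\}$ the values $(f_0,f_1,f_2,f_3,g)$, and whether $\mathcal P_I$ is polytopal (Y) or not (N), are as follows. $\{1,2\}$: $(40,480,1920,960,23040)$, Y; $\{1,3\}$: $(600,14400,72000,36000,864000)$, Y; $\{1,4\}$: $(120,5760,5760,120,69120)$, Y; $\{1,5\}$: $(960,1920,480,40,23040)$, Y; $\{1,6\}$: $(36000,72000,14400,600,864000)$, Y; $\{2,3\}$: $(960,34560,230400,115200,2764800)$, Y; $\{2,4\}$: $(192,4608,18432,384,221184)$, Y; $\{2,5\}$: $(128,1536,1536,128,73728)$, N; $\{2,6\}$: $(4800,57600,46080,1920,2764800)$, N; $\{3,4\}$: $(2880,138240,691200,14400,8294400)$, Y; $\{3,5\}$: $(1920,46080,57600,4800,2764800)$, N; $\{3,6\}$: $(72000,1728000,1728000,72000,103680000)$, N; $\{4,5\}$: $(384,18432,4608,192,221184)$, Y; $\{4,6\}$: $(14400,691200,138240,2880,8294400)$, Y; $\{5,6\}$: $(115200,230400,34560,960,2764800)$,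 Y; $\{1,2,3\}$: $(4800,691200,13824000,6912000,165888000)$, Y; $\{1,2,4\}$: $(960,276480,1105920,23040,13271040)$, Y; $\{1,2,5\}$: $(7680,92160,92160,7680,4423680)$, Y; $\{1,2,6\}$: $(288000,3456000,2764800,115200,165888000)$, Y; $\{1,3,4\}$: $(14400,8294400,41472000,864000,497664000)$, Y; $\{1,3,5\}$: $(115200,2764800,3456000,288000,165888000)$, Y; $\{1,3,6\}$: $(4320000,103680000,103680000,4320000,6220800000)$, Y; $\{1,4,5\}$: $(23040,1105920,276480,960,13271040)$, Y; $\{1,4,6\}$: $(864000,41472000,8294400,14400,497664000)$, Y; $\{1,5,6\}$: $(6912000,13824000,691200,4800,165888000)$, Y; $\{2,3,4\}$: $(23040,6635520,132710400,2764800,1592524800)$, Y; $\{2,3,5\}$: $(15360,2211840,11059200,921600,530841600)$, N; $\{2,3,6\}$: $(576000,82944000,331776000,13824000,19906560000)$, N; $\{2,4,5\}$: $(3072,884736,884736,3072,42467328)$, N; $\{2,4,6\}$: $(115200,33177600,26542080,46080,1592524800)$, N; $\{2,5,6\}$: $(921600,11059200,2211840,15360,530841600)$, N; $\{3,4,5\}$: $(46080,26542080,33177600,115200,1592524800)$, N; $\{3,4,6\}$: $(1728000,995328000,995328000,1728000,59719680000)$, N; $\{3,5,6\}$: $(13824000,331776000,82944000,576000,19906560000)$, N; $\{4,5,6\}$: $(2764800,132710400,6635520,23040,1592524800)$, Y.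
   Context: Polytopes. An (abstract) $n$-polytope is a ranked poset with ranks $-1,\dots,n$ such that: there are a unique least face (rank $-1$) and a unique greatest face (rank $n$); every flag (maximal chain) has $n+2$ faces; it is strongly flag-connected (any two flags $\Phi,\Psi$ are joined by a sequence of flags, consecutive ones differing in exactly one face, all containing $\Phi\cap\Psi$); and whenever $F<G$ have ranks $j-1$ and $j+1$ there are exactly two $j$-faces strictly between them. The Schläfli symbols denote the face lattices of the corresponding regular convex polytopes, here of rank $n=4$. For such a polytope $\mathcal P$ with a fixed base flag $\Phi$, its automorphism group is $\langle\rho_0,\dots,\rho_{n-1}\rangle$, where $\rho_i$ maps $\Phi$ to the unique flag differing from $\Phi$ exactly in its $i$-face; the $i$-th entry of the symbol is the order of $\sigma_i=\rho_{i-1}\rho_i$ ($1\le i\le n-1$). The rotation group is $\Gamma^+(\mathcal P)=\langle\sigma_1,\dots,\sigma_{n-1}\rangle$. Mix. For such polytopes $\mathcal Q_1,\dots,\mathcal Q_m$ of rank $n$ with rotation-group generators $\sigma_i^{(r)}$, let $\beta_i=(\sigma_i^{(1)},\dots,\sigma_i^{(m)})$ for $1\le i\le n-1$ and let $\Gamma^+=\langle\beta_1,\dots,\beta_{n-1}\rangle\le\Gamma^+(\mathcal Q_1)\times\cdots\times\Gamma^+(\mathcal Q_m)$. For $J\subseteq\{0,\dots,n-1\}$ put $\Gamma^+_J=\langle\beta_i\beta_{i+1}\cdots\beta_j\mid 1\le i\le j\le n-1,\ i-1\in J,\ j\in J\rangle$. The mix $\mathcal Q_1\diamond\cdots\diamond\mathcal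 Q_m$ is the poset whose $j$-faces ($0\le j\le n-1$) are the right cosets of $\Gamma^+_{\{0,\dots,n-1\}\setminus\{j\}}$ in $\Gamma^+$, together with a least face of rank $-1$ and a greatest face of rank $n$, where a $j$-face is below a $k$-face ($j<k$) if and only if the two cosets intersect. The mix is called polytopal if it is a polytope; equivalently, $\Gamma^+$ satisfies the intersection property $\Gamma^+_J\cap\Gamma^+_K=\Gamma^+_{J\cap K}$ for all $J,K\subseteq\{0,\dots,n-1\}$. *)

theory Defs
  imports
    "HOL-Analysis.Polytope"
    "HOL-Analysis.Finite_Cartesian_Product"
    "HOL-Algebra.Bij"
    "HOL-Algebra.Product_Groups"
    "HOL-Algebra.Multiplicative_Group"
begin

subsection \<open>Abstract polytopes\<close>

record 'a ranked_poset =
  faces :: "'a set"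
  face_le :: "'a \<Rightarrow> 'a \<Rightarrow> bool"
  face_rank :: "'a \<Rightarrow> int"

definition face_less :: "('a, 'm) ranked_poset_scheme \<Rightarrow> 'a \<Rightarrow> 'a \<Rightarrow> bool" where
  "face_less Q F G \<longleftrightarrow> face_le Q F G \<and> F \<noteq> G"

definition faces_of_rank :: "('a, 'm) ranked_poset_scheme \<Rightarrow> int \<Rightarrow> 'a set" where
  "faces_of_rank Q j = {F \<in> faces Q. face_rank Q F = j}"

definition flags :: "('a, 'm) ranked_poset_scheme \<Rightarrow> 'a set set" where
  "flags Q = {\<Phi>. pred_on.maxchain (faces Q) (face_le Q) \<Phi>}"

definition adjacent_flags :: "'a set \<Rightarrow> 'a set \<Rightarrow> bool" where
  "adjacent_flags \<Phi> \<Psi> \<longleftrightarrow> card (\<Phi> - \<Psi>) = 1 \<and> card (\<Psi> - \<Phi>) = 1"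

definition strongly_flag_connected :: "('a, 'm) ranked_poset_scheme \<Rightarrow> bool" where
  "strongly_flag_connected Q \<longleftrightarrow>
     (\<forall>\<Phi>\<in>flags Q. \<forall>\<Psi>\<in>flags Q.
        (\<Phi>, \<Psi>) \<in> {(A, B). A \<in> flags Q \<and> B \<in> flags Q \<and> \<Phi> \<inter> \<Psi> \<subseteq> A \<and> \<Phi> \<inter> \<Psi> \<subseteq> B
                        \<and> adjacent_flags A B}\<^sup>*)"

definition abstract_polytope :: "nat \<Rightarrow> ('a, 'm) ranked_poset_scheme \<Rightarrow> bool" where
  "abstract_polytope n Q \<longleftrightarrow>
     partial_order_on (faces Q) {(F, G). F \<in> faces Q \<and> G \<in> faces Q \<and> face_le Q F G} \<and>
     (\<forall>F\<in>faces Q. - 1 \<le> face_rank Q F \<and> face_rank Q F \<le> int n) \<and>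
     (\<forall>F\<in>faces Q. \<forall>G\<in>faces Q. face_less Q F G \<longrightarrow> face_rank Q F < face_rank Q G) \<and>
     (\<exists>!F. F \<in> faces_of_rank Q (- 1)) \<and>
     (\<forall>F\<in>faces_of_rank Q (- 1). \<forall>G\<in>faces Q. face_le Q F G) \<and>
     (\<exists>!F. F \<in> faces_of_rank Q (int n)) \<and>
     (\<forall>F\<in>faces_of_rank Q (int n). \<forall>G\<in>faces Q. face_le Q G F) \<and>
     (\<forall>\<Phi>\<in>flags Q. card \<Phi> = n + 2) \<and>
     strongly_flag_connected Q \<and>
     (\<forall>j. \<forall>F\<in>faces_of_rank Q (j - 1). \<forall>G\<in>faces_of_rank Q (j + 1). face_less Q F G \<longrightarrow>
        card {H \<in> faces_of_rank Q j. face_less Q F H \<and> face_less Q H G} = 2)"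


subsection \<open>Regular convex polytopes and their face lattices\<close>

text \<open>
  The faces include the empty set, whose affine dimension is -1, and the polytope itself.
\<close>

definition face_lattice :: "'a::euclidean_space set \<Rightarrow> 'a set ranked_poset" where
  "face_lattice P = \<lparr>faces = {F. F face_of P}, face_le = (\<subseteq>), face_rank = aff_dim\<rparr>"

definition regular_convex_polytope :: "nat \<Rightarrow> 'a::euclidean_space set \<Rightarrow> bool" where
  "regular_convex_polytope n P \<longleftrightarrow>
     polytope P \<and> aff_dim P = int n \<and>
     (\<forall>\<Phi>\<in>flags (face_lattice P). \<forall>\<Psi>\<in>flags (face_lattice P).
        \<exists>f :: 'a \<Rightarrow> 'a. (\<forall>x y. dist (f x) (f y) = dist x y) \<and> f ` P = P \<and> (`) f ` \<Phi> = \<Psi>)"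


subsection \<open>Automorphisms and rotations\<close>

definition automorphisms :: "('a, 'm) ranked_poset_scheme \<Rightarrow> ('a \<Rightarrow> 'a) set" where
  "automorphisms Q = {f \<in> Bij (faces Q).
     \<forall>F\<in>faces Q. \<forall>G\<in>faces Q. face_le Q (f F) (f G) \<longleftrightarrow> face_le Q F G}"

definition aut_group :: "('a, 'm) ranked_poset_scheme \<Rightarrow> ('a \<Rightarrow> 'a) monoid" where
  "aut_group Q = BijGroup (faces Q)\<lparr>carrier := automorphisms Q\<rparr>"

definition differ_exactly_at ::
    "('a, 'm) ranked_poset_scheme \<Rightarrow> nat \<Rightarrow> 'a set \<Rightarrow> 'a set \<Rightarrow> bool" where
  "differ_exactly_at Q i \<Phi> \<Psi> \<longleftrightarrow>
     \<Phi> \<noteq> \<Psi> \<and> {F \<in> \<Phi>. face_rank Q F \<noteq> int i} = {F \<in> \<Psi>. face_rank Q F \<noteq> int i}"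

definition rho :: "('a, 'm) ranked_poset_scheme \<Rightarrow> 'a set \<Rightarrow> nat \<Rightarrow> 'a \<Rightarrow> 'a" where
  "rho Q \<Phi> i = (THE f. f \<in> automorphisms Q \<and>
     f ` \<Phi> = (THE \<Psi>. \<Psi> \<in> flags Q \<and> differ_exactly_at Q i \<Phi> \<Psi>))"

text \<open>
  Multiplication in \<open>aut_group\<close> is composition of maps acting on the left.  The opposite convention
  gives an isomorphic mix: inversion fixes each involution \<open>rho\<close> and reverses products.
\<close>

definition sigma :: "('a, 'm) ranked_poset_scheme \<Rightarrow> 'a set \<Rightarrow> nat \<Rightarrow> 'a \<Rightarrow> 'a" where
  "sigma Q \<Phi> i = rho Q \<Phi> (i - 1) \<otimes>\<^bsub>aut_group Q\<^esub> rho Q \<Phi> i"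

definition schlafli_symbol :: "nat \<Rightarrow> ('a, 'm) ranked_poset_scheme \<Rightarrow> 'a set \<Rightarrow> nat list" where
  "schlafli_symbol n Q \<Phi> = map (\<lambda>i. group.ord (aut_group Q) (sigma Q \<Phi> i)) [1..<n]"

definition rotation_group ::
    "nat \<Rightarrow> ('a, 'm) ranked_poset_scheme \<Rightarrow> 'a set \<Rightarrow> ('a \<Rightarrow> 'a) monoid" where
  "rotation_group n Q \<Phi> = subgroup_generated (aut_group Q) (sigma Q \<Phi> ` {1..n - 1})"


subsection \<open>The mix\<close>

text \<open>
  The polytopes to be mixed form a family \<open>Q\<close> indexed by a set \<open>R\<close>, with base flags \<open>\<Phi>\<close>;
  \<open>n\<close> is their common rank.
\<close>

definition mix_beta ::
    "'r set \<Rightarrow> ('r \<Rightarrow> ('a, 'm) ranked_poset_scheme) \<Rightarrow> ('r \<Rightarrow> 'a set) \<Rightarrow> nat \<Rightarrow> 'r \<Rightarrow> 'a \<Rightarrow> 'a" where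
  "mix_beta R Q \<Phi> i = (\<lambda>r\<in>R. sigma (Q r) (\<Phi> r) i)"

definition mix_group ::
    "nat \<Rightarrow> 'r set \<Rightarrow> ('r \<Rightarrow> ('a, 'm) ranked_poset_scheme) \<Rightarrow> ('r \<Rightarrow> 'a set) \<Rightarrow> ('r \<Rightarrow> 'a \<Rightarrow> 'a) monoid" where
  "mix_group n R Q \<Phi> =
     subgroup_generated (product_group R (\<lambda>r. rotation_group n (Q r) (\<Phi> r)))
       (mix_beta R Q \<Phi> ` {1..n - 1})"

definition mix_word ::
    "nat \<Rightarrow> 'r set \<Rightarrow> ('r \<Rightarrow> ('a, 'm) ranked_poset_scheme) \<Rightarrow> ('r \<Rightarrow> 'a set) \<Rightarrow> nat \<Rightarrow> nat
      \<Rightarrow> 'r \<Rightarrow> 'a \<Rightarrow> 'a" where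
  "mix_word n R Q \<Phi> i j =
     foldr (\<lambda>k w. mix_beta R Q \<Phi> k \<otimes>\<^bsub>mix_group n R Q \<Phi>\<^esub> w) [i..<Suc j] \<one>\<^bsub>mix_group n R Q \<Phi>\<^esub>"

definition mix_subgroup ::
    "nat \<Rightarrow> 'r set \<Rightarrow> ('r \<Rightarrow> ('a, 'm) ranked_poset_scheme) \<Rightarrow> ('r \<Rightarrow> 'a set) \<Rightarrow> nat set
      \<Rightarrow> ('r \<Rightarrow> 'a \<Rightarrow> 'a) set" where
  "mix_subgroup n R Q \<Phi> J = generate (mix_group n R Q \<Phi>)
     {mix_word n R Q \<Phi> i j | i j. 1 \<le> i \<and> i \<le> j \<and> j \<le> n - 1 \<and> i - 1 \<in> J \<and> j \<in> J}"

text \<open>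
  The rank is recorded with each coset, because the subgroups for two different ranks need not
  be distinct in general.
\<close>

datatype 'g mix_face = Least_Face | Coset_Face nat "'g set" | Greatest_Face

fun mix_le :: "'g mix_face \<Rightarrow> 'g mix_face \<Rightarrow> bool" where
  "mix_le Least_Face _ = True"
| "mix_le _ Greatest_Face = True"
| "mix_le (Coset_Face j C) (Coset_Face k D) = (j = k \<and> C = D \<or> j < k \<and> C \<inter> D \<noteq> {})"
| "mix_le _ _ = False"

fun mix_rank :: "nat \<Rightarrow> 'g mix_face \<Rightarrow> int" where
  "mix_rank n Least_Face = - 1"
| "mix_rank n (Coset_Face j C) = int j"
| "mix_rank n Greatest_Face = int n"

definition mix ::
    "nat \<Rightarrow> 'r set \<Rightarrow> ('r \<Rightarrow> ('a, 'm) ranked_poset_scheme) \<Rightarrow> ('r \<Rightarrow> 'a set)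
      \<Rightarrow> ('r \<Rightarrow> 'a \<Rightarrow> 'a) mix_face ranked_poset" where
  "mix n R Q \<Phi> =
     \<lparr>faces = {Least_Face, Greatest_Face} \<union>
        {Coset_Face j C | j C. j < n \<and>
           C \<in> rcosets\<^bsub>mix_group n R Q \<Phi>\<^esub> (mix_subgroup n R Q \<Phi> ({..<n} - {j}))},
      face_le = mix_le,
      face_rank = mix_rank n\<rparr>"

end

theory Submission
  imports Defs "HOL-Analysis.Determinants"
begin

text \<open>
  The faces of the mix are cosets in the subgroup \<open>\<Gamma>\<^sup>+\<close> of a product of rotation groups, so the numbers in the table are
  indices of subgroups, and polytopality is a statement about the intersection of two of them. Three ideas
  determine these subgroups.

  Geometry of one polytope. The symmetry that moves the base flag to its \<open>i\<close>-adjacent flag fixes the centroids of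
  the other faces of the base flag, hence is a reflection (\<open>reflection\<close>). The cones spanned by the centroids of
  the faces of a flag do not overlap (\<open>chambers_disjoint\<close>), and therefore a symmetry that fixes some faces of the base
  flag is a product of those reflections that fix them (\<open>stab\<close>). This gives the intersection property for one
  polytope (\<open>inter_03\<close>) and, by orbits and stabilisers, the orders of all subgroups generated by reflections: the
  Schlaefli symbol determines the angles between consecutive mirrors up to sign, and for an entry 5 up to conjugation in
  \<open>\<rat>(\<surd>5)\<close> (\<open>gram\<close>), and in suitable coordinates the orbit of a centroid consists of integral vectors over
  \<open>\<int>[\<tau>]\<close>, where \<open>\<tau>\<^sup>2 = 3\<tau> - 1\<close>, that do not depend on these choices; they are enumerated (\<open>card_gen_chain\<close>).

  Coset posets. Let four involutions with a string diagram generate a group. Each coset of a parabolic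
  subgroup contains orientation preserving elements, so the poset of cosets in the rotation subgroup is the poset of
  cosets in the whole group. Because the outermost involution commutes with the two furthest from it, pairwise
  incident cosets have a common element (\<open>interpolate\<close>, \<open>helly\<close>). Hence flags correspond to group elements and the
  diamond condition holds in every case, and only strong flag-connectedness can fail: it is the
  condition that the subgroups of the vertex figure and of the facet meet in the subgroup generated by
  the two middle involutions (\<open>polytope_M\<close>).

  The product. Powers of one generator isolate a factor: the 45th power of the last generator is trivial in every
  factor except \<open>{3,3,4}\<close>, where it is the generator itself, since the other last entries are 3 and 5; in the same
  way 36 isolates \<open>{3,3,5}\<close>, and 9 isolates \<open>{3,4,3}\<close> at the middle generator; the first generator serves \<open>{4,3,3}\<close> and \<open>{5,3,3}\<close>. The relation \<open>(xy)\<^sup>2 = 1\<close> spreads this from one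
  generator to the next (\<open>emb_propagate\<close>), so \<open>\<Gamma>\<^sup>+\<close> is the full direct product. The same holds for the facet subgroup, except that
  all factors with facets \<open>{3,3}\<close> move together, because the tetrahedral rotation group is presented by
  \<open>a\<^sup>3 = b\<^sup>3 = (ab)\<^sup>2 = 1\<close> (\<open>det_tetra\<close>); dually for vertex figures. The numbers follow from Lagrange's theorem. An element
  of both end subgroups is a power of the middle generator in each factor, and it is a power of the middle generator
  of \<open>\<Gamma>\<^sup>+\<close> if these exponents can be chosen equal. The diagonal parts force this among the factors with facets \<open>{3,3}\<close> and
  among those with vertex figures \<open>{3,3}\<close>, while \<open>{3,4,3}\<close> is harmless because its exponent counts modulo 4 and not
  modulo 3. Thus the intersection property fails exactly if both classes occur and the simplex, which
  belongs to both, is absent (\<open>polytopal\<close>).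
\<close>

section \<open>Groups generated by four involutions with a string diagram\<close>

text \<open>
  The group comes with what geometry supplies: \<open>S i\<close> plays the stabiliser of the face of rank \<open>i\<close> of the base flag in the group
  of all symmetries, and \<open>sg\<close> the determinant. In a product, \<open>S i\<close> is taken componentwise; it may then be larger than
  the parabolic subgroup \<open>P i\<close>, and this is where polytopality is lost. Three of the stabilisers still meet
  in a group of order 2 in \<open>G\<close>, even in a product, because \<open>sg\<close> agrees on all components.
\<close>

locale string_group = group A for A :: "('a,'b) monoid_scheme" (structure) +
  fixes \<rho> :: "nat \<Rightarrow> 'a" and S :: "nat \<Rightarrow> 'a set" and sg :: "'a \<Rightarrow> int"
  assumes rho_closed: "i < 4 \<Longrightarrow> \<rho> i \<in> carrier A"
    and rho_sq: "i < 4 \<Longrightarrow> \<rho> i \<otimes> \<rho> i = \<one>"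
    and rho_comm: "j < 4 \<Longrightarrow> i + 2 \<le> j \<Longrightarrow> \<rho> i \<otimes> \<rho> j = \<rho> j \<otimes> \<rho> i"
    and S_subgroup: "i < 4 \<Longrightarrow> subgroup (S i) A"
    and rho_S: "i < 4 \<Longrightarrow> j < 4 \<Longrightarrow> \<rho> i \<in> S j \<longleftrightarrow> i \<noteq> j"
    and sg_mult: "x \<in> carrier A \<Longrightarrow> y \<in> carrier A \<Longrightarrow> sg (x \<otimes> y) = sg x * sg y"
    and sg_rho: "i < 4 \<Longrightarrow> sg (\<rho> i) = - 1"
    and S_triple: "l < 4 \<Longrightarrow> x \<in> generate A (\<rho> ` {..<4}) \<Longrightarrow> (\<forall>i<4. i \<noteq> l \<longrightarrow> x \<in> S i)
                   \<Longrightarrow> x = \<one> \<or> x = \<rho> l"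
    and finite_G: "finite (generate A (\<rho> ` {..<4}))"
begin

text \<open>
  Standard parabolic subgroups and their rotation subgroups. The latter are generated by products of two generators of
  the same parabolic subgroup, which is the subgroup \<open>\<Gamma>\<^sup>+\<^sub>J\<close> of the mix.
\<close>

definition par :: "nat set \<Rightarrow> 'a set" where
  "par J = generate A (\<rho> ` J)"

definition ev :: "nat set \<Rightarrow> 'a set" where
  "ev J = generate A {\<rho> i \<otimes> \<rho> j | i j. i \<in> J \<and> j \<in> J}"

abbreviation P :: "nat \<Rightarrow> 'a set" where "P j \<equiv> par ({..<4} - {j})"
abbreviation G :: "'a set" where "G \<equiv> par {..<4}"
abbreviation Gp :: "'a set" where "Gp \<equiv> ev {..<4}"

lemma par_subgroup: "J \<subseteq> {..<4} \<Longrightarrow> subgroup (par J) A"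
  unfolding par_def by (rule generate_is_subgroup) (auto simp: rho_closed)

lemma ev_subgroup: "J \<subseteq> {..<4} \<Longrightarrow> subgroup (ev J) A"
  unfolding ev_def by (rule generate_is_subgroup) (auto simp: rho_closed subset_iff)

lemma par_closed: "J \<subseteq> {..<4} \<Longrightarrow> x \<in> par J \<Longrightarrow> x \<in> carrier A"
  using par_subgroup subgroup.mem_carrier by metis

lemma ev_closed: "J \<subseteq> {..<4} \<Longrightarrow> x \<in> ev J \<Longrightarrow> x \<in> carrier A"
  using ev_subgroup subgroup.mem_carrier by metis

lemma par_mono: "J \<subseteq> K \<Longrightarrow> K \<subseteq> {..<4} \<Longrightarrow> par J \<subseteq> par K"
  unfolding par_def by (intro mono_generate image_mono) auto

lemma rho_par: "i \<in> J \<Longrightarrow> \<rho> i \<in> par J"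
  unfolding par_def by (rule generate.incl) auto

lemma inv_rho: "i < 4 \<Longrightarrow> inv (\<rho> i) = \<rho> i"
  by (simp add: rho_closed rho_sq inv_equality)

lemma par_induct [consumes 2, case_names one step]:
  assumes J: "J \<subseteq> {..<4}" and x: "x \<in> par J"
    and one: "Q \<one>"
    and step: "\<And>i y. i \<in> J \<Longrightarrow> y \<in> par J \<Longrightarrow> Q y \<Longrightarrow> Q (\<rho> i \<otimes> y)"
  shows "Q x"
proof -
  have "\<forall>y \<in> par J. Q y \<longrightarrow> Q (z \<otimes> y)" if "z \<in> generate A (\<rho> ` J)" for z
    using that
  proof (induction rule: generate.induct)
    case one
    then show ?case using J par_closed by auto
  next
    case (incl h)
    then show ?case using step by auto
  next
    case (inv h)
    then obtain i where i: "i \<in> J" "h = \<rho> i" by auto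
    then have "inv h = \<rho> i" using J inv_rho by auto
    then show ?case using step i by auto
  next
    case (eng h1 h2)
    have h: "h1 \<in> par J" "h2 \<in> par J" using eng by (auto simp: par_def)
    show ?case
    proof (intro ballI impI)
      fix y assume y: "y \<in> par J" "Q y"
      have "h2 \<otimes> y \<in> par J" using h y par_subgroup[OF J] subgroup.m_closed by metis
      then have "Q (h1 \<otimes> (h2 \<otimes> y))" using eng y by blast
      then show "Q (h1 \<otimes> h2 \<otimes> y)" using m_assoc h y par_closed[OF J] by metis
    qed
  qed
  then have "Q (x \<otimes> \<one>)" using x one J par_subgroup subgroup.one_closed unfolding par_def by metis
  then show ?thesis using x par_closed[OF J] by simp
qed

lemma par_sub_S: "J \<subseteq> {..<4} \<Longrightarrow> i < 4 \<Longrightarrow> i \<notin> J \<Longrightarrow> par J \<subseteq> S i"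
  unfolding par_def by (rule generate_subgroup_incl[OF _ S_subgroup]) (auto simp: rho_S)

lemma rho_rho: "i < 4 \<Longrightarrow> x \<in> carrier A \<Longrightarrow> \<rho> i \<otimes> (\<rho> i \<otimes> x) = x"
  by (simp add: m_assoc[symmetric] rho_closed rho_sq)

lemma rho_comm': assumes "i < 4" "j < 4" "i + 2 \<le> j \<or> j + 2 \<le> i"
  shows "\<rho> i \<otimes> \<rho> j = \<rho> j \<otimes> \<rho> i"
  using rho_comm assms by metis

lemma rho_left_comm: assumes "i < 4" "j < 4" "i + 2 \<le> j \<or> j + 2 \<le> i" "x \<in> carrier A"
  shows "\<rho> i \<otimes> (\<rho> j \<otimes> x) = \<rho> j \<otimes> (\<rho> i \<otimes> x)"
  using rho_comm'[OF assms(1-3)] assms by (metis m_assoc rho_closed)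

text \<open>A generator that commutes with all the others splits off as a factor of order 2.\<close>

lemma par_insert_comm:
  assumes "insert a K \<subseteq> {..<4}" and far: "\<And>k. k \<in> K \<Longrightarrow> k + 2 \<le> a \<or> a + 2 \<le> k"
    and x: "x \<in> par (insert a K)"
  shows "x \<in> par K \<or> \<rho> a \<otimes> x \<in> par K"
  using assms(1) x
proof (induction rule: par_induct)
  case one
  then show ?case using par_subgroup[of K] assms(1) subgroup.one_closed by auto
next
  case (step i y)
  have K: "K \<subseteq> {..<4}" "a < 4" using assms(1) by auto
  have y: "y \<in> carrier A" using par_closed step assms(1) by blast
  show ?case
  proof (cases "i = a")
    case True
    then show ?thesis using step K rho_rho y by auto
  next
    case False
    then have i: "i \<in> K" "i < 4" using step K by auto
    have "\<rho> i \<in> par K" using rho_par i by auto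
    then have "z \<in> par K \<Longrightarrow> \<rho> i \<otimes> z \<in> par K" for z using par_subgroup[OF K(1)] subgroup.m_closed by metis
    moreover have "\<rho> a \<otimes> (\<rho> i \<otimes> y) = \<rho> i \<otimes> (\<rho> a \<otimes> y)"
      using rho_left_comm[of a i y] far[OF i(1)] i K y by auto
    ultimately show ?thesis using step by auto
  qed
qed

lemma ev_mult: "J \<subseteq> {..<4} \<Longrightarrow> x \<in> ev J \<Longrightarrow> y \<in> ev J \<Longrightarrow> x \<otimes> y \<in> ev J"
  using ev_subgroup subgroup.m_closed by metis

lemma par_mult: "J \<subseteq> {..<4} \<Longrightarrow> x \<in> par J \<Longrightarrow> y \<in> par J \<Longrightarrow> x \<otimes> y \<in> par J"
  using par_subgroup subgroup.m_closed by metis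

lemma par_inv: "J \<subseteq> {..<4} \<Longrightarrow> x \<in> par J \<Longrightarrow> inv x \<in> par J"
  using par_subgroup subgroup.m_inv_closed by metis

lemma par_one: "J \<subseteq> {..<4} \<Longrightarrow> \<one> \<in> par J"
  using par_subgroup subgroup.one_closed by metis

lemma rho_rho_ev: "i \<in> J \<Longrightarrow> j \<in> J \<Longrightarrow> \<rho> i \<otimes> \<rho> j \<in> ev J"
  unfolding ev_def by (rule generate.incl) auto

lemma ev_sub_par: "J \<subseteq> {..<4} \<Longrightarrow> ev J \<subseteq> par J"
  unfolding ev_def
  by (rule generate_subgroup_incl[OF _ par_subgroup]) (auto intro: par_mult rho_par)

lemma sg_one: "sg \<one> = 1"
  using sg_mult[of "\<rho> 0" "\<rho> 0"] sg_rho[of 0] rho_sq[of 0] rho_closed[of 0] by simp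

lemma sg_par:
  assumes J: "J \<subseteq> {..<4}" and x: "x \<in> par J" shows "sg x = 1 \<or> sg x = -1"
  using J x
proof (induction rule: par_induct)
  case one then show ?case by (simp add: sg_one)
next
  case (step i y)
  then have "i < 4" "y \<in> carrier A" using par_closed[of J y] J by auto
  then show ?case using sg_mult[of "\<rho> i" y] rho_closed[of i] sg_rho[of i] step by auto
qed

lemma sg_ev: assumes J: "J \<subseteq> {..<4}" and "x \<in> ev J" shows "sg x = 1"
  using assms(2) unfolding ev_def
proof (induction rule: generate.induct)
  case one then show ?case by (simp add: sg_one)
next
  case (incl h)
  then show ?case using J by (auto simp: sg_mult rho_closed sg_rho subset_iff)
next
  case (inv h)
  then show ?case using J by (auto simp: sg_mult rho_closed sg_rho subset_iff inv_mult_group inv_rho)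
next
  case (eng h1 h2)
  then show ?case using sg_mult ev_closed[OF J] unfolding ev_def by simp
qed

text \<open>
  Appending one fixed generator makes any odd element even, so the rotation subgroup has index at most 2.
\<close>

lemma par_even:
  assumes J: "J \<subseteq> {..<4}" and k: "k \<in> J" and x: "x \<in> par J"
  shows "x \<in> ev J \<or> \<rho> k \<otimes> x \<in> ev J"
  using J x
proof (induction rule: par_induct)
  case one
  then show ?case using ev_subgroup[OF J] subgroup.one_closed by auto
next
  case (step i y)
  have c: "y \<in> carrier A" "\<rho> i \<in> carrier A" "\<rho> k \<in> carrier A" "k < 4"
    using par_closed[OF J] rho_closed J step k by auto
  have 1: "\<rho> k \<otimes> (\<rho> i \<otimes> y) = (\<rho> k \<otimes> \<rho> i) \<otimes> y" using c by (simp add: m_assoc)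
  have 2: "\<rho> i \<otimes> y = (\<rho> i \<otimes> \<rho> k) \<otimes> (\<rho> k \<otimes> y)" using c by (simp add: m_assoc rho_rho)
  show ?case using step(3) ev_mult[OF J rho_rho_ev] step k 1 2 by metis
qed

lemma ev_iff: assumes J: "J \<subseteq> {..<4}" shows "x \<in> ev J \<longleftrightarrow> x \<in> par J \<and> sg x = 1"
proof
  assume "x \<in> ev J" then show "x \<in> par J \<and> sg x = 1" using ev_sub_par sg_ev J by auto
next
  assume x: "x \<in> par J \<and> sg x = 1"
  show "x \<in> ev J"
  proof (cases "J = {}")
    case True
    then have "x = \<one>" using x unfolding par_def by (auto simp: generate_empty)
    then show ?thesis using ev_subgroup[OF J] subgroup.one_closed by auto
  next
    case False
    then obtain k where k: "k \<in> J" by auto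
    have "sg (\<rho> k \<otimes> x) = -1" using sg_mult sg_rho x par_closed[OF J] rho_closed J k by auto
    then show ?thesis using par_even[OF J k] x sg_ev[OF J] by fastforce
  qed
qed

lemma card_par: assumes J: "J \<subseteq> {..<4}" "J \<noteq> {}" shows "card (par J) = 2 * card (ev J)"
proof -
  obtain k where k: "k \<in> J" using J by auto
  have fin: "finite (par J)" using finite_G par_mono[OF J(1)] finite_subset unfolding par_def by blast
  have k4: "k < 4" using k J by auto
  have split: "par J = ev J \<union> (\<lambda>x. \<rho> k \<otimes> x) ` ev J"
  proof (intro equalityI subsetI)
    fix x assume x: "x \<in> par J"
    from par_even[OF J(1) k x] show "x \<in> ev J \<union> (\<lambda>x. \<rho> k \<otimes> x) ` ev J"
    proof
      assume "\<rho> k \<otimes> x \<in> ev J"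
      then show ?thesis using rho_rho[OF k4 par_closed[OF J(1) x]] by (metis UnI2 imageI)
    qed auto
  next
    fix x assume "x \<in> ev J \<union> (\<lambda>x. \<rho> k \<otimes> x) ` ev J"
    then show "x \<in> par J" using ev_sub_par[OF J(1)] par_mult[OF J(1) rho_par[OF k]] by auto
  qed
  have disj: "ev J \<inter> (\<lambda>x. \<rho> k \<otimes> x) ` ev J = {}"
  proof -
    have "sg (\<rho> k \<otimes> x) = -1" if "x \<in> ev J" for x
      using that sg_ev[OF J(1)] ev_closed[OF J(1)] sg_mult rho_closed[OF k4] sg_rho[OF k4] by simp
    then show ?thesis using sg_ev[OF J(1)] by fastforce
  qed
  have inj: "inj_on (\<lambda>x. \<rho> k \<otimes> x) (ev J)"
    using ev_closed[OF J(1)] rho_closed[OF k4] by (auto simp: inj_on_def)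
  have f: "finite (ev J)" using fin ev_sub_par[OF J(1)] finite_subset by blast
  show ?thesis unfolding split using disj inj f by (simp add: card_Un_disjoint card_image)
qed

section \<open>Common elements of cosets\<close>

text \<open>
  Two elements lie in the same right coset of \<open>P i\<close>, that is, they represent the same face of rank \<open>i\<close>.
\<close>

definition E :: "nat \<Rightarrow> 'a \<Rightarrow> 'a \<Rightarrow> bool" where
  "E i x y \<longleftrightarrow> x \<in> G \<and> y \<in> G \<and> x \<otimes> inv y \<in> P i"

lemma G_closed: "x \<in> G \<Longrightarrow> x \<in> carrier A" using par_closed by auto

lemma P_sub_G: "P i \<subseteq> G" by (rule par_mono) auto

lemma E_refl: "x \<in> G \<Longrightarrow> E i x x"
  unfolding E_def using G_closed par_one by auto

lemma E_sym: "E i x y \<Longrightarrow> E i y x"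
  unfolding E_def using par_inv[of "{..<4} - {i}" "x \<otimes> inv y"]
  by (auto simp: inv_mult_group G_closed)

lemma E_trans: assumes "E i x y" "E i y z" shows "E i x z"
proof -
  have c: "x \<in> carrier A" "y \<in> carrier A" "z \<in> carrier A" using assms G_closed unfolding E_def by auto
  have "(x \<otimes> inv y) \<otimes> (y \<otimes> inv z) = x \<otimes> inv z" using c
    by (metis inv_closed inv_solve_left' m_assoc m_closed)
  then show ?thesis using assms par_mult[of "{..<4} - {i}"] unfolding E_def by (metis Diff_subset)
qed

lemma E_left: assumes "x \<in> G" "m \<in> P i" shows "E i (m \<otimes> x) x"
proof -
  have "m \<in> carrier A" "x \<in> carrier A" using assms G_closed P_sub_G by auto
  then have "m \<otimes> x \<otimes> inv x = m" by (simp add: m_assoc)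
  then show ?thesis unfolding E_def using assms par_mult[of "{..<4}" m x] P_sub_G by auto
qed

lemma E_rho: "x \<in> G \<Longrightarrow> j < 4 \<Longrightarrow> j \<noteq> i \<Longrightarrow> E i (\<rho> j \<otimes> x) x"
  by (rule E_left) (auto intro: rho_par)

text \<open>
  The parabolic subgroup without \<open>\<rho>\<^sub>1\<close> is the product of the group of order 2 generated by \<open>\<rho>\<^sub>0\<close> with the parabolic subgroup on
  \<open>{2, 3}\<close>. So if two elements represent the same face of rank 1, one can replace the 0-face of one by that of the
  other by multiplying with \<open>\<rho>\<^sub>0\<close> at most once, without changing the other faces; dually for ranks 2 and 3.
\<close>

lemma interpolate:
  assumes "i = 1 \<and> a = 0 \<or> i = 2 \<and> a = 3" and E: "E i x y"
  shows "\<exists>x'. E a x' y \<and> (\<forall>j<4. j \<noteq> a \<longrightarrow> E j x' x)"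
proof -
  have a: "a < 4" using assms by auto
  define K where "K = ({..<4} - {i}) - {a}"
  have K: "insert a K \<subseteq> {..<4}" "{..<4} - {i} = insert a K" "\<And>k. k \<in> K \<Longrightarrow> k + 2 \<le> a \<or> a + 2 \<le> k"
    using assms(1) unfolding K_def by auto
  have G: "x \<in> G" "y \<in> G" and m: "x \<otimes> inv y \<in> par (insert a K)" using E K unfolding E_def by auto
  have c: "x \<in> carrier A" "y \<in> carrier A" "\<rho> a \<in> carrier A" using G G_closed rho_closed a by auto
  have KP: "par K \<subseteq> P a" by (rule par_mono) (auto simp: K_def)
  from par_insert_comm[OF K(1) K(3) m] show ?thesis
  proof
    assume "x \<otimes> inv y \<in> par K"
    then have "E a x y" using KP G unfolding E_def by auto
    then show ?thesis using E_refl G by blast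
  next
    assume "\<rho> a \<otimes> (x \<otimes> inv y) \<in> par K"
    then have "(\<rho> a \<otimes> x) \<otimes> inv y \<in> P a" using KP c by (auto simp: m_assoc)
    moreover have "\<rho> a \<otimes> x \<in> G" using par_mult rho_par a G by auto
    ultimately have "E a (\<rho> a \<otimes> x) y" using G unfolding E_def by auto
    then show ?thesis using E_rho[OF G(1) a] by metis
  qed
qed

text \<open>
  Three of the four ranks include both 0 and 1 or both 2 and 3, and there the elements can be merged by interpolation. This gives transitivity of incidence without any intersection property.
\<close>

lemma meet_trans:
  assumes "i < j" "j < k" "k < 4" "E i x a" "E j x b" "E j y b" "E k y c"
  shows "\<exists>z. E i z a \<and> E j z b \<and> E k z c"
proof -
  consider "i = 0" "j = 1" | "j = 2" "k = 3" using assms(1-3) by linarith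
  then show ?thesis
  proof cases
    case 1
    have "E 1 y x" using assms 1 E_sym E_trans by metis
    from interpolate[OF _ this, of 0] obtain z where "E 0 z x" "\<forall>j<4. j \<noteq> 0 \<longrightarrow> E j z y" by auto
    moreover have "j < 4" "k < 4" "j \<noteq> 0" "k \<noteq> 0" using assms 1 by auto
    ultimately show ?thesis using assms 1 E_trans by metis
  next
    case 2
    have "E 2 x y" using assms 2 E_sym E_trans by metis
    from interpolate[OF _ this, of 3] obtain z where "E 3 z y" "\<forall>j<4. j \<noteq> 3 \<longrightarrow> E j z x" by auto
    moreover have "j < 4" "i < 4" "j \<noteq> 3" "i \<noteq> 3" using assms 2 by auto
    ultimately show ?thesis using assms 2 E_trans by metis
  qed
qed

lemma helly3:
  assumes "i < j" "j < k" "k < 4"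
    and "\<exists>x. E i x a \<and> E j x b" "\<exists>x. E j x b \<and> E k x c" "\<exists>x. E i x a \<and> E k x c"
  shows "\<exists>z. E i z a \<and> E j z b \<and> E k z c"
  using meet_trans[OF assms(1-3)] assms(4,5) by blast

lemma helly4:
  assumes "\<exists>x. E 0 x a \<and> E 1 x b" "\<exists>x. E 1 x b \<and> E 2 x c" "\<exists>x. E 2 x c \<and> E 3 x d"
  shows "\<exists>z. E 0 z a \<and> E 1 z b \<and> E 2 z c \<and> E 3 z d"
proof -
  obtain x where x: "E 0 x a" "E 1 x b" "E 2 x c" using meet_trans[of 0 1 2 _ a b _ c] assms by auto
  obtain y where y: "E 2 y c" "E 3 y d" using assms by auto
  have "E 2 x y" using x y E_sym E_trans by metis
  from interpolate[OF _ this, of 3] obtain z where "E 3 z y" "\<forall>j<4. j \<noteq> 3 \<longrightarrow> E j z x" by auto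
  then have "E 3 z y" "E 0 z x" "E 1 z x" "E 2 z x" by auto
  then show ?thesis using x y E_trans by metis
qed

text \<open>
  This is what makes every chain of faces part of a flag that comes from a group element. The ranks are merged two at a time.
\<close>

lemma helly:
  assumes T: "T \<subseteq> {..<4::nat}" and g: "\<And>i. i \<in> T \<Longrightarrow> g i \<in> G"
    and pair: "\<And>i j. i \<in> T \<Longrightarrow> j \<in> T \<Longrightarrow> i < j \<Longrightarrow> \<exists>x. E i x (g i) \<and> E j x (g j)"
  shows "\<exists>z \<in> G. \<forall>i\<in>T. E i z (g i)"
proof -
  have inG: "E i z y \<Longrightarrow> z \<in> G" for i z y unfolding E_def by auto
  have cover: "i \<in> T \<Longrightarrow> i = 0 \<or> i = 1 \<or> i = 2 \<or> i = 3" for i using T by auto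
  note p = pair[of 0 1] pair[of 0 2] pair[of 0 3] pair[of 1 2] pair[of 1 3] pair[of 2 3]
  have one: "\<one> \<in> G" using par_one by auto
  show ?thesis
  proof (cases "0 \<in> T"; cases "1 \<in> T"; cases "2 \<in> T"; cases "3 \<in> T")
    assume "0 \<in> T" "1 \<in> T" "2 \<in> T" "3 \<in> T"
    then show ?thesis using helly4[of "g 0" "g 1" "g 2" "g 3"] p cover inG by (smt (verit, best) zero_less_one one_less_numeral_iff numeral_less_iff semiring_norm)
  next
    assume "0 \<in> T" "1 \<in> T" "2 \<in> T" "3 \<notin> T"
    then show ?thesis using helly3[of 0 1 2 "g 0" "g 1" "g 2"] p cover inG by simp metis
  next
    assume "0 \<in> T" "1 \<in> T" "2 \<notin> T" "3 \<in> T"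
    then show ?thesis using helly3[of 0 1 3 "g 0" "g 1" "g 3"] p cover inG by simp metis
  next
    assume "0 \<in> T" "1 \<notin> T" "2 \<in> T" "3 \<in> T"
    then show ?thesis using helly3[of 0 2 3 "g 0" "g 2" "g 3"] p cover inG by simp metis
  next
    assume "0 \<notin> T" "1 \<in> T" "2 \<in> T" "3 \<in> T"
    then show ?thesis using helly3[of 1 2 3 "g 1" "g 2" "g 3"] p cover inG by simp metis
  qed (use p cover inG E_refl g one in \<open>simp; metis\<close>)+
qed

lemma S_of_P: "i < 4 \<Longrightarrow> x \<in> P i \<Longrightarrow> x \<in> S i"
  using par_sub_S[of "{..<4} - {i}" i] by auto

lemma S_inter_trivial: assumes "x \<in> G" "\<And>i. i < 4 \<Longrightarrow> x \<in> S i" shows "x = \<one>"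
  using S_triple[of 0 x] assms rho_S[of 0 0] unfolding par_def by auto

text \<open>
  The parabolic subgroup without \<open>i\<close> is a direct product with the factor of order 2 generated by \<open>\<rho>\<^sub>a\<close>, and on the remaining
  two generators the stabilisers leave only \<open>\<rho>\<^sub>l\<close>.
\<close>

lemma split_inter:
  assumes ia: "i = 1 \<and> a = 0 \<or> i = 2 \<and> a = 3" and l: "l < 4" "l \<noteq> i" "l \<noteq> a" and b: "b < 4" "b \<noteq> i" "b \<noteq> a" "b \<noteq> l"
    and x: "x \<in> P i" "x \<in> P b"
  shows "x = \<one> \<or> x = \<rho> l \<or> x = \<rho> a \<or> x = \<rho> a \<otimes> \<rho> l"
proof -
  define K where "K = ({..<4} - {i}) - {a}"
  have a: "a < 4" "a \<noteq> i" using ia by auto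
  have K: "insert a K \<subseteq> {..<4}" "{..<4} - {i} = insert a K" "\<And>k. k \<in> K \<Longrightarrow> k + 2 \<le> a \<or> a + 2 \<le> k"
    using ia unfolding K_def by auto
  have xG: "x \<in> G" "x \<in> carrier A" using x P_sub_G G_closed by auto
  have *: "y = \<one> \<or> y = \<rho> l" if "y \<in> par K" "y \<in> P b" for y
  proof (rule S_triple[OF l(1)])
    show "y \<in> generate A (\<rho> ` {..<4})" using that P_sub_G unfolding par_def by blast
    show "\<forall>j<4. j \<noteq> l \<longrightarrow> y \<in> S j"
    proof (intro allI impI)
      fix j :: nat assume j: "j < 4" "j \<noteq> l"
      show "y \<in> S j"
      proof (cases "j = b")
        case True then show ?thesis using S_of_P that j by auto
      next
        case False
        then have "j = i \<or> j = a" using ia l b j by auto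
        then have "j \<notin> K" unfolding K_def by auto
        then show ?thesis using par_sub_S[of K j] K j that by auto
      qed
    qed
  qed
  have "x \<in> par K \<or> \<rho> a \<otimes> x \<in> par K"
    using par_insert_comm[of a K x] K x by auto
  then show ?thesis
  proof
    assume "\<rho> a \<otimes> x \<in> par K"
    moreover have "\<rho> a \<otimes> x \<in> P b" using par_mult[of "{..<4} - {b}"] rho_par[of a "{..<4} - {b}"] x a b by auto
    ultimately have "\<rho> a \<otimes> x = \<one> \<or> \<rho> a \<otimes> x = \<rho> l" using * by auto
    then have "\<rho> a \<otimes> (\<rho> a \<otimes> x) = \<rho> a \<or> \<rho> a \<otimes> (\<rho> a \<otimes> x) = \<rho> a \<otimes> \<rho> l" using rho_closed[of a] a by auto
    then show ?thesis using rho_rho a xG by auto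
  qed (use * x in auto)
qed

text \<open>
  The element \<open>x\<close> relates two flags that agree in the ranks next to \<open>n\<close>; up to \<open>P n\<close> there are only two such flags.
\<close>

lemma diamond:
  assumes n: "n < 4" and x: "x \<in> G" "0 < n \<Longrightarrow> x \<in> P (n - 1)" "n < 3 \<Longrightarrow> x \<in> P (n + 1)"
  shows "x \<in> P n \<or> x \<otimes> \<rho> n \<in> P n"
proof -
  have c: "x \<in> carrier A" "\<rho> n \<in> carrier A" using x G_closed rho_closed n by auto
  have end_case: "x \<in> P n \<or> x \<otimes> \<rho> n \<in> P n" if "i = 1 \<and> n = 0 \<or> i = 2 \<and> n = 3" "x \<in> P i" for i
  proof -
    define K where "K = ({..<4} - {i}) - {n}"
    have K: "insert n K \<subseteq> {..<4}" "{..<4} - {i} = insert n K" "\<And>k. k \<in> K \<Longrightarrow> k + 2 \<le> n \<or> n + 2 \<le> k"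
      using that unfolding K_def by auto
    have "inv x \<in> par (insert n K)" using par_inv[of "{..<4}-{i}" x] that K by auto
    then have "inv x \<in> par K \<or> \<rho> n \<otimes> inv x \<in> par K" using par_insert_comm K by blast
    moreover have "par K \<subseteq> P n" by (rule par_mono) (auto simp: K_def)
    ultimately have "inv x \<in> P n \<or> \<rho> n \<otimes> inv x \<in> P n" by auto
    then have "inv (inv x) \<in> P n \<or> inv (\<rho> n \<otimes> inv x) \<in> P n" using par_inv[of "{..<4}-{n}"] by auto
    then show ?thesis using c n by (simp add: inv_mult_group inv_rho)
  qed
  have mid_case: "x \<in> P n \<or> x \<otimes> \<rho> n \<in> P n" if "i = 1 \<and> a = 0 \<and> n = 2 \<and> b = 3 \<or> i = 2 \<and> a = 3 \<and> n = 1 \<and> b = 0" "x \<in> P i" "x \<in> P b" for i a b :: nat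
  proof -
    have "x = \<one> \<or> x = \<rho> n \<or> x = \<rho> a \<or> x = \<rho> a \<otimes> \<rho> n"
      by (rule split_inter[of i a n b]) (use that in auto)
    moreover have "\<one> \<in> P n" "\<rho> a \<in> P n" using par_one rho_par that by auto
    moreover have "\<rho> a \<in> carrier A" using that rho_closed by auto
    ultimately show ?thesis using c n by (auto simp: rho_sq m_assoc)
  qed
  consider "n = 0" | "n = 1" | "n = 2" | "n = 3" using n by linarith
  then show ?thesis
  proof cases
    case 1 then show ?thesis using end_case[of 1] x by auto
  next
    case 2 then show ?thesis using mid_case[of 2 3 0] x by (auto simp: numeral_2_eq_2)
  next
    case 3 then show ?thesis using mid_case[of 1 0 3] x by (auto simp: numeral_3_eq_3)
  next
    case 4 then show ?thesis using end_case[of 2] x by auto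
  qed
qed

text \<open>
  All intersections of the four maximal parabolic subgroups are as expected except possibly \<open>P 0 \<inter> P 3\<close>. When the
  omitted ranks include 1 or 2, a factor of order 2 splits off; three omitted ranks are covered by \<open>S_triple\<close>.
\<close>

lemma inter_par:
  assumes H: "P 0 \<inter> P 3 \<subseteq> par {1,2}"
    and T: "T \<subseteq> {..<4}" and x: "x \<in> G" "\<And>i. i \<in> T \<Longrightarrow> x \<in> P i"
  shows "x \<in> par ({..<4} - T)"
proof -
  have xS: "x \<in> S i" if "i \<in> T" for i using x that T S_of_P by auto
  have xc: "x \<in> carrier A" using x G_closed by auto
  have U: "{..<4::nat} = {0,1,2,3}" by auto
  have triple: "x \<in> par ({..<4} - T)" if "{..<4} - T \<subseteq> {l}" "l < 4" for l
  proof -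
    have "x = \<one> \<or> x = \<rho> l" using S_triple[of l x] x xS that unfolding par_def by blast
    moreover have "x = \<one>" if "l \<in> T"
    proof (rule S_inter_trivial[OF x(1)])
      fix i :: nat assume "i < 4"
      then have "i \<in> T" using that \<open>{..<4} - T \<subseteq> {l}\<close> by auto
      then show "x \<in> S i" by (rule xS)
    qed
    ultimately show ?thesis using par_one[of "{..<4} - T"] rho_par[of l "{..<4} - T"] that by (cases "l \<in> T") auto
  qed
  have pair: "x \<in> par {a, l}"
    if "i = 1 \<and> a = 0 \<or> i = 2 \<and> a = 3" "l < 4" "l \<noteq> i" "l \<noteq> a" "b < 4" "b \<noteq> i" "b \<noteq> a" "b \<noteq> l" "T = {i, b}"
    for i a b l :: nat
  proof -
    have "x \<in> P i" "x \<in> P b" using x that by blast+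
    then have "x = \<one> \<or> x = \<rho> l \<or> x = \<rho> a \<or> x = \<rho> a \<otimes> \<rho> l"
      by (rule split_inter[OF that(1-8)])
    moreover have "{a, l} \<subseteq> {..<4}" using that by auto
    ultimately show ?thesis using par_one rho_par[of _ "{a, l}"] par_mult by auto
  qed
  have adj: "x \<in> par ({..<4} - T)" if "i = 1 \<and> a = 0 \<or> i = 2 \<and> a = 3" "T = {i, a}" for i a
  proof -
    define K where "K = {..<4} - T"
    have K: "insert a K \<subseteq> {..<4}" "{..<4} - {i} = insert a K" "\<And>k. k \<in> K \<Longrightarrow> k + 2 \<le> a \<or> a + 2 \<le> k"
      using that unfolding K_def by auto
    have a4: "a < 4" using K by auto
    have "x \<in> P i" using x that by blast
    then have "x \<in> par K \<or> \<rho> a \<otimes> x \<in> par K" using par_insert_comm[OF K(1,3)] K(2) by simp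
    moreover have "\<rho> a \<otimes> x \<notin> par K"
    proof
      assume "\<rho> a \<otimes> x \<in> par K"
      then have "\<rho> a \<otimes> x \<in> P a" using par_mono[of K "{..<4} - {a}"] K that unfolding K_def by auto
      moreover have "inv x \<in> P a" using x that par_inv by auto
      ultimately have "\<rho> a \<otimes> x \<otimes> inv x \<in> P a" using par_mult[of "{..<4} - {a}"] by auto
      then have "\<rho> a \<in> P a" using xc rho_closed[OF a4] by (simp add: m_assoc)
      then show False using S_of_P[OF a4] rho_S[OF a4 a4] by auto
    qed
    ultimately show ?thesis unfolding K_def by auto
  qed
  have eqi: "T = X"
    if "0 \<in> T \<longleftrightarrow> 0 \<in> X" "1 \<in> T \<longleftrightarrow> 1 \<in> X" "2 \<in> T \<longleftrightarrow> 2 \<in> X" "3 \<in> T \<longleftrightarrow> 3 \<in> X" "X \<subseteq> {..<4}" for X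
  proof (rule Set.set_eqI)
    fix n show "n \<in> T \<longleftrightarrow> n \<in> X"
    proof (cases "n \<in> {..<4}")
      case True then show ?thesis using that(1-4) unfolding U by blast
    qed (use T that(5) in blast)
  qed
  have tri: "\<exists>l<4. {..<4} - T \<subseteq> {l}"
    if "0 \<in> T \<and> 1 \<in> T \<and> 2 \<in> T \<or> 0 \<in> T \<and> 1 \<in> T \<and> 3 \<in> T \<or> 0 \<in> T \<and> 2 \<in> T \<and> 3 \<in> T \<or> 1 \<in> T \<and> 2 \<in> T \<and> 3 \<in> T"
    using that
  proof (elim disjE)
    assume "0 \<in> T \<and> 1 \<in> T \<and> 2 \<in> T" then show ?thesis unfolding U by (intro exI[of _ 3]) auto
  next
    assume "0 \<in> T \<and> 1 \<in> T \<and> 3 \<in> T" then show ?thesis unfolding U by (intro exI[of _ 2]) auto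
  next
    assume "0 \<in> T \<and> 2 \<in> T \<and> 3 \<in> T" then show ?thesis unfolding U by (intro exI[of _ 1]) auto
  next
    assume "1 \<in> T \<and> 2 \<in> T \<and> 3 \<in> T" then show ?thesis unfolding U by (intro exI[of _ 0]) auto
  qed
  have tri': "x \<in> par ({..<4} - T)"
    if "0 \<in> T \<and> 1 \<in> T \<and> 2 \<in> T \<or> 0 \<in> T \<and> 1 \<in> T \<and> 3 \<in> T \<or> 0 \<in> T \<and> 2 \<in> T \<and> 3 \<in> T \<or> 1 \<in> T \<and> 2 \<in> T \<and> 3 \<in> T"
    using tri[OF that] triple by (elim exE conjE)
  have "T = {} \<or> T = {0} \<or> T = {1} \<or> T = {2} \<or> T = {3}
    \<or> T = {0,1} \<or> T = {0,2} \<or> T = {0,3} \<or> T = {1,2} \<or> T = {1,3} \<or> T = {2,3}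
    \<or> (0 \<in> T \<and> 1 \<in> T \<and> 2 \<in> T \<or> 0 \<in> T \<and> 1 \<in> T \<and> 3 \<in> T \<or> 0 \<in> T \<and> 2 \<in> T \<and> 3 \<in> T \<or> 1 \<in> T \<and> 2 \<in> T \<and> 3 \<in> T)"
    using eqi[of "{}"] eqi[of "{0}"] eqi[of "{1}"] eqi[of "{2}"] eqi[of "{3}"] eqi[of "{0,1}"] eqi[of "{0,2}"]
      eqi[of "{0,3}"] eqi[of "{1,2}"] eqi[of "{1,3}"] eqi[of "{2,3}"]
    by (cases "0 \<in> T"; cases "1 \<in> T"; cases "2 \<in> T"; cases "3 \<in> T"; simp del: One_nat_def)
  then show ?thesis
  proof (elim disjE)
    assume T: "T = {0,1}"
    have "T = {1,0}" unfolding T by (rule insert_commute)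
    then show ?thesis using adj[of 1 0] by simp
  next
    assume T: "T = {0,2}"
    have "T = {2,0}" unfolding T by (rule insert_commute)
    then have "x \<in> par {3, 1}" using pair[of 2 3 1 0] by simp
    moreover have "{..<4} - T = {3, 1}" unfolding T U by auto
    ultimately show ?thesis by simp
  next
    assume T: "T = {0,3}"
    then have "x \<in> par {1,2}" using x H by auto
    moreover have "{..<4} - T = {1,2}" unfolding T U by auto
    ultimately show ?thesis by simp
  next
    assume T: "T = {1,2}"
    then have "x \<in> par {0, 3}" using pair[of 1 0 3 2] by simp
    moreover have "{..<4} - T = {0, 3}" unfolding T U by auto
    ultimately show ?thesis by simp
  next
    assume T: "T = {1,3}"
    then have "x \<in> par {0, 2}" using pair[of 1 0 2 3] by simp
    moreover have "{..<4} - T = {0, 2}" unfolding T U by auto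
    ultimately show ?thesis by simp
  next
    assume T: "T = {2,3}" then show ?thesis using adj[of 2 3] by simp
  next
    assume "T = {}" then show ?thesis using x by simp
  next
    assume T: "T = {0}"
    have "x \<in> P 0" by (rule x(2)) (simp add: T)
    then show ?thesis using T by simp
  next
    assume T: "T = {1}"
    have "x \<in> P 1" by (rule x(2)) (simp add: T)
    then show ?thesis using T by simp
  next
    assume T: "T = {2}"
    have "x \<in> P 2" by (rule x(2)) (simp add: T)
    then show ?thesis using T by simp
  next
    assume T: "T = {3}"
    have "x \<in> P 3" by (rule x(2)) (simp add: T)
    then show ?thesis using T by simp
  qed (use tri' in \<open>simp only: simp_thms\<close>)+
qed

section \<open>The poset of cosets\<close>

text \<open>
  The face is the set of even elements of a right coset. The representative \<open>g\<close> may be odd, so that reflections can move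
  flags.
\<close>

definition face :: "nat \<Rightarrow> 'a \<Rightarrow> 'a mix_face" where
  "face i g = Coset_Face i {x \<in> Gp. x \<otimes> inv g \<in> P i}"

definition flag :: "'a \<Rightarrow> 'a mix_face set" where
  "flag g = {Least_Face, Greatest_Face} \<union> (\<lambda>i. face i g) ` {..<4}"

definition M :: "'a mix_face ranked_poset" where
  "M = \<lparr>faces = {Least_Face, Greatest_Face} \<union> {face i g | i g. i < 4 \<and> g \<in> G},
        face_le = mix_le, face_rank = mix_rank 4\<rparr>"

lemma rho_mult_G: "i < 4 \<Longrightarrow> x \<in> G \<Longrightarrow> \<rho> i \<otimes> x \<in> G"
  using par_mult rho_par by auto

lemma Gp_sub: "Gp \<subseteq> G" by (rule ev_sub_par) auto

lemma even_or: assumes "x \<in> G" "k < 4" shows "x \<in> Gp \<or> \<rho> k \<otimes> x \<in> Gp"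
  using par_even[of "{..<4}" k x] assms by auto

lemma face_E: "g \<in> G \<Longrightarrow> face i g = Coset_Face i {x \<in> Gp. E i x g}"
  unfolding face_def E_def using Gp_sub by auto

lemma face_rep: assumes "g \<in> G" "i < 4" shows "\<exists>x \<in> Gp. E i x g"
proof -
  obtain k where k: "k < 4" "k \<noteq> i" using that[of 0] that[of 1] by (cases "i = 0") auto
  show ?thesis using even_or[OF assms(1) k(1)] E_refl E_rho[OF assms(1) k] assms by auto
qed

lemma face_eq: assumes "g \<in> G" "h \<in> G" "i < 4" shows "face i g = face j h \<longleftrightarrow> i = j \<and> E i g h"
proof
  assume "face i g = face j h"
  then have "i = j" "{x \<in> Gp. E i x g} = {x \<in> Gp. E j x h}" using assms by (auto simp: face_E)
  then show "i = j \<and> E i g h" using face_rep[OF assms(1,3)] E_sym E_trans by blast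
next
  assume "i = j \<and> E i g h"
  then show "face i g = face j h" using assms E_sym E_trans unfolding face_E[OF assms(1)] face_E[OF assms(2)] by blast
qed

lemma le_face:
  assumes "g \<in> G" "h \<in> G" "i < 4" "j < 4"
  shows "mix_le (face i g) (face j h) \<longleftrightarrow> (i = j \<and> E i g h) \<or> (i < j \<and> (\<exists>x. E i x g \<and> E j x h))"
proof -
  have "(\<exists>x\<in>Gp. E i x g \<and> E j x h) \<longleftrightarrow> (\<exists>x. E i x g \<and> E j x h)" if "i < j"
  proof
    assume "\<exists>x. E i x g \<and> E j x h"
    then obtain x where x: "E i x g" "E j x h" by auto
    then have xG: "x \<in> G" unfolding E_def by auto
    have "\<exists>k<4. k \<noteq> i \<and> k \<noteq> j"
    proof -
      have "card {i,j} \<le> 2" by (simp add: card_insert_if)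
      then have "\<not> {..<4} \<subseteq> {i,j}" using card_mono[of "{i,j}" "{..<4::nat}"] by auto
      then show ?thesis by auto
    qed
    then obtain k where k: "k < 4" "k \<noteq> i" "k \<noteq> j" by auto
    show "\<exists>x\<in>Gp. E i x g \<and> E j x h"
      using even_or[OF xG k(1)] x E_rho[OF xG k(1,2)] E_rho[OF xG k(1,3)] E_trans by blast
  qed auto
  moreover have "face i g = face j h \<longleftrightarrow> i = j \<and> E i g h" using face_eq assms by auto
  ultimately show ?thesis using assms by (auto simp: face_E)
qed

lemma le_simps [simp]: "mix_le F Least_Face \<longleftrightarrow> F = Least_Face" "mix_le Greatest_Face F \<longleftrightarrow> F = Greatest_Face"
  "mix_le F Greatest_Face"
  by (cases F; simp)+

lemma face_neq [simp]: "face i g \<noteq> Least_Face" "face i g \<noteq> Greatest_Face"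
  "Least_Face \<noteq> face i g" "Greatest_Face \<noteq> face i g" "mix_rank 4 (face i g) = int i"
  by (auto simp: face_def)

lemma faces_M: "faces M = {Least_Face, Greatest_Face} \<union> {face i g | i g. i < 4 \<and> g \<in> G}"
  and face_le_M [simp]: "face_le M = mix_le" and face_rank_M [simp]: "face_rank M = mix_rank 4"
  unfolding M_def by auto

lemma faces_M_cases: assumes "F \<in> faces M"
  obtains "F = Least_Face" | "F = Greatest_Face" | i g where "i < 4" "g \<in> G" "F = face i g"
  using assms unfolding faces_M by auto

lemma le_trans_M:
  assumes F: "F \<in> faces M" "F' \<in> faces M" "F'' \<in> faces M" and le: "mix_le F F'" "mix_le F' F''"
  shows "mix_le F F''"
proof -
  consider "F = Least_Face" | "F'' = Greatest_Face" |
    i g j h k u where "i < 4" "g \<in> G" "F = face i g" "j < 4" "h \<in> G" "F' = face j h" "k < 4" "u \<in> G" "F'' = face k u"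
    using F le by (elim faces_M_cases) auto
  then show ?thesis
  proof cases
    case 3
    then have 1: "(i = j \<and> E i g h) \<or> (i < j \<and> (\<exists>x. E i x g \<and> E j x h))"
       "(j = k \<and> E j h u) \<or> (j < k \<and> (\<exists>x. E j x h \<and> E k x u))" using le le_face by auto
    have "(i = k \<and> E i g u) \<or> (i < k \<and> (\<exists>x. E i x g \<and> E k x u))"
    proof (cases "i < j \<and> j < k")
      case True
      then obtain x y where "E i x g" "E j x h" "E j y h" "E k y u" using 1 by auto
      then show ?thesis using meet_trans[of i j k x g h y u] True 3 by auto
    next
      case False
      then consider "i = j" "E i g h" | "j = k" "E j h u" using 1 by blast
      then show ?thesis
      proof cases
        case a: 1
        have tr: "E i x g" if "E i x h" for x using that a E_sym E_trans by blast
        from 1(2) show ?thesis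
        proof
          assume "j = k \<and> E j h u" then show ?thesis using a E_trans by blast
        next
          assume "j < k \<and> (\<exists>x. E j x h \<and> E k x u)" then show ?thesis using a tr by blast
        qed
      next
        case a: 2
        have tr: "E k x u" if "E k x h" for x using that a E_trans by blast
        from 1(1) show ?thesis
        proof
          assume "i = j \<and> E i g h" then show ?thesis using a E_trans by blast
        next
          assume "i < j \<and> (\<exists>x. E i x g \<and> E j x h)" then show ?thesis using a tr by blast
        qed
      qed
    qed
    then show ?thesis using 3 le_face by auto
  qed auto
qed

lemma in_flag: assumes "g \<in> G" "h \<in> G" "i < 4" shows "face i h \<in> flag g \<longleftrightarrow> E i h g"
  unfolding flag_def using assms face_eq[OF assms(2,1,3)] by auto

lemma flag_sub: "g \<in> G \<Longrightarrow> flag g \<subseteq> faces M"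
  unfolding flag_def faces_M by auto

lemma flag_le: assumes "g \<in> G" "X \<in> flag g" "Y \<in> flag g" "mix_rank 4 X < mix_rank 4 Y"
  shows "mix_le X Y"
  using assms E_refl[OF assms(1)] unfolding flag_def by (auto simp: le_face intro!: exI[of _ g])

lemma flag_rank: assumes "X \<in> flag g" "Y \<in> flag g" "mix_rank 4 X = mix_rank 4 Y" shows "X = Y"
  using assms unfolding flag_def by auto

text \<open>
  By the Helly property, since a chain of faces consists of pairwise intersecting cosets.
\<close>

lemma chain_flag:
  assumes C: "C \<subseteq> faces M" and comp: "\<And>X Y. X \<in> C \<Longrightarrow> Y \<in> C \<Longrightarrow> mix_le X Y \<or> mix_le Y X"
  shows "\<exists>z\<in>G. C \<subseteq> flag z"
proof -
  define T where "T = {i. i < 4 \<and> (\<exists>g\<in>G. face i g \<in> C)}"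
  define g where "g i = (SOME g. g \<in> G \<and> face i g \<in> C)" for i
  have g: "g i \<in> G \<and> face i (g i) \<in> C" if "i \<in> T" for i
    unfolding g_def by (rule someI_ex) (use that in \<open>auto simp: T_def\<close>)
  have T4: "T \<subseteq> {..<4}" unfolding T_def by auto
  have "\<exists>z \<in> G. \<forall>i\<in>T. E i z (g i)"
  proof (rule helly[OF T4])
    fix i j assume ij: "i \<in> T" "j \<in> T" "i < j"
    then have "mix_le (face i (g i)) (face j (g j)) \<or> mix_le (face j (g j)) (face i (g i))" using comp g by blast
    then show "\<exists>x. E i x (g i) \<and> E j x (g j)" using ij g T4 by (auto simp: le_face subset_iff)
  qed (use g in auto)
  then obtain z where z: "z \<in> G" "\<And>i. i \<in> T \<Longrightarrow> E i z (g i)" by auto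
  have "X \<in> flag z" if X: "X \<in> C" for X
  proof -
    have "X \<in> faces M" using X C by auto
    then show ?thesis
    proof (cases rule: faces_M_cases)
      case (3 i h)
      then have i: "i \<in> T" using X unfolding T_def by auto
      then have "mix_le (face i h) (face i (g i)) \<or> mix_le (face i (g i)) (face i h)" using comp g X 3 by blast
      then have "E i h (g i)" using 3 g[OF i] E_sym by (auto simp: le_face)
      then have "E i h z" using z(2)[OF i] E_sym E_trans by blast
      then show ?thesis using 3 in_flag z by auto
    qed (auto simp: flag_def)
  qed
  then show ?thesis using z by auto
qed

lemma flag_comp: assumes "g \<in> G" "X \<in> flag g" "Y \<in> flag g" shows "mix_le X Y \<or> mix_le Y X"
proof -
  have "mix_le X X" if "X \<in> flag g" for X using that E_refl assms unfolding flag_def by (auto simp: le_face)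
  then show ?thesis using flag_le[OF assms(1)] flag_rank[of X g Y] assms by (metis linorder_neqE)
qed

lemma flag_eq: assumes "g \<in> G" "h \<in> G" "flag g \<subseteq> flag h" shows "g = h"
proof -
  have "E i g h" if "i < 4" for i
    using assms in_flag[OF assms(2,1) that] in_flag[OF assms(1,1) that] E_refl that by auto
  then have *: "g \<otimes> inv h \<in> S i" if "i < 4" for i using S_of_P that unfolding E_def by auto
  have "g \<otimes> inv h \<in> G" using assms par_mult par_inv by auto
  then have "g \<otimes> inv h = \<one>" using S_inter_trivial * by auto
  then show ?thesis using assms G_closed by (metis inv_closed inv_equality inv_inv)
qed

text \<open>The flags form one orbit of the full group, also when the poset is not a polytope.\<close>

lemma flags_M: "flags M = flag ` G"
proof -
  have chain: "pred_on.chain (faces M) (face_le M) C \<longleftrightarrow> C \<subseteq> faces M \<and> (\<forall>X\<in>C. \<forall>Y\<in>C. mix_le X Y \<or> mix_le Y X)"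
 for C
  proof -
    have "mix_le X X" if "X \<in> faces M" for X
      using that by (cases rule: faces_M_cases) (auto simp: le_face E_refl)
    then show ?thesis unfolding pred_on.chain_def by auto
  qed
  show ?thesis
  proof (intro equalityI subsetI)
    fix C assume "C \<in> flags M"
    then have C: "pred_on.chain (faces M) (face_le M) C" "\<And>D. pred_on.chain (faces M) (face_le M) D \<Longrightarrow> \<not> C \<subset> D"
      unfolding flags_def pred_on.maxchain_def by auto
    then obtain z where z: "z \<in> G" "C \<subseteq> flag z" using chain_flag[of C] chain by auto
    moreover have "pred_on.chain (faces M) (face_le M) (flag z)"
      using chain flag_comp[OF z(1)] flag_sub[OF z(1)] by auto
    ultimately have "C = flag z" using C by blast
    then show "C \<in> flag ` G" using z by auto
  next
    fix C assume "C \<in> flag ` G"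
    then obtain z where z: "z \<in> G" "C = flag z" by auto
    have "\<not> C \<subset> D" if D: "pred_on.chain (faces M) (face_le M) D" for D
    proof
      assume "C \<subset> D"
      moreover obtain y where "y \<in> G" "D \<subseteq> flag y" using chain_flag[of D] D chain by auto
      ultimately show False using flag_eq[of z y] z by auto
    qed
    moreover have "pred_on.chain (faces M) (face_le M) C"
      unfolding chain using flag_comp[OF z(1)] flag_sub[OF z(1)] z by blast
    ultimately show "C \<in> flags M" unfolding flags_def pred_on.maxchain_def by simp
  qed
qed

lemma card_flags_M: "card (flags M) = 2 * card Gp"
proof -
  have "inj_on flag G" using flag_eq by (auto simp: inj_on_def)
  then have "card (flags M) = card G" unfolding flags_M by (rule card_image)
  moreover have "{..<4::nat} \<noteq> {}" by (metis lessThan_iff empty_iff zero_less_numeral)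
  ultimately show ?thesis using card_par[of "{..<4}"] by simp
qed

lemma card_flag: assumes "g \<in> G" shows "card (flag g) = 6"
proof -
  have "inj_on (\<lambda>i. face i g) {..<4}" by (auto simp: inj_on_def face_def)
  then have "card ((\<lambda>i. face i g) ` {..<4}) = 4" by (simp add: card_image)
  moreover have "flag g = insert Least_Face (insert Greatest_Face ((\<lambda>i. face i g) ` {..<4}))"
    unfolding flag_def by auto
  moreover have "Least_Face \<notin> (\<lambda>i. face i g) ` {..<4}" "Greatest_Face \<notin> (\<lambda>i. face i g) ` {..<4}" by auto
  ultimately show ?thesis by simp
qed

lemma adjacent_flag: assumes "g \<in> G" "i < 4" shows "adjacent_flags (flag g) (flag (\<rho> i \<otimes> g))"
proof -
  have g': "\<rho> i \<otimes> g \<in> G" using rho_mult_G assms by auto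
  have nE: "\<not> E i (\<rho> i \<otimes> g) g"
  proof
    assume "E i (\<rho> i \<otimes> g) g"
    then have "\<rho> i \<in> P i" using assms G_closed rho_closed unfolding E_def by (simp add: m_assoc)
    then show False using S_of_P rho_S assms by auto
  qed
  have E: "E j (\<rho> i \<otimes> g) g" if "j < 4" "j \<noteq> i" for j using E_rho assms that by auto
  have "flag g - flag (\<rho> i \<otimes> g) = {face i g}"
  proof (intro equalityI subsetI)
    fix X assume X: "X \<in> flag g - flag (\<rho> i \<otimes> g)"
    then obtain j where j: "j < 4" "X = face j g" unfolding flag_def by auto
    then have "\<not> E j g (\<rho> i \<otimes> g)" using X in_flag[OF g' assms(1)] by auto
    then have "j = i" using E E_sym j by blast
    then show "X \<in> {face i g}" using j by auto
  qed (use in_flag[OF g' assms(1)] in_flag[OF assms(1,1)] assms nE E_sym E_refl in auto)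
  moreover have "flag (\<rho> i \<otimes> g) - flag g = {face i (\<rho> i \<otimes> g)}"
  proof (intro equalityI subsetI)
    fix X assume X: "X \<in> flag (\<rho> i \<otimes> g) - flag g"
    then obtain j where j: "j < 4" "X = face j (\<rho> i \<otimes> g)" unfolding flag_def by auto
    then have "\<not> E j (\<rho> i \<otimes> g) g" using X in_flag[OF assms(1) g'] by auto
    then have "j = i" using E j by blast
    then show "X \<in> {face i (\<rho> i \<otimes> g)}" using j by auto
  qed (use in_flag[OF assms(1) g'] in_flag[OF g' g'] assms nE E_refl[OF g'] in auto)
  ultimately show ?thesis unfolding adjacent_flags_def by simp
qed

text \<open>
  The element that moves one flag to another lies in the parabolic subgroup of the ranks in which they differ; a word for
  it in the generators is a path of adjacent flags that never changes the common faces.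
\<close>

lemma connected_if:
  assumes H: "P 0 \<inter> P 3 \<subseteq> par {1,2}"
  shows "strongly_flag_connected M"
  unfolding strongly_flag_connected_def
proof (intro ballI)
  fix \<Phi> \<Psi> assume "\<Phi> \<in> flags M" "\<Psi> \<in> flags M"
  then obtain x y where xy: "x \<in> G" "\<Phi> = flag x" "y \<in> G" "\<Psi> = flag y" unfolding flags_M by auto
  let ?R = "{(X, Y). X \<in> flags M \<and> Y \<in> flags M \<and> \<Phi> \<inter> \<Psi> \<subseteq> X \<and> \<Phi> \<inter> \<Psi> \<subseteq> Y \<and> adjacent_flags X Y}"
  define T where "T = {i. i < 4 \<and> E i y x}"
  have T4: "{..<4} - T \<subseteq> {..<4}" "T \<subseteq> {..<4}" unfolding T_def by auto
  define m where "m = y \<otimes> inv x"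
  have "m \<in> par ({..<4} - T)"
    by (rule inter_par[OF H T4(2)]) (use xy in \<open>auto simp: T_def E_def m_def intro: par_mult par_inv\<close>)
  moreover have incl: "\<Phi> \<inter> \<Psi> \<subseteq> flag (w \<otimes> x)" if w: "w \<in> par ({..<4} - T)" for w
  proof
    fix X assume X: "X \<in> \<Phi> \<inter> \<Psi>"
    have wG: "w \<in> G" using w par_mono[OF T4(1)] by auto
    have wx: "w \<otimes> x \<in> G" using par_mult wG xy by auto
    show "X \<in> flag (w \<otimes> x)"
    proof (cases "\<exists>i<4. X = face i x")
      case True
      then obtain i where i: "i < 4" "X = face i x" by auto
      then have "E i x y" using X xy in_flag by auto
      then have "i \<in> T" using i E_sym unfolding T_def by auto
      then have "w \<in> P i" using w par_mono[of "{..<4} - T" "{..<4} - {i}"] by auto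
      then have "E i x (w \<otimes> x)" using E_left xy E_sym by auto
      then show ?thesis using i in_flag wx xy by auto
    qed (use X xy in \<open>auto simp: flag_def\<close>)
  qed
  have path: "(flag x, flag (m \<otimes> x)) \<in> ?R\<^sup>*" if "m \<in> par ({..<4} - T)" for m
    using T4(1) that
  proof (induction rule: par_induct)
    case one
    then show ?case using xy G_closed by auto
  next
    case (step i w)
    have i: "i < 4" using step by auto
    have wG: "w \<in> G" using step par_mono[OF T4(1)] by auto
    have wx: "w \<otimes> x \<in> G" using par_mult wG xy by auto
    have a: "\<rho> i \<otimes> w \<otimes> x = \<rho> i \<otimes> (w \<otimes> x)" using m_assoc rho_closed i wG xy G_closed by auto
    have "\<rho> i \<otimes> w \<in> par ({..<4} - T)" using par_mult[OF T4(1)] rho_par step by auto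
    then have "\<Phi> \<inter> \<Psi> \<subseteq> flag (\<rho> i \<otimes> (w \<otimes> x))" using incl a by metis
    then have "(flag (w \<otimes> x), flag (\<rho> i \<otimes> (w \<otimes> x))) \<in> ?R"
      using adjacent_flag[OF wx i] incl[OF step(2)] wx rho_mult_G[OF i wx] unfolding flags_M by auto
    then show ?case using step a by (metis (no_types, lifting) rtrancl.rtrancl_into_rtrancl)
  qed
  moreover have "m \<otimes> x = y" unfolding m_def using xy G_closed by (simp add: m_assoc)
  ultimately show "(\<Phi>, \<Psi>) \<in> ?R\<^sup>*" using xy path[of m] by simp
qed

text \<open>
  If \<open>m\<close> is in both end subgroups, the flags of \<open>\<one>\<close> and \<open>m\<close> share their faces of ranks 0 and 3. A path between them
  that keeps these faces uses only \<open>\<rho>\<^sub>1\<close> and \<open>\<rho>\<^sub>2\<close>, and so spells \<open>m\<close> as a word in them.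
\<close>

lemma connected_only_if:
  assumes con: "strongly_flag_connected M"
  shows "P 0 \<inter> P 3 \<subseteq> par {1,2}"
proof
  fix m assume m: "m \<in> P 0 \<inter> P 3"
  then have mG: "m \<in> G" "m \<in> carrier A" using P_sub_G G_closed by auto
  have oneG: "\<one> \<in> G" using par_one by auto
  let ?R = "{(X, Y). X \<in> flags M \<and> Y \<in> flags M \<and> flag \<one> \<inter> flag m \<subseteq> X \<and> flag \<one> \<inter> flag m \<subseteq> Y \<and> adjacent_flags X Y}"
  have "(flag \<one>, flag m) \<in> ?R\<^sup>*"
    using con oneG mG unfolding strongly_flag_connected_def flags_M by blast
  moreover have "\<exists>w\<in>par {1,2}. Y = flag w" if "(flag \<one>, Y) \<in> ?R\<^sup>*" for Y
    using that
  proof (induction rule: rtrancl_induct)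
    case base
    then show ?case using par_one[of "{1,2}"] by auto
  next
    case (step X Y)
    then obtain w where w: "w \<in> par {1,2}" "X = flag w" by auto
    obtain w' where w': "w' \<in> G" "Y = flag w'" using step unfolding flags_M by auto
    have wG: "w \<in> G" using w par_mono[of "{1,2}" "{..<4}"] by auto
    have "E 0 m \<one>" "E 3 m \<one>" using m mG oneG unfolding E_def by auto
    then have "face 0 m \<in> flag \<one> \<inter> flag m" "face 3 m \<in> flag \<one> \<inter> flag m" using in_flag oneG mG E_refl by auto
    then have "face 0 m \<in> flag w'" "face 3 m \<in> flag w'" "face 0 m \<in> flag w" "face 3 m \<in> flag w"
      using step w w' by auto
    then have "E 0 m w'" "E 3 m w'" "E 0 m w" "E 3 m w" using in_flag w' wG mG by auto
    then have E03: "E 0 w' w" "E 3 w' w" using E_sym E_trans by blast+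
    have "card (flag w - flag w') = 1" using step w w' unfolding adjacent_flags_def by auto
    then obtain X0 where X0: "flag w - flag w' = {X0}" using card_1_singletonE by blast
    then obtain l where l: "l < 4" "X0 = face l w" unfolding flag_def by auto
    have "E j w' w" if "j < 4" "j \<noteq> l" for j
    proof -
      have "face j w \<noteq> face l w" using that by (auto simp: face_def)
      then have "face j w \<in> flag w'" using X0 l in_flag[OF wG wG] that E_refl[OF wG] by blast
      then show ?thesis using in_flag w' wG that E_sym by blast
    qed
    then have S: "\<forall>j<4. j \<noteq> l \<longrightarrow> w' \<otimes> inv w \<in> S j" using S_of_P unfolding E_def by auto
    have c: "w \<in> carrier A" "w' \<in> carrier A" using wG w' G_closed by auto
    have "w' \<otimes> inv w \<in> G" using par_mult par_inv w' wG by auto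
    then have "w' \<otimes> inv w = \<one> \<or> w' \<otimes> inv w = \<rho> l" using S_triple[OF l(1) _ S] unfolding par_def by auto
    moreover have eq: "w' = (w' \<otimes> inv w) \<otimes> w" using c by (simp add: m_assoc)
    moreover have "l \<noteq> 0 \<and> l \<noteq> 3" if "w' \<otimes> inv w = \<rho> l"
    proof -
      have "\<rho> l \<in> S 0" "\<rho> l \<in> S 3" using E03 that S_of_P unfolding E_def by auto
      then show ?thesis using rho_S[of l 0] rho_S[of l 3] l by auto
    qed
    ultimately have "w' \<in> par {1,2}"
    proof (elim disjE)
      assume "w' \<otimes> inv w = \<rho> l"
      then have "l \<in> {1,2}" "w' = \<rho> l \<otimes> w" using \<open>w' \<otimes> inv w = \<rho> l \<Longrightarrow> l \<noteq> 0 \<and> l \<noteq> 3\<close> l eq by auto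
      then show ?thesis using par_mult[of "{1,2}"] rho_par w by auto
    qed (use w c eq in auto)
    then show ?case using w' by auto
  qed
  ultimately obtain w where "w \<in> par {1,2}" "flag m = flag w" by blast
  moreover from this have "w \<in> G" using par_mono[of "{1,2}" "{..<4}"] by auto
  ultimately show "m \<in> par {1,2}" using flag_eq[of m w] mG by auto
qed

lemma diamond_M:
  assumes F: "F \<in> faces_of_rank M (j - 1)" and K: "K \<in> faces_of_rank M (j + 1)" and less: "face_less M F K"
  shows "card {H \<in> faces_of_rank M j. face_less M F H \<and> face_less M H K} = 2"
proof -
  have FK: "F \<in> faces M" "K \<in> faces M" "mix_rank 4 F = j - 1" "mix_rank 4 K = j + 1" "mix_le F K"
    using F K less unfolding faces_of_rank_def face_less_def by auto
  have rk: "- 1 \<le> mix_rank 4 X \<and> mix_rank 4 X \<le> 4" if "X \<in> faces M" for X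
    using that by (cases rule: faces_M_cases) auto
  have "0 \<le> j" "j \<le> 3" using rk[OF FK(1)] rk[OF FK(2)] FK by auto
  then obtain n where n: "j = int n" "n < 4" using that[of "nat j"] by auto
  have refl: "mix_le X X" if "X \<in> faces M" for X
    using that by (cases rule: faces_M_cases) (auto simp: le_face E_refl)
  obtain g where g: "g \<in> G" "{F, K} \<subseteq> flag g" using chain_flag[of "{F,K}"] FK refl by auto
  have g': "\<rho> n \<otimes> g \<in> G" using rho_mult_G g n by auto
  have other: "X \<in> flag (\<rho> n \<otimes> g)" if "X \<in> flag g" "mix_rank 4 X \<noteq> j" for X
  proof (cases "\<exists>i<4. X = face i g")
    case True
    then obtain i where i: "i < 4" "X = face i g" by auto
    then have "E i g (\<rho> n \<otimes> g)" using E_rho[OF g(1) n(2)] that n E_sym by auto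
    then show ?thesis using in_flag[OF g' g(1)] i by auto
  qed (use that in \<open>auto simp: flag_def\<close>)
  have "{H \<in> faces_of_rank M j. face_less M F H \<and> face_less M H K} = {face n g, face n (\<rho> n \<otimes> g)}" (is "?L = ?R")
  proof (intro equalityI subsetI)
    fix H assume "H \<in> ?L"
    then have H: "H \<in> faces M" "mix_rank 4 H = j" "mix_le F H" "mix_le H K"
      unfolding faces_of_rank_def face_less_def by auto
    obtain h where h: "h \<in> G" "{F, H, K} \<subseteq> flag h" using chain_flag[of "{F,H,K}"] FK H refl by auto
    have Hh: "H = face n h" using flag_rank[of H h "face n h"] H n h E_refl in_flag by auto
    define m where "m = h \<otimes> inv g"
    have mG: "m \<in> G" unfolding m_def using h g par_mult par_inv by auto
    have c: "m \<in> carrier A" "g \<in> carrier A" "h \<in> carrier A" "\<rho> n \<in> carrier A" using mG g h G_closed rho_closed n by auto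
    have mP: "m \<in> P i" if "X \<in> flag g" "X \<in> flag h" "mix_rank 4 X = int i" "i < 4" for X i
    proof -
      have "X = face i g" "X = face i h" using flag_rank[of X _ "face i _"] that g h in_flag E_refl by auto
      then show ?thesis using face_eq[of g h i i] g h that E_sym unfolding m_def E_def by metis
    qed
    have "m \<in> P n \<or> m \<otimes> \<rho> n \<in> P n"
    proof (rule diamond[OF n(2) mG])
      assume "0 < n" then show "m \<in> P (n - 1)" using mP[of F "n - 1"] g h FK n by auto
    next
      assume "n < 3" then show "m \<in> P (n + 1)" using mP[of K "n + 1"] g h FK n by auto
    qed
    then have "E n h g \<or> E n h (\<rho> n \<otimes> g)"
    proof
      assume "m \<otimes> \<rho> n \<in> P n"
      moreover have "h \<otimes> inv (\<rho> n \<otimes> g) = m \<otimes> \<rho> n" unfolding m_def using c n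
        by (simp add: inv_mult_group inv_rho m_assoc)
      ultimately show ?thesis using h g' unfolding E_def by auto
    qed (use h g in \<open>auto simp: m_def E_def\<close>)
    then show "H \<in> ?R" using Hh face_eq[of h _ n n] h g g' n by auto
  next
    fix H assume "H \<in> ?R"
    then obtain u where u: "u \<in> G" "H = face n u" "{F, K} \<subseteq> flag u" using g g' other FK by auto
    have Hu: "H \<in> flag u" using u in_flag E_refl n by auto
    have "mix_le F H" "mix_le H K" using flag_le[OF u(1)] Hu u FK n by auto
    moreover have "F \<noteq> H" "H \<noteq> K" using u n FK by auto
    ultimately show "H \<in> ?L" using u n FK unfolding faces_of_rank_def face_less_def faces_M by auto
  qed
  moreover have "face n g \<noteq> face n (\<rho> n \<otimes> g)"
  proof
    assume "face n g = face n (\<rho> n \<otimes> g)"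
    then have "E n (\<rho> n \<otimes> g) g" using face_eq[of g "\<rho> n \<otimes> g" n n] g g' n E_sym by auto
    then have "\<rho> n \<in> P n" using g n G_closed rho_closed unfolding E_def by (simp add: m_assoc)
    then show False using S_of_P rho_S n by auto
  qed
  ultimately show ?thesis by simp
qed

theorem polytope_M: "abstract_polytope 4 M \<longleftrightarrow> P 0 \<inter> P 3 \<subseteq> par {1,2}"
proof
  assume "abstract_polytope 4 M"
  then show "P 0 \<inter> P 3 \<subseteq> par {1,2}" using connected_only_if unfolding abstract_polytope_def by auto
next
  assume H: "P 0 \<inter> P 3 \<subseteq> par {1,2}"
  have refl: "mix_le X X" if "X \<in> faces M" for X
    using that by (cases rule: faces_M_cases) (auto simp: le_face E_refl)
  have rank: "mix_rank 4 X < mix_rank 4 Y" if "X \<in> faces M" "Y \<in> faces M" "mix_le X Y" "X \<noteq> Y" for X Y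
    using that by (elim faces_M_cases) (auto simp: le_face face_eq)
  have antisym: "X = Y" if "X \<in> faces M" "Y \<in> faces M" "mix_le X Y" "mix_le Y X" for X Y
    using rank[OF that(1,2,3)] rank[OF that(2,1,4)] by fastforce
  let ?r = "{(X, Y). X \<in> faces M \<and> Y \<in> faces M \<and> face_le M X Y}"
  have "refl_on (faces M) ?r" using refl by (auto simp: refl_on_def)
  moreover have "trans ?r" by (rule transI) (use le_trans_M in auto)
  moreover have "antisym ?r" by (rule antisymI) (use antisym in auto)
  ultimately have "partial_order_on (faces M) ?r"
    unfolding partial_order_on_def preorder_on_def by auto
  moreover have "\<forall>F\<in>faces M. - 1 \<le> face_rank M F \<and> face_rank M F \<le> int 4"
    by (auto elim!: faces_M_cases)
  moreover have "\<forall>F\<in>faces M. \<forall>G\<in>faces M. face_less M F G \<longrightarrow> face_rank M F < face_rank M G"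
    using rank unfolding face_less_def by auto
  moreover have L: "faces_of_rank M (- 1) = {Least_Face}" "faces_of_rank M (int 4) = {Greatest_Face}"
    unfolding faces_of_rank_def by (auto elim!: faces_M_cases simp: faces_M)
  moreover have "\<forall>\<Phi>\<in>flags M. card \<Phi> = 4 + 2" using card_flag unfolding flags_M by auto
  ultimately show "abstract_polytope 4 M"
    unfolding abstract_polytope_def using connected_if[OF H] diamond_M by (auto simp: L)
qed

text \<open>
  Every coset of a maximal parabolic subgroup contains an even element, which turns it into a coset of the rotation subgroup.
\<close>

lemma faces_eq_cosets:
  assumes j: "j < 4"
  shows "Coset_Face j ` (rcosets\<^bsub>A\<lparr>carrier := Gp\<rparr>\<^esub> (ev ({..<4} - {j}))) = face j ` G"
proof -
  let ?H = "ev ({..<4} - {j})" and ?B = "A\<lparr>carrier := Gp\<rparr>"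
  have HGp: "?H \<subseteq> Gp" unfolding ev_def by (rule mono_generate) auto
    have coset: "?H #>\<^bsub>?B\<^esub> g = {x \<in> Gp. x \<otimes> inv g \<in> P j}" if g: "g \<in> Gp" for g
    proof -
      have gc: "g \<in> carrier A" "g \<in> G" using g Gp_sub G_closed by auto
      show ?thesis
      proof (intro equalityI subsetI)
        fix x assume "x \<in> ?H #>\<^bsub>?B\<^esub> g"
        then obtain h where h: "h \<in> ?H" "x = h \<otimes> g" unfolding r_coset_def by auto
        then have "h \<in> Gp" "h \<in> P j" "h \<in> carrier A" using HGp ev_sub_par[of "{..<4}-{j}"] Gp_sub G_closed by auto
        then show "x \<in> {x \<in> Gp. x \<otimes> inv g \<in> P j}" using h g gc ev_mult by (auto simp: m_assoc)
      next
        fix x assume x: "x \<in> {x \<in> Gp. x \<otimes> inv g \<in> P j}"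
        then have xc: "x \<in> carrier A" "x \<in> Gp" using Gp_sub G_closed by auto
        have "inv g \<in> Gp" by (rule subgroup.m_inv_closed[OF ev_subgroup g]) auto
        then have "x \<otimes> inv g \<in> Gp" using ev_mult xc by auto
        then have "x \<otimes> inv g \<in> ?H" using x ev_iff[of "{..<4} - {j}"] ev_iff[of "{..<4}"] by auto
        moreover have "x = (x \<otimes> inv g) \<otimes> g" using xc gc by (simp add: m_assoc)
        ultimately show "x \<in> ?H #>\<^bsub>?B\<^esub> g" unfolding r_coset_def by auto
      qed
    qed
    have "face j ` G = face j ` Gp"
    proof (intro equalityI subsetI)
      fix X assume "X \<in> face j ` G"
      then obtain g where g: "g \<in> G" "X = face j g" by auto
      from face_rep[OF g(1) j] obtain x where "x \<in> Gp" "E j x g" by auto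
      moreover from this have "face j x = X" using g face_eq[of x g j j] Gp_sub j by auto
      ultimately show "X \<in> face j ` Gp" by (metis imageI)
    qed (use Gp_sub in auto)
    moreover have "face j ` Gp = Coset_Face j ` (rcosets\<^bsub>?B\<^esub> ?H)"
      unfolding RCOSETS_def using coset by (auto simp: face_def image_iff)
    ultimately show ?thesis by simp
qed

lemma card_faces_M:
  assumes j: "j < 4"
  shows "card (faces_of_rank M (int j)) * card (ev ({..<4} - {j})) = card Gp"
proof -
  let ?H = "ev ({..<4} - {j})" and ?B = "A\<lparr>carrier := Gp\<rparr>"
  have HGp: "?H \<subseteq> Gp" unfolding ev_def by (rule mono_generate) auto
  interpret B: group ?B by (rule subgroup_imp_group[OF ev_subgroup]) auto
  have H: "subgroup ?H ?B" using subgroup_incl[OF ev_subgroup ev_subgroup HGp] by auto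
  have fin: "finite Gp" using finite_G Gp_sub finite_subset unfolding par_def by blast
  have "card (rcosets\<^bsub>?B\<^esub> ?H) * card ?H = order ?B"
    by (rule B.lagrange[OF H])
  moreover have "faces_of_rank M (int j) = face j ` G"
    using j unfolding faces_of_rank_def by (auto elim!: faces_M_cases simp: faces_M)
  then have "faces_of_rank M (int j) = Coset_Face j ` (rcosets\<^bsub>?B\<^esub> ?H)"
    unfolding faces_eq_cosets[OF j] .
  moreover have "card (Coset_Face j ` X) = card X" for X :: "'a set set"
    by (rule card_image) (auto simp: inj_on_def)
  ultimately show ?thesis by (simp add: order_def)
qed

end

section \<open>Rotation generators\<close>

context string_group
begin

definition \<beta> :: "nat \<Rightarrow> 'a" where "\<beta> k = \<rho> (k - 1) \<otimes> \<rho> k"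

lemma \<beta>_closed: "0 < k \<Longrightarrow> k < 4 \<Longrightarrow> \<beta> k \<in> carrier A"
  unfolding \<beta>_def by (simp add: rho_closed)

lemma word:
  assumes "1 \<le> i" "i \<le> j" "j < 4"
  shows "foldr (\<lambda>k w. \<beta> k \<otimes> w) [i..<Suc j] \<one> = \<rho> (i - 1) \<otimes> \<rho> j"
  using assms(2,1)
proof (induction i rule: inc_induct)
  case base
  then show ?case using assms(3) by (simp add: \<beta>_def rho_closed)
next
  case (step i)
  have "foldr (\<lambda>k w. \<beta> k \<otimes> w) [i..<Suc j] \<one> = \<beta> i \<otimes> foldr (\<lambda>k w. \<beta> k \<otimes> w) [Suc i..<Suc j] \<one>"
    using step.hyps by (subst upt_conv_Cons) auto
  also have "\<dots> = \<beta> i \<otimes> (\<rho> i \<otimes> \<rho> j)" using step by simp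
  also have "\<dots> = \<rho> (i - 1) \<otimes> \<rho> j"
    using step.hyps assms(3) by (simp add: \<beta>_def m_assoc rho_closed rho_rho)
  finally show ?case .
qed

lemma ev_less:
  assumes J: "J \<subseteq> {..<4}"
  shows "ev J = generate A {\<rho> a \<otimes> \<rho> b | a b. a \<in> J \<and> b \<in> J \<and> a < b}" (is "_ = generate A ?X")
proof
  have X: "?X \<subseteq> carrier A" using J rho_closed by auto
  show "ev J \<subseteq> generate A ?X" unfolding ev_def
  proof (rule generate_subgroup_incl[OF _ generate_is_subgroup[OF X]], safe)
    fix i j assume ij: "i \<in> J" "j \<in> J"
    then have c: "i < 4" "j < 4" using J by auto
    consider "i < j" | "i = j" | "j < i" by linarith
    then show "\<rho> i \<otimes> \<rho> j \<in> generate A ?X"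
    proof cases
      case 1 then show ?thesis using ij by (intro generate.incl) auto
    next
      case 2 then show ?thesis using c generate.one by (simp add: rho_sq)
    next
      case 3
      then have "inv (\<rho> j \<otimes> \<rho> i) \<in> generate A ?X" using ij by (intro generate.inv) auto
      then show ?thesis using c by (simp add: inv_mult_group inv_rho rho_closed)
    qed
  qed
  show "generate A ?X \<subseteq> ev J" unfolding ev_def by (rule mono_generate) auto
qed

lemma ev_interval:
  assumes ab: "b < 4"
  shows "ev {a..b} = generate A (\<beta> ` {Suc a..b})"
proof
  have J: "{a..b} \<subseteq> {..<4}" using ab by auto
  have X: "\<beta> ` {Suc a..b} \<subseteq> carrier A" using ab \<beta>_closed by auto
  have w: "foldr (\<lambda>k w. \<beta> k \<otimes> w) xs \<one> \<in> generate A (\<beta> ` {Suc a..b})" if "set xs \<subseteq> {Suc a..b}" for xs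
    using that
  proof (induction xs)
    case Nil then show ?case by (simp add: generate.one)
  next
    case (Cons k xs)
    then have "\<beta> k \<in> generate A (\<beta> ` {Suc a..b})" by (intro generate.incl) auto
    then show ?case using Cons by (auto intro: generate.eng)
  qed
  show "ev {a..b} \<subseteq> generate A (\<beta> ` {Suc a..b})" unfolding ev_less[OF J]
  proof (rule generate_subgroup_incl[OF _ generate_is_subgroup[OF X]], safe)
    fix i j assume ij: "i \<in> {a..b}" "j \<in> {a..b}" "i < j"
    then have "foldr (\<lambda>k w. \<beta> k \<otimes> w) [Suc i..<Suc j] \<one> = \<rho> i \<otimes> \<rho> j" using word[of "Suc i" j] ab by auto
    moreover have "set [Suc i..<Suc j] \<subseteq> {Suc a..b}" using ij by auto
    ultimately show "\<rho> i \<otimes> \<rho> j \<in> generate A (\<beta> ` {Suc a..b})" using w by metis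
  qed
  have "\<beta> k \<in> ev {a..b}" if "k \<in> {Suc a..b}" for k
    unfolding \<beta>_def using that by (intro rho_rho_ev) auto
  then show "generate A (\<beta> ` {Suc a..b}) \<subseteq> ev {a..b}"
    by (intro generate_subgroup_incl[OF _ ev_subgroup[OF J]]) auto
qed

text \<open>An isolated node of the diagram contributes a direct factor of order 2.\<close>

lemma card_par_insert:
  assumes aK: "insert a K \<subseteq> {..<4}" "a \<notin> K" and far: "\<And>k. k \<in> K \<Longrightarrow> k + 2 \<le> a \<or> a + 2 \<le> k"
  shows "card (par (insert a K)) = 2 * card (par K)"
proof -
  have a: "a < 4" and K: "K \<subseteq> {..<4}" using aK by auto
  have split: "par (insert a K) = par K \<union> (\<lambda>x. \<rho> a \<otimes> x) ` par K"
  proof (intro equalityI subsetI)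
    fix x assume x: "x \<in> par (insert a K)"
    from par_insert_comm[OF aK(1) far x] show "x \<in> par K \<union> (\<lambda>x. \<rho> a \<otimes> x) ` par K"
    proof
      assume "\<rho> a \<otimes> x \<in> par K"
      then show ?thesis using rho_rho[OF a par_closed[OF aK(1) x]] by (metis UnI2 imageI)
    qed auto
  next
    fix x assume "x \<in> par K \<union> (\<lambda>x. \<rho> a \<otimes> x) ` par K"
    then show "x \<in> par (insert a K)"
      using par_mono[of K "insert a K"] aK(1) par_mult[OF aK(1) rho_par[of a "insert a K"]] by auto
  qed
  have disj: "par K \<inter> (\<lambda>x. \<rho> a \<otimes> x) ` par K = {}"
  proof (rule ccontr)
    assume "par K \<inter> (\<lambda>x. \<rho> a \<otimes> x) ` par K \<noteq> {}"
    then obtain x where x: "x \<in> par K" "\<rho> a \<otimes> x \<in> par K" by auto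
    then have "(\<rho> a \<otimes> x) \<otimes> inv x \<in> par K" using par_mult[OF K] par_inv[OF K] by auto
    then have "\<rho> a \<in> par K" using x par_closed[OF K] rho_closed[OF a] by (simp add: m_assoc)
    then have "\<rho> a \<in> S a" using par_sub_S[OF K a aK(2)] by auto
    then show False using rho_S[OF a a] by simp
  qed
  have inj: "inj_on (\<lambda>x. \<rho> a \<otimes> x) (par K)"
    using par_closed[OF K] rho_closed[OF a] by (auto simp: inj_on_def)
  have "par K \<subseteq> G" by (rule par_mono) (use K in auto)
  then have f: "finite (par K)" using finite_G finite_subset unfolding par_def[of "{..<4}"] by blast
  show ?thesis unfolding split using disj inj f by (simp add: card_Un_disjoint card_image)
qed

lemma card_ev_insert:
  assumes aK: "insert a {i..Suc i} \<subseteq> {..<4}" and far: "\<And>k. k \<in> {i..Suc i} \<Longrightarrow> k + 2 \<le> a \<or> a + 2 \<le> k"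
  shows "card (ev (insert a {i..Suc i})) = 2 * ord (\<beta> (Suc i))"
proof -
  have "a \<notin> {i..Suc i}" using far[of a] by auto
  then have "card (par (insert a {i..Suc i})) = 2 * card (par {i..Suc i})"
    by (rule card_par_insert[OF aK _ far])
  then have "2 * card (ev (insert a {i..Suc i})) = 2 * (2 * card (ev {i..Suc i}))"
    using card_par[OF aK] card_par[of "{i..Suc i}"] aK by simp
  moreover have "Suc i \<in> {i..Suc i}" by simp
  then have i4: "Suc i < 4" using aK by blast
  then have "ev {i..Suc i} = generate A {\<beta> (Suc i)}"
    using ev_interval[of "Suc i" i] by simp
  moreover have "\<beta> (Suc i) \<in> carrier A" using \<beta>_closed[of "Suc i"] i4 by simp
  ultimately show ?thesis using generate_pow_card by simp
qed

lemma beta_beta_sq: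
  assumes "0 < k" "Suc k < 4"
  shows "(\<beta> k \<otimes> \<beta> (Suc k)) \<otimes> (\<beta> k \<otimes> \<beta> (Suc k)) = \<one>" "(\<beta> (Suc k) \<otimes> \<beta> k) \<otimes> (\<beta> (Suc k) \<otimes> \<beta> k) = \<one>"
proof -
  have c: "\<rho> (k - 1) \<in> carrier A" "\<rho> k \<in> carrier A" "\<rho> (Suc k) \<in> carrier A" using assms rho_closed by auto
  have p: "\<beta> k \<otimes> \<beta> (Suc k) = \<rho> (k - 1) \<otimes> \<rho> (Suc k)" using c assms by (simp add: \<beta>_def m_assoc rho_rho)
  have comm: "\<rho> (k - 1) \<otimes> \<rho> (Suc k) = \<rho> (Suc k) \<otimes> \<rho> (k - 1)" using assms by (intro rho_comm) auto
  have "(\<rho> (k - 1) \<otimes> \<rho> (Suc k)) \<otimes> (\<rho> (k - 1) \<otimes> \<rho> (Suc k)) = (\<rho> (k - 1) \<otimes> \<rho> (Suc k)) \<otimes> (\<rho> (Suc k) \<otimes> \<rho> (k - 1))"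
    using comm by simp
  also have "\<dots> = \<one>" using c assms by (simp add: m_assoc rho_rho rho_sq)
  finally show 1: "(\<beta> k \<otimes> \<beta> (Suc k)) \<otimes> (\<beta> k \<otimes> \<beta> (Suc k)) = \<one>" using p by simp
  have lc: "\<rho> (Suc k) \<otimes> (\<rho> (k - 1) \<otimes> x) = \<rho> (k - 1) \<otimes> (\<rho> (Suc k) \<otimes> x)" if "x \<in> carrier A" for x
    using rho_left_comm[of "Suc k" "k - 1" x] assms that by auto
  show "(\<beta> (Suc k) \<otimes> \<beta> k) \<otimes> (\<beta> (Suc k) \<otimes> \<beta> k) = \<one>"
    using c assms by (simp add: \<beta>_def m_assoc rho_rho lc rho_sq del: One_nat_def)
qed

end

section \<open>The rotation group of the tetrahedron\<close>

context group
begin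

text \<open>
  Normal forms for \<open>\<langle>a, b | a\<^sup>3 = b\<^sup>3 = (ab)\<^sup>2 = 1\<rangle>\<close>: the pair \<open>(i, j)\<close> stands for \<open>b\<^sup>i a b\<^sup>j\<close>, and the value \<open>j = 3\<close> encodes the
  words \<open>b\<^sup>i\<close> without the letter \<open>a\<close>. There are 12 of them.
\<close>

definition tword :: "'a \<Rightarrow> 'a \<Rightarrow> nat \<times> nat \<Rightarrow> 'a" where
  "tword a b = (\<lambda>(i, j). ((\<otimes>) b ^^ i) (if j = 3 then \<one> else a \<otimes> ((\<otimes>) b ^^ j) \<one>))"

text \<open>
  Left multiplication by the generators permutes the normal forms in a way that does not depend on the group. Hence 12 is
  an upper bound for the order, and two groups with these relations move in parallel.
\<close>

lemma tword_mult:
  assumes a: "a \<in> carrier G" and b: "b \<in> carrier G"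
    and rel: "a \<otimes> a \<otimes> a = \<one>" "b \<otimes> b \<otimes> b = \<one>" "(a \<otimes> b) \<otimes> (a \<otimes> b) = \<one>"
    and w: "w \<in> {..<3} \<times> {..<4}"
  shows "b \<otimes> tword a b w = tword a b ((fst w + 1) mod 3, snd w)"
    "a \<otimes> tword a b w = tword a b
      (if snd w = 3 then (0, fst w) else if fst w = 0 then (1, (snd w + 1) mod 3)
       else if fst w = 1 then ((snd w + 2) mod 3, 3) else (2, (snd w + 2) mod 3))"
proof -
  have bbb: "b \<otimes> (b \<otimes> (b \<otimes> x)) = x" if "x \<in> carrier G" for x
  proof -
    have "b \<otimes> (b \<otimes> (b \<otimes> x)) = (b \<otimes> b \<otimes> b) \<otimes> x" using a b that by (simp add: m_assoc)
    then show ?thesis using rel(2) that by simp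
  qed
  have aaa: "a \<otimes> (a \<otimes> (a \<otimes> x)) = x" if "x \<in> carrier G" for x
  proof -
    have "a \<otimes> (a \<otimes> (a \<otimes> x)) = (a \<otimes> a \<otimes> a) \<otimes> x" using a b that by (simp add: m_assoc)
    then show ?thesis using rel(1) that by simp
  qed
  have abab: "a \<otimes> (b \<otimes> (a \<otimes> (b \<otimes> x))) = x" if "x \<in> carrier G" for x
  proof -
    have "a \<otimes> (b \<otimes> (a \<otimes> (b \<otimes> x))) = ((a \<otimes> b) \<otimes> (a \<otimes> b)) \<otimes> x" using a b that by (simp add: m_assoc)
    then show ?thesis using rel(3) that by simp
  qed
  have bab: "b \<otimes> (a \<otimes> (b \<otimes> x)) = a \<otimes> (a \<otimes> x)" if "x \<in> carrier G" for x
    using abab[OF that] aaa[of "b \<otimes> (a \<otimes> (b \<otimes> x))"] a b that by (metis m_closed)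
  have aa: "a \<otimes> (a \<otimes> x) = b \<otimes> (a \<otimes> (b \<otimes> x))" if "x \<in> carrier G" for x using bab[OF that] by simp
  have aba: "a \<otimes> (b \<otimes> (a \<otimes> x)) = b \<otimes> (b \<otimes> x)" if "x \<in> carrier G" for x
    using abab[of "b \<otimes> (b \<otimes> x)"] bbb[OF that] a b that by simp
  have abba: "a \<otimes> (b \<otimes> (b \<otimes> (a \<otimes> x))) = b \<otimes> (b \<otimes> (a \<otimes> (b \<otimes> (b \<otimes> x))))" if x: "x \<in> carrier G" for x
  proof -
    have "a \<otimes> (b \<otimes> (b \<otimes> (a \<otimes> x))) = a \<otimes> (a \<otimes> (b \<otimes> (a \<otimes> (a \<otimes> x))))"
      using aba[of "a \<otimes> x"] x a b by simp
    also have "\<dots> = b \<otimes> (a \<otimes> (b \<otimes> (b \<otimes> (b \<otimes> (a \<otimes> (b \<otimes> x))))))"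
      using aa[OF x] aa[of "b \<otimes> (b \<otimes> (a \<otimes> (b \<otimes> x)))"] x a b by simp
    also have "\<dots> = b \<otimes> (a \<otimes> (a \<otimes> (b \<otimes> x)))" using bbb[of "a \<otimes> (b \<otimes> x)"] x a b by simp
    also have "\<dots> = b \<otimes> (b \<otimes> (a \<otimes> (b \<otimes> (b \<otimes> x))))" using aa[of "b \<otimes> x"] x a b by simp
    finally show ?thesis .
  qed
  obtain i j where ij: "w = (i, j)" "i < 3" "j < 4" using w by auto
  have i: "i = 0 \<or> i = 1 \<or> i = 2" and j: "j = 0 \<or> j = 1 \<or> j = 2 \<or> j = 3" using ij by linarith+
  have two: "f ^^ 2 = f \<circ> f" for f :: "'a \<Rightarrow> 'a" by (simp add: numeral_2_eq_2 fun_eq_iff)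
  have mods: "Suc 0 mod 3 = 1" "Suc (Suc 0) mod 3 = 2" "(2::nat) mod 3 = 2" "(3::nat) mod 3 = 0" "(4::nat) mod 3 = 1" by simp_all
  have r1: "b \<otimes> (b \<otimes> b) = \<one>" using rel(2) b by (simp add: m_assoc)
  have r2: "a \<otimes> (b \<otimes> a) = b \<otimes> b" using aba[of \<one>] a b by simp
  have r3: "a \<otimes> (b \<otimes> (b \<otimes> a)) = b \<otimes> (b \<otimes> (a \<otimes> (b \<otimes> b)))" using abba[of \<one>] a b by simp
  have r4: "a \<otimes> a = b \<otimes> (a \<otimes> b)" using aa[of \<one>] a b by simp
  show "b \<otimes> tword a b w = tword a b ((fst w + 1) mod 3, snd w)"
    using i j a b by (elim disjE) (simp_all add: ij(1) tword_def two bbb r1)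
  show "a \<otimes> tword a b w = tword a b
      (if snd w = 3 then (0, fst w) else if fst w = 0 then (1, (snd w + 1) mod 3)
       else if fst w = 1 then ((snd w + 2) mod 3, 3) else (2, (snd w + 2) mod 3))"
    using i j a b by (elim disjE) (simp_all add: ij(1) tword_def two aba abba aa bbb r1 r2 r3 r4)
qed

lemma generate_left_induct [consumes 2, case_names one step inv_step]:
  assumes X: "X \<subseteq> carrier G" and x: "x \<in> generate G X"
    and one: "Q \<one>"
    and step: "\<And>h y. h \<in> X \<Longrightarrow> y \<in> generate G X \<Longrightarrow> Q y \<Longrightarrow> Q (h \<otimes> y)"
    and inv_step: "\<And>h y. h \<in> X \<Longrightarrow> y \<in> generate G X \<Longrightarrow> Q y \<Longrightarrow> Q (inv h \<otimes> y)"
  shows "Q x"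
proof -
  have "\<forall>y \<in> generate G X. Q y \<longrightarrow> Q (z \<otimes> y)" if "z \<in> generate G X" for z
    using that
  proof (induction rule: generate.induct)
    case one
    then show ?case using generate_in_carrier[OF X] by auto
  next
    case (incl h) then show ?case using step by auto
  next
    case (inv h) then show ?case using inv_step by auto
  next
    case (eng h1 h2)
    show ?case
    proof (intro ballI impI)
      fix y assume y: "y \<in> generate G X" "Q y"
      have "h2 \<otimes> y \<in> generate G X" using eng(2) y(1) by (rule generate.eng)
      then have "Q (h1 \<otimes> (h2 \<otimes> y))" using eng y by blast
      then show "Q (h1 \<otimes> h2 \<otimes> y)" using m_assoc generate_in_carrier[OF X] eng y by metis
    qed
  qed
  then have "Q (x \<otimes> \<one>)" using x one generate.one by metis
  then show ?thesis using generate_in_carrier[OF X x] by simp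
qed

end

section \<open>Products\<close>

text \<open>
  The stabilisers are taken componentwise. For three of them, each component is trivial or the remaining generator, and the
  signs of all components agree with the sign at \<open>r0\<close>; so the components are all trivial or all equal to the generator.
\<close>

lemma product_string_group:
  fixes A :: "'r \<Rightarrow> 'a monoid"
  assumes I: "finite I" "r0 \<in> I" and sgp: "\<And>r. r \<in> I \<Longrightarrow> string_group (A r) (\<rho> r) (S r) (sg r)"
  shows "string_group (product_group I A) (\<lambda>i. \<lambda>r\<in>I. \<rho> r i)
     (\<lambda>i. {x \<in> carrier (product_group I A). \<forall>r\<in>I. x r \<in> S r i}) (\<lambda>x. sg r0 (x r0))"
proof -
  let ?B = "product_group I A" and ?R = "\<lambda>i. \<lambda>r\<in>I. \<rho> r i"
  have grp: "group (A r)" if "r \<in> I" for r using sgp[OF that] by (rule string_group.axioms)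
  have B: "group ?B" using grp by simp
  interpret B: group ?B by (rule B)
  note cl = string_group.rho_closed[OF sgp]
  have Rc: "?R i \<in> carrier ?B" if "i < 4" for i using cl[OF _ that] by auto
  have invR: "inv\<^bsub>?B\<^esub> (?R i) = ?R i" if "i < 4" for i
  proof (rule B.inv_equality)
    show "?R i \<otimes>\<^bsub>?B\<^esub> ?R i = \<one>\<^bsub>?B\<^esub>" using string_group.rho_sq[OF sgp that] by (auto intro!: restrict_ext)
  qed (use Rc that in auto)
  have comp: "x \<in> carrier ?B \<and> (\<forall>r\<in>I. x r \<in> generate (A r) (\<rho> r ` {..<4}) \<and> sg r (x r) = sg r0 (x r0))"
    if "x \<in> generate ?B (?R ` {..<4})" for x
    using that
  proof (induction rule: generate.induct)
    case one
    have "sg r \<one>\<^bsub>A r\<^esub> = 1" if "r \<in> I" for r using string_group.sg_one[OF sgp[OF that]] .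
    then show ?case using B.one_closed I(2) by (auto simp: generate.one)
  next
    case (incl h)
    then obtain i where i: "i < 4" "h = ?R i" by auto
    then show ?case using Rc[OF i(1)] string_group.sg_rho[OF sgp i(1)] I(2) by (auto intro: generate.incl)
  next
    case (inv h)
    then obtain i where i: "i < 4" "h = ?R i" by auto
    then have "inv\<^bsub>?B\<^esub> h = ?R i" using invR by simp
    then show ?case using Rc[OF i(1)] string_group.sg_rho[OF sgp i(1)] I(2) i by (auto intro: generate.incl)
  next
    case (eng h1 h2)
    have "h1 \<otimes>\<^bsub>?B\<^esub> h2 \<in> carrier ?B" using eng by (intro B.m_closed) auto
    moreover have "sg r (h1 r \<otimes>\<^bsub>A r\<^esub> h2 r) = sg r (h1 r) * sg r (h2 r)" if "r \<in> I" for r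
      using eng that by (intro string_group.sg_mult[OF sgp[OF that]]) auto
    moreover have "h1 r \<otimes>\<^bsub>A r\<^esub> h2 r \<in> generate (A r) (\<rho> r ` {..<4})" if "r \<in> I" for r
      using eng that by (intro generate.eng) auto
    moreover have "sg r (h1 r) = sg r0 (h1 r0)" "sg r (h2 r) = sg r0 (h2 r0)" if "r \<in> I" for r
      using eng that by auto
    ultimately show ?case
    proof (intro conjI ballI)
      fix r assume r: "r \<in> I"
      assume *: "\<And>r. r \<in> I \<Longrightarrow> h1 r \<otimes>\<^bsub>A r\<^esub> h2 r \<in> generate (A r) (\<rho> r ` {..<4})"
        "\<And>r. r \<in> I \<Longrightarrow> sg r (h1 r \<otimes>\<^bsub>A r\<^esub> h2 r) = sg r (h1 r) * sg r (h2 r)"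
        "\<And>r. r \<in> I \<Longrightarrow> sg r (h1 r) = sg r0 (h1 r0)" "\<And>r. r \<in> I \<Longrightarrow> sg r (h2 r) = sg r0 (h2 r0)"
      show "(h1 \<otimes>\<^bsub>?B\<^esub> h2) r \<in> generate (A r) (\<rho> r ` {..<4})" using *(1)[OF r] r by simp
      show "sg r ((h1 \<otimes>\<^bsub>?B\<^esub> h2) r) = sg r0 ((h1 \<otimes>\<^bsub>?B\<^esub> h2) r0)"
        using *(2)[OF r] *(2)[OF I(2)] *(3)[OF r] *(4)[OF r] r I(2) by simp
    qed
  qed
  show ?thesis
  proof (intro string_group.intro string_group_axioms.intro)
    show "group ?B" by (rule B)
  next
    fix i assume "i < (4::nat)" then show "?R i \<in> carrier ?B" by (rule Rc)
  next
    fix i assume "i < (4::nat)" then show "?R i \<otimes>\<^bsub>?B\<^esub> ?R i = \<one>\<^bsub>?B\<^esub>"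
      using string_group.rho_sq[OF sgp] by (auto intro!: restrict_ext)
  next
    fix i j :: nat assume "j < 4" "i + 2 \<le> j" then show "?R i \<otimes>\<^bsub>?B\<^esub> ?R j = ?R j \<otimes>\<^bsub>?B\<^esub> ?R i"
      using string_group.rho_comm[OF sgp] by (auto intro!: restrict_ext)
  next
    fix i assume i: "i < (4::nat)"
    note sub = string_group.S_subgroup[OF sgp i]
    show "subgroup {x \<in> carrier ?B. \<forall>r\<in>I. x r \<in> S r i} ?B"
    proof (rule B.subgroupI)
      show "{x \<in> carrier ?B. \<forall>r\<in>I. x r \<in> S r i} \<noteq> {}"
        using B.one_closed sub subgroup.one_closed by (intro ex_in_conv[THEN iffD1] exI[of _ "\<one>\<^bsub>?B\<^esub>"]) auto
    next
      fix x assume x: "x \<in> {x \<in> carrier ?B. \<forall>r\<in>I. x r \<in> S r i}"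
      have "inv\<^bsub>?B\<^esub> x = (\<lambda>r\<in>I. inv\<^bsub>A r\<^esub> x r)" using x grp by (intro inv_product_group) auto
      moreover have "inv\<^bsub>?B\<^esub> x \<in> carrier ?B" using x by (intro B.inv_closed) auto
      ultimately show "inv\<^bsub>?B\<^esub> x \<in> {x \<in> carrier ?B. \<forall>r\<in>I. x r \<in> S r i}"
        using x sub subgroup.m_inv_closed by fastforce
    next
      fix x y assume x: "x \<in> {x \<in> carrier ?B. \<forall>r\<in>I. x r \<in> S r i}" and y: "y \<in> {x \<in> carrier ?B. \<forall>r\<in>I. x r \<in> S r i}"
      have "x \<otimes>\<^bsub>?B\<^esub> y \<in> carrier ?B" using x y by (intro B.m_closed) auto
      then show "x \<otimes>\<^bsub>?B\<^esub> y \<in> {x \<in> carrier ?B. \<forall>r\<in>I. x r \<in> S r i}"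
        using x y sub subgroup.m_closed by fastforce
    qed auto
  next
    fix i j :: nat assume ij: "i < 4" "j < 4"
    show "?R i \<in> {x \<in> carrier ?B. \<forall>r\<in>I. x r \<in> S r j} \<longleftrightarrow> i \<noteq> j"
      using Rc[OF ij(1)] string_group.rho_S[OF sgp ij] I(2) by auto
  next
    fix x y assume "x \<in> carrier ?B" "y \<in> carrier ?B"
    then show "sg r0 ((x \<otimes>\<^bsub>?B\<^esub> y) r0) = sg r0 (x r0) * sg r0 (y r0)"
      using string_group.sg_mult[OF sgp[OF I(2)]] I(2) by auto
  next
    fix i :: nat assume "i < 4" then show "sg r0 (?R i r0) = - 1"
      using string_group.sg_rho[OF sgp[OF I(2)]] I(2) by simp
  next
    fix l x assume l: "l < (4::nat)" and x: "x \<in> generate ?B (?R ` {..<4})"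
      and S: "\<forall>i<4. i \<noteq> l \<longrightarrow> x \<in> {x \<in> carrier ?B. \<forall>r\<in>I. x r \<in> S r i}"
    note c = comp[OF x]
    have two: "x r = \<one>\<^bsub>A r\<^esub> \<or> x r = \<rho> r l" if "r \<in> I" for r
      using string_group.S_triple[OF sgp[OF that] l, of "x r"] c S that by auto
    have s1: "sg r (x r) = 1 \<longleftrightarrow> x r = \<one>\<^bsub>A r\<^esub>" if "r \<in> I" for r
      using two[OF that] string_group.sg_one[OF sgp[OF that]] string_group.sg_rho[OF sgp[OF that] l] by auto
    show "x = \<one>\<^bsub>?B\<^esub> \<or> x = ?R l"
    proof (cases "sg r0 (x r0) = 1")
      case True
      then have "x r = \<one>\<^bsub>A r\<^esub>" if "r \<in> I" for r using s1[OF that] c that by simp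
      then have "x = \<one>\<^bsub>?B\<^esub>" using c by (auto simp: PiE_iff extensional_def fun_eq_iff)
      then show ?thesis by simp
    next
      case False
      then have "x r = \<rho> r l" if "r \<in> I" for r using s1[OF that] two[OF that] c that by auto
      then have "x = ?R l" using c by (auto simp: PiE_iff extensional_def fun_eq_iff)
      then show ?thesis by simp
    qed
  next
    have "x \<in> (\<Pi>\<^sub>E r\<in>I. generate (A r) (\<rho> r ` {..<4}))" if "x \<in> generate ?B (?R ` {..<4})" for x
      using comp[OF that] by (simp add: PiE_def Pi_def)
    then have "generate ?B (?R ` {..<4}) \<subseteq> (\<Pi>\<^sub>E r\<in>I. generate (A r) (\<rho> r ` {..<4}))" by blast
    moreover have "finite (\<Pi>\<^sub>E r\<in>I. generate (A r) (\<rho> r ` {..<4}))"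
      using string_group.finite_G[OF sgp] I(1) by (intro finite_PiE) auto
    ultimately show "finite (generate ?B (?R ` {..<4}))" by (rule finite_subset)
  qed
qed

section \<open>Faces of convex polytopes\<close>

lemma face_dim_eq:
  fixes P :: "'a::euclidean_space set"
  assumes "F face_of P" "K face_of P" "F \<subseteq> K" "aff_dim F = aff_dim K"
  shows "F = K"
proof (rule ccontr)
  assume "F \<noteq> K"
  moreover have "F face_of K" using assms face_of_face by blast
  ultimately show False using face_of_aff_dim_lt[of K F] face_of_imp_convex assms by auto
qed

lemma face_dim_less:
  fixes P :: "'a::euclidean_space set"
  assumes "F face_of P" "K face_of P" "F \<subset> K"
  shows "aff_dim F < aff_dim K"
  using face_dim_eq[OF assms(1,2)] assms aff_dim_subset[of F K] by fastforce

text \<open>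
  The smaller face lies in a facet of the larger one, whose dimension is still too big to be equal to it.
\<close>

lemma intermediate_face:
  fixes P :: "'a::euclidean_space set"
  assumes P: "polytope P" and F: "F face_of P" and K: "K face_of P"
    and sub: "F \<subseteq> K" and dim: "aff_dim F + 2 \<le> aff_dim K"
  shows "\<exists>H. H face_of P \<and> F \<subset> H \<and> H \<subset> K"
proof -
  have KP: "polytope K" using face_of_polytope_polytope P K by blast
  have FK: "F face_of K" using face_of_face[OF K] F sub by blast
  have dF: "- 1 \<le> aff_dim F" by (rule aff_dim_geq)
  obtain H where H: "H facet_of K" "F \<subseteq> H"
  proof (cases "F = {}")
    case True
    then have "0 < aff_dim K" using dim by simp
    then show ?thesis using polytope_facet_exists[OF KP] that True by blast
  next
    case False
    have "F \<noteq> K" using dim by auto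
    then show ?thesis
      using face_of_polyhedron_subset_facet[OF polytope_imp_polyhedron[OF KP] FK False] that by blast
  qed
  have "H face_of K" using H facet_of_imp_face_of by blast
  then have "H face_of P" "H \<subseteq> K" using face_of_trans K face_of_imp_subset by blast+
  moreover have "aff_dim H = aff_dim K - 1" using H unfolding facet_of_def by auto
  ultimately show ?thesis using H dim by (intro exI[of _ H]) auto
qed

lemma supporting_face:
  fixes K :: "'a::euclidean_space set"
  assumes "polytope K" "H face_of K"
  obtains a b where "\<And>x. x \<in> K \<Longrightarrow> a \<bullet> x \<le> b" "\<And>x. x \<in> K \<Longrightarrow> x \<in> H \<longleftrightarrow> a \<bullet> x = b"
proof -
  have "H exposed_face_of K" using exposed_face_of_polyhedron polytope_imp_polyhedron assms by blast
  then obtain a b where "K \<subseteq> {x. a \<bullet> x \<le> b}" "H = K \<inter> {x. a \<bullet> x = b}"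
    unfolding exposed_face_of_def by blast
  then show ?thesis using that[of a b] by blast
qed

text \<open>
  A supporting functional that vanishes on the combination is nonnegative on all summands, hence vanishes on each of
  them.
\<close>

lemma positive_combination_in_face:
  fixes K :: "'a::euclidean_space set"
  assumes K: "polytope K" and H: "H face_of K" and I: "finite I"
    and w: "\<And>i. i \<in> I \<Longrightarrow> 0 < w i" "sum w I = 1" and x: "\<And>i. i \<in> I \<Longrightarrow> x i \<in> K"
    and mem: "(\<Sum>i\<in>I. w i *\<^sub>R x i) \<in> H" and i: "i \<in> I"
  shows "x i \<in> H"
proof -
  obtain a b where ab: "\<And>x. x \<in> K \<Longrightarrow> a \<bullet> x \<le> b" "\<And>x. x \<in> K \<Longrightarrow> x \<in> H \<longleftrightarrow> a \<bullet> x = b"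
    using supporting_face[OF K H] by blast
  have "(\<Sum>i\<in>I. w i *\<^sub>R x i) \<in> K" using mem H face_of_imp_subset by blast
  then have "a \<bullet> (\<Sum>i\<in>I. w i *\<^sub>R x i) = b" using ab mem by blast
  then have "(\<Sum>i\<in>I. w i * (a \<bullet> x i)) = b" by (simp add: inner_sum_right)
  then have "(\<Sum>i\<in>I. w i * (b - a \<bullet> x i)) = 0"
    using w(2) by (simp add: algebra_simps sum_subtractf flip: sum_distrib_right sum_distrib_left)
  moreover have "0 \<le> w i * (b - a \<bullet> x i)" if "i \<in> I" for i using ab(1)[OF x[OF that]] w(1)[OF that] by simp
  ultimately have "w i * (b - a \<bullet> x i) = 0" using sum_nonneg_eq_0_iff[OF I, of "\<lambda>i. w i * (b - a \<bullet> x i)"] i by blast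
  then show ?thesis using w(1)[OF i] ab(2)[OF x[OF i]] by simp
qed

lemma rel_interior_facets:
  fixes K :: "'a::euclidean_space set"
  assumes "polytope K" "x \<in> K" "\<And>H. H face_of K \<Longrightarrow> x \<in> H \<Longrightarrow> H = K"
  shows "x \<in> rel_interior K"
proof -
  have "x \<notin> H" if "H facet_of K" for H
    using that assms(3)[of H] facet_of_imp_face_of[of H K] facet_of_irrefl by blast
  then show ?thesis using rel_interior_of_polyhedron[OF polytope_imp_polyhedron[OF assms(1)]] assms(2) by blast
qed

lemma positive_combination_rel_interior:
  fixes K :: "'a::euclidean_space set"
  assumes K: "polytope K" and I: "finite I"
    and w: "\<And>i. i \<in> I \<Longrightarrow> 0 < w i" "sum w I = 1" and x: "\<And>i. i \<in> I \<Longrightarrow> x i \<in> K"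
    and i: "i \<in> I" "x i \<in> rel_interior K"
  shows "(\<Sum>i\<in>I. w i *\<^sub>R x i) \<in> rel_interior K"
proof (rule rel_interior_facets[OF K])
  show "(\<Sum>i\<in>I. w i *\<^sub>R x i) \<in> K"
    using convex_sum[OF I polytope_imp_convex[OF K], of w x] w x less_imp_le by metis
  fix H assume H: "H face_of K" "(\<Sum>i\<in>I. w i *\<^sub>R x i) \<in> H"
  then have "x i \<in> H" using positive_combination_in_face[OF K H(1) I w x H(2) i(1)] by blast
  then show "H = K" using face_of_disjoint_rel_interior[OF H(1)] i by blast
qed

section \<open>Centroids\<close>

text \<open>
  The centroid of the vertices, rather than the centre of mass: it commutes with affine isomorphisms just as well, and it
  is a finite sum.
\<close>

definition centroid :: "'a::euclidean_space set \<Rightarrow> 'a" where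
  "centroid F = (\<Sum>v | v extreme_point_of F. (1 / real (card {v. v extreme_point_of F})) *\<^sub>R v)"

lemma polytope_extreme:
  fixes F :: "'a::euclidean_space set"
  assumes "polytope F"
  shows "finite {v. v extreme_point_of F}" "F = convex hull {v. v extreme_point_of F}"
  using finite_polyhedron_extreme_points[OF polytope_imp_polyhedron[OF assms]]
    Krein_Milman_Minkowski[of F] polytope_imp_compact polytope_imp_convex assms by auto

lemma centroid_rel_interior:
  fixes F :: "'a::euclidean_space set"
  assumes F: "polytope F" "F \<noteq> {}"
  shows "centroid F \<in> rel_interior F"
proof (rule rel_interior_facets[OF F(1)])
  let ?V = "{v. v extreme_point_of F}"
  have fin: "finite ?V" and hull: "F = convex hull ?V" using polytope_extreme[OF F(1)] by auto
  have ne: "?V \<noteq> {}" using hull F(2) by (metis convex_hull_empty)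
  have card: "0 < card ?V" using fin ne card_gt_0_iff by blast
  have V: "v \<in> F" if "v \<in> ?V" for v using that unfolding extreme_point_of_def by auto
  have w: "(\<Sum>v\<in>?V. 1 / real (card ?V)) = 1" using card by simp
  show "centroid F \<in> F" unfolding centroid_def
    by (rule convex_sum[OF fin polytope_imp_convex[OF F(1)] w]) (use V in auto)
  fix H assume H: "H face_of F" "centroid F \<in> H"
  have "v \<in> H" if "v \<in> ?V" for v
    using positive_combination_in_face[OF F(1) H(1) fin _ w V _ that, of "\<lambda>v. v"] H(2) card
    unfolding centroid_def by auto
  then have "convex hull ?V \<subseteq> H" using face_of_imp_convex[OF H(1)] by (intro hull_minimal) auto
  then show "H = F" using hull face_of_imp_subset[OF H(1)] by auto
qed

lemma centroid_image:
  fixes T :: "'a::euclidean_space \<Rightarrow> 'a" and t :: 'a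
  assumes T: "linear T" "inj T" and F: "polytope F" "F \<noteq> {}"
  shows "centroid ((\<lambda>x. t + T x) ` F) = t + T (centroid F)"
proof -
  let ?f = "\<lambda>x. t + T x"
  let ?V = "{v. v extreme_point_of F}"
  have img: "?f ` X = (+) t ` (T ` X)" for X by auto
  have ext: "?f v extreme_point_of ?f ` F \<longleftrightarrow> v extreme_point_of F" for v
  proof -
    have "{?f v} face_of ?f ` F \<longleftrightarrow> {v} face_of F"
      using face_of_translation_eq[of t "T ` {v}" "T ` F"] face_of_linear_image[OF T, of "{v}" F]
      unfolding img by simp
    then show ?thesis by (simp add: face_of_singleton)
  qed
  have "{v. v extreme_point_of ?f ` F} = ?f ` ?V"
  proof (intro equalityI subsetI)
    fix v assume "v \<in> {v. v extreme_point_of ?f ` F}"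
    then have v: "v extreme_point_of ?f ` F" by simp
    then obtain u where "v = ?f u" unfolding extreme_point_of_def by auto
    then show "v \<in> ?f ` ?V" using v ext by auto
  qed (use ext in auto)
  moreover have inj: "inj_on ?f ?V" using T(2) by (auto simp: inj_on_def inj_def)
  moreover have "finite ?V" "?V \<noteq> {}"
    using polytope_extreme[OF F(1)] F(2) by (metis, metis convex_hull_empty)
  then have "0 < card ?V" by (simp add: card_gt_0_iff)
  ultimately show ?thesis
    unfolding centroid_def
    by (simp add: card_image sum.reindex o_def scaleR_add_right sum.distrib linear_sum[OF T(1)]
        linear_scale[OF T(1)] scaleR_left.sum[symmetric])
qed

section \<open>The diamond property\<close>

text \<open>
  Modulo the affine hull of \<open>F\<close> the face \<open>K\<close> is a planar cone. A functional that supports it along the ray of the third face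
  would have to be positive at points of the other two, and yet the third ray is a combination of these two; the
  signs of the coefficients are found by evaluating the functionals of the first two faces.
\<close>

lemma two_faces_at_most:
  fixes P :: "'a::euclidean_space set"
  assumes P: "polytope P" and F: "F face_of P" and K: "K face_of P"
    and H: "\<And>i. i < (3::nat) \<Longrightarrow> H i face_of P \<and> F \<subseteq> H i \<and> H i \<subseteq> K \<and> aff_dim (H i) = aff_dim F + 1"
    and dim: "aff_dim K = aff_dim F + 2" and dist: "H 0 \<noteq> H 1" "H 0 \<noteq> H 2" "H 1 \<noteq> H 2"
  shows False
proof -
  have KP: "polytope K" using face_of_polytope_polytope P K by blast
  have dist': "H i \<noteq> H j" if "i < 3" "j < 3" "i \<noteq> j" for i j
  proof -
    have "i = 0 \<or> i = 1 \<or> i = 2" "j = 0 \<or> j = 1 \<or> j = 2" using that by linarith+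
    then show ?thesis using that(3) dist dist[symmetric] by (elim disjE) simp_all
  qed
  have HK: "H i face_of K" if "i < 3" for i using face_of_face[OF K] H[OF that] by blast
  have "\<exists>x. x \<in> rel_interior (H i)" if "i < 3" for i
  proof -
    have "aff_dim (H i) \<ge> 0" using H[OF that] aff_dim_geq[of F] by simp
    then have "H i \<noteq> {}" by auto
    moreover have "convex (H i)" using H[OF that] face_of_imp_convex by metis
    ultimately show ?thesis using rel_interior_eq_empty[of "H i"] by auto
  qed
  then obtain h where h: "\<And>i. i < 3 \<Longrightarrow> h i \<in> rel_interior (H i)" by metis
  have hH: "h i \<in> H i" "h i \<in> K" if "i < 3" for i
    using h[OF that] rel_interior_subset H[OF that] by blast+
  have hn: "h i \<notin> H j" if "i < 3" "j < 3" "i \<noteq> j" for i j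
  proof
    assume "h i \<in> H j"
    then have "H i \<subseteq> H j"
      using subset_of_face_of[OF HK[OF that(2)], of "H i"] H[OF that(1)] h[OF that(1)] by blast
    then show False using face_dim_eq[of "H i" P "H j"] H[OF that(1)] H[OF that(2)] dist' that by simp
  qed
  have hF: "h i \<notin> F" if "i < 3" for i
  proof (cases "i = 0")
    case True then show ?thesis using hn[of i 1] H[of 1] by auto
  next
    case False then show ?thesis using hn[of i 0] H[of 0] that by auto
  qed
  have aff: "affine hull X \<inter> K = X" if "X face_of P" "X \<subseteq> K" for X
    using face_of_imp_eq_affine_Int[of K X] polytope_imp_convex[OF KP] face_of_face[OF K] that by blast
  have dim1: "aff_dim (insert (h 0) F) = aff_dim F + 1"
    using aff[OF F] H[of 0] hF[of 0] hH[of 0] by (auto simp: aff_dim_insert)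
  have hull1: "affine hull (insert (h 0) F) = affine hull (H 0)"
  proof (rule affine_dim_equal)
    show "affine hull (insert (h 0) F) \<subseteq> affine hull (H 0)"
      using hH(1)[of 0] H[of 0] by (intro hull_mono) auto
    show "aff_dim (affine hull (insert (h 0) F)) = aff_dim (affine hull (H 0))"
      using dim1 H[of 0] by simp
  qed auto
  have "h 1 \<notin> affine hull (insert (h 0) F)"
    using hull1 aff[of "H 0"] H[of 0] hn[of 1 0] hH[of 1] by auto
  then have dim2: "aff_dim (insert (h 1) (insert (h 0) F)) = aff_dim K"
    using dim1 dim by (simp add: aff_dim_insert)
  have "affine hull (insert (h 1) (insert (h 0) F)) = affine hull K"
  proof (rule affine_dim_equal)
    show "affine hull (insert (h 1) (insert (h 0) F)) \<subseteq> affine hull K"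
      using hH(2)[of 0] hH(2)[of 1] H[of 0] by (intro hull_mono) auto
    show "aff_dim (affine hull (insert (h 1) (insert (h 0) F))) = aff_dim (affine hull K)"
      using dim2 by simp
  qed auto
  then have h2: "h 2 \<in> affine hull (insert (h 1) (insert (h 0) F))"
    using hH(2)[of 2] hull_inc by force
  have "\<exists>f::'a \<Rightarrow> real. (\<exists>a b. f = (\<lambda>x. b - a \<bullet> x)) \<and> (\<forall>x\<in>K. 0 \<le> f x) \<and> (\<forall>x\<in>K. x \<in> H i \<longleftrightarrow> f x = 0)" if "i < 3" for i
  proof -
    have Hi: "H i face_of K" using HK that by blast
    obtain a b where ab: "\<And>x. x \<in> K \<Longrightarrow> a \<bullet> x \<le> b" "\<And>x. x \<in> K \<Longrightarrow> x \<in> H i \<longleftrightarrow> a \<bullet> x = b"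
      using supporting_face[OF KP Hi] by blast
    show ?thesis by (rule exI[of _ "\<lambda>x. b - a \<bullet> x"]) (use ab in auto)
  qed
  then obtain f :: "nat \<Rightarrow> 'a \<Rightarrow> real" where f: "\<And>i. i < 3 \<Longrightarrow> (\<exists>a b. f i = (\<lambda>x. b - a \<bullet> x)) \<and> (\<forall>x\<in>K. 0 \<le> f i x) \<and> (\<forall>x\<in>K. x \<in> H i \<longleftrightarrow> f i x = 0)"
    by metis
  have f_aff: "f i (u *\<^sub>R x + v *\<^sub>R y) = u * f i x + v * f i y" if "u + v = 1" "i < 3" for u v x y i
  proof -
    have "\<exists>a b. f i = (\<lambda>x. b - a \<bullet> x)" using f[OF that(2)] by blast
    then obtain a b where ab: "f i = (\<lambda>x. b - a \<bullet> x)" by blast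
    have "b = u * b + v * b" using that(1) by (metis distrib_right mult_1)
    then show ?thesis unfolding ab by (simp add: inner_add_right algebra_simps)
  qed
  have pos: "0 < f i (h j)" if "i < 3" "j < 3" "i \<noteq> j" for i j
    using f[OF that(1)] hH(2)[OF that(2)] hn[OF that(2,1)] that by force
  have zero: "f i x = 0" if "x \<in> H i" "i < 3" for i x using f[OF that(2)] that H[OF that(2)] by blast
  have zF: "f i x = 0" if "x \<in> F" "i < 3" for i x using zero that H[OF that(2)] by blast
  define Q where "Q = {z. \<exists>x y. f 0 z = y * f 0 (h 1) \<and> f 1 z = x * f 1 (h 0) \<and> f 2 z = x * f 2 (h 0) + y * f 2 (h 1)}"
  have "affine Q"
    unfolding affine_def
  proof (intro ballI allI impI)
    fix z z' and u v :: real assume "z \<in> Q" "z' \<in> Q" and uv: "u + v = 1"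
    then obtain x y x' y' where
      "f 0 z = y * f 0 (h 1)" "f 1 z = x * f 1 (h 0)" "f 2 z = x * f 2 (h 0) + y * f 2 (h 1)"
      "f 0 z' = y' * f 0 (h 1)" "f 1 z' = x' * f 1 (h 0)" "f 2 z' = x' * f 2 (h 0) + y' * f 2 (h 1)"
      unfolding Q_def by auto
    then show "u *\<^sub>R z + v *\<^sub>R z' \<in> Q" unfolding Q_def
      by (intro CollectI exI[of _ "u * x + v * x'"] exI[of _ "u * y + v * y'"]) (simp add: f_aff[OF uv] algebra_simps)
  qed
  moreover have "insert (h 1) (insert (h 0) F) \<subseteq> Q"
  proof -
    have "h 0 \<in> Q" unfolding Q_def using zero[OF hH(1)] by (intro CollectI exI[of _ 1] exI[of _ 0]) auto
    moreover have "h 1 \<in> Q" unfolding Q_def using zero[OF hH(1)] by (intro CollectI exI[of _ 0] exI[of _ 1]) auto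
    moreover have "x \<in> Q" if "x \<in> F" for x unfolding Q_def using zF[OF that] by (intro CollectI exI[of _ 0]) auto
    ultimately show ?thesis by auto
  qed
  ultimately have "h 2 \<in> Q" using h2 hull_minimal[of _ Q affine] by blast
  then obtain x y where xy: "f 0 (h 2) = y * f 0 (h 1)" "f 1 (h 2) = x * f 1 (h 0)"
    "f 2 (h 2) = x * f 2 (h 0) + y * f 2 (h 1)" unfolding Q_def by auto
  have "0 < y" "0 < x" using xy pos[of 0 2] pos[of 0 1] pos[of 1 2] pos[of 1 0] by (auto simp: zero_less_mult_iff)
  then have "0 < f 2 (h 2)" using xy(3) pos[of 2 0] pos[of 2 1] by (simp add: add_pos_pos)
  then show False using zero[OF hH(1), of 2] by simp
qed

text \<open>
  A nonempty face is the intersection of the facets containing it, so one facet is not enough. For the empty face, the edge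
  has a vertex other than \<open>H\<close>, because it is the hull of its vertices.
\<close>

lemma two_faces_at_least:
  fixes P :: "'a::euclidean_space set"
  assumes P: "polytope P" and F: "F face_of P" and K: "K face_of P"
    and H: "H face_of P" "F \<subseteq> H" "H \<subseteq> K" "aff_dim H = aff_dim F + 1"
    and dim: "aff_dim K = aff_dim F + 2"
  shows "\<exists>H'. H' face_of P \<and> F \<subseteq> H' \<and> H' \<subseteq> K \<and> aff_dim H' = aff_dim F + 1 \<and> H' \<noteq> H"
proof -
  have KP: "polytope K" using face_of_polytope_polytope P K by blast
  have FK: "F face_of K" using face_of_face[OF K] F H by blast
  have trans: "X face_of P \<and> X \<subseteq> K" if "X face_of K" for X
    using that K face_of_trans face_of_imp_subset by blast
  show ?thesis
  proof (cases "F = {}")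
    case False
    have "F \<noteq> K" using dim by auto
    then have F_eq: "F = \<Inter>{F'. F' facet_of K \<and> F \<subseteq> F'}"
      using face_of_polyhedron[OF polytope_imp_polyhedron[OF KP] FK False] by blast
    have "\<not> {F'. F' facet_of K \<and> F \<subseteq> F'} \<subseteq> {H}"
    proof
      assume "{F'. F' facet_of K \<and> F \<subseteq> F'} \<subseteq> {H}"
      then have "H \<subseteq> \<Inter>{F'. F' facet_of K \<and> F \<subseteq> F'}" by blast
      then have "H \<subseteq> F" using F_eq by simp
      then show False using H by simp
    qed
    then obtain H' where "H' facet_of K" "F \<subseteq> H'" "H' \<noteq> H" by blast
    then show ?thesis using trans[of H'] dim unfolding facet_of_def by (intro exI[of _ H']) auto
  next
    case True
    have "K \<noteq> H" using H dim by auto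
    obtain v where v: "v extreme_point_of K" "v \<notin> H"
    proof (rule ccontr)
      assume "\<not> thesis"
      then have "{v. v extreme_point_of K} \<subseteq> H" using that by blast
      then have "convex hull {v. v extreme_point_of K} \<subseteq> H" using H face_of_imp_convex by (intro hull_minimal) auto
      then show False using polytope_extreme(2)[OF KP] H \<open>K \<noteq> H\<close> by auto
    qed
    then have "{v} face_of K" by (simp add: face_of_singleton)
    then show ?thesis using trans[of "{v}"] v True by (intro exI[of _ "{v}"]) auto
  qed
qed

section \<open>Flags of a regular convex 4-polytope\<close>

locale regular_4polytope =
  fixes P :: "(real ^ 4) set"
  assumes reg: "regular_convex_polytope 4 P"
begin

abbreviation L :: "(real ^ 4) set ranked_poset" where "L \<equiv> face_lattice P"

lemma polyP: "polytope P" and dimP: "aff_dim P = 4"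
  using reg unfolding regular_convex_polytope_def by auto

lemma L_simps [simp]: "faces L = {F. F face_of P}" "face_le L = (\<subseteq>)" "face_rank L = aff_dim"
  by (auto simp: face_lattice_def)

lemma P_face: "P face_of P" using face_of_refl polytope_imp_convex polyP by blast

lemma face_dim_bounds: "F face_of P \<Longrightarrow> - 1 \<le> aff_dim F \<and> aff_dim F \<le> 4"
  using aff_dim_geq[of F] aff_dim_subset[of F P] face_of_imp_subset[of F P] dimP by auto

lemma chain_iff: "pred_on.chain (faces L) (face_le L) C \<longleftrightarrow>
   C \<subseteq> {F. F face_of P} \<and> (\<forall>F\<in>C. \<forall>K\<in>C. F \<subseteq> K \<or> K \<subseteq> F)"
  unfolding pred_on.chain_def by auto

text \<open>
  Maximality of a chain forces a face of each dimension, since a gap could be filled by an intermediate face.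
\<close>

lemma flag_iff:
  "\<Phi> \<in> flags L \<longleftrightarrow> \<Phi> \<subseteq> {F. F face_of P} \<and> (\<forall>F\<in>\<Phi>. \<forall>K\<in>\<Phi>. F \<subseteq> K \<or> K \<subseteq> F)
     \<and> (\<forall>k. - 1 \<le> k \<and> k \<le> 4 \<longrightarrow> (\<exists>F\<in>\<Phi>. aff_dim F = k))" (is "_ \<longleftrightarrow> ?R")
proof
  assume "\<Phi> \<in> flags L"
  then have mc: "pred_on.chain (faces L) (face_le L) \<Phi>" "\<And>D. pred_on.chain (faces L) (face_le L) D \<Longrightarrow> \<not> \<Phi> \<subset> D"
    unfolding flags_def pred_on.maxchain_def by blast+
  have ch: "\<Phi> \<subseteq> {F. F face_of P}" "\<forall>F\<in>\<Phi>. \<forall>K\<in>\<Phi>. F \<subseteq> K \<or> K \<subseteq> F"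
    using mc(1) unfolding chain_iff by blast+
  have max: "\<not> \<Phi> \<subset> D" if "D \<subseteq> {F. F face_of P}" "\<forall>F\<in>D. \<forall>K\<in>D. F \<subseteq> K \<or> K \<subseteq> F" for D
    by (rule mc(2)) (use that chain_iff in blast)
  have ext: "H \<in> \<Phi>" if "H face_of P" "\<And>F. F \<in> \<Phi> \<Longrightarrow> F \<subseteq> H \<or> H \<subseteq> F" for H
  proof (rule ccontr)
    assume "H \<notin> \<Phi>"
    then have "\<Phi> \<subset> insert H \<Phi>" by auto
    moreover have "\<not> \<Phi> \<subset> insert H \<Phi>" by (rule max) (use ch that in auto)
    ultimately show False by blast
  qed
  have P\<Phi>: "P \<in> \<Phi>"
  proof (rule ext[OF P_face])
    fix F assume "F \<in> \<Phi>"
    then have "F face_of P" using ch by blast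
    then show "F \<subseteq> P \<or> P \<subseteq> F" using face_of_imp_subset by blast
  qed
  have e\<Phi>: "{} \<in> \<Phi>" by (rule ext) auto
  have fin: "finite \<Phi>" using finite_subset[OF ch(1)] finite_polytope_faces[OF polyP] by blast
  have "\<exists>F\<in>\<Phi>. aff_dim F = k" if k: "- 1 \<le> k" "k \<le> 4" for k
  proof (rule ccontr)
    assume no: "\<not> (\<exists>F\<in>\<Phi>. aff_dim F = k)"
    let ?A = "{F \<in> \<Phi>. aff_dim F < k}" and ?B = "{F \<in> \<Phi>. k < aff_dim F}"
    have "aff_dim ({} :: (real^4) set) \<noteq> k" using no e\<Phi> by blast
    then have "{} \<in> ?A" using e\<Phi> k by auto
    then have Ane: "?A \<noteq> {}" by blast
    have "aff_dim P \<noteq> k" using no P\<Phi> by blast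
    then have "P \<in> ?B" using P\<Phi> k dimP by auto
    then have Bne: "?B \<noteq> {}" by blast
    obtain F where F: "F \<in> ?A" "\<And>F'. F' \<in> ?A \<Longrightarrow> F \<subseteq> F' \<Longrightarrow> F = F'"
      using finite_has_maximal[of ?A] fin Ane by auto
    obtain K where K: "K \<in> ?B" "\<And>F'. F' \<in> ?B \<Longrightarrow> F' \<subseteq> K \<Longrightarrow> K = F'"
      using finite_has_minimal[of ?B] fin Bne by auto
    have below: "F' \<subseteq> F" if "F' \<in> ?A" for F' using that F ch(2) by blast
    have above: "K \<subseteq> F'" if "F' \<in> ?B" for F' using that K ch(2) by blast
    have "F \<subseteq> K"
    proof (rule ccontr)
      assume "\<not> F \<subseteq> K"
      then have "K \<subseteq> F" using ch(2) F(1) K(1) by blast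
      then show False using aff_dim_subset[of K F] F(1) K(1) by auto
    qed
    then obtain H where H: "H face_of P" "F \<subset> H" "H \<subset> K"
      using intermediate_face[OF polyP, of F K] F(1) K(1) ch(1) by auto
    have "H \<in> \<Phi>"
    proof (rule ext[OF H(1)])
      fix F' assume "F' \<in> \<Phi>"
      then have "F' \<in> ?A \<or> F' \<in> ?B" using no by force
      then show "F' \<subseteq> H \<or> H \<subseteq> F'" using below above H by blast
    qed
    then have "H \<in> ?A \<or> H \<in> ?B" using no by force
    then show False using below above H by blast
  qed
  then show ?R using ch by blast
next
  assume R: ?R
  then have R1: "\<Phi> \<subseteq> {F. F face_of P}" and R3: "\<And>k. - 1 \<le> k \<and> k \<le> 4 \<Longrightarrow> \<exists>F\<in>\<Phi>. aff_dim F = k" by simp_all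
  have nosub: "\<not> \<Phi> \<subset> D" if D: "D \<subseteq> {F. F face_of P}" "\<forall>F\<in>D. \<forall>K\<in>D. F \<subseteq> K \<or> K \<subseteq> F" for D
  proof
    assume sub: "\<Phi> \<subset> D"
    then obtain X where X: "X \<in> D" "X \<notin> \<Phi>" by blast
    then have "X face_of P" using D by auto
    then obtain F where F: "F \<in> \<Phi>" "aff_dim F = aff_dim X"
      using R3[OF face_dim_bounds] by meson
    have FD: "F \<in> D" "F face_of P" using F sub R by auto
    have "F \<subseteq> X \<or> X \<subseteq> F" using D(2) X(1) FD(1) by blast
    then have "F = X" using face_dim_eq FD(2) \<open>X face_of P\<close> F(2) by metis
    then show False using F X by auto
  qed
  have "pred_on.chain (faces L) (face_le L) \<Phi>" unfolding chain_iff using R by simp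
  moreover have "\<not> (\<exists>D. pred_on.chain (faces L) (face_le L) D \<and> \<Phi> \<subset> D)"
    using nosub unfolding chain_iff by meson
  ultimately show "\<Phi> \<in> flags L" unfolding flags_def pred_on.maxchain_def by (intro CollectI conjI)
qed

definition flag_face :: "(real ^ 4) set set \<Rightarrow> int \<Rightarrow> (real ^ 4) set" where
  "flag_face \<Phi> k = (THE F. F \<in> \<Phi> \<and> aff_dim F = k)"

lemma flag_ex1:
  assumes "\<Phi> \<in> flags L" "- 1 \<le> k" "k \<le> 4" shows "\<exists>!F. F \<in> \<Phi> \<and> aff_dim F = k"
proof -
  have R: "\<Phi> \<subseteq> {F. F face_of P}" "\<forall>F\<in>\<Phi>. \<forall>K\<in>\<Phi>. F \<subseteq> K \<or> K \<subseteq> F" "\<exists>F\<in>\<Phi>. aff_dim F = k"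
    using assms unfolding flag_iff by auto
  then obtain F where F: "F \<in> \<Phi>" "aff_dim F = k" by blast
  moreover have "K = F" if "K \<in> \<Phi>" "aff_dim K = k" for K
  proof -
    have "K face_of P" "F face_of P" "K \<subseteq> F \<or> F \<subseteq> K" using R that F by auto
    then show ?thesis using face_dim_eq[of K P F] face_dim_eq[of F P K] that F by auto
  qed
  ultimately show ?thesis by blast
qed

lemma flag_face: assumes "\<Phi> \<in> flags L" "- 1 \<le> k" "k \<le> 4" shows "flag_face \<Phi> k \<in> \<Phi>" "aff_dim (flag_face \<Phi> k) = k" "flag_face \<Phi> k face_of P"
proof -
  show 1: "flag_face \<Phi> k \<in> \<Phi>" "aff_dim (flag_face \<Phi> k) = k" using theI'[OF flag_ex1[OF assms]] unfolding flag_face_def by auto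
  show "flag_face \<Phi> k face_of P" using 1 assms(1) unfolding flag_iff by auto
qed

lemma flag_face_eq: assumes "\<Phi> \<in> flags L" "F \<in> \<Phi>" "aff_dim F = k" shows "flag_face \<Phi> k = F"
proof -
  have "F face_of P" using assms unfolding flag_iff by auto
  then show ?thesis using flag_ex1[OF assms(1), of k] face_dim_bounds[of F] flag_face[OF assms(1), of k] assms by blast
qed

lemma flag_face_mono: assumes "\<Phi> \<in> flags L" "- 1 \<le> k" "k \<le> l" "l \<le> 4" shows "flag_face \<Phi> k \<subseteq> flag_face \<Phi> l"
proof (rule ccontr)
  assume n: "\<not> flag_face \<Phi> k \<subseteq> flag_face \<Phi> l"
  have k: "flag_face \<Phi> k \<in> \<Phi>" "aff_dim (flag_face \<Phi> k) = k" "flag_face \<Phi> k face_of P" by (rule flag_face; use assms in simp)+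
  have l: "flag_face \<Phi> l \<in> \<Phi>" "aff_dim (flag_face \<Phi> l) = l" "flag_face \<Phi> l face_of P" by (rule flag_face; use assms in simp)+
  have "flag_face \<Phi> l \<subset> flag_face \<Phi> k" using n k(1) l(1) assms(1) unfolding flag_iff by blast
  then show False using face_dim_less[OF l(3) k(3)] k l assms by auto
qed

lemma flag_fc: assumes "\<Phi> \<in> flags L" shows "\<Phi> = flag_face \<Phi> ` {-1..4}"
proof (intro equalityI subsetI)
  fix F assume F: "F \<in> \<Phi>"
  then have "F face_of P" using assms unfolding flag_iff by auto
  then show "F \<in> flag_face \<Phi> ` {-1..4}" using flag_face_eq[OF assms F refl] face_dim_bounds[of F] by (metis atLeastAtMost_iff imageI)
qed (use flag_face[OF assms] in auto)

lemma flag_eqI: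
  assumes "\<Phi> \<in> flags L" "\<Psi> \<in> flags L" "\<And>k. - 1 \<le> k \<Longrightarrow> k \<le> 4 \<Longrightarrow> flag_face \<Phi> k = flag_face \<Psi> k"
  shows "\<Phi> = \<Psi>"
proof -
  have "flag_face \<Phi> ` {-1..4} = flag_face \<Psi> ` {-1..4}" by (rule image_cong) (use assms in auto)
  then show ?thesis using flag_fc assms(1,2) by metis
qed

lemma flag_of:
  assumes "\<And>k. - 1 \<le> k \<Longrightarrow> k \<le> 4 \<Longrightarrow> f k face_of P \<and> aff_dim (f k) = k"
    and "\<And>k. - 1 \<le> k \<Longrightarrow> k < 4 \<Longrightarrow> f k \<subseteq> f (k + 1)"
  shows "f ` {-1..4} \<in> flags L" "\<And>k. - 1 \<le> k \<Longrightarrow> k \<le> 4 \<Longrightarrow> flag_face (f ` {-1..4}) k = f k"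
proof -
  have mono: "f k \<subseteq> f l" if "- 1 \<le> k" "k \<le> l" "l \<le> 4" for k l
    using that(2,3)
  proof (induction l rule: int_ge_induct)
    case (step i) then show ?case using assms(2)[of i] that(1) by auto
  qed auto
  show fl: "f ` {-1..4} \<in> flags L" unfolding flag_iff
  proof (intro conjI ballI allI impI)
    fix F K assume "F \<in> f ` {-1..4}" "K \<in> f ` {-1..4}"
    then obtain k l where "F = f k" "K = f l" "k \<in> {-1..4}" "l \<in> {-1..4}" by auto
    then show "F \<subseteq> K \<or> K \<subseteq> F" using mono[of k l] mono[of l k] by (cases "k \<le> l") auto
  qed (use assms(1) in auto)
  fix k :: int assume "- 1 \<le> k" "k \<le> 4"
  then show "flag_face (f ` {-1..4}) k = f k" using flag_face_eq[OF fl, of "f k" k] assms(1)[of k] by auto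
qed

lemma differ_iff:
  assumes "\<Phi> \<in> flags L" "\<Psi> \<in> flags L" and i: "i < 4"
  shows "differ_exactly_at L i \<Phi> \<Psi> \<longleftrightarrow>
    flag_face \<Phi> (int i) \<noteq> flag_face \<Psi> (int i) \<and> (\<forall>k. - 1 \<le> k \<and> k \<le> 4 \<and> k \<noteq> int i \<longrightarrow> flag_face \<Phi> k = flag_face \<Psi> k)" (is "?D \<longleftrightarrow> ?R")
proof
  assume D: ?D
  have eq: "flag_face \<Phi> k = flag_face \<Psi> k" if "- 1 \<le> k" "k \<le> 4" "k \<noteq> int i" for k
  proof -
    have "flag_face \<Phi> k \<in> {F \<in> \<Phi>. aff_dim F \<noteq> int i}" using flag_face[OF assms(1) that(1,2)] that by auto
    then have "flag_face \<Phi> k \<in> \<Psi>" using D unfolding differ_exactly_at_def by auto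
    then show ?thesis using flag_face_eq[OF assms(2)] flag_face[OF assms(1) that(1,2)] by metis
  qed
  moreover have "flag_face \<Phi> (int i) \<noteq> flag_face \<Psi> (int i)"
  proof
    assume e: "flag_face \<Phi> (int i) = flag_face \<Psi> (int i)"
    have "\<Phi> = \<Psi>" by (rule flag_eqI[OF assms(1,2)]) (use eq e in metis)
    then show False using D unfolding differ_exactly_at_def by auto
  qed
  ultimately show ?R by blast
next
  assume R: ?R
  have sub: "{F \<in> \<Phi>. aff_dim F \<noteq> int i} \<subseteq> {F \<in> \<Psi>. aff_dim F \<noteq> int i}"
    if "\<Phi> \<in> flags L" "\<Psi> \<in> flags L" "\<And>k. - 1 \<le> k \<and> k \<le> 4 \<and> k \<noteq> int i \<Longrightarrow> flag_face \<Phi> k = flag_face \<Psi> k" for \<Phi> \<Psi>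
  proof
    fix F assume F: "F \<in> {F \<in> \<Phi>. aff_dim F \<noteq> int i}"
    then have "F face_of P" using that(1) unfolding flag_iff by auto
    then have b: "- 1 \<le> aff_dim F" "aff_dim F \<le> 4" using face_dim_bounds by auto
    have "F = flag_face \<Phi> (aff_dim F)" using flag_face_eq[OF that(1), of F] F by auto
    also have "\<dots> = flag_face \<Psi> (aff_dim F)" using that(3) b F by auto
    finally have "F \<in> \<Psi>" using flag_face(1)[OF that(2) b] by simp
    then show "F \<in> {F \<in> \<Psi>. aff_dim F \<noteq> int i}" using F by auto
  qed
  have "{F \<in> \<Phi>. aff_dim F \<noteq> int i} = {F \<in> \<Psi>. aff_dim F \<noteq> int i}"
    by (intro subset_antisym sub) (use assms R in auto)
  then show ?D using R unfolding differ_exactly_at_def by auto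
qed

text \<open>The diamond property, in the form that fixes all ranks but one of a flag.\<close>

lemma no_three:
  assumes "\<Phi> \<in> flags L" "\<Psi> \<in> flags L" "\<Xi> \<in> flags L" and i: "i < (4::nat)"
    and agree: "\<And>k. - 1 \<le> k \<Longrightarrow> k \<le> 4 \<Longrightarrow> k \<noteq> int i \<Longrightarrow> flag_face \<Phi> k = flag_face \<Psi> k \<and> flag_face \<Phi> k = flag_face \<Xi> k"
    and ne: "flag_face \<Phi> (int i) \<noteq> flag_face \<Psi> (int i)" "flag_face \<Phi> (int i) \<noteq> flag_face \<Xi> (int i)"
  shows "flag_face \<Psi> (int i) = flag_face \<Xi> (int i)"
proof (rule ccontr)
  assume ne': "flag_face \<Psi> (int i) \<noteq> flag_face \<Xi> (int i)"
  let ?H = "\<lambda>n::nat. if n = 0 then flag_face \<Phi> (int i) else if n = 1 then flag_face \<Psi> (int i) else flag_face \<Xi> (int i)"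
  let ?F = "flag_face \<Phi> (int i - 1)" and ?K = "flag_face \<Phi> (int i + 1)"
  have F: "?F = flag_face \<Psi> (int i - 1)" "?F = flag_face \<Xi> (int i - 1)" "?K = flag_face \<Psi> (int i + 1)" "?K = flag_face \<Xi> (int i + 1)"
    using agree[of "int i - 1"] agree[of "int i + 1"] i by auto
  have d: "aff_dim ?F = int i - 1" "aff_dim ?K = int i + 1" "?F face_of P" "?K face_of P"
    using flag_face[OF assms(1), of "int i - 1"] flag_face[OF assms(1), of "int i + 1"] i by auto
  have bet: "flag_face X (int i) face_of P \<and> flag_face X (int i - 1) \<subseteq> flag_face X (int i) \<and> flag_face X (int i) \<subseteq> flag_face X (int i + 1) \<and> aff_dim (flag_face X (int i)) = int i"
    if "X \<in> flags L" for X
    using flag_face[OF that, of "int i"] flag_face_mono[OF that, of "int i - 1" "int i"] flag_face_mono[OF that, of "int i" "int i + 1"] i by auto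
  have "?H n face_of P \<and> ?F \<subseteq> ?H n \<and> ?H n \<subseteq> ?K \<and> aff_dim (?H n) = aff_dim ?F + 1" for n
    using bet[OF assms(1)] bet[OF assms(2)] bet[OF assms(3)] F d by (cases "n = 0"; cases "n = 1") auto
  then show False
    using two_faces_at_most[OF polyP d(3,4), of ?H] d ne ne' by simp
qed

definition adj_flag :: "(real ^ 4) set set \<Rightarrow> nat \<Rightarrow> (real ^ 4) set set" where
  "adj_flag \<Phi> i = (THE \<Psi>. \<Psi> \<in> flags L \<and> differ_exactly_at L i \<Phi> \<Psi>)"

lemma adj_flag_ex1: assumes \<Phi>: "\<Phi> \<in> flags L" and i: "i < 4"
  shows "\<exists>!\<Psi>. \<Psi> \<in> flags L \<and> differ_exactly_at L i \<Phi> \<Psi>"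
proof -
  let ?F = "flag_face \<Phi> (int i - 1)" and ?K = "flag_face \<Phi> (int i + 1)" and ?H = "flag_face \<Phi> (int i)"
  have d: "aff_dim ?F = int i - 1" "aff_dim ?K = int i + 1" "?F face_of P" "?K face_of P"
    "?H face_of P" "aff_dim ?H = int i" "?F \<subseteq> ?H" "?H \<subseteq> ?K"
    using flag_face[OF \<Phi>, of "int i - 1"] flag_face[OF \<Phi>, of "int i + 1"] flag_face[OF \<Phi>, of "int i"]
      flag_face_mono[OF \<Phi>, of "int i - 1" "int i"] flag_face_mono[OF \<Phi>, of "int i" "int i + 1"] i by auto
  obtain H' where H': "H' face_of P" "?F \<subseteq> H'" "H' \<subseteq> ?K" "aff_dim H' = aff_dim ?F + 1" "H' \<noteq> ?H"
    using two_faces_at_least[OF polyP d(3,4,5,7,8)] d by auto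
  define f where "f k = (if k = int i then H' else flag_face \<Phi> k)" for k
  have f1: "f k face_of P \<and> aff_dim (f k) = k" if "- 1 \<le> k" "k \<le> 4" for k
    using flag_face[OF \<Phi> that] H' d unfolding f_def by auto
  have f2: "f k \<subseteq> f (k + 1)" if "- 1 \<le> k" "k < 4" for k
  proof -
    consider "k = int i" | "k + 1 = int i" | "k \<noteq> int i" "k + 1 \<noteq> int i" by blast
    then show ?thesis
    proof cases
      case 1 then show ?thesis using H' unfolding f_def by simp
    next
      case 2
      then have "k = int i - 1" by simp
      then show ?thesis using H' unfolding f_def by simp
    next
      case 3 then show ?thesis using flag_face_mono[OF \<Phi>, of k "k + 1"] that unfolding f_def by simp
    qed
  qed
  let ?\<Psi> = "f ` {-1..4}"
  have \<Psi>: "?\<Psi> \<in> flags L" by (rule flag_of(1)[of f, OF f1 f2])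
  have flag_face\<Psi>: "flag_face ?\<Psi> k = f k" if "- 1 \<le> k" "k \<le> 4" for k by (rule flag_of(2)[of f, OF f1 f2 that])
  have diff: "differ_exactly_at L i \<Phi> ?\<Psi>"
    unfolding differ_iff[OF \<Phi> \<Psi> i] using flag_face\<Psi> H' i by (auto simp: f_def)
  show ?thesis
  proof (rule ex1I[of _ ?\<Psi>])
    fix \<Xi> assume \<Xi>: "\<Xi> \<in> flags L \<and> differ_exactly_at L i \<Phi> \<Xi>"
    then have X: "\<Xi> \<in> flags L" "flag_face \<Phi> (int i) \<noteq> flag_face \<Xi> (int i)" "\<And>k. - 1 \<le> k \<and> k \<le> 4 \<and> k \<noteq> int i \<Longrightarrow> flag_face \<Phi> k = flag_face \<Xi> k"
      using differ_iff[OF \<Phi> _ i] by auto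
    have Y: "flag_face \<Phi> (int i) \<noteq> flag_face ?\<Psi> (int i)" "\<And>k. - 1 \<le> k \<and> k \<le> 4 \<and> k \<noteq> int i \<Longrightarrow> flag_face \<Phi> k = flag_face ?\<Psi> k"
      using differ_iff[OF \<Phi> \<Psi> i] diff by auto
    have eq: "flag_face \<Xi> (int i) = flag_face ?\<Psi> (int i)"
      by (rule no_three[OF \<Phi> X(1) \<Psi> i]) (use X Y in auto)
    show "\<Xi> = ?\<Psi>"
    proof (rule flag_eqI[OF X(1) \<Psi>])
      fix k :: int assume "- 1 \<le> k" "k \<le> 4"
      then show "flag_face \<Xi> k = flag_face ?\<Psi> k" using eq X(3)[of k] Y(2)[of k] by (cases "k = int i") auto
    qed
  qed (use \<Psi> diff in auto)
qed

lemma adj_flag: assumes "\<Phi> \<in> flags L" "i < 4"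
  shows "adj_flag \<Phi> i \<in> flags L" "flag_face \<Phi> (int i) \<noteq> flag_face (adj_flag \<Phi> i) (int i)"
    "\<And>k. - 1 \<le> k \<Longrightarrow> k \<le> 4 \<Longrightarrow> k \<noteq> int i \<Longrightarrow> flag_face (adj_flag \<Phi> i) k = flag_face \<Phi> k"
proof -
  have *: "adj_flag \<Phi> i \<in> flags L \<and> differ_exactly_at L i \<Phi> (adj_flag \<Phi> i)"
    unfolding adj_flag_def by (rule theI'[OF adj_flag_ex1[OF assms]])
  then show "adj_flag \<Phi> i \<in> flags L" by blast
  with * show "flag_face \<Phi> (int i) \<noteq> flag_face (adj_flag \<Phi> i) (int i)"
    "\<And>k. - 1 \<le> k \<Longrightarrow> k \<le> 4 \<Longrightarrow> k \<noteq> int i \<Longrightarrow> flag_face (adj_flag \<Phi> i) k = flag_face \<Phi> k"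
    using differ_iff[OF assms(1) _ assms(2)] by auto
qed

lemma adj_flag_unique:
  assumes "\<Phi> \<in> flags L" "i < 4" "\<Psi> \<in> flags L" "flag_face \<Phi> (int i) \<noteq> flag_face \<Psi> (int i)"
    "\<And>k. - 1 \<le> k \<Longrightarrow> k \<le> 4 \<Longrightarrow> k \<noteq> int i \<Longrightarrow> flag_face \<Psi> k = flag_face \<Phi> k"
  shows "\<Psi> = adj_flag \<Phi> i"
proof -
  have "differ_exactly_at L i \<Phi> \<Psi>" using differ_iff[OF assms(1,3,2)] assms by auto
  then have "(THE \<Psi>. \<Psi> \<in> flags L \<and> differ_exactly_at L i \<Phi> \<Psi>) = \<Psi>"
    by (intro the1_equality[OF adj_flag_ex1[OF assms(1,2)]] conjI assms(3))
  then show ?thesis unfolding adj_flag_def by (rule sym)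
qed

lemma adj_flag_nb: assumes "\<Phi> \<in> flags L" "i < 4" shows "adj_flag (adj_flag \<Phi> i) i = \<Phi>"
proof (rule adj_flag_unique[symmetric])
  show "adj_flag \<Phi> i \<in> flags L" "flag_face (adj_flag \<Phi> i) (int i) \<noteq> flag_face \<Phi> (int i)" using adj_flag[OF assms] by auto
qed (use adj_flag[OF assms] assms in auto)

text \<open>
  The faces of the two ranks are not adjacent, so each is determined by its own pair of neighbours, which the other
  exchange does not change.
\<close>

lemma adj_flag_comm: assumes \<Phi>: "\<Phi> \<in> flags L" and ij: "i < 4" "j < 4" "i + 2 \<le> j \<or> j + 2 \<le> i"
  shows "adj_flag (adj_flag \<Phi> i) j = adj_flag (adj_flag \<Phi> j) i"
proof (rule adj_flag_unique)
  let ?I = "adj_flag \<Phi> i" and ?J = "adj_flag \<Phi> j" and ?X = "adj_flag (adj_flag \<Phi> i) j"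
  have I: "?I \<in> flags L" and J: "?J \<in> flags L" using adj_flag \<Phi> ij by auto
  show "?J \<in> flags L" "i < 4" by fact+
  show X: "?X \<in> flags L" using adj_flag(1)[OF I ij(2)] .
  have ij': "int i \<noteq> int j" "int i \<noteq> int j - 1" "int i \<noteq> int j + 1" using ij by auto
  have Xi: "flag_face ?X (int i) = flag_face ?I (int i)" using adj_flag(3)[OF I ij(2), of "int i"] ij ij' by auto
  have Ji: "flag_face ?J (int i) = flag_face \<Phi> (int i)" using adj_flag(3)[OF \<Phi> ij(2), of "int i"] ij ij' by auto
  show "flag_face ?J (int i) \<noteq> flag_face ?X (int i)" using Xi Ji adj_flag(2)[OF \<Phi> ij(1)] by simp
  fix k :: int assume k: "- 1 \<le> k" "k \<le> 4" "k \<noteq> int i"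
  show "flag_face ?X k = flag_face ?J k"
  proof (cases "k = int j")
    case False
    then show ?thesis using adj_flag(3)[OF I ij(2) k(1,2)] adj_flag(3)[OF \<Phi> ij(1) k(1,2)] adj_flag(3)[OF \<Phi> ij(2) k(1,2)] k by simp
  next
    case True
    \<comment> \<open>compare with the flag obtained from the other order: both j-faces lie between the same faces of the base flag\<close>
    define Y where "Y = (\<lambda>k. if k = int j then flag_face ?X k else flag_face \<Phi> k) ` {-1..4}"
    let ?f = "\<lambda>k. if k = int j then flag_face ?X k else flag_face \<Phi> k"
    have f1: "?f k face_of P \<and> aff_dim (?f k) = k" if "- 1 \<le> k" "k \<le> 4" for k
      using flag_face[OF \<Phi> that] flag_face[OF X that] by (cases "k = int j") auto
    have near: "flag_face ?X l = flag_face \<Phi> l" if "l = int j - 1 \<or> l = int j + 1" for l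
      using adj_flag(3)[OF I ij(2), of l] adj_flag(3)[OF \<Phi> ij(1), of l] that ij ij' by auto
    have f2: "?f k \<subseteq> ?f (k + 1)" if "- 1 \<le> k" "k < 4" for k
    proof -
      have "flag_face \<Phi> k \<subseteq> flag_face \<Phi> (k + 1)" using flag_face_mono[OF \<Phi>, of k "k + 1"] that by simp
      moreover have "flag_face ?X k \<subseteq> flag_face ?X (k + 1)" using flag_face_mono[OF X, of k "k + 1"] that by simp
      moreover have "flag_face ?X k = flag_face \<Phi> k" if "k + 1 = int j" using near[of k] that by simp
      moreover have "flag_face ?X (k + 1) = flag_face \<Phi> (k + 1)" if "k = int j" using near[of "k+1"] that by simp
      ultimately show ?thesis by (cases "k = int j"; cases "k + 1 = int j") auto
    qed
    have Y: "Y \<in> flags L" unfolding Y_def by (rule flag_of(1)[of ?f, OF f1 f2])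
    have fcY: "flag_face Y k = ?f k" if "- 1 \<le> k" "k \<le> 4" for k
      unfolding Y_def by (rule flag_of(2)[of ?f, OF f1 f2 that])
    have "Y = ?J"
    proof (rule adj_flag_unique[OF \<Phi> ij(2) Y])
      have "flag_face ?I (int j) = flag_face \<Phi> (int j)" using adj_flag(3)[OF \<Phi> ij(1), of "int j"] ij ij' by auto
      then show "flag_face \<Phi> (int j) \<noteq> flag_face Y (int j)" using adj_flag(2)[OF I ij(2)] fcY[of "int j"] ij by simp
    qed (use fcY in simp)
    then show ?thesis using fcY[OF k(1,2)] True by simp
  qed
qed

end

section \<open>Symmetries and barycentric chambers\<close>

context regular_4polytope
begin

definition c :: "real ^ 4" where "c = centroid P"

text \<open>
  A symmetry is recorded by its linear part \<open>T\<close>, because every isometry that preserves the polytope fixes the centroid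
  \<open>c\<close>.
\<close>

definition act :: "(real ^ 4 \<Rightarrow> real ^ 4) \<Rightarrow> (real ^ 4) set \<Rightarrow> (real ^ 4) set" where
  "act T F = (\<lambda>x. c + T (x - c)) ` F"

definition Iso :: "(real ^ 4 \<Rightarrow> real ^ 4) set" where
  "Iso = {T. orthogonal_transformation T \<and> act T P = P}"

abbreviation fl :: "(real ^ 4 \<Rightarrow> real ^ 4) \<Rightarrow> (real ^ 4) set set \<Rightarrow> (real ^ 4) set set" where
  "fl T \<Phi> \<equiv> act T ` \<Phi>"

lemma act_comp: "act (S \<circ> T) F = act S (act T F)"
  unfolding act_def by (simp add: image_image)

lemma act_id: "act id F = F" "act (\<lambda>x. x) F = F"
  unfolding act_def by auto

lemma Iso_orth: "T \<in> Iso \<Longrightarrow> orthogonal_transformation T" unfolding Iso_def by auto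
lemma Iso_linear: "T \<in> Iso \<Longrightarrow> linear T" using Iso_orth orthogonal_transformation_linear by blast
lemma Iso_inj: "T \<in> Iso \<Longrightarrow> inj T" using Iso_orth orthogonal_transformation_inj by blast
lemma Iso_inner: "T \<in> Iso \<Longrightarrow> T x \<bullet> T y = x \<bullet> y" using Iso_orth unfolding orthogonal_transformation_def by blast

lemma Iso_id: "id \<in> Iso" unfolding Iso_def by (simp add: act_id id_def)

lemma Iso_comp: "S \<in> Iso \<Longrightarrow> T \<in> Iso \<Longrightarrow> S \<circ> T \<in> Iso"
  unfolding Iso_def by (simp add: act_comp orthogonal_transformation_compose)

lemma Iso_inv: assumes "T \<in> Iso" shows "inv_into UNIV T \<in> Iso" "inv_into UNIV T \<circ> T = id" "T \<circ> inv_into UNIV T = id"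
proof -
  have o: "orthogonal_transformation T" using assms Iso_orth by auto
  show 1: "inv_into UNIV T \<circ> T = id" "T \<circ> inv_into UNIV T = id"
    using orthogonal_transformation_inj[OF o] orthogonal_transformation_surj[OF o] by (auto simp: surj_iff)
  have "act (inv_into UNIV T) (act T P) = P" using act_comp[of "inv_into UNIV T" T P] 1 act_id by simp
  then have "act (inv_into UNIV T) P = P" using assms unfolding Iso_def by simp
  then show "inv_into UNIV T \<in> Iso" using orthogonal_transformation_inv[OF o] unfolding Iso_def by simp
qed

lemma act_affine: assumes "linear T" shows "act T F = (\<lambda>x. (c - T c) + T x) ` F"
  unfolding act_def by (rule image_cong) (auto simp: linear_diff[OF assms])

lemma act_trans: assumes "linear T" shows "act T F = (+) (c - T c) ` (T ` F)"
  unfolding act_affine[OF assms] by (simp add: image_image)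

lemma act_subset_iff: assumes "T \<in> Iso" shows "act T F \<subseteq> act T K \<longleftrightarrow> F \<subseteq> K"
proof -
  have "inj (\<lambda>x. c + T (x - c))" by (auto intro!: injI dest!: injD[OF Iso_inj[OF assms]])
  then show ?thesis unfolding act_def by (rule inj_image_subset_iff)
qed

lemma act_face: assumes "T \<in> Iso" "F face_of P" shows "act T F face_of P"
proof -
  have "act T F face_of act T P"
    unfolding act_trans[OF Iso_linear[OF assms(1)]] using assms Iso_linear Iso_inj
    by (simp add: face_of_linear_image)
  then show ?thesis using assms(1) unfolding Iso_def by simp
qed

lemma act_dim: assumes "T \<in> Iso" shows "aff_dim (act T F) = aff_dim F"
  unfolding act_trans[OF Iso_linear[OF assms]]
  using aff_dim_injective_linear_image[OF Iso_linear[OF assms] Iso_inj[OF assms]]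
  by (simp add: aff_dim_translation_eq)

lemma act_cen: assumes "T \<in> Iso" "F face_of P" "F \<noteq> {}" shows "centroid (act T F) - c = T (centroid F - c)"
proof -
  have "polytope F" using face_of_polytope_polytope polyP assms by blast
  then have "centroid (act T F) = (c - T c) + T (centroid F)"
    unfolding act_affine[OF Iso_linear[OF assms(1)]]
    using centroid_image[OF Iso_linear[OF assms(1)] Iso_inj[OF assms(1)]] assms by blast
  then show ?thesis using linear_diff[OF Iso_linear[OF assms(1)]] by simp
qed

lemma fl_flag: assumes T: "T \<in> Iso" and \<Phi>: "\<Phi> \<in> flags L"
  shows "fl T \<Phi> \<in> flags L" "\<And>k. - 1 \<le> k \<Longrightarrow> k \<le> 4 \<Longrightarrow> flag_face (fl T \<Phi>) k = act T (flag_face \<Phi> k)"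
proof -
  have R: "\<Phi> \<subseteq> {F. F face_of P}" "\<forall>F\<in>\<Phi>. \<forall>K\<in>\<Phi>. F \<subseteq> K \<or> K \<subseteq> F" "\<forall>k. - 1 \<le> k \<and> k \<le> 4 \<longrightarrow> (\<exists>F\<in>\<Phi>. aff_dim F = k)"
    using \<Phi> unfolding flag_iff by auto
  show f: "fl T \<Phi> \<in> flags L" unfolding flag_iff
  proof (intro conjI ballI allI impI)
    show "fl T \<Phi> \<subseteq> {F. F face_of P}" using R(1) act_face[OF T] by blast
    fix F K assume "F \<in> fl T \<Phi>" "K \<in> fl T \<Phi>"
    then obtain F' K' where FK: "F = act T F'" "K = act T K'" "F' \<in> \<Phi>" "K' \<in> \<Phi>" by blast
    then have "F' \<subseteq> K' \<or> K' \<subseteq> F'" using R(2) by blast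
    then show "F \<subseteq> K \<or> K \<subseteq> F" using act_subset_iff[OF T] FK(1,2) by simp
  next
    fix k assume "- 1 \<le> k \<and> k \<le> (4::int)"
    then obtain F where "F \<in> \<Phi>" "aff_dim F = k" using R(3) by blast
    then show "\<exists>F\<in>fl T \<Phi>. aff_dim F = k" using act_dim[OF T] by auto
  qed
  fix k :: int assume k: "- 1 \<le> k" "k \<le> 4"
  show "flag_face (fl T \<Phi>) k = act T (flag_face \<Phi> k)"
    by (rule flag_face_eq[OF f]) (use flag_face[OF \<Phi> k] act_dim[OF T] in auto)
qed

lemma fl_comp: "fl (S \<circ> T) \<Phi> = fl S (fl T \<Phi>)"
  by (simp add: image_image act_comp)

lemma transitive: assumes \<Phi>: "\<Phi> \<in> flags L" "\<Psi> \<in> flags L" shows "\<exists>T\<in>Iso. fl T \<Phi> = \<Psi>"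
proof -
  have "\<forall>\<Phi>\<in>flags (face_lattice P). \<forall>\<Psi>\<in>flags (face_lattice P).
        \<exists>f :: real^4 \<Rightarrow> real^4. (\<forall>x y. dist (f x) (f y) = dist x y) \<and> f ` P = P \<and> (`) f ` \<Phi> = \<Psi>"
    using reg unfolding regular_convex_polytope_def by blast
  from this[rule_format, OF \<Phi>] obtain f :: "real^4 \<Rightarrow> real^4"
    where f: "\<forall>x y. dist (f x) (f y) = dist x y" "f ` P = P" "(`) f ` \<Phi> = \<Psi>"
    by (elim exE conjE)
  define T where "T x = f x - f 0" for x
  have o: "orthogonal_transformation T"
    unfolding orthogonal_transformation_isometry T_def using f(1) by (auto simp: dist_norm)
  have fT: "f = (\<lambda>x. f 0 + T x)" unfolding T_def by auto
  have lin: "linear T" "inj T" using o orthogonal_transformation_linear orthogonal_transformation_inj by auto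
  have "P \<noteq> {}" using dimP by auto
  then have "centroid (f ` P) = f 0 + T c" unfolding c_def
    using centroid_image[OF lin polyP, of "f 0"] fT by metis
  then have flag_face: "f 0 = c - T c" using f(2) unfolding c_def[symmetric] by (metis c_def add_diff_cancel_right')
  have "act T F = f ` F" for F unfolding act_affine[OF lin(1)] using fT flag_face by metis
  then show ?thesis using f o unfolding Iso_def by auto
qed

text \<open>
  The vertices of the barycentric chamber of a flag and, in the next definition, their positions relative to the
  centre.
\<close>

definition b :: "(real ^ 4) set set \<Rightarrow> nat \<Rightarrow> real ^ 4" where
  "b \<Phi> k = centroid (flag_face \<Phi> (int k))"

definition u :: "(real ^ 4) set set \<Rightarrow> nat \<Rightarrow> real ^ 4" where
  "u \<Phi> k = b \<Phi> k - c"

lemma flag_face_nonempty: assumes "\<Phi> \<in> flags L" "k \<le> (4::nat)" shows "flag_face \<Phi> (int k) \<noteq> {}"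
  using flag_face(2)[OF assms(1), of "int k"] assms(2) by auto

lemma b_rel: assumes "\<Phi> \<in> flags L" "k \<le> (4::nat)"
  shows "b \<Phi> k \<in> rel_interior (flag_face \<Phi> (int k))"
  unfolding b_def
  by (rule centroid_rel_interior)
    (use face_of_polytope_polytope[OF polyP flag_face(3)[OF assms(1)]] flag_face_nonempty[OF assms] assms(2) in auto)

lemma b_in: assumes "\<Phi> \<in> flags L" "k \<le> l" "l \<le> (4::nat)" shows "b \<Phi> k \<in> flag_face \<Phi> (int l)"
  using b_rel[OF assms(1), of k] rel_interior_subset flag_face_mono[OF assms(1), of "int k" "int l"] assms(2,3)
  by (meson subsetD of_nat_le_iff order_trans le_trans of_nat_0_le_iff zle_int neg_le_0_iff_le zero_le_one of_nat_le_numeral_iff)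

lemma fc4: assumes "\<Phi> \<in> flags L" shows "flag_face \<Phi> 4 = P"
  using face_dim_eq[OF flag_face(3)[OF assms] P_face, of 4] flag_face(2,3)[OF assms, of 4] dimP face_of_imp_subset by auto

lemma b4: assumes "\<Phi> \<in> flags L" shows "b \<Phi> 4 = c"
  unfolding b_def c_def using fc4[OF assms] by simp

lemma u_fl: assumes "T \<in> Iso" "\<Phi> \<in> flags L" "k \<le> 4" shows "u (fl T \<Phi>) k = T (u \<Phi> k)"
  unfolding u_def b_def using fl_flag(2)[OF assms(1,2), of "int k"] assms(3)
    act_cen[OF assms(1) flag_face(3)[OF assms(2)] flag_face_nonempty[OF assms(2,3)]] by simp

text \<open>
  Each barycentre is in the relative interior of its face and therefore not in the affine hull of the previous ones, which
  lie in a proper face.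
\<close>

lemma u_span: assumes \<Phi>: "\<Phi> \<in> flags L" shows "span (u \<Phi> ` {..<4}) = UNIV"
proof -
  have fcl: "polytope (flag_face \<Phi> (int k))" "convex (flag_face \<Phi> (int k))" if "k \<le> 4" for k :: nat
    using face_of_polytope_polytope[OF polyP flag_face(3)[OF \<Phi>, of "int k"]] polytope_imp_convex that by auto
  have dims: "aff_dim (b \<Phi> ` {..k}) = int k" if "k \<le> 4" for k
    using that
  proof (induction k)
    case 0
    have "{..0::nat} = {0}" by auto
    then show ?case by (simp add: aff_dim_sing)
  next
    case (Suc k)
    have k: "k \<le> 4" "int k \<le> 4" "int (Suc k) \<le> 4" using Suc by auto
    let ?F = "flag_face \<Phi> (int k)" and ?K = "flag_face \<Phi> (int (Suc k))"
    have "?F face_of P" "?K face_of P" "?F \<subseteq> ?K" "aff_dim ?F = int k" "aff_dim ?K = int (Suc k)"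
      using flag_face[OF \<Phi>, of "int k"] flag_face[OF \<Phi>, of "int (Suc k)"] flag_face_mono[OF \<Phi>, of "int k" "int (Suc k)"] k by auto
    then have FK: "?F face_of ?K" "?F \<noteq> ?K" using face_of_face by auto
    have "b \<Phi> (Suc k) \<notin> affine hull ?F"
    proof
      assume "b \<Phi> (Suc k) \<in> affine hull ?F"
      then have "b \<Phi> (Suc k) \<in> ?F"
        using face_of_imp_eq_affine_Int[OF fcl(2)[OF Suc.prems] FK(1)] b_in[OF \<Phi>, of "Suc k" "Suc k"] Suc.prems by auto
      then show False using face_of_disjoint_rel_interior[OF FK] b_rel[OF \<Phi> Suc.prems] by blast
    qed
    moreover have "affine hull (b \<Phi> ` {..k}) \<subseteq> affine hull ?F"
      by (rule hull_mono) (use b_in[OF \<Phi>] k in auto)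
    ultimately have "b \<Phi> (Suc k) \<notin> affine hull (b \<Phi> ` {..k})" by blast
    then show ?case using Suc k by (simp add: atMost_Suc aff_dim_insert)
  qed
  have "aff_dim (b \<Phi> ` {..4}) = int DIM(real^4)" using dims[of 4] by simp
  then have "affine hull (b \<Phi> ` {..4}) = UNIV" by (simp only: aff_dim_eq_full)
  moreover have "b \<Phi> ` {..4} = insert c (b \<Phi> ` {..<4})"
    using b4[OF \<Phi>] by (simp add: lessThan_Suc_atMost[symmetric] lessThan_Suc numeral_eq_Suc insert_commute)
  ultimately have "(\<lambda>x. c + x) ` span ((\<lambda>x. - c + x) ` b \<Phi> ` {..<4}) = UNIV"
    using affine_hull_insert_span_gen[of c "b \<Phi> ` {..<4}"] by simp
  moreover have "(\<lambda>x. - c + x) ` b \<Phi> ` {..<4} = u \<Phi> ` {..<4}" unfolding u_def by (auto simp: image_image)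
  ultimately have "(\<lambda>x. c + x) ` span (u \<Phi> ` {..<4}) = UNIV" by simp
  show ?thesis
  proof (intro equalityI subsetI UNIV_I)
    fix x :: "real^4"
    have "c + x \<in> (\<lambda>x. c + x) ` span (u \<Phi> ` {..<4})" using \<open>(\<lambda>x. c + x) ` span (u \<Phi> ` {..<4}) = UNIV\<close> by simp
    then show "x \<in> span (u \<Phi> ` {..<4})" by auto
  qed
qed

lemma orth_all: assumes "\<Phi> \<in> flags L" "\<And>i. i < 4 \<Longrightarrow> x \<bullet> u \<Phi> i = 0" shows "x = 0"
proof -
  have "orthogonal x y" if "y \<in> u \<Phi> ` {..<4}" for y using that assms(2) by (auto simp: orthogonal_def)
  then have "orthogonal x x" using orthogonal_to_span[of x "u \<Phi> ` {..<4}" x] u_span[OF assms(1)] by auto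
  then show ?thesis by (simp add: orthogonal_def)
qed

lemma Iso_eqI: assumes "\<Phi> \<in> flags L" "S \<in> Iso" "T \<in> Iso" "\<And>i. i < 4 \<Longrightarrow> S (u \<Phi> i) = T (u \<Phi> i)" shows "S = T"
proof
  fix x
  have "x \<in> span (u \<Phi> ` {..<4})" using u_span assms(1) by auto
  then show "S x = T x"
    using linear_eq_on_span[OF Iso_linear[OF assms(2)] Iso_linear[OF assms(3)], of "u \<Phi> ` {..<4}"] assms(4) by auto
qed

text \<open>
  A symmetry is linear and its values on the four spanning vectors \<open>u \<Phi> i\<close> are determined by the image flag.
\<close>

lemma free: assumes "\<Phi> \<in> flags L" "S \<in> Iso" "T \<in> Iso" "fl S \<Phi> = fl T \<Phi>" shows "S = T"
proof (rule Iso_eqI[OF assms(1-3)])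
  fix i :: nat assume "i < 4"
  then show "S (u \<Phi> i) = T (u \<Phi> i)"
    using u_fl[OF assms(2,1), of i] u_fl[OF assms(3,1), of i] assms(4) by simp
qed

lemma adj_flag_fl: assumes T: "T \<in> Iso" and \<Phi>: "\<Phi> \<in> flags L" and i: "i < 4" shows "adj_flag (fl T \<Phi>) i = fl T (adj_flag \<Phi> i)"
proof (rule adj_flag_unique[symmetric])
  have n: "adj_flag \<Phi> i \<in> flags L" using adj_flag \<Phi> i by auto
  show "fl T \<Phi> \<in> flags L" "i < 4" "fl T (adj_flag \<Phi> i) \<in> flags L" using fl_flag(1)[OF T] \<Phi> n i by auto
  have "act T F \<noteq> act T K" if "F \<noteq> K" for F K using that act_subset_iff[OF T, of F K] act_subset_iff[OF T, of K F] by blast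
  then show "flag_face (fl T \<Phi>) (int i) \<noteq> flag_face (fl T (adj_flag \<Phi> i)) (int i)"
    using fl_flag(2)[OF T \<Phi>, of "int i"] fl_flag(2)[OF T n, of "int i"] adj_flag(2)[OF \<Phi> i] i by auto
  fix k :: int assume "- 1 \<le> k" "k \<le> 4" "k \<noteq> int i"
  then show "flag_face (fl T (adj_flag \<Phi> i)) k = flag_face (fl T \<Phi>) k"
    using fl_flag(2)[OF T \<Phi>, of k] fl_flag(2)[OF T n, of k] adj_flag(3)[OF \<Phi> i, of k] by auto
qed

text \<open>
  Barycentric chambers do not overlap. By downward induction on the dimension: the ray from the barycentre of the common face of
  rank \<open>k\<close> through the given point leaves that face at a unique point; on the side of \<open>\<Phi>\<close> this point is in the
  relative interior of the next face of \<open>\<Phi>\<close>, so the next face of \<open>\<Psi>\<close>, which also contains it, is the same, and the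
  argument repeats there with the exit point.
\<close>

lemma chamber_peel:
  assumes \<Phi>: "\<Phi> \<in> flags L" and \<Psi>: "\<Psi> \<in> flags L"
  shows "k \<le> 4 \<Longrightarrow> flag_face \<Phi> (int k) = flag_face \<Psi> (int k) \<Longrightarrow> (\<And>i. i < k \<Longrightarrow> 0 < d i) \<Longrightarrow> (\<And>i. i < k \<Longrightarrow> (0::real) \<le> e i)
    \<Longrightarrow> (\<Sum>i<k. d i *\<^sub>R (b \<Phi> i - b \<Phi> k)) = (\<Sum>i<k. e i *\<^sub>R (b \<Psi> i - b \<Psi> k))
    \<Longrightarrow> (\<forall>j<k. flag_face \<Phi> (int j) = flag_face \<Psi> (int j))"
proof (induction k)
  case (Suc k)
  let ?K = "flag_face \<Phi> (int (Suc k))" and ?F = "flag_face \<Phi> (int k)" and ?F' = "flag_face \<Psi> (int k)" and ?o = "b \<Phi> (Suc k)"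
  have k: "k \<le> 4" "Suc k \<le> 4" "int k \<le> 4" "int (Suc k) \<le> 4" using Suc by auto
  have o: "b \<Psi> (Suc k) = ?o" using Suc.prems(2) unfolding b_def by simp
  have faces: "?F face_of P" "?F' face_of P" "?K face_of P" "?F \<subseteq> ?K" "?F' \<subseteq> ?K"
    "aff_dim ?F = int k" "aff_dim ?F' = int k" "aff_dim ?K = int (Suc k)"
    using flag_face[OF \<Phi>, of "int k"] flag_face[OF \<Psi>, of "int k"] flag_face[OF \<Phi>, of "int (Suc k)"]
      flag_face_mono[OF \<Phi>, of "int k" "int (Suc k)"] flag_face_mono[OF \<Psi>, of "int k" "int (Suc k)"] k Suc.prems(2) by auto
  have poly: "polytope ?F" "polytope ?F'" "polytope ?K" using face_of_polytope_polytope[OF polyP] faces by auto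
  have cK: "convex ?K" using poly polytope_imp_convex by auto
  have FK: "?F face_of ?K" "?F \<noteq> ?K" "?F' face_of ?K" "?F' \<noteq> ?K" using faces face_of_face[OF faces(3)] by auto
  have oK: "?o \<in> rel_interior ?K" using b_rel[OF \<Phi> k(2)] .
  have notin: "x \<notin> rel_interior ?K" if "x \<in> ?F \<or> x \<in> ?F'" for x
    using face_of_disjoint_rel_interior[OF FK(1,2)] face_of_disjoint_rel_interior[OF FK(3,4)] that by blast
  define D where "D = sum d {..<Suc k}"
  define E where "E = sum e {..<Suc k}"
  have D: "0 < D" unfolding D_def by (rule sum_pos) (use Suc.prems(3) in auto)
  define z where "z = (\<Sum>i<Suc k. (d i / D) *\<^sub>R b \<Phi> i)"
  have zF: "z \<in> rel_interior ?F" unfolding z_def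
    by (rule positive_combination_rel_interior[OF poly(1), of "{..<Suc k}" "\<lambda>i. d i / D" "b \<Phi>" k])
      (use D Suc.prems(3) b_in[OF \<Phi>] b_rel[OF \<Phi> k(1)] k in \<open>auto simp: D_def sum_divide_distrib[symmetric]\<close>)
  then have zF': "z \<in> ?F" using rel_interior_subset by blast
  have lhs: "(\<Sum>i<Suc k. d i *\<^sub>R (b \<Phi> i - ?o)) = D *\<^sub>R (z - ?o)"
    unfolding z_def using D by (simp add: D_def scaleR_diff_right scaleR_sum_right sum_subtractf scaleR_left.sum[symmetric] del: sum.lessThan_Suc)
  have E: "0 \<le> E" unfolding E_def by (rule sum_nonneg) (use Suc.prems(4) in auto)
  have "E \<noteq> 0"
  proof
    assume "E = 0"
    then have "e i = 0" if "i < Suc k" for i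
      using sum_nonneg_eq_0_iff[of "{..<Suc k}" e] Suc.prems(4) that unfolding E_def by auto
    then have "(\<Sum>i<Suc k. e i *\<^sub>R (b \<Psi> i - b \<Psi> (Suc k))) = 0" by (intro sum.neutral) auto
    then have "z = ?o" using lhs D Suc.prems(5) by simp
    then show False using notin zF' oK by blast
  qed
  then have E: "0 < E" using E by simp
  define z' where "z' = (\<Sum>i<Suc k. (e i / E) *\<^sub>R b \<Psi> i)"
  have zF2: "z' \<in> ?F'" unfolding z'_def
    by (rule convex_sum) (use E Suc.prems(4) b_in[OF \<Psi>] k poly(2) in \<open>auto simp: E_def sum_divide_distrib[symmetric] intro: polytope_imp_convex\<close>)
  have rhs: "(\<Sum>i<Suc k. e i *\<^sub>R (b \<Psi> i - ?o)) = E *\<^sub>R (z' - ?o)"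
    unfolding z'_def using E by (simp add: E_def scaleR_diff_right scaleR_sum_right sum_subtractf scaleR_left.sum[symmetric] del: sum.lessThan_Suc)
  have eq: "D *\<^sub>R (z - ?o) = E *\<^sub>R (z' - ?o)" using lhs rhs Suc.prems(5) o by simp
  have seg: "x = y" if xy: "x \<in> ?F \<or> x \<in> ?F'" "y \<in> ?F \<or> y \<in> ?F'" and eq: "A *\<^sub>R (x - ?o) = B *\<^sub>R (y - ?o)" and AB: "0 < A" "A \<le> B" for x y A B
  proof (rule ccontr)
    assume "x \<noteq> y"
    have y: "y = ?o + (A / B) *\<^sub>R (x - ?o)"
    proof -
      have "(1 / B) *\<^sub>R (A *\<^sub>R (x - ?o)) = (1 / B) *\<^sub>R (B *\<^sub>R (y - ?o))" using eq by simp
      then show ?thesis using AB by (simp add: algebra_simps)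
    qed
    have "A / B \<noteq> 1" using y \<open>x \<noteq> y\<close> by auto
    then have AB': "0 < A / B" "A / B < 1" using AB by auto
    have "x \<in> ?K" using xy faces by auto
    then have "x - (1 - A / B) *\<^sub>R (x - ?o) \<in> rel_interior ?K"
      by (intro rel_interior_convex_shrink[OF cK oK]) (use AB' in auto)
    moreover have "x - (1 - A / B) *\<^sub>R (x - ?o) = y" using y by (simp add: algebra_simps)
    ultimately show False using notin xy by auto
  qed
  have zz: "z = z'"
    using seg[OF _ _ eq] seg[OF _ _ eq[symmetric]] zF' zF2 D E by (cases "D \<le> E") auto
  then have "(D - E) *\<^sub>R (z - ?o) = 0" using eq by (simp add: algebra_simps)
  moreover have "z \<noteq> ?o" using notin zF' oK by auto
  ultimately have DE: "D = E" by simp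
  have "?F \<subseteq> ?F'" using subset_of_face_of[OF FK(3) faces(4)] zF zF2 zz by blast
  then have facet_rot_order: "?F = ?F'" using face_dim_eq[OF faces(1,2)] faces by simp
  then have bb: "b \<Psi> k = b \<Phi> k" unfolding b_def by simp
  have sums: "(\<Sum>i<Suc k. d i *\<^sub>R b \<Phi> i) = (\<Sum>i<Suc k. e i *\<^sub>R b \<Psi> i)"
  proof -
    have "(\<Sum>i<Suc k. d i *\<^sub>R b \<Phi> i) = D *\<^sub>R z" unfolding z_def using D by (simp add: scaleR_sum_right del: sum.lessThan_Suc)
    also have "\<dots> = E *\<^sub>R z'" using zz DE by simp
    also have "\<dots> = (\<Sum>i<Suc k. e i *\<^sub>R b \<Psi> i)" unfolding z'_def using E by (simp add: scaleR_sum_right del: sum.lessThan_Suc)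
    finally show ?thesis .
  qed
  have shift: "(\<Sum>i<k. f i *\<^sub>R (B i - B k)) = (\<Sum>i<Suc k. f i *\<^sub>R B i) - sum f {..<Suc k} *\<^sub>R B k"
    for f :: "nat \<Rightarrow> real" and B :: "nat \<Rightarrow> real^4"
    by (simp add: scaleR_diff_right sum_subtractf scaleR_left.sum[symmetric] scaleR_add_left)
  have "\<forall>j<k. flag_face \<Phi> (int j) = flag_face \<Psi> (int j)"
  proof (rule Suc.IH[OF k(1) facet_rot_order])
    show "(\<Sum>i<k. d i *\<^sub>R (b \<Phi> i - b \<Phi> k)) = (\<Sum>i<k. e i *\<^sub>R (b \<Psi> i - b \<Psi> k))"
      unfolding shift using sums bb DE unfolding D_def E_def by simp
  qed (use Suc.prems in auto)
  then show ?case using facet_rot_order by (auto simp: less_Suc_eq)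
qed simp

lemma chambers_disjoint:
  assumes \<Phi>: "\<Phi> \<in> flags L" and \<Psi>: "\<Psi> \<in> flags L"
    and d: "\<And>i. i < 4 \<Longrightarrow> 0 < d i" and e: "\<And>i. i < 4 \<Longrightarrow> (0::real) \<le> e i"
    and eq: "(\<Sum>i<4. d i *\<^sub>R u \<Phi> i) = (\<Sum>i<4. e i *\<^sub>R u \<Psi> i)"
  shows "\<Phi> = \<Psi>"
proof -
  have 4: "flag_face \<Phi> 4 = flag_face \<Psi> 4" using fc4 \<Phi> \<Psi> by metis
  have "\<forall>j<4. flag_face \<Phi> (int j) = flag_face \<Psi> (int j)"
    by (rule chamber_peel[OF \<Phi> \<Psi>, of 4 d e]) (use 4 d e eq b4[OF \<Phi>] b4[OF \<Psi>] in \<open>auto simp: u_def\<close>)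
  moreover have "flag_face \<Phi> (- 1) = flag_face \<Psi> (- 1)"
    using flag_face(2)[OF \<Phi>, of "-1"] flag_face(2)[OF \<Psi>, of "-1"]
      aff_dim_empty[of "flag_face \<Phi> (-1)"] aff_dim_empty[of "flag_face \<Psi> (-1)"] by simp
  ultimately show ?thesis
  proof (intro flag_eqI[OF \<Phi> \<Psi>])
    fix k :: int assume "\<forall>j<4. flag_face \<Phi> (int j) = flag_face \<Psi> (int j)" "flag_face \<Phi> (- 1) = flag_face \<Psi> (- 1)" "- 1 \<le> k" "k \<le> 4"
    moreover have "k = -1 \<or> k = 4 \<or> (\<exists>j<4. k = int j)" using calculation(3,4) by (cases "0 \<le> k") (auto elim!: nonneg_int_cases)
    ultimately show "flag_face \<Phi> k = flag_face \<Psi> k" using 4 by auto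
  qed
qed

end

section \<open>The generating reflections\<close>

locale flagged_4polytope = regular_4polytope +
  fixes \<Phi> :: "(real ^ 4) set set"
  assumes \<Phi>: "\<Phi> \<in> flags (face_lattice P)"
begin

abbreviation v :: "nat \<Rightarrow> real ^ 4" where "v \<equiv> u \<Phi>"

text \<open>
  Such a symmetry exists because the symmetries are transitive on flags, and it is unique by \<open>free\<close>.
\<close>

definition s :: "nat \<Rightarrow> real ^ 4 \<Rightarrow> real ^ 4" where
  "s i = (SOME T. T \<in> Iso \<and> fl T \<Phi> = adj_flag \<Phi> i)"

lemma s: assumes "i < 4" shows "s i \<in> Iso" "fl (s i) \<Phi> = adj_flag \<Phi> i"
proof -
  have "\<exists>T. T \<in> Iso \<and> fl T \<Phi> = adj_flag \<Phi> i" using transitive[OF \<Phi> adj_flag(1)[OF \<Phi> assms]] by blast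
  then have "s i \<in> Iso \<and> fl (s i) \<Phi> = adj_flag \<Phi> i" unfolding s_def by (rule someI_ex)
  then show "s i \<in> Iso" "fl (s i) \<Phi> = adj_flag \<Phi> i" by auto
qed

lemma s_s: assumes "i < 4" shows "s i \<circ> s i = id"
proof (rule free[OF \<Phi> Iso_comp[OF s(1) s(1)] Iso_id])
  have "fl (s i \<circ> s i) \<Phi> = fl (s i) (adj_flag \<Phi> i)" using fl_comp[of "s i" "s i" \<Phi>] s(2)[OF assms] by metis
  also have "\<dots> = adj_flag (fl (s i) \<Phi>) i" using adj_flag_fl[OF s(1)[OF assms] \<Phi> assms] by simp
  also have "\<dots> = \<Phi>" using adj_flag_nb[OF \<Phi> assms] s(2)[OF assms] by simp
  finally show "fl (s i \<circ> s i) \<Phi> = fl id \<Phi>" by (simp add: act_id image_def)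
qed (use assms in auto)

lemma s_comm: assumes "i < 4" "j < 4" "i + 2 \<le> j \<or> j + 2 \<le> i" shows "s i \<circ> s j = s j \<circ> s i"
proof (rule free[OF \<Phi> Iso_comp[OF s(1) s(1)] Iso_comp[OF s(1) s(1)]])
  have *: "fl (s i \<circ> s j) \<Phi> = adj_flag (adj_flag \<Phi> i) j" if "i < 4" "j < 4" for i j
  proof -
    have "fl (s i \<circ> s j) \<Phi> = fl (s i) (adj_flag \<Phi> j)" using fl_comp[of "s i" "s j" \<Phi>] s(2)[OF that(2)] by metis
    then show ?thesis using adj_flag_fl[OF s(1)[OF that(1)] \<Phi> that(2)] s(2)[OF that(1)] by simp
  qed
  show "fl (s i \<circ> s j) \<Phi> = fl (s j \<circ> s i) \<Phi>" using * adj_flag_comm[OF \<Phi> assms] assms by simp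
qed (use assms in auto)

lemma s_fix: assumes "i < 4" "j < 4" "j \<noteq> i" shows "s i (v j) = v j"
proof -
  have "flag_face (adj_flag \<Phi> i) (int j) = flag_face \<Phi> (int j)" using adj_flag(3)[OF \<Phi> assms(1), of "int j"] assms by auto
  then have "u (adj_flag \<Phi> i) j = v j" unfolding u_def b_def by simp
  then show ?thesis using u_fl[OF s(1)[OF assms(1)] \<Phi>, of j] s(2)[OF assms(1)] assms by simp
qed

lemma s_move: assumes "i < 4" shows "s i (v i) \<noteq> v i"
proof
  assume "s i (v i) = v i"
  then have "s i (v j) = id (v j)" if "j < 4" for j using s_fix[OF assms that] by (cases "j = i") auto
  then have "s i = id" using Iso_eqI[OF \<Phi> s(1)[OF assms] Iso_id] by auto
  then have "adj_flag \<Phi> i = \<Phi>" using s(2)[OF assms] by (simp add: act_id image_def)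
  then show False using adj_flag(2)[OF \<Phi> assms] by simp
qed

text \<open>
  The unit normal of the wall of the base chamber opposite to \<open>v i\<close>, pointing inwards. The vectors \<open>n i\<close> and \<open>v i\<close> are dual
  bases up to scaling.
\<close>

definition n :: "nat \<Rightarrow> real ^ 4" where
  "n i = (SOME x. norm x = 1 \<and> (\<forall>j<4. j \<noteq> i \<longrightarrow> x \<bullet> v j = 0) \<and> 0 < x \<bullet> v i)"

lemma n: assumes "i < 4" shows "norm (n i) = 1" "\<And>j. j < 4 \<Longrightarrow> j \<noteq> i \<Longrightarrow> n i \<bullet> v j = 0" "0 < n i \<bullet> v i"
proof -
  let ?S = "v ` ({..<4} - {i})"
  have "card ?S \<le> 3" using card_image_le[of "{..<4} - {i}" v] assms by simp
  then have "dim ?S < DIM(real ^ 4)" using dim_le_card'[of ?S] by simp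
  then obtain x where x: "x \<noteq> 0" "\<And>y. y \<in> span ?S \<Longrightarrow> orthogonal x y"
    using orthogonal_to_subspace_exists[of ?S] by blast
  have x0: "x \<bullet> v j = 0" if "j < 4" "j \<noteq> i" for j
    using x(2)[OF span_base[of "v j" ?S]] that by (auto simp: orthogonal_def)
  have xi: "x \<bullet> v i \<noteq> 0" using orth_all[OF \<Phi>, of x] x0 x(1) by metis
  define y where "y = (sgn (x \<bullet> v i) / norm x) *\<^sub>R x"
  have "norm y = 1 \<and> (\<forall>j<4. j \<noteq> i \<longrightarrow> y \<bullet> v j = 0) \<and> 0 < y \<bullet> v i"
    unfolding y_def using x(1) x0 xi by (auto simp: abs_sgn_eq sgn_if divide_simps zero_less_mult_iff)
  then have "norm (n i) = 1 \<and> (\<forall>j<4. j \<noteq> i \<longrightarrow> n i \<bullet> v j = 0) \<and> 0 < n i \<bullet> v i"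
    unfolding n_def by (rule someI)
  then show "norm (n i) = 1" "\<And>j. j < 4 \<Longrightarrow> j \<noteq> i \<Longrightarrow> n i \<bullet> v j = 0" "0 < n i \<bullet> v i" by auto
qed

lemma n_unit: "i < 4 \<Longrightarrow> n i \<bullet> n i = 1"
  using n(1)[of i] by (simp add: power2_norm_eq_inner[symmetric])

lemma n_line: assumes i: "i < 4" and x: "\<And>j. j < 4 \<Longrightarrow> j \<noteq> i \<Longrightarrow> x \<bullet> v j = 0"
  shows "x = (x \<bullet> n i) *\<^sub>R n i"
proof -
  define k where "k = (x \<bullet> v i) / (n i \<bullet> v i)"
  have "x - k *\<^sub>R n i = 0"
  proof (rule orth_all[OF \<Phi>])
    fix j :: nat assume "j < 4"
    then show "(x - k *\<^sub>R n i) \<bullet> v j = 0"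
      using x n[OF i] by (cases "j = i") (auto simp: inner_diff_left k_def)
  qed
  then have x: "x = k *\<^sub>R n i" by simp
  then have "x \<bullet> n i = k" using n_unit[OF i] by simp
  then show ?thesis using x by simp
qed

text \<open>
  The symmetry fixes the three vectors \<open>v j\<close> with \<open>j \<noteq> i\<close>, so it maps the orthogonal line spanned by \<open>n i\<close> to itself. It is not the
  identity, so it acts on this line by \<open>- 1\<close>.
\<close>

lemma reflection: assumes i: "i < 4" shows "s i x = x - (2 * (n i \<bullet> x)) *\<^sub>R n i"
proof -
  note I = s(1)[OF i]
  have fix_inner: "s i y \<bullet> v j = y \<bullet> v j" if "j < 4" "j \<noteq> i" for y j
    using Iso_inner[OF I, of y "v j"] s_fix[OF i that] by simp
  have "s i (n i) \<bullet> v j = 0" if "j < 4" "j \<noteq> i" for j using fix_inner[OF that] n(2)[OF i that] by simp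
  then have sn: "s i (n i) = (s i (n i) \<bullet> n i) *\<^sub>R n i" by (rule n_line[OF i])
  define l where "l = s i (n i) \<bullet> n i"
  have "l * l = 1"
  proof -
    have "s i (n i) \<bullet> s i (n i) = 1" using Iso_inner[OF I] n_unit[OF i] by simp
    then have "(l *\<^sub>R n i) \<bullet> (l *\<^sub>R n i) = 1" using sn unfolding l_def[symmetric] by metis
    then show ?thesis using n_unit[OF i] by simp
  qed
  then have "l = 1 \<or> l = -1" by (simp add: square_eq_1_iff)
  moreover have "l \<noteq> 1"
  proof
    assume "l = 1"
    then have sn1: "s i (n i) = n i" using sn unfolding l_def[symmetric] by simp
    let ?z = "s i (v i) - v i"
    have "?z \<bullet> v j = 0" if "j < 4" "j \<noteq> i" for j using fix_inner[OF that] by (simp add: inner_diff_left)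
    then have "?z = (?z \<bullet> n i) *\<^sub>R n i" by (rule n_line[OF i])
    moreover have "?z \<bullet> n i = 0" using Iso_inner[OF I, of "v i" "n i"] sn1 by (simp add: inner_diff_left)
    ultimately show False using s_move[OF i] by simp
  qed
  ultimately have sn: "s i (n i) = - n i" using sn unfolding l_def[symmetric] by simp
  let ?z = "s i x - x + (2 * (n i \<bullet> x)) *\<^sub>R n i"
  have "?z \<bullet> v j = 0" if "j < 4" "j \<noteq> i" for j
    using fix_inner[OF that] n(2)[OF i that] by (simp add: inner_diff_left inner_add_left)
  then have zl: "?z = (?z \<bullet> n i) *\<^sub>R n i" by (rule n_line[OF i])
  have "s i x \<bullet> n i = - (n i \<bullet> x)"
    using Iso_inner[OF I, of x "n i"] sn by (simp add: inner_commute)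
  moreover have "?z \<bullet> n i = s i x \<bullet> n i - x \<bullet> n i + 2 * (n i \<bullet> x)"
    using n_unit[OF i] by (simp add: inner_diff_left inner_add_left)
  ultimately have "?z \<bullet> n i = 0" using inner_commute[of x "n i"] by linarith
  then have "?z = 0" using zl by (metis scaleR_zero_left)
  moreover have "s i x = ?z + (x - (2 * (n i \<bullet> x)) *\<^sub>R n i)" by simp
  ultimately show ?thesis by simp
qed

text \<open>The generators are involutions, so the words in them form a group.\<close>

inductive_set gen :: "nat set \<Rightarrow> (real ^ 4 \<Rightarrow> real ^ 4) set" for K where
  gen_id: "id \<in> gen K"
| gen_step: "T \<in> gen K \<Longrightarrow> i \<in> K \<Longrightarrow> s i \<circ> T \<in> gen K"

lemma gen_Iso: assumes "K \<subseteq> {..<4}" "T \<in> gen K" shows "T \<in> Iso"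
  using assms(2)
proof induction
  case gen_id show ?case by (rule Iso_id)
next
  case (gen_step T i)
  then have "i < 4" using assms(1) by auto
  then show ?case using gen_step by (metis Iso_comp s(1))
qed

lemma gen_comp: assumes "S \<in> gen K" "T \<in> gen K" shows "S \<circ> T \<in> gen K"
  using assms(1)
proof induction
  case gen_id show ?case using assms(2) by simp
next
  case (gen_step S i)
  then show ?case by (metis comp_assoc gen.gen_step)
qed

lemma gen_s: "i \<in> K \<Longrightarrow> s i \<in> gen K" using gen_step[OF gen_id, of i K] by simp

lemma gen_mono: "K \<subseteq> K' \<Longrightarrow> gen K \<subseteq> gen K'"
proof
  fix T assume K: "K \<subseteq> K'" and "T \<in> gen K"
  from this(2) show "T \<in> gen K'"
  proof induction
    case gen_id show ?case by (rule gen.gen_id)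
  next
    case (gen_step T i) then show ?case by (metis K gen.gen_step subsetD)
  qed
qed

lemma gen_fix: assumes "K \<subseteq> {..<4}" "T \<in> gen K" "j < 4" "j \<notin> K" shows "T (v j) = v j"
  using assms(2)
proof induction
  case (gen_step T i)
  then have "i < 4" "j \<noteq> i" using assms by auto
  then show ?case using gen_step s_fix assms by simp
qed simp

lemma finite_flags: "finite (flags L)"
proof (rule finite_subset)
  show "flags L \<subseteq> Pow {F. F face_of P}" unfolding flag_iff[abs_def] by (auto simp: flag_iff)
qed (use finite_polytope_faces[OF polyP] in simp)

lemma finite_Iso: "finite Iso"
proof (rule finite_imageD)
  show "finite ((\<lambda>T. fl T \<Phi>) ` Iso)" by (rule finite_subset[OF _ finite_flags]) (use fl_flag(1)[OF _ \<Phi>] in auto)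
  show "inj_on (\<lambda>T. fl T \<Phi>) Iso" using free[OF \<Phi>] by (auto simp: inj_on_def)
qed

lemma finite_gen: "K \<subseteq> {..<4} \<Longrightarrow> finite (gen K)"
  using finite_subset[OF _ finite_Iso] gen_Iso by blast

text \<open>Coordinates in the basis \<open>v\<close>, read off with the dual basis.\<close>

lemma expand: "y = (\<Sum>i<4. ((n i \<bullet> y) / (n i \<bullet> v i)) *\<^sub>R v i)"
proof -
  have lin: "linear (\<lambda>y. \<Sum>i<4. ((n i \<bullet> y) / (n i \<bullet> v i)) *\<^sub>R v i)"
    by (rule linearI) (simp_all add: inner_add_right add_divide_distrib scaleR_add_left sum.distrib scaleR_sum_right)
  have vj: "v j = (\<Sum>i<4. ((n i \<bullet> v j) / (n i \<bullet> v i)) *\<^sub>R v i)" if j: "j < 4" for j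
  proof -
    have "(\<Sum>i<4. ((n i \<bullet> v j) / (n i \<bullet> v i)) *\<^sub>R v i) = (\<Sum>i<4. if i = j then v j else 0)"
      by (rule sum.cong) (use n(2) n(3)[OF j] j in auto)
    then show ?thesis using j by simp
  qed
  have "x = (\<Sum>i<4. ((n i \<bullet> x) / (n i \<bullet> v i)) *\<^sub>R v i)" if "x \<in> v ` {..<4}" for x
    using that vj by blast
  moreover have "y \<in> span (v ` {..<4})" using u_span[OF \<Phi>] by simp
  ultimately show ?thesis by (rule linear_eq_on_span[OF linear_ident lin])
qed

text \<open>
  The stabiliser of faces of the base flag is generated by the reflections that fix these faces. Take a point \<open>x\<close> inside the base
  chamber whose coordinates for the fixed faces dominate, and choose \<open>w\<close> in the reflection subgroup such that \<open>w x\<close> has the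
  largest inner product with \<open>g x\<close>. Reflecting cannot increase this product, which says that \<open>g x\<close> is on the positive
  side of the walls of the chamber of \<open>w\<close> for the moving faces; for the fixed faces this holds by the choice of \<open>x\<close>.
  So \<open>g x\<close> lies in the chambers of both \<open>g\<close> and \<open>w\<close>, and chambers do not overlap.
\<close>

theorem stab:
  assumes g: "g \<in> Iso" and J: "J \<subseteq> {..<4}" and fixJ: "\<And>j. j \<in> J \<Longrightarrow> g (v j) = v j"
  shows "g \<in> gen ({..<4} - J)"
proof -
  let ?K = "{..<4} - J"
  have K: "?K \<subseteq> {..<4}" by auto
  define m where "m = Min ((\<lambda>i. n i \<bullet> v i) ` {..<4})"
  define B where "B = (\<Sum>i<4. norm (v i))"
  have "0 \<in> {..<4::nat}" by simp
  then have "m \<in> (\<lambda>i. n i \<bullet> v i) ` {..<4}" unfolding m_def by (intro Min_in) blast+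
  then have m: "0 < m" "\<And>i. i < 4 \<Longrightarrow> m \<le> n i \<bullet> v i" unfolding m_def using n(3) by (auto intro!: Min_le)
  have B: "0 \<le> B" unfolding B_def by (rule sum_nonneg) simp
  \<comment> \<open>small enough that the moving faces cannot outweigh a fixed one in the estimate below\<close>
  define \<epsilon> where "\<epsilon> = m / (B + 1)"
  have \<epsilon>: "0 < \<epsilon>" "\<epsilon> * B < m" unfolding \<epsilon>_def using m(1) B by (auto simp: field_simps)
  define d where "d i = (if i \<in> J then 1 else \<epsilon>)" for i :: nat
  have d: "0 < d i" for i using \<epsilon> unfolding d_def by auto
  define x where "x = (\<Sum>i<4. d i *\<^sub>R v i)"
  have nx: "n i \<bullet> x = d i * (n i \<bullet> v i)" if i: "i < 4" for i
  proof -
    have "n i \<bullet> x = (\<Sum>j<4. d j * (n i \<bullet> v j))" unfolding x_def by (simp add: inner_sum_right)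
    also have "\<dots> = (\<Sum>j<4. if j = i then d i * (n i \<bullet> v i) else 0)" by (rule sum.cong) (use n(2)[OF i] in auto)
    finally show ?thesis using i by simp
  qed
  define y where "y = g x"
  have y: "y = (\<Sum>i<4. d i *\<^sub>R g (v i))"
    unfolding y_def x_def by (simp add: linear_sum[OF Iso_linear[OF g]] linear_scale[OF Iso_linear[OF g]])
  let ?A = "(\<lambda>w. w x \<bullet> y) ` gen ?K"
  have A: "finite ?A" "?A \<noteq> {}" using finite_gen[OF K] gen_id by auto
  have "Max ?A \<in> ?A" by (rule Max_in[OF A])
  then obtain w where w: "w \<in> gen ?K" "Max ?A = w x \<bullet> y" by (elim imageE) simp
  have wmax: "w' x \<bullet> y \<le> w x \<bullet> y" if "w' \<in> gen ?K" for w' using Max_ge[OF A(1), of "w' x \<bullet> y"] w(2) that by simp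
  have wI: "w \<in> Iso" using gen_Iso[OF K w(1)] .
  define e where "e i = (w (n i) \<bullet> y) / (n i \<bullet> v i)" for i
  have y2: "y = (\<Sum>i<4. e i *\<^sub>R w (v i))"
  proof -
    let ?w' = "inv_into UNIV w"
    have w': "?w' \<in> Iso" "w (?w' y) = y" using Iso_inv[OF wI] by (auto simp: fun_eq_iff)
    have "w (?w' y) = (\<Sum>i<4. ((n i \<bullet> ?w' y) / (n i \<bullet> v i)) *\<^sub>R w (v i))"
      by (subst expand[of "?w' y"]) (simp add: linear_sum[OF Iso_linear[OF wI]] linear_scale[OF Iso_linear[OF wI]])
    moreover have "n i \<bullet> ?w' y = w (n i) \<bullet> y" for i using Iso_inner[OF wI, of "n i" "?w' y"] w'(2) by simp
    ultimately show ?thesis unfolding e_def using w'(2) by simp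
  qed
  have e: "0 \<le> e i" if i: "i < 4" for i
  proof (cases "i \<in> J")
    case False
    then have "w \<circ> s i \<in> gen ?K" using gen_comp[OF w(1) gen_s] i by auto
    then have "w (s i x) \<bullet> y \<le> w x \<bullet> y" using wmax by fastforce
    then have "w x \<bullet> y - (2 * (n i \<bullet> x)) * (w (n i) \<bullet> y) \<le> w x \<bullet> y"
      unfolding reflection[OF i] by (simp add: linear_diff[OF Iso_linear[OF wI]] linear_scale[OF Iso_linear[OF wI]] inner_diff_left)
    then have "0 \<le> (n i \<bullet> x) * (w (n i) \<bullet> y)" by simp
    moreover have "0 < n i \<bullet> x" using nx[OF i] d n(3)[OF i] by simp
    ultimately have "0 \<le> w (n i) \<bullet> y" by (simp add: zero_le_mult_iff)
    then show ?thesis unfolding e_def using n(3)[OF i] by simp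
  next
    case True
    have t: "(if j = i then n i \<bullet> v i else 0) - \<epsilon> * norm (v j) \<le> d j * (w (n i) \<bullet> g (v j))" if j: "j < 4" for j
    proof (cases "j \<in> J")
      case jJ: True
      have "w (v j) = v j" using gen_fix[OF K w(1) j] jJ by auto
      then have "w (n i) \<bullet> g (v j) = n i \<bullet> v j" using fixJ[OF jJ] Iso_inner[OF wI, of "n i" "v j"] by simp
      then show ?thesis using jJ n(2)[OF i j] \<epsilon>(1) unfolding d_def by auto
    next
      case jJ: False
      have "\<bar>w (n i) \<bullet> g (v j)\<bar> \<le> norm (w (n i)) * norm (g (v j))" by (rule Cauchy_Schwarz_ineq2)
      also have "\<dots> = norm (v j)"
        using orthogonal_transformation_norm[OF Iso_orth[OF wI]] orthogonal_transformation_norm[OF Iso_orth[OF g]] n(1)[OF i] by simp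
      finally have "- norm (v j) \<le> w (n i) \<bullet> g (v j)" by linarith
      then have "\<epsilon> * (- norm (v j)) \<le> \<epsilon> * (w (n i) \<bullet> g (v j))" using \<epsilon>(1) by (intro mult_left_mono) auto
      moreover have "j \<noteq> i" using jJ True by auto
      ultimately show ?thesis using jJ unfolding d_def by simp
    qed
    have "0 < n i \<bullet> v i - \<epsilon> * B" using \<epsilon>(2) m(2)[OF i] by simp
    also have "\<dots> = (\<Sum>j<4. (if j = i then n i \<bullet> v i else 0) - \<epsilon> * norm (v j))"
      unfolding B_def using i by (simp add: sum_subtractf sum_distrib_left)
    also have "\<dots> \<le> (\<Sum>j<4. d j * (w (n i) \<bullet> g (v j)))" by (rule sum_mono) (use t in auto)
    also have "\<dots> = w (n i) \<bullet> y" unfolding y by (simp add: inner_sum_right)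
    finally show ?thesis unfolding e_def using n(3)[OF i] by simp
  qed
  have "fl g \<Phi> = fl w \<Phi>"
  proof (rule chambers_disjoint[OF fl_flag(1)[OF g \<Phi>] fl_flag(1)[OF wI \<Phi>], of d e])
    show "(\<Sum>i<4. d i *\<^sub>R u (fl g \<Phi>) i) = (\<Sum>i<4. e i *\<^sub>R u (fl w \<Phi>) i)"
      using y y2 u_fl[OF g \<Phi>] u_fl[OF wI \<Phi>] by simp
  qed (use d e in auto)
  then have "g = w" using free[OF \<Phi> g wI] by simp
  then show ?thesis using w(1) by simp
qed

text \<open>
  Orbit and stabiliser of \<open>v j\<close>, where the stabiliser is again a reflection subgroup.
\<close>

lemma card_gen:
  assumes K: "K \<subseteq> {..<4}" and j: "j \<in> K"
  shows "card (gen K) = card ((\<lambda>T. T (v j)) ` gen K) * card (gen (K - {j}))"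
proof -
  let ?f = "\<lambda>T. T (v j)"
  have Kj: "K - {j} \<subseteq> {..<4}" using K by auto
  have fib: "card {T \<in> gen K. ?f T = p} = card (gen (K - {j}))" if "p \<in> ?f ` gen K" for p
  proof -
    have "\<exists>R. R \<in> gen K \<and> R (v j) = p" using that by auto
    then obtain R where R: "R \<in> gen K" "R (v j) = p" by blast
    have RI: "R \<in> Iso" using gen_Iso[OF K R(1)] .
    note iR = Iso_inv[OF RI]
    have "{T \<in> gen K. ?f T = p} = (\<lambda>T. R \<circ> T) ` gen (K - {j})"
    proof (intro equalityI subsetI)
      fix T assume "T \<in> {T \<in> gen K. ?f T = p}"
      then have T: "T \<in> gen K" "T (v j) = p" by auto
      let ?g = "inv_into UNIV R \<circ> T"
      have "?g \<in> gen ({..<4} - (({..<4} - K) \<union> {j}))"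
      proof (rule stab)
        show "?g \<in> Iso" using Iso_comp iR(1) gen_Iso[OF K T(1)] by auto
        fix i assume "i \<in> ({..<4} - K) \<union> {j}"
        then have "T (v i) = R (v i)"
          using gen_fix[OF K T(1), of i] gen_fix[OF K R(1), of i] T(2) R(2) by auto
        then show "?g (v i) = v i" using iR(2) by (metis comp_apply id_apply)
      qed (use j K in auto)
      moreover have "{..<4} - (({..<4} - K) \<union> {j}) = K - {j}" using K by auto
      moreover have "T = R \<circ> ?g" using iR(3) by (metis comp_assoc id_comp)
      ultimately show "T \<in> (\<lambda>T. R \<circ> T) ` gen (K - {j})" by auto
    next
      fix T assume "T \<in> (\<lambda>T. R \<circ> T) ` gen (K - {j})"
      then obtain S where S: "S \<in> gen (K - {j})" "T = R \<circ> S" by auto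
      then have "S \<in> gen K" using gen_mono[of "K - {j}" K] by auto
      then show "T \<in> {T \<in> gen K. ?f T = p}"
        using S gen_comp[OF R(1)] gen_fix[OF Kj S(1), of j] R(2) K j by auto
    qed
    moreover have "inj_on (\<lambda>T. R \<circ> T) X" for X :: "(real ^ 4 \<Rightarrow> real ^ 4) set" using Iso_inj[OF RI] by (auto simp: inj_on_def fun_eq_iff inj_def)
    ultimately show ?thesis by (simp add: card_image)
  qed
  have "card (gen K) = (\<Sum>T\<in>gen K. 1)" by simp
  also have "\<dots> = (\<Sum>p\<in>?f ` gen K. \<Sum>T\<in>{T \<in> gen K. ?f T = p}. 1)" by (rule sum.image_gen[OF finite_gen[OF K]])
  also have "\<dots> = (\<Sum>p\<in>?f ` gen K. card (gen (K - {j})))" by (rule sum.cong) (use fib in auto)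
  finally show ?thesis by simp
qed

lemma gen_empty: "gen {} = {id}"
proof -
  have "T = id" if "T \<in> gen {}" for T using that by induction auto
  then show ?thesis using gen_id by auto
qed

section \<open>Angles between the mirrors\<close>

lemma n_far: assumes ij: "i < 4" "j < 4" "i + 2 \<le> j \<or> j + 2 \<le> i" shows "n i \<bullet> n j = 0"
proof -
  define a where "a = n i \<bullet> n j"
  have ji: "n j \<bullet> n i = a" unfolding a_def by (simp add: inner_commute)
  have "s i (s j (n j)) = s j (s i (n j))" using s_comm[OF ij] by (metis comp_apply)
  then have "s i (s j (n j)) \<bullet> v i = s j (s i (n j)) \<bullet> v i" by simp
  moreover have "i \<noteq> j" using ij by auto
  ultimately have "a * (n i \<bullet> v i) = 0"
    using n_unit[OF ij(1)] n_unit[OF ij(2)] n(2)[OF ij(2,1)] unfolding reflection[OF ij(1)] reflection[OF ij(2)]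
    by (simp add: inner_diff_right inner_diff_left ji a_def[symmetric] algebra_simps)
  then show ?thesis using n(3)[OF ij(1)] unfolding a_def by simp
qed

text \<open>
  The product \<open>R\<close> of two adjacent reflections is the rotation by twice the angle between the mirrors. In the basis
  \<open>n h, n i\<close> the coordinates \<open>X m\<close> of the images of \<open>n h\<close> under the powers of \<open>R\<close> are polynomials in \<open>\<sigma> = t - 2\<close>, the trace of the rotation, and
  \<open>R\<^sup>p = 1\<close> yields an equation for \<open>t\<close>. For \<open>p = 5\<close> both roots remain, since the order does not distinguish the pentagon
  from the pentagram.
\<close>

lemma gram:
  assumes i: "i = Suc h" "i < 4" and R: "R = s h \<circ> s i" and p: "p \<in> {3, 4, 5}"
    and Rp: "R ^^ p = id" and R2: "R ^^ 2 \<noteq> id" and t: "t = 4 * (n h \<bullet> n i)^2"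
  shows "n h \<bullet> n i \<noteq> 0" "p = 3 \<Longrightarrow> t = 1" "p = 4 \<Longrightarrow> t = 2" "p = 5 \<Longrightarrow> t^2 = 3 * t - 1"
proof -
  let ?a = "n h" and ?b = "n i"
  define k where "k = ?a \<bullet> ?b"
  have i1: "h < 4" "h \<noteq> i" using i by auto
  have kk: "?b \<bullet> ?a = k" "?a \<bullet> ?b = k" "?a \<bullet> ?a = 1" "?b \<bullet> ?b = 1" unfolding k_def using n_unit i i1 by (auto simp: inner_commute)
  have R_apply: "R x = x - (2 * (?b \<bullet> x)) *\<^sub>R ?b - (2 * (?a \<bullet> x) - 4 * k * (?b \<bullet> x)) *\<^sub>R ?a" for x
    unfolding R comp_apply reflection[OF i(2)] reflection[OF i1(1)]
    by (simp add: inner_diff_right kk algebra_simps)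
  show k0: "?a \<bullet> ?b \<noteq> 0"
  proof
    assume "?a \<bullet> ?b = 0"
    then have "k = 0" unfolding k_def by simp
    then have "R (R x) = x" for x
      unfolding R_apply by (simp add: inner_diff_right kk algebra_simps)
    then show False using R2 by (auto simp: numeral_2_eq_2 fun_eq_iff)
  qed
  have indep: "x = x' \<and> y = y'" if "x *\<^sub>R ?a + y *\<^sub>R ?b = x' *\<^sub>R ?a + y' *\<^sub>R ?b" for x y x' y' :: real
  proof -
    have eq: "(x *\<^sub>R ?a + y *\<^sub>R ?b) \<bullet> z = (x' *\<^sub>R ?a + y' *\<^sub>R ?b) \<bullet> z" for z using that by simp
    have "x * (?a \<bullet> v h) = x' * (?a \<bullet> v h)"
      using eq[of "v h"] n(2)[OF i(2), of h] i1 by (simp add: inner_add_left)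
    moreover have "y * (?b \<bullet> v i) = y' * (?b \<bullet> v i)"
      using eq[of "v i"] n(2)[OF i1(1), of i] i1 i by (simp add: inner_add_left)
    ultimately show ?thesis using n(3)[OF i1(1)] n(3)[OF i(2)] by simp
  qed
  have R_ab: "R (x *\<^sub>R ?a + y *\<^sub>R ?b) = (x * (4 * k * k - 1) + 2 * k * y) *\<^sub>R ?a + (- 2 * k * x - y) *\<^sub>R ?b" for x y
  proof -
    have z: "?b \<bullet> (x *\<^sub>R ?a + y *\<^sub>R ?b) = x * k + y" "?a \<bullet> (x *\<^sub>R ?a + y *\<^sub>R ?b) = x + y * k"
      by (simp_all add: inner_add_right kk)
    have split: "x *\<^sub>R ?a + y *\<^sub>R ?b - B *\<^sub>R ?b - A *\<^sub>R ?a = (x - A) *\<^sub>R ?a + (y - B) *\<^sub>R ?b" for A B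
      by (simp add: scaleR_left_diff_distrib)
    have "R (x *\<^sub>R ?a + y *\<^sub>R ?b) =
        (x - (2 * (x + y * k) - 4 * k * (x * k + y))) *\<^sub>R ?a + (y - 2 * (x * k + y)) *\<^sub>R ?b"
      unfolding R_apply z by (rule split)
    also have "x - (2 * (x + y * k) - 4 * k * (x * k + y)) = x * (4 * k * k - 1) + 2 * k * y"
      by (simp add: algebra_simps)
    also have "y - 2 * (x * k + y) = - 2 * k * x - y" by simp
    finally show ?thesis .
  qed
  have tk: "t = 4 * k * k" unfolding t k_def by (simp add: power2_eq_square)
  have k0: "k \<noteq> 0" using k0 unfolding k_def .
  define X where "X m = rec_nat (1::real, 0::real) (\<lambda>_ (x, y). (x * (t - 1) + 2 * k * y, - 2 * k * x - y)) m" for m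
  have X0: "X 0 = (1, 0)" and XS: "X (Suc m) = (fst (X m) * (t - 1) + 2 * k * snd (X m), - 2 * k * fst (X m) - snd (X m))" for m
    unfolding X_def by (auto simp: case_prod_unfold)
  have Rm: "(R ^^ m) ?a = fst (X m) *\<^sub>R ?a + snd (X m) *\<^sub>R ?b" for m
  proof (induction m)
    case (Suc m)
    have "(R ^^ Suc m) ?a = R ((R ^^ m) ?a)" by simp
    then show ?case unfolding Suc R_ab XS tk by simp
  qed (simp add: X0)
  have "fst (X p) *\<^sub>R ?a + snd (X p) *\<^sub>R ?b = 1 *\<^sub>R ?a + 0 *\<^sub>R ?b" using Rm[of p] Rp by simp
  then have Xp: "fst (X p) = 1" "snd (X p) = 0" using indep by blast+
  define \<sigma> where "\<sigma> = t - 2"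
  have kt: "4 * k * k = \<sigma> + 2" unfolding \<sigma>_def tk by simp
  have X1: "X 1 = (\<sigma> + 1, - 2 * k)" using XS[of 0] X0 unfolding \<sigma>_def by simp
  have X2: "X 2 = (\<sigma>^2 + \<sigma> - 1, - 2 * k * \<sigma>)"
    using XS[of 1] X1 kt unfolding \<sigma>_def by (simp add: numeral_2_eq_2 power2_eq_square algebra_simps)
  have X3: "X 3 = (\<sigma>^3 + \<sigma>^2 - 2 * \<sigma> - 1, - 2 * k * (\<sigma>^2 - 1))"
  proof -
    have "fst (X 3) = (\<sigma>^2 + \<sigma> - 1) * (\<sigma> + 1) - (4 * k * k) * \<sigma>" using XS[of 2] X2 unfolding \<sigma>_def by (simp add: algebra_simps)
    then have "fst (X 3) = \<sigma>^3 + \<sigma>^2 - 2 * \<sigma> - 1" unfolding kt by (simp add: power2_eq_square power3_eq_cube algebra_simps)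
    moreover have "snd (X 3) = - 2 * k * (\<sigma>^2 - 1)" using XS[of 2] X2 by (simp add: algebra_simps)
    ultimately show ?thesis by (metis prod.collapse)
  qed
  have X4: "X 4 = (\<sigma>^4 + \<sigma>^3 - 3 * \<sigma>^2 - 2 * \<sigma> + 1, - 2 * k * (\<sigma>^3 - 2 * \<sigma>))"
  proof -
    have "X 4 = X (Suc 3)" by simp
    then have "fst (X 4) = (\<sigma>^3 + \<sigma>^2 - 2 * \<sigma> - 1) * (\<sigma> + 1) - (4 * k * k) * (\<sigma>^2 - 1)" "snd (X 4) = - 2 * k * (\<sigma>^3 + \<sigma>^2 - 2 * \<sigma> - 1) + 2 * k * (\<sigma>^2 - 1)"
      using XS[of 3] X3 unfolding \<sigma>_def by (simp_all add: algebra_simps)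
    then have "fst (X 4) = \<sigma>^4 + \<sigma>^3 - 3 * \<sigma>^2 - 2 * \<sigma> + 1" "snd (X 4) = - 2 * k * (\<sigma>^3 - 2 * \<sigma>)"
      unfolding kt by (simp_all add: power2_eq_square power3_eq_cube power4_eq_xxxx algebra_simps)
    then show ?thesis by (metis prod.collapse)
  qed
  have X5: "snd (X 5) = - 2 * k * (\<sigma>^4 - 3 * \<sigma>^2 + 1)" "fst (X 5) = (\<sigma>^4 + \<sigma>^3 - 3 * \<sigma>^2 - 2 * \<sigma> + 1) * (\<sigma> + 1) - (\<sigma> + 2) * (\<sigma>^3 - 2 * \<sigma>)"
  proof -
    have "X 5 = X (Suc 4)" by simp
    then have "snd (X 5) = - 2 * k * (\<sigma>^4 + \<sigma>^3 - 3 * \<sigma>^2 - 2 * \<sigma> + 1) + 2 * k * (\<sigma>^3 - 2 * \<sigma>)"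
      "fst (X 5) = (\<sigma>^4 + \<sigma>^3 - 3 * \<sigma>^2 - 2 * \<sigma> + 1) * (\<sigma> + 1) - (4 * k * k) * (\<sigma>^3 - 2 * \<sigma>)"
      using XS[of 4] X4 unfolding \<sigma>_def by (simp_all add: algebra_simps)
    then show "snd (X 5) = - 2 * k * (\<sigma>^4 - 3 * \<sigma>^2 + 1)" "fst (X 5) = (\<sigma>^4 + \<sigma>^3 - 3 * \<sigma>^2 - 2 * \<sigma> + 1) * (\<sigma> + 1) - (\<sigma> + 2) * (\<sigma>^3 - 2 * \<sigma>)"
      unfolding kt by (simp_all add: algebra_simps)
  qed
  show "t = 1" if "p = 3"
  proof -
    have "\<sigma>^2 = 1" using Xp(2) X3 k0 that by simp
    moreover have "\<sigma>^3 + \<sigma>^2 - 2 * \<sigma> - 1 = 1" using Xp(1) X3 that by simp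
    ultimately have "\<sigma> = -1 \<or> \<sigma> = 1" "\<sigma>^3 = 2 * \<sigma> + 1" by (auto simp: power2_eq_1_iff)
    then show ?thesis unfolding \<sigma>_def by auto
  qed
  show "t = 2" if "p = 4"
  proof -
    have c: "\<sigma>^3 = 2 * \<sigma>" using Xp(2) X4 k0 that by simp
    moreover have "\<sigma>^4 + \<sigma>^3 - 3 * \<sigma>^2 - 2 * \<sigma> + 1 = 1" using Xp(1) X4 that by simp
    moreover have "\<sigma>^4 = \<sigma> * \<sigma>^3" by (simp add: power4_eq_xxxx power3_eq_cube)
    ultimately have "- (\<sigma>^2) = 0" by (simp add: power2_eq_square)
    then show ?thesis unfolding \<sigma>_def by simp
  qed
  show "t^2 = 3 * t - 1" if "p = 5"
  proof -
    have c: "\<sigma>^4 - 3 * \<sigma>^2 + 1 = 0" using Xp(2) X5 k0 that by simp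
    then have f: "(\<sigma>^2 + \<sigma> - 1) * (\<sigma>^2 - \<sigma> - 1) = 0" by (simp add: power2_eq_square power4_eq_xxxx algebra_simps)
    have g: "(\<sigma>^4 + \<sigma>^3 - 3 * \<sigma>^2 - 2 * \<sigma> + 1) * (\<sigma> + 1) - (\<sigma> + 2) * (\<sigma>^3 - 2 * \<sigma>) = 1" using Xp(1) X5 that by simp
    have "\<sigma>^2 + \<sigma> - 1 = 0"
    proof (rule ccontr)
      assume "\<sigma>^2 + \<sigma> - 1 \<noteq> 0"
      then have h: "\<sigma>^2 = \<sigma> + 1" using f by auto
      have h2: "\<sigma> * \<sigma> = \<sigma> + 1" using h by (simp add: power2_eq_square)
      have "\<sigma>^3 = \<sigma> * (\<sigma> * \<sigma>)" by (simp add: power3_eq_cube)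
      also have "\<dots> = \<sigma> * \<sigma> + \<sigma>" by (subst h2) (simp add: distrib_left)
      finally have h3: "\<sigma>^3 = 2 * \<sigma> + 1" using h2 by simp
      have "\<sigma>^4 = \<sigma> * \<sigma>^3" by (simp add: power4_eq_xxxx power3_eq_cube)
      also have "\<dots> = 2 * (\<sigma> * \<sigma>) + \<sigma>" unfolding h3 by (simp add: distrib_left)
      finally have h4: "\<sigma>^4 = 3 * \<sigma> + 2" using h2 by simp
      show False using g unfolding h3 h4 h by simp
    qed
    then show ?thesis unfolding \<sigma>_def by (simp add: power2_eq_square algebra_simps)
  qed
qed

end

section \<open>Orbits of integral label vectors\<close>

text \<open>
  The pair \<open>(a, b)\<close> stands for \<open>a + b \<tau>\<close> with \<open>\<tau>\<^sup>2 = 3\<tau> - 1\<close>, and a label for the four coordinates of a vector with respect to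
  rescaled normals.
\<close>

type_synonym quad = "int \<times> int"
type_synonym quad_label = "quad \<times> quad \<times> quad \<times> quad"

text \<open>
  Multiplication by \<open>t = 4 (n h \<bullet> n i)\<^sup>2\<close>, which is 1, 2 or \<open>\<tau>\<close> for an entry 3, 4 or 5 of the Schlaefli symbol.
\<close>

fun quad_scale :: "nat \<Rightarrow> quad \<Rightarrow> quad" where
  "quad_scale m (a, b) = (if m = 3 then (a, b) else if m = 4 then (2 * a, 2 * b) else (- b, a + 3 * b))"

fun quad_add :: "quad \<Rightarrow> quad \<Rightarrow> quad" where "quad_add (a, b) (c, d) = (a + c, b + d)"

text \<open>
  The reflections in these coordinates. The scaling of the normals is chosen such that one of the two off-diagonal entries
  of the Cartan matrix for each pair of adjacent nodes is \<open>- 1\<close> and the other is \<open>- t\<close>.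
\<close>

fun label_step :: "nat \<Rightarrow> nat \<Rightarrow> nat \<Rightarrow> nat \<Rightarrow> quad_label \<Rightarrow> quad_label" where
  "label_step p q r i (w, x, y, z) =
    (if i = 0 then ((- fst w, - snd w), quad_add x w, y, z)
     else if i = 1 then (quad_add w (quad_scale p x), (- fst x, - snd x), quad_add y x, z)
     else if i = 2 then (w, quad_add x (quad_scale q y), (- fst y, - snd y), quad_add z y)
     else (w, x, quad_add y (quad_scale r z), (- fst z, - snd z)))"

text \<open>
  Search with a bound on the number of steps; \<open>None\<close> means that the bound was too small.
\<close>

fun orbit_search :: "(nat \<Rightarrow> 'v \<Rightarrow> 'v) \<Rightarrow> nat list \<Rightarrow> nat \<Rightarrow> 'v list \<Rightarrow> 'v list \<Rightarrow> 'v list option" where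
  "orbit_search f K 0 seen todo = (if todo = [] then Some seen else None)"
| "orbit_search f K (Suc n) seen [] = Some seen"
| "orbit_search f K (Suc n) seen (v # todo) =
     (let new = remdups (filter (\<lambda>w. w \<notin> set seen) (map (\<lambda>i. f i v) K)) in orbit_search f K n (new @ seen) (todo @ new))"

definition unit_label :: "nat \<Rightarrow> quad_label" where
  "unit_label j = (if j = 0 then ((1,0),(0,0),(0,0),(0,0)) else if j = 1 then ((0,0),(1,0),(0,0),(0,0))
     else if j = 2 then ((0,0),(0,0),(1,0),(0,0)) else ((0,0),(0,0),(0,0),(1,0)))"

text \<open>
  The largest orbit that occurs has 120 elements, so that 121 steps are enough. The value 0 marks failure, since an orbit
  is nonempty.
\<close>

definition orbit_length :: "nat \<Rightarrow> nat \<Rightarrow> nat \<Rightarrow> nat \<Rightarrow> nat list \<Rightarrow> nat" where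
  "orbit_length p q r j K = (case orbit_search (label_step p q r) K 121 [unit_label j] [unit_label j] of Some xs \<Rightarrow> length xs | None \<Rightarrow> 0)"

text \<open>
  The order of the subgroup generated by the reflections in the list, as the product of the orbit lengths along the chain
  of stabilisers that removes the nodes from the front of the list.
\<close>

fun chain_order :: "nat \<Rightarrow> nat \<Rightarrow> nat \<Rightarrow> nat list \<Rightarrow> nat" where
  "chain_order p q r [] = 1"
| "chain_order p q r (j # K) = orbit_length p q r j (j # K) * chain_order p q r K"

definition reach :: "(nat \<Rightarrow> 'v \<Rightarrow> 'v) \<Rightarrow> nat set \<Rightarrow> ('v \<times> 'v) set" where
  "reach f K = {(x, f i x) | x i. i \<in> K}\<^sup>*"

lemma reach_refl: "(x, x) \<in> reach f K" unfolding reach_def by simp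

lemma reach_step: "(x, y) \<in> reach f K \<Longrightarrow> i \<in> K \<Longrightarrow> (x, f i y) \<in> reach f K"
  unfolding reach_def by (rule rtrancl_into_rtrancl) auto

lemma reach_trans: "(x, y) \<in> reach f K \<Longrightarrow> (y, z) \<in> reach f K \<Longrightarrow> (x, z) \<in> reach f K"
  unfolding reach_def by (rule rtrancl_trans)

lemma orbit_search_correct:
  assumes "orbit_search f K m seen todo = Some xs" "distinct seen" "set todo \<subseteq> set seen"
    and "\<And>v. v \<in> set seen \<Longrightarrow> v \<in> set todo \<or> (\<forall>i\<in>set K. f i v \<in> set seen)"
  shows "distinct xs \<and> set seen \<subseteq> set xs \<and> (\<forall>v\<in>set xs. \<forall>i\<in>set K. f i v \<in> set xs) \<and>
     (\<forall>v\<in>set xs. \<exists>w\<in>set seen. (w, v) \<in> reach f (set K))"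
  using assms
proof (induction f K m seen todo rule: orbit_search.induct)
  case (1 f K seen todo)
  then have "todo = []" "xs = seen" by (auto split: if_splits)
  then show ?case using 1 reach_refl by force
next
  case (2 f K m seen)
  then show ?case using reach_refl by force
next
  case (3 f K m seen v todo)
  define new where "new = remdups (filter (\<lambda>w. w \<notin> set seen) (map (\<lambda>i. f i v) K))"
  have new: "distinct new" "set new = {w. w \<notin> set seen \<and> (\<exists>i\<in>set K. w = f i v)}" unfolding new_def by auto
  have IH: "distinct xs \<and> set (new @ seen) \<subseteq> set xs \<and> (\<forall>v\<in>set xs. \<forall>i\<in>set K. f i v \<in> set xs) \<and>
     (\<forall>v\<in>set xs. \<exists>w\<in>set (new @ seen). (w, v) \<in> reach f (set K))"
  proof (rule 3(1)[OF new_def])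
    show "orbit_search f K m (new @ seen) (todo @ new) = Some xs" using 3(2) by (simp add: new_def Let_def)
    show "distinct (new @ seen)" using new 3(3) by auto
    show "set (todo @ new) \<subseteq> set (new @ seen)" using 3(4) by auto
    fix w assume "w \<in> set (new @ seen)"
    then consider "w \<in> set new" | "w \<in> set seen" by auto
    then show "w \<in> set (todo @ new) \<or> (\<forall>i\<in>set K. f i w \<in> set (new @ seen))"
    proof cases
      case 2
      from 3(5)[OF this] show ?thesis using new by auto
    qed auto
  qed
  have v: "v \<in> set seen" using 3(4) by auto
  have "\<exists>w'\<in>set seen. (w', y) \<in> reach f (set K)" if "y \<in> set xs" for y
  proof -
    obtain w where w: "w \<in> set (new @ seen)" "(w, y) \<in> reach f (set K)" using IH \<open>y \<in> set xs\<close> by blast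
    show ?thesis
    proof (cases "w \<in> set seen")
      case False
      then obtain i where "i \<in> set K" "w = f i v" using w new by auto
      then have "(v, w) \<in> reach f (set K)" using reach_step[OF reach_refl] by metis
      then show ?thesis using v w reach_trans by metis
    qed (use w in blast)
  qed
  then show ?case using IH by auto
qed

lemma orbit_length_correct:
  assumes "orbit_length p q r j K \<noteq> 0"
  shows "card {w. (unit_label j, w) \<in> reach (label_step p q r) (set K)} = orbit_length p q r j K"
    "finite {w. (unit_label j, w) \<in> reach (label_step p q r) (set K)}"
proof -
  obtain xs where xs: "orbit_search (label_step p q r) K 121 [unit_label j] [unit_label j] = Some xs"
    using assms unfolding orbit_length_def by (auto split: option.splits)
  have c: "distinct xs \<and> set [unit_label j] \<subseteq> set xs \<and> (\<forall>v\<in>set xs. \<forall>i\<in>set K. label_step p q r i v \<in> set xs) \<and>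
     (\<forall>v\<in>set xs. \<exists>w\<in>set [unit_label j]. (w, v) \<in> reach (label_step p q r) (set K))"
    by (rule orbit_search_correct[OF xs]) auto
  have "w \<in> set xs" if "(unit_label j, w) \<in> reach (label_step p q r) (set K)" for w
    using that unfolding reach_def
    by (induction rule: rtrancl_induct) (use c in auto)
  then have eq: "{w. (unit_label j, w) \<in> reach (label_step p q r) (set K)} = set xs" using c by auto
  show "card {w. (unit_label j, w) \<in> reach (label_step p q r) (set K)} = orbit_length p q r j K"
    unfolding eq using xs c by (simp add: orbit_length_def distinct_card)
  show "finite {w. (unit_label j, w) \<in> reach (label_step p q r) (set K)}" unfolding eq by simp
qed

definition quad_val :: "real \<Rightarrow> quad \<Rightarrow> real" where "quad_val \<tau> z = of_int (fst z) + of_int (snd z) * \<tau>"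

definition bond :: "real \<Rightarrow> nat \<Rightarrow> real" where "bond \<tau> m = (if m = 3 then 1 else if m = 4 then 2 else \<tau>)"

lemma quad_val_add: "quad_val \<tau> (quad_add x y) = quad_val \<tau> x + quad_val \<tau> y"
  by (cases x; cases y) (simp add: quad_val_def algebra_simps)

lemma quad_val_neg: "quad_val \<tau> (- fst x, - snd x) = - quad_val \<tau> x"
  by (simp add: quad_val_def)

lemma quad_val_mul: assumes "\<tau>^2 = 3 * \<tau> - 1" shows "quad_val \<tau> (quad_scale m x) = bond \<tau> m * quad_val \<tau> x"
proof -
  have "\<tau> * \<tau> = 3 * \<tau> - 1" using assms by (simp add: power2_eq_square)
  have *: "\<tau> * (A + B * \<tau>) = - B + (A + 3 * B) * \<tau>" for A B
  proof -
    have "\<tau> * (A + B * \<tau>) = A * \<tau> + B * (\<tau> * \<tau>)" by (simp add: algebra_simps)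
    also have "\<dots> = - B + (A + 3 * B) * \<tau>" unfolding \<open>\<tau> * \<tau> = 3 * \<tau> - 1\<close> by (simp add: algebra_simps)
    finally show ?thesis .
  qed
  obtain a b where x: "x = (a, b)" by (cases x)
  consider "m = 3" | "m = 4" | "m \<noteq> 3" "m \<noteq> 4" by blast
  then show ?thesis
  proof cases
    case 3 then show ?thesis using *[of "of_int a" "of_int b"] by (simp add: quad_val_def bond_def x)
  qed (simp_all add: quad_val_def bond_def x algebra_simps)
qed

text \<open>The exponent of 5 would be even on the left and odd on the right.\<close>

lemma int_sqrt5: assumes "x^2 = 5 * y^2" shows "y = (0::int)"
proof (rule ccontr)
  assume y: "y \<noteq> 0"
  then have x: "x \<noteq> 0" using assms by auto
  have p: "prime_elem (5::int)" by simp
  have "multiplicity 5 (x^2) = 2 * multiplicity 5 x"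
    using prime_elem_multiplicity_power_distrib[OF p x] by simp
  moreover have "multiplicity 5 (5 * y^2) = 1 + 2 * multiplicity 5 y"
    using prime_elem_multiplicity_mult_distrib[OF p, of 5 "y^2"] prime_elem_multiplicity_power_distrib[OF p y] y
    by simp
  ultimately have "2 * multiplicity 5 x = 1 + 2 * multiplicity 5 y" using assms by simp
  then show False by arith
qed

text \<open>
  The minimal polynomial of \<open>\<tau>\<close> has discriminant 5, so \<open>1\<close> and \<open>\<tau>\<close> are linearly independent over the integers.
\<close>

lemma quad_val_inj: assumes \<tau>: "\<tau>^2 = 3 * \<tau> - 1" and eq: "quad_val \<tau> x = quad_val \<tau> y" shows "x = y"
proof -
  define A where "A = fst x - fst y"
  define B where "B = snd x - snd y"
  have AB: "of_int A + of_int B * \<tau> = 0" using eq unfolding A_def B_def quad_val_def by (simp add: algebra_simps)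
  then have a: "of_int A = - (of_int B * \<tau>)" by simp
  have "(of_int (2 * A + 3 * B))^2 = (of_int B * (3 - 2 * \<tau>))^2" by (simp add: a algebra_simps)
  also have "\<dots> = of_int B ^ 2 * (9 - 12 * \<tau> + 4 * \<tau>^2)" by (simp add: power2_eq_square algebra_simps)
  also have "\<dots> = of_int (5 * B^2)" unfolding \<tau> by simp
  finally have "of_int ((2 * A + 3 * B)^2) = (of_int (5 * B^2) :: real)" by simp
  then have "(2 * A + 3 * B)^2 = 5 * B^2" by (simp only: of_int_eq_iff)
  then have "B = 0" using int_sqrt5 by blast
  moreover have "A = 0" using AB calculation by simp
  ultimately show ?thesis unfolding A_def B_def by (simp add: prod_eq_iff)
qed

text \<open>
  The factor \<open>l\<close> normalises the start vector of an orbit, which is a multiple of a dual basis vector.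
\<close>

definition label_val :: "real \<Rightarrow> real \<Rightarrow> quad_label \<Rightarrow> real \<times> real \<times> real \<times> real" where
  "label_val \<tau> l = (\<lambda>(w, x, y, z). (l * quad_val \<tau> w, l * quad_val \<tau> x, l * quad_val \<tau> y, l * quad_val \<tau> z))"

lemma label_val_inj: assumes "\<tau>^2 = 3 * \<tau> - 1" "l \<noteq> 0" shows "inj (label_val \<tau> l)"
  using quad_val_inj[OF assms(1)] assms(2) by (auto simp: inj_def label_val_def)

definition real_label_step :: "real \<Rightarrow> real \<Rightarrow> real \<Rightarrow> nat \<Rightarrow> real \<times> real \<times> real \<times> real \<Rightarrow> real \<times> real \<times> real \<times> real" where
  "real_label_step t1 t2 t3 i = (\<lambda>(w, x, y, z).
    (if i = 0 then (- w, x + w, y, z)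
     else if i = 1 then (w + t1 * x, - x, y + x, z)
     else if i = 2 then (w, x + t2 * y, - y, z + y)
     else (w, x, y + t3 * z, - z)))"

lemma label_val_step: assumes "\<tau>^2 = 3 * \<tau> - 1"
  shows "label_val \<tau> l (label_step p q r i V) = real_label_step (bond \<tau> p) (bond \<tau> q) (bond \<tau> r) i (label_val \<tau> l V)"
proof -
  obtain w x y z where V: "V = (w, x, y, z)" by (rule prod_cases4)
  show ?thesis unfolding V
    by (simp add: label_val_def real_label_step_def quad_val_add quad_val_neg quad_val_mul[OF assms] algebra_simps del: quad_scale.simps quad_add.simps)
qed

context flagged_4polytope
begin

text \<open>
  The coordinates \<open>Lab\<close> are chosen such that the reflections act on them by integral matrices over \<open>\<int>[\<tau>]\<close>. They translate the orbit of \<open>v j\<close>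
  into an orbit of label vectors, and this translation is injective because \<open>1\<close> and \<open>\<tau>\<close> are independent.
\<close>

lemma card_gen_chain:
  assumes \<tau>: "\<tau>^2 = 3 * \<tau> - 1"
    and nz: "n 0 \<bullet> n 1 \<noteq> 0" "n 1 \<bullet> n 2 \<noteq> 0" "n 2 \<bullet> n 3 \<noteq> 0"
    and t: "4 * (n 0 \<bullet> n 1)^2 = bond \<tau> p" "4 * (n 1 \<bullet> n 2)^2 = bond \<tau> q" "4 * (n 2 \<bullet> n 3)^2 = bond \<tau> r"
    and K: "distinct K" "set K \<subseteq> {..<4}" and chain_order: "chain_order p q r K \<noteq> 0"
  shows "card (gen (set K)) = chain_order p q r K"
proof -
  define g1 where "g1 = n 0 \<bullet> n 1"
  define g2 where "g2 = n 1 \<bullet> n 2"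
  define g3 where "g3 = n 2 \<bullet> n 3"
  define k1 where "k1 = - 1 / (2 * g1)"
  define k2 where "k2 = - k1 / (2 * g2)"
  define k3 where "k3 = - k2 / (2 * g3)"
  have g: "g1 \<noteq> 0" "g2 \<noteq> 0" "g3 \<noteq> 0" using nz unfolding g1_def g2_def g3_def by auto
  have k: "k1 \<noteq> 0" "k2 \<noteq> 0" "k3 \<noteq> 0" unfolding k1_def k2_def k3_def using g by auto
  define Lab where "Lab x = (n 0 \<bullet> x, k1 * (n 1 \<bullet> x), k2 * (n 2 \<bullet> x), k3 * (n 3 \<bullet> x))" for x
  have Lab_inj: "x = y" if "Lab x = Lab y" for x y
  proof -
    have e: "n 0 \<bullet> x = n 0 \<bullet> y" "n 1 \<bullet> x = n 1 \<bullet> y" "n 2 \<bullet> x = n 2 \<bullet> y" "n 3 \<bullet> x = n 3 \<bullet> y"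
      using that k unfolding Lab_def by auto
    have "n i \<bullet> x = n i \<bullet> y" if "i < 4" for i
    proof -
      have "i = 0 \<or> i = 1 \<or> i = 2 \<or> i = 3" using that by linarith
      then show ?thesis using e by blast
    qed
    then have "(\<Sum>i<4. ((n i \<bullet> x) / (n i \<bullet> v i)) *\<^sub>R v i) = (\<Sum>i<4. ((n i \<bullet> y) / (n i \<bullet> v i)) *\<^sub>R v i)" by simp
    then show ?thesis using expand[of x] expand[of y] by simp
  qed
  have far: "n 0 \<bullet> n 2 = 0" "n 0 \<bullet> n 3 = 0" "n 1 \<bullet> n 3 = 0" "n 2 \<bullet> n 0 = 0" "n 3 \<bullet> n 0 = 0" "n 3 \<bullet> n 1 = 0"
    using n_far[of 0 2] n_far[of 0 3] n_far[of 1 3] n_far[of 2 0] n_far[of 3 0] n_far[of 3 1] by auto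
  have near: "n 0 \<bullet> n 1 = g1" "n 1 \<bullet> n 2 = g2" "n 2 \<bullet> n 3 = g3" "n 1 \<bullet> n 0 = g1" "n 2 \<bullet> n 1 = g2" "n 3 \<bullet> n 2 = g3"
    unfolding g1_def g2_def g3_def by (auto simp: inner_commute)
  have un: "n 0 \<bullet> n 0 = 1" "n 1 \<bullet> n 1 = 1" "n 2 \<bullet> n 2 = 1" "n 3 \<bullet> n 3 = 1" using n_unit by auto
  have tt: "bond \<tau> p = 4 * g1 * g1" "bond \<tau> q = 4 * g2 * g2" "bond \<tau> r = 4 * g3 * g3"
    using t unfolding g1_def g2_def g3_def by (auto simp: power2_eq_square)
  have Lab_step: "Lab (s i x) = real_label_step (bond \<tau> p) (bond \<tau> q) (bond \<tau> r) i (Lab x)" if i: "i < 4" for i x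
  proof -
    have "i = 0 \<or> i = 1 \<or> i = 2 \<or> i = 3" using i by linarith
    moreover have "Lab (s 0 x) = real_label_step (bond \<tau> p) (bond \<tau> q) (bond \<tau> r) 0 (Lab x)"
      unfolding Lab_def real_label_step_def using g
      by (simp add: reflection[of 0] inner_diff_right far near un tt k1_def k2_def k3_def field_simps del: One_nat_def)
    moreover have "Lab (s 1 x) = real_label_step (bond \<tau> p) (bond \<tau> q) (bond \<tau> r) 1 (Lab x)"
      unfolding Lab_def real_label_step_def using g
      by (simp add: reflection[of 1] inner_diff_right far near un tt k1_def k2_def k3_def field_simps del: One_nat_def)
    moreover have "Lab (s 2 x) = real_label_step (bond \<tau> p) (bond \<tau> q) (bond \<tau> r) 2 (Lab x)"
      unfolding Lab_def real_label_step_def using g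
      by (simp add: reflection[of 2] inner_diff_right far near un tt k1_def k2_def k3_def field_simps del: One_nat_def)
    moreover have "Lab (s 3 x) = real_label_step (bond \<tau> p) (bond \<tau> q) (bond \<tau> r) 3 (Lab x)"
      unfolding Lab_def real_label_step_def using g
      by (simp add: reflection[of 3] inner_diff_right far near un tt k1_def k2_def k3_def field_simps del: One_nat_def)
    ultimately show ?thesis by blast
  qed
  have orbit: "card ((\<lambda>T. T (v j)) ` gen (set K)) = orbit_length p q r j K"
    if j: "j < 4" and K: "set K \<subseteq> {..<4}" and o: "orbit_length p q r j K \<noteq> 0" for j K
  proof -
    let ?R = "{w. (unit_label j, w) \<in> reach (label_step p q r) (set K)}"
    have "\<exists>l. l \<noteq> 0 \<and> Lab (v j) = label_val \<tau> l (unit_label j)"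
    proof -
      have nv: "n i \<bullet> v j = 0" if "i < 4" "i \<noteq> j" for i using n(2)[of i j] j that by auto
      have "j = 0 \<or> j = 1 \<or> j = 2 \<or> j = 3" using j by linarith
      then show ?thesis
      proof (elim disjE)
        assume "j = 0" then show ?thesis using nv[of 1] nv[of 2] nv[of 3] n(3)[of 0]
          by (intro exI[of _ "n 0 \<bullet> v 0"]) (simp add: Lab_def label_val_def unit_label_def quad_val_def del: One_nat_def)
      next
        assume "j = 1" then show ?thesis using nv[of 0] nv[of 2] nv[of 3] n(3)[of 1] k
          by (intro exI[of _ "k1 * (n 1 \<bullet> v 1)"]) (simp add: Lab_def label_val_def unit_label_def quad_val_def del: One_nat_def)
      next
        assume "j = 2" then show ?thesis using nv[of 0] nv[of 1] nv[of 3] n(3)[of 2] k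
          by (intro exI[of _ "k2 * (n 2 \<bullet> v 2)"]) (simp add: Lab_def label_val_def unit_label_def quad_val_def del: One_nat_def)
      next
        assume "j = 3" then show ?thesis using nv[of 0] nv[of 1] nv[of 2] n(3)[of 3] k
          by (intro exI[of _ "k3 * (n 3 \<bullet> v 3)"]) (simp add: Lab_def label_val_def unit_label_def quad_val_def del: One_nat_def)
      qed
    qed
    then obtain l where l: "l \<noteq> 0" "Lab (v j) = label_val \<tau> l (unit_label j)" by blast
    have "Lab ` (\<lambda>T. T (v j)) ` gen (set K) = label_val \<tau> l ` ?R"
    proof (intro equalityI subsetI)
      fix y assume "y \<in> Lab ` (\<lambda>T. T (v j)) ` gen (set K)"
      then obtain T where T: "T \<in> gen (set K)" "y = Lab (T (v j))" by blast
      have "\<exists>w \<in> ?R. Lab (T (v j)) = label_val \<tau> l w" using T(1)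
      proof induction
        case gen_id show ?case using l(2) reach_refl by (intro bexI[of _ "unit_label j"]) auto
      next
        case (gen_step T i)
        then obtain w where w: "w \<in> ?R" "Lab (T (v j)) = label_val \<tau> l w" by blast
        have i: "i < 4" "i \<in> set K" using gen_step K by auto
        have "Lab ((s i \<circ> T) (v j)) = label_val \<tau> l (label_step p q r i w)"
          using Lab_step[OF i(1)] w(2) label_val_step[OF \<tau>] by simp
        moreover have "(unit_label j, w) \<in> reach (label_step p q r) (set K)" using w(1) by simp
        then have "label_step p q r i w \<in> ?R" by (intro CollectI reach_step i(2))
        ultimately show ?case by (intro bexI[of _ "label_step p q r i w"])
      qed
      then show "y \<in> label_val \<tau> l ` ?R" using T by blast
    next
      fix y assume "y \<in> label_val \<tau> l ` ?R"
      then obtain w where w: "(unit_label j, w) \<in> reach (label_step p q r) (set K)" "y = label_val \<tau> l w" by blast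
      from w(1) have "\<exists>T\<in>gen (set K). Lab (T (v j)) = label_val \<tau> l w" unfolding reach_def
      proof (induction rule: rtrancl_induct)
        case base show ?case using l(2) gen_id by (intro bexI[of _ id]) auto
      next
        case (step w w')
        obtain T where T0: "T \<in> gen (set K)" "Lab (T (v j)) = label_val \<tau> l w" using step.IH by (elim bexE)
        obtain i where i0: "i \<in> set K" "w' = label_step p q r i w" using step(2) by auto
        note T = T0 i0
        have i: "i < 4" using T K by auto
        have "Lab ((s i \<circ> T) (v j)) = label_val \<tau> l w'"
          using Lab_step[OF i] T(2,4) label_val_step[OF \<tau>] by simp
        then show ?case by (intro bexI[of _ "s i \<circ> T"] gen_step[OF T(1,3)])
      qed
      then obtain T where T: "T \<in> gen (set K)" "Lab (T (v j)) = label_val \<tau> l w" by (elim bexE)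
      have "Lab (T (v j)) \<in> Lab ` (\<lambda>T. T (v j)) ` gen (set K)" by (intro imageI T(1))
      then show "y \<in> Lab ` (\<lambda>T. T (v j)) ` gen (set K)" using T(2) w(2) by simp
    qed
    moreover have "card (Lab ` X) = card X" for X by (rule card_image) (use Lab_inj in \<open>auto simp: inj_on_def\<close>)
    moreover have "card (label_val \<tau> l ` X) = card X" for X
      by (rule card_image) (use label_val_inj[OF \<tau> l(1)] in \<open>auto simp: inj_on_def inj_def\<close>)
    ultimately have "card ((\<lambda>T. T (v j)) ` gen (set K)) = card ?R" by metis
    then show ?thesis using orbit_length_correct[OF o] by simp
  qed
  show ?thesis using K chain_order
  proof (induction K)
    case Nil then show ?case by (simp add: gen_empty)
  next
    case (Cons j K)
    have j: "j < 4" "set (j # K) \<subseteq> {..<4}" "set (j # K) - {j} = set K" using Cons.prems by auto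
    have "card (gen (set (j # K))) = card ((\<lambda>T. T (v j)) ` gen (set (j # K))) * card (gen (set K))"
      using card_gen[OF j(2), of j] j(3) by simp
    then show ?case using orbit[OF j(1,2)] Cons by simp
  qed
qed

end

section \<open>The automorphism group of the face lattice\<close>

context flagged_4polytope
begin

text \<open>Automorphisms are extensional functions on the set of faces.\<close>

definition face_map :: "(real ^ 4 \<Rightarrow> real ^ 4) \<Rightarrow> (real ^ 4) set \<Rightarrow> (real ^ 4) set" where
  "face_map T = restrict (act T) (faces L)"

abbreviation AG :: "((real ^ 4) set \<Rightarrow> (real ^ 4) set) monoid" where "AG \<equiv> aut_group L"

lemma face_map_aut: assumes T: "T \<in> Iso" shows "face_map T \<in> automorphisms L"
proof -
  have "bij_betw (act T) (faces L) (faces L)"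
  proof (rule bij_betwI')
    fix F K assume "F \<in> faces L" "K \<in> faces L"
    then show "(act T F = act T K) = (F = K)"
      using act_subset_iff[OF T, of F K] act_subset_iff[OF T, of K F] by auto
  next
    fix F assume "F \<in> faces L" then show "act T F \<in> faces L" using act_face[OF T] by simp
  next
    fix F assume F: "F \<in> faces L"
    let ?R = "inv_into UNIV T"
    have "act ?R F \<in> faces L" using act_face[OF Iso_inv(1)[OF T]] F by simp
    moreover have "act T (act ?R F) = F" using act_comp[of T ?R F] Iso_inv(3)[OF T] act_id(1) by simp
    ultimately show "\<exists>K\<in>faces L. F = act T K" by metis
  qed
  then have "face_map T \<in> Bij (faces L)" unfolding face_map_def Bij_def by (simp add: bij_betw_restrict_eq)
  then show ?thesis unfolding automorphisms_def face_map_def using act_subset_iff[OF T] by auto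
qed

lemma aut_props: assumes "a \<in> automorphisms L"
  shows "\<And>F. F face_of P \<Longrightarrow> a F face_of P" "\<And>F K. F face_of P \<Longrightarrow> K face_of P \<Longrightarrow> a F \<subseteq> a K \<longleftrightarrow> F \<subseteq> K"
    "a \<in> extensional (faces L)"
  using assms unfolding automorphisms_def Bij_def by (auto dest: bij_betwE)

text \<open>
  An automorphism of the face lattice is only assumed to preserve inclusion. It preserves dimension because the six faces of a
  flag have strictly increasing dimensions between \<open>- 1\<close> and 4.
\<close>

lemma aut_flag: assumes a: "a \<in> automorphisms L" and \<Psi>: "\<Psi> \<in> flags L"
  shows "a ` \<Psi> \<in> flags L" "\<And>k. - 1 \<le> k \<Longrightarrow> k \<le> 4 \<Longrightarrow> flag_face (a ` \<Psi>) k = a (flag_face \<Psi> k)"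
proof -
  define f where "f k = a (flag_face \<Psi> k)" for k
  note A = aut_props[OF a]
  have f: "f k face_of P" if "- 1 \<le> k" "k \<le> 4" for k unfolding f_def using A(1) flag_face(3)[OF \<Psi> that] by auto
  have lt: "f k \<subset> f (k + 1)" if "- 1 \<le> k" "k < 4" for k
  proof -
    have "flag_face \<Psi> k \<subset> flag_face \<Psi> (k + 1)"
      using flag_face_mono[OF \<Psi>, of k "k + 1"] flag_face(2)[OF \<Psi>, of k] flag_face(2)[OF \<Psi>, of "k + 1"] that by force
    then show ?thesis unfolding f_def
      using A(2)[OF flag_face(3)[OF \<Psi>, of k] flag_face(3)[OF \<Psi>, of "k + 1"]] A(2)[OF flag_face(3)[OF \<Psi>, of "k + 1"] flag_face(3)[OF \<Psi>, of k]] that by auto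
  qed
  define D where "D k = aff_dim (f k)" for k
  have Dlt: "D k < D (k + 1)" if "- 1 \<le> k" "k < 4" for k unfolding D_def
    by (rule face_dim_less[OF f f lt]) (use that in auto)
  have "D (-1) < D 0" "D 0 < D 1" "D 1 < D 2" "D 2 < D 3" "D 3 < D 4"
    using Dlt[of "-1"] Dlt[of 0] Dlt[of 1] Dlt[of 2] Dlt[of 3] by auto
  moreover have "- 1 \<le> D (-1)" "D 4 \<le> 4" unfolding D_def using face_dim_bounds[OF f] by auto
  ultimately have Dk: "D (-1) = -1" "D 0 = 0" "D 1 = 1" "D 2 = 2" "D 3 = 3" "D 4 = 4" by linarith+
  have D: "D k = k" if "- 1 \<le> k" "k \<le> 4" for k
  proof -
    have "k = -1 \<or> k = 0 \<or> k = 1 \<or> k = 2 \<or> k = 3 \<or> k = 4" using that by linarith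
    then show ?thesis using Dk by blast
  qed
  have f1: "f k face_of P \<and> aff_dim (f k) = k" if "- 1 \<le> k" "k \<le> 4" for k using f[OF that] D[OF that] unfolding D_def by simp
  have f2: "f k \<subseteq> f (k + 1)" if "- 1 \<le> k" "k < 4" for k using lt[OF that] by blast
  have img: "a ` \<Psi> = f ` {-1..4}" unfolding f_def by (subst flag_fc[OF \<Psi>]) (simp add: image_image)
  show "a ` \<Psi> \<in> flags L" unfolding img by (rule flag_of(1)[of f, OF f1 f2])
  show "flag_face (a ` \<Psi>) k = a (flag_face \<Psi> k)" if "- 1 \<le> k" "k \<le> 4" for k
    unfolding img f_def[symmetric] by (rule flag_of(2)[of f, OF f1 f2 that])
qed

lemma aut_nb: assumes a: "a \<in> automorphisms L" and \<Psi>: "\<Psi> \<in> flags L" and i: "i < 4"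
  shows "a ` adj_flag \<Psi> i = adj_flag (a ` \<Psi>) i"
proof (rule adj_flag_unique)
  have nf: "adj_flag \<Psi> i \<in> flags L" using adj_flag(1)[OF \<Psi> i] .
  show "a ` \<Psi> \<in> flags L" "i < 4" "a ` adj_flag \<Psi> i \<in> flags L" using aut_flag(1)[OF a] \<Psi> nf i by auto
  have "a F \<noteq> a K" if "F \<noteq> K" "F face_of P" "K face_of P" for F K
    using aut_props(2)[OF a that(2,3)] aut_props(2)[OF a that(3,2)] that(1) by auto
  then have "a (flag_face \<Psi> (int i)) \<noteq> a (flag_face (adj_flag \<Psi> i) (int i))"
    using adj_flag(2)[OF \<Psi> i] flag_face(3)[OF \<Psi>, of "int i"] flag_face(3)[OF nf, of "int i"] i by auto
  then show "flag_face (a ` \<Psi>) (int i) \<noteq> flag_face (a ` adj_flag \<Psi> i) (int i)"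
    using aut_flag(2)[OF a \<Psi>, of "int i"] aut_flag(2)[OF a nf, of "int i"] i by simp
  fix k :: int assume k: "- 1 \<le> k" "k \<le> 4" "k \<noteq> int i"
  show "flag_face (a ` adj_flag \<Psi> i) k = flag_face (a ` \<Psi>) k"
    using aut_flag(2)[OF a \<Psi> k(1,2)] aut_flag(2)[OF a nf k(1,2)] adj_flag(3)[OF \<Psi> i k] by simp
qed

lemma face_in_flag: assumes F: "F face_of P" shows "\<exists>\<Psi>\<in>flags L. F \<in> \<Psi>"
proof -
  let ?A = "{C. pred_on.chain (faces L) (face_le L) C \<and> F \<in> C}"
  have "?A \<subseteq> Pow {F. F face_of P}" unfolding chain_iff by blast
  then have fin: "finite ?A" by (rule finite_subset) (use finite_polytope_faces[OF polyP] in simp)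
  have "{F} \<in> ?A" unfolding chain_iff using F by simp
  then have "?A \<noteq> {}" by blast
  from finite_has_maximal[OF fin this] obtain C where C: "C \<in> ?A" "\<forall>D\<in>?A. C \<subseteq> D \<longrightarrow> C = D"
    by (elim bexE) (rule that)
  have "C \<in> flags L" unfolding flags_def pred_on.maxchain_def
  proof (intro CollectI conjI)
    show "pred_on.chain (faces L) (face_le L) C" using C(1) by blast
    show "\<not> (\<exists>D. pred_on.chain (faces L) (face_le L) D \<and> C \<subset> D)"
    proof
      assume "\<exists>D. pred_on.chain (faces L) (face_le L) D \<and> C \<subset> D"
      then obtain D where D: "pred_on.chain (faces L) (face_le L) D" "C \<subset> D" by blast
      then have "D \<in> ?A" using C(1) by blast
      then have "C = D" using C(2) D(2) by (metis psubset_imp_subset)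
      then show False using D(2) by blast
    qed
  qed
  then show ?thesis using C(1) by blast
qed

lemma Iso_gen: "Iso = gen {..<4}"
  using stab[of _ "{}"] gen_Iso[of "{..<4}"] by auto

text \<open>
  Automorphisms commute with passing to adjacent flags, and every flag is reached from the base flag by adjacent flags, since
  the symmetries are generated by the reflections.
\<close>

lemma aut_rigid:
  fixes d :: "(real ^ 4) set \<Rightarrow> (real ^ 4) set"
  assumes a: "a \<in> automorphisms L" and d: "d \<in> automorphisms L" and eq: "a ` \<Phi> = d ` \<Phi>"
  shows "a = d"
proof -
  have step: "a ` fl (R \<circ> T) \<Phi> = d ` fl (R \<circ> T) \<Phi>"
    if "T \<in> gen {..<4}" "R \<in> Iso" "a ` fl R \<Phi> = d ` fl R \<Phi>" for T R
    using that
  proof (induction arbitrary: R)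
    case gen_id then show ?case by simp
  next
    case (gen_step T i)
    then have i: "i < 4" by simp
    have Rf: "fl R \<Phi> \<in> flags L" using fl_flag(1)[OF gen_step.prems(1) \<Phi>] .
    have Rs: "R \<circ> s i \<in> Iso" using Iso_comp gen_step.prems(1) s(1)[OF i] by blast
    have "fl (R \<circ> s i) \<Phi> = adj_flag (fl R \<Phi>) i"
      using fl_comp[of R "s i" \<Phi>] s(2)[OF i] adj_flag_fl[OF gen_step.prems(1) \<Phi> i] by metis
    then have "a ` fl (R \<circ> s i) \<Phi> = d ` fl (R \<circ> s i) \<Phi>"
      using aut_nb[OF a Rf i] aut_nb[OF d Rf i] gen_step.prems(2) by metis
    from gen_step.IH[OF Rs this] show ?case by (simp only: comp_assoc)
  qed
  have id: "fl id \<Phi> = \<Phi>" by (simp add: act_id image_def)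
  have flags_eq: "a ` \<Psi> = d ` \<Psi>" if \<Psi>: "\<Psi> \<in> flags L" for \<Psi>
  proof -
    obtain T where T: "T \<in> Iso" "fl T \<Phi> = \<Psi>" using transitive[OF \<Phi> \<Psi>] by blast
    have "a ` fl (id \<circ> T) \<Phi> = d ` fl (id \<circ> T) \<Phi>"
      by (rule step) (use T(1) Iso_gen Iso_id eq id in simp_all)
    then show ?thesis using T(2) by simp
  qed
  have "a F = d F" if F: "F face_of P" for F
  proof -
    obtain \<Psi> where \<Psi>: "\<Psi> \<in> flags L" "F \<in> \<Psi>" using face_in_flag[OF F] by blast
    have k: "- 1 \<le> aff_dim F" "aff_dim F \<le> 4" using face_dim_bounds[OF F] by auto
    have "flag_face \<Psi> (aff_dim F) = F" by (rule flag_face_eq[OF \<Psi>]) simp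
    then show ?thesis using aut_flag(2)[OF a \<Psi>(1) k] aut_flag(2)[OF d \<Psi>(1) k] flags_eq[OF \<Psi>(1)] by simp
  qed
  then show ?thesis
    using extensionalityI[OF aut_props(3)[OF a] aut_props(3)[OF d]] by simp
qed

lemma face_map_\<Phi>: "face_map T ` \<Phi> = fl T \<Phi>"
proof -
  have "\<Phi> \<subseteq> faces L" using \<Phi> unfolding flag_iff by simp
  then show ?thesis unfolding face_map_def by (intro image_cong) auto
qed

text \<open>
  Both sides act simply transitively on the flags. This allows all computations in the automorphism group to be done with linear maps.
\<close>

lemma aut_eq: "automorphisms L = face_map ` Iso"
proof (intro equalityI subsetI)
  fix a assume a: "a \<in> automorphisms L"
  obtain T where T: "T \<in> Iso" "fl T \<Phi> = a ` \<Phi>" using transitive[OF \<Phi> aut_flag(1)[OF a \<Phi>]] by blast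
  have "a = face_map T" by (rule aut_rigid[OF a face_map_aut[OF T(1)]]) (use T face_map_\<Phi> in simp)
  then show "a \<in> face_map ` Iso" using T by blast
qed (use face_map_aut in auto)

lemma face_map_inj: assumes "S \<in> Iso" "T \<in> Iso" "face_map S = face_map T" shows "S = T"
  using free[OF \<Phi> assms(1,2)] face_map_\<Phi> assms(3) by metis

lemma rho_lat: assumes i: "i < 4" shows "rho L \<Phi> i = face_map (s i)"
  unfolding rho_def adj_flag_def[symmetric]
proof (rule the_equality)
  show "face_map (s i) \<in> automorphisms L \<and> face_map (s i) ` \<Phi> = adj_flag \<Phi> i"
    using face_map_aut[OF s(1)[OF i]] face_map_\<Phi> s(2)[OF i] by simp
  fix f assume "f \<in> automorphisms L \<and> f ` \<Phi> = adj_flag \<Phi> i"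
  then show "f = face_map (s i)" using aut_rigid[of f "face_map (s i)"] face_map_aut[OF s(1)[OF i]] face_map_\<Phi> s(2)[OF i] by simp
qed

lemma carrier_AG: "carrier AG = face_map ` Iso"
  unfolding aut_group_def by (simp add: aut_eq)

lemma face_map_mult: assumes "S \<in> Iso" "T \<in> Iso" shows "face_map S \<otimes>\<^bsub>AG\<^esub> face_map T = face_map (S \<circ> T)"
proof -
  have B: "face_map S \<in> Bij (faces L)" "face_map T \<in> Bij (faces L)" using face_map_aut assms unfolding automorphisms_def by auto
  have "compose (faces L) (face_map S) (face_map T) = face_map (S \<circ> T)"
    unfolding compose_def face_map_def using act_face[OF assms(2)] by (intro restrict_ext) (simp add: act_comp)
  then show ?thesis unfolding aut_group_def BijGroup_def using B by simp
qed

lemma one_AG: "\<one>\<^bsub>AG\<^esub> = face_map id"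
  unfolding aut_group_def BijGroup_def face_map_def by (simp add: act_id cong: restrict_cong)

lemma group_AG: "group AG"
proof (rule groupI)
  fix x y assume "x \<in> carrier AG" "y \<in> carrier AG"
  then show "x \<otimes>\<^bsub>AG\<^esub> y \<in> carrier AG" unfolding carrier_AG using face_map_mult Iso_comp by auto
next
  show "\<one>\<^bsub>AG\<^esub> \<in> carrier AG" unfolding carrier_AG one_AG using Iso_id by auto
next
  fix x y z assume "x \<in> carrier AG" "y \<in> carrier AG" "z \<in> carrier AG"
  then show "x \<otimes>\<^bsub>AG\<^esub> y \<otimes>\<^bsub>AG\<^esub> z = x \<otimes>\<^bsub>AG\<^esub> (y \<otimes>\<^bsub>AG\<^esub> z)"
    unfolding carrier_AG using Iso_comp by (auto simp: face_map_mult comp_assoc)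
next
  fix x assume "x \<in> carrier AG"
  then show "\<one>\<^bsub>AG\<^esub> \<otimes>\<^bsub>AG\<^esub> x = x" unfolding carrier_AG one_AG using Iso_id by (auto simp: face_map_mult)
next
  fix x assume "x \<in> carrier AG"
  then obtain T where T: "T \<in> Iso" "x = face_map T" unfolding carrier_AG by auto
  then have "face_map (inv_into UNIV T) \<otimes>\<^bsub>AG\<^esub> x = \<one>\<^bsub>AG\<^esub>" using face_map_mult Iso_inv[OF T(1)] one_AG by simp
  then show "\<exists>y\<in>carrier AG. y \<otimes>\<^bsub>AG\<^esub> x = \<one>\<^bsub>AG\<^esub>" unfolding carrier_AG using Iso_inv(1)[OF T(1)] by blast
qed

lemma face_map_pow: "T \<in> Iso \<Longrightarrow> face_map T [^]\<^bsub>AG\<^esub> (m::nat) = face_map (T ^^ m) \<and> T ^^ m \<in> Iso"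
proof (induction m)
  case 0
  then show ?case using one_AG Iso_id by (simp add: id_def)
next
  case (Suc m)
  have "face_map T [^]\<^bsub>AG\<^esub> Suc m = face_map T [^]\<^bsub>AG\<^esub> m \<otimes>\<^bsub>AG\<^esub> face_map T" by simp
  also have "\<dots> = face_map (T ^^ m \<circ> T)" using Suc face_map_mult by simp
  finally have "face_map T [^]\<^bsub>AG\<^esub> Suc m = face_map (T ^^ m \<circ> T)" .
  moreover have "T ^^ Suc m = T ^^ m \<circ> T" by (rule funpow_Suc_right)
  moreover have "T ^^ m \<circ> T \<in> Iso" by (intro Iso_comp) (use Suc in auto)
  ultimately show ?case by metis
qed

section \<open>Orientation\<close>

definition det_sign :: "(real ^ 4 \<Rightarrow> real ^ 4) \<Rightarrow> int" where
  "det_sign T = (if 0 < det (matrix T) then 1 else -1)"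

lemma det_pm: assumes "T \<in> Iso" shows "det (matrix T) = 1 \<or> det (matrix T) = -1"
  using det_orthogonal_matrix orthogonal_transformation_matrix[of T] Iso_orth[OF assms] by blast

lemma det_sign_mult: assumes "S \<in> Iso" "T \<in> Iso" shows "det_sign (S \<circ> T) = det_sign S * det_sign T"
proof -
  have "matrix (S \<circ> T) = matrix S ** matrix T"
    by (rule matrix_compose) (use Iso_linear assms in auto)
  then have "det (matrix (S \<circ> T)) = det (matrix S) * det (matrix T)" by (simp add: det_mul)
  then show ?thesis using det_pm[OF assms(1)] det_pm[OF assms(2)] unfolding det_sign_def by auto
qed

text \<open>
  The reflection is conjugate, by a rotation of the first axis to its normal, to a diagonal matrix with one entry \<open>- 1\<close>.
\<close>

lemma det_sign_s: assumes i: "i < 4" shows "det_sign (s i) = -1"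
proof -
  let ?e = "axis 1 1 :: real ^ 4"
  have "norm (n i) = 1" "norm ?e = 1" using n(1)[OF i] by (simp_all add: norm_eq_1 inner_axis_axis)
  then obtain f where f: "orthogonal_transformation f" "f ?e = n i"
    using orthogonal_transformation_exists[of ?e "n i"] by metis
  have lf: "linear f" using f orthogonal_transformation_linear by auto
  define D where "D x = x - (2 * (?e \<bullet> x)) *\<^sub>R ?e" for x :: "real ^ 4"
  have lD: "linear D" unfolding D_def by (rule linearI) (simp_all add: inner_add_right algebra_simps)
  have Dj: "D (axis j 1) = (if j = 1 then - axis j 1 else axis j 1)" for j
    by (simp add: D_def inner_axis_axis scaleR_2)
  have Dc: "D (axis j 1) $ k = (if j = k then if j = 1 then -1 else 1 else 0)" for j k
    unfolding Dj by (simp add: axis_def)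
  have mD: "matrix D $ k $ j = (if j = k then if j = 1 then -1 else 1 else 0)" for j k
    unfolding matrix_def using Dc by simp
  have "s i \<circ> f = f \<circ> D"
  proof
    fix x
    have "n i \<bullet> f x = ?e \<bullet> x" using f unfolding orthogonal_transformation_def by metis
    then show "(s i \<circ> f) x = (f \<circ> D) x"
      unfolding comp_apply reflection[OF i] D_def linear_diff[OF lf] linear_scale[OF lf] f(2) by simp
  qed
  then have "matrix (s i) ** matrix f = matrix f ** matrix D"
    using matrix_compose[OF lf Iso_linear[OF s(1)[OF i]]] matrix_compose[OF lD lf] by metis
  then have "det (matrix (s i)) * det (matrix f) = det (matrix f) * det (matrix D)" by (metis det_mul)
  moreover have "det (matrix f) \<noteq> 0"
    using det_orthogonal_matrix[of "matrix f"] orthogonal_transformation_matrix[of f] f(1) by force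
  ultimately have "det (matrix (s i)) = det (matrix D)" by simp
  also have "\<dots> = prod (\<lambda>j. matrix D $ j $ j) UNIV"
    by (rule det_diagonal) (simp add: mD)
  also have "\<dots> = prod (\<lambda>j. if j = 1 then -1 else 1) (UNIV :: 4 set)"
    by (rule prod.cong) (simp_all add: mD)
  also have "\<dots> = -1" by simp
  finally show ?thesis unfolding det_sign_def by simp
qed

text \<open>
  The map \<open>face_map\<close> is injective on symmetries, so the description is unique on the automorphism group.
\<close>

definition sgA :: "((real ^ 4) set \<Rightarrow> (real ^ 4) set) \<Rightarrow> int" where
  "sgA a = det_sign (THE T. T \<in> Iso \<and> face_map T = a)"

lemma sgA: "T \<in> Iso \<Longrightarrow> sgA (face_map T) = det_sign T"
proof -
  assume "T \<in> Iso"
  then have "(THE S. S \<in> Iso \<and> face_map S = face_map T) = T" using face_map_inj by (intro the_equality) auto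
  then show ?thesis unfolding sgA_def by simp
qed

definition SA :: "nat \<Rightarrow> ((real ^ 4) set \<Rightarrow> (real ^ 4) set) set" where
  "SA i = face_map ` {T \<in> Iso. T (v i) = v i}"

lemma generate_lat: assumes K: "K \<subseteq> {..<4}" shows "generate AG (rho L \<Phi> ` K) = face_map ` gen K"
proof -
  interpret AG: group AG by (rule group_AG)
  have rho: "rho L \<Phi> i = face_map (s i)" "s i \<in> Iso" "s i \<in> gen K" if "i \<in> K" for i
    using rho_lat[of i] s(1)[of i] gen_s[OF that] that K by auto
  have invr: "inv\<^bsub>AG\<^esub> (face_map (s i)) = face_map (s i)" if "i \<in> K" for i
  proof (rule AG.inv_equality)
    have "i < 4" using that K by auto
    then show "face_map (s i) \<otimes>\<^bsub>AG\<^esub> face_map (s i) = \<one>\<^bsub>AG\<^esub>" using face_map_mult rho(2)[OF that] s_s one_AG by simp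
  qed (use rho(2)[OF that] in \<open>auto simp: carrier_AG\<close>)
  show ?thesis
  proof (intro equalityI subsetI)
    fix x assume "x \<in> generate AG (rho L \<Phi> ` K)"
    then show "x \<in> face_map ` gen K"
    proof induction
      case one then show ?case using one_AG gen_id by auto
    next
      case (incl h) then show ?case using rho by auto
    next
      case (inv h) then show ?case using rho invr by auto
    next
      case (eng h1 h2)
      then obtain S T where "S \<in> gen K" "T \<in> gen K" "h1 = face_map S" "h2 = face_map T" by auto
      then show ?case using gen_comp face_map_mult gen_Iso[OF K] by (metis imageI)
    qed
  next
    fix x assume "x \<in> face_map ` gen K"
    then obtain T where T: "T \<in> gen K" "x = face_map T" by auto
    from T(1) have "face_map T \<in> generate AG (rho L \<Phi> ` K)"
    proof induction
      case gen_id show ?case by (subst one_AG[symmetric]) (rule generate.one)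
    next
      case (gen_step T i)
      have "face_map (s i) \<in> generate AG (rho L \<Phi> ` K)" using rho(1)[OF gen_step(2)] gen_step(2)
        by (metis generate.incl imageI)
      then have "face_map (s i) \<otimes>\<^bsub>AG\<^esub> face_map T \<in> generate AG (rho L \<Phi> ` K)" using gen_step by (intro generate.eng)
      moreover have "face_map (s i) \<otimes>\<^bsub>AG\<^esub> face_map T = face_map (s i \<circ> T)"
        by (rule face_map_mult[OF rho(2)[OF gen_step(2)] gen_Iso[OF K gen_step(1)]])
      ultimately show ?case by metis
    qed
    then show "x \<in> generate AG (rho L \<Phi> ` K)" using T by simp
  qed
qed

lemma string_group_AG: "string_group AG (rho L \<Phi>) SA sgA"
proof -
  interpret AG: group AG by (rule group_AG)
  show ?thesis
  proof (intro string_group.intro string_group_axioms.intro)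
    show "group AG" by (rule group_AG)
  next
    fix i assume i: "i < (4::nat)"
    show "rho L \<Phi> i \<in> carrier AG" using rho_lat[OF i] s(1)[OF i] carrier_AG by auto
    show "rho L \<Phi> i \<otimes>\<^bsub>AG\<^esub> rho L \<Phi> i = \<one>\<^bsub>AG\<^esub>"
      using rho_lat[OF i] face_map_mult[OF s(1)[OF i] s(1)[OF i]] s_s[OF i] one_AG by simp
    show "sgA (rho L \<Phi> i) = - 1" using rho_lat[OF i] sgA[OF s(1)[OF i]] det_sign_s[OF i] by simp
    show "subgroup (SA i) AG"
    proof (rule AG.subgroupI)
      show "SA i \<subseteq> carrier AG" unfolding SA_def carrier_AG by auto
      show "SA i \<noteq> {}" unfolding SA_def using Iso_id by auto
      fix a assume "a \<in> SA i"
      then obtain T where T: "T \<in> Iso" "T (v i) = v i" "a = face_map T" unfolding SA_def by auto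
      let ?R = "inv_into UNIV T"
      have "inv\<^bsub>AG\<^esub> a = face_map ?R"
        by (rule AG.inv_equality) (use T Iso_inv[OF T(1)] face_map_mult one_AG carrier_AG in auto)
      moreover have "?R (v i) = v i" using Iso_inv(2)[OF T(1)] T(2) by (metis comp_apply id_apply)
      ultimately show "inv\<^bsub>AG\<^esub> a \<in> SA i" unfolding SA_def using Iso_inv(1)[OF T(1)] by auto
      fix b assume "b \<in> SA i"
      then obtain S where S: "S \<in> Iso" "S (v i) = v i" "b = face_map S" unfolding SA_def by auto
      have "a \<otimes>\<^bsub>AG\<^esub> b = face_map (T \<circ> S)" using face_map_mult S T by simp
      then show "a \<otimes>\<^bsub>AG\<^esub> b \<in> SA i" unfolding SA_def using S T Iso_comp by auto
    qed
  next
    fix i j assume ij: "i < (4::nat)" "j < (4::nat)"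
    show "rho L \<Phi> i \<in> SA j \<longleftrightarrow> i \<noteq> j"
    proof
      assume "rho L \<Phi> i \<in> SA j"
      then obtain T where T: "T \<in> Iso" "T (v j) = v j" "face_map (s i) = face_map T" unfolding SA_def rho_lat[OF ij(1)] by auto
      then have "s i = T" using face_map_inj s(1)[OF ij(1)] by blast
      then show "i \<noteq> j" using T(2) s_move[OF ij(1)] by auto
    next
      assume "i \<noteq> j"
      then show "rho L \<Phi> i \<in> SA j" unfolding SA_def rho_lat[OF ij(1)] using s(1)[OF ij(1)] s_fix[OF ij(1,2)] by auto
    qed
  next
    fix i j :: nat assume ij: "j < 4" "i + 2 \<le> j"
    then have i: "i < 4" by simp
    show "rho L \<Phi> i \<otimes>\<^bsub>AG\<^esub> rho L \<Phi> j = rho L \<Phi> j \<otimes>\<^bsub>AG\<^esub> rho L \<Phi> i"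
      unfolding rho_lat[OF i] rho_lat[OF ij(1)] using face_map_mult s(1)[OF i] s(1)[OF ij(1)] s_comm[OF i ij(1)] ij by simp
  next
    fix x y assume "x \<in> carrier AG" "y \<in> carrier AG"
    then obtain S T where "S \<in> Iso" "T \<in> Iso" "x = face_map S" "y = face_map T" unfolding carrier_AG by auto
    then show "sgA (x \<otimes>\<^bsub>AG\<^esub> y) = sgA x * sgA y" using face_map_mult sgA Iso_comp det_sign_mult by simp
  next
    fix l x assume l: "l < (4::nat)" and x: "x \<in> generate AG (rho L \<Phi> ` {..<4})" "\<forall>i<4. i \<noteq> l \<longrightarrow> x \<in> SA i"
    obtain T where T: "T \<in> gen {..<4}" "x = face_map T" using x(1) generate_lat[of "{..<4}"] by auto
    have TI: "T \<in> Iso" using T Iso_gen by simp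
    have "T (v i) = v i" if "i < 4" "i \<noteq> l" for i
    proof -
      have "x \<in> SA i" using x(2) that by blast
      then obtain S where "S \<in> Iso" "S (v i) = v i" "x = face_map S" unfolding SA_def by auto
      then show ?thesis using face_map_inj[OF TI] T(2) by metis
    qed
    then have "T \<in> gen ({..<4} - ({..<4} - {l}))" by (intro stab[OF TI]) auto
    moreover have "{..<4} - ({..<4} - {l}) = {l}" using l by auto
    ultimately have "T \<in> gen {l}" by simp
    then have "T = id \<or> T = s l"
    proof induction
      case (gen_step T i)
      then show ?case using s_s[OF l] by (metis comp_id singletonD)
    qed auto
    then show "x = \<one>\<^bsub>AG\<^esub> \<or> x = rho L \<Phi> l" using T(2) one_AG rho_lat[OF l] by auto
  next
    show "finite (generate AG (rho L \<Phi> ` {..<4}))"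
      using generate_lat[of "{..<4}"] finite_gen[of "{..<4}"] by simp
  qed
qed

text \<open>
  An element of both subgroups fixes \<open>v 0\<close> and \<open>v 3\<close>, so \<open>stab\<close> applies.
\<close>

lemma inter_03: "generate AG (rho L \<Phi> ` ({..<4} - {0})) \<inter> generate AG (rho L \<Phi> ` ({..<4} - {3})) \<subseteq> generate AG (rho L \<Phi> ` {1,2})"
proof
  fix x assume x: "x \<in> generate AG (rho L \<Phi> ` ({..<4} - {0})) \<inter> generate AG (rho L \<Phi> ` ({..<4} - {3}))"
  have sub: "{..<4} - {0} \<subseteq> {..<4::nat}" "{..<4} - {3} \<subseteq> {..<4::nat}" by auto
  obtain S T where S: "S \<in> gen ({..<4} - {0})" "x = face_map S" and T: "T \<in> gen ({..<4} - {3})" "x = face_map T"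
    using x unfolding generate_lat[OF sub(1)] generate_lat[OF sub(2)] by auto
  have I: "S \<in> Iso" "T \<in> Iso" using gen_Iso S T sub by blast+
  then have "S = T" using face_map_inj S T by metis
  then have "S (v 0) = v 0" "S (v 3) = v 3"
    using gen_fix[OF sub(1) S(1), of 0] gen_fix[OF sub(2) T(1), of 3] by auto
  then have "S \<in> gen ({..<4} - {0,3})" by (intro stab[OF I(1)]) auto
  moreover have "{..<4} - {0,3} = {1,2::nat}" by auto
  ultimately show "x \<in> generate AG (rho L \<Phi> ` {1,2})" using generate_lat[of "{1,2}"] S(2) by auto
qed

lemma sigma_lat: assumes "i \<in> {1,2,3}" shows "sigma L \<Phi> i = face_map (s (i - 1) \<circ> s i)"
proof -
  have "i - 1 < 4" "i < 4" using assms by auto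
  then show ?thesis unfolding sigma_def using rho_lat face_map_mult s(1) by simp
qed

lemma card_generate:
  assumes sch: "schlafli_symbol 4 L \<Phi> = [p, q, r]"
    and pqr: "(p, q, r) \<in> {(3,3,3), (3,3,4), (3,3,5), (3,4,3), (4,3,3), (5,3,3)}"
    and K: "distinct K" "set K \<subseteq> {..<4}" "chain_order p q r K \<noteq> 0"
  shows "card (generate AG (rho L \<Phi> ` set K)) = chain_order p q r K"
proof -
  interpret AG: group AG by (rule group_AG)
  have l: "[1..<4] = [1,2,3::nat]" by (simp add: upt_rec)
  have ords: "AG.ord (sigma L \<Phi> 1) = p" "AG.ord (sigma L \<Phi> 2) = q" "AG.ord (sigma L \<Phi> 3) = r"
    using sch unfolding schlafli_symbol_def l by auto
  have gr: "n h \<bullet> n i \<noteq> 0 \<and> (m = 3 \<longrightarrow> 4 * (n h \<bullet> n i)^2 = 1) \<and> (m = 4 \<longrightarrow> 4 * (n h \<bullet> n i)^2 = 2) \<and>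
      (m = 5 \<longrightarrow> (4 * (n h \<bullet> n i)^2)^2 = 3 * (4 * (n h \<bullet> n i)^2) - 1)"
    if i: "i = Suc h" "i \<in> {1,2,3}" and m: "AG.ord (sigma L \<Phi> i) = m" "m \<in> {3,4,5}" for h i m
  proof -
    define R where "R = s h \<circ> s i"
    have i4: "i < 4" "h < 4" using i by auto
    have RI: "R \<in> Iso" unfolding R_def using Iso_comp s(1) i4 by auto
    have sg: "sigma L \<Phi> i = face_map R" using sigma_lat[OF i(2)] i(1) unfolding R_def by simp
    have car: "face_map R \<in> carrier AG" using RI carrier_AG by auto
    have "face_map R [^]\<^bsub>AG\<^esub> m = \<one>\<^bsub>AG\<^esub>" using AG.pow_ord_eq_1[OF car] m(1) sg by simp
    then have "R ^^ m = id" using face_map_pow[OF RI, of m] face_map_inj[OF _ Iso_id] one_AG by metis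
    moreover have "R ^^ 2 \<noteq> id"
    proof
      assume "R ^^ 2 = id"
      then have "face_map R [^]\<^bsub>AG\<^esub> (2::nat) = \<one>\<^bsub>AG\<^esub>" using face_map_pow[OF RI, of 2] one_AG by simp
      then have "m dvd 2" using AG.pow_eq_id[OF car, of 2] m(1) sg by simp
      then show False using m(2) by (auto dest: dvd_imp_le)
    qed
    ultimately show ?thesis using gram[OF i(1) i4(1) R_def m(2) _ _ refl] by blast
  qed
  have m: "p \<in> {3,4,5}" "q \<in> {3,4,5}" "r \<in> {3,4,5}" using pqr by auto
  have g1: "n 0 \<bullet> n 1 \<noteq> 0 \<and> (p = 3 \<longrightarrow> 4 * (n 0 \<bullet> n 1)^2 = 1) \<and> (p = 4 \<longrightarrow> 4 * (n 0 \<bullet> n 1)^2 = 2) \<and>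
      (p = 5 \<longrightarrow> (4 * (n 0 \<bullet> n 1)^2)^2 = 3 * (4 * (n 0 \<bullet> n 1)^2) - 1)" by (rule gr) (use ords m in auto)
  have g2: "n 1 \<bullet> n 2 \<noteq> 0 \<and> (q = 3 \<longrightarrow> 4 * (n 1 \<bullet> n 2)^2 = 1) \<and> (q = 4 \<longrightarrow> 4 * (n 1 \<bullet> n 2)^2 = 2) \<and>
      (q = 5 \<longrightarrow> (4 * (n 1 \<bullet> n 2)^2)^2 = 3 * (4 * (n 1 \<bullet> n 2)^2) - 1)" by (rule gr) (use ords m in auto)
  have g3: "n 2 \<bullet> n 3 \<noteq> 0 \<and> (r = 3 \<longrightarrow> 4 * (n 2 \<bullet> n 3)^2 = 1) \<and> (r = 4 \<longrightarrow> 4 * (n 2 \<bullet> n 3)^2 = 2) \<and>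
      (r = 5 \<longrightarrow> (4 * (n 2 \<bullet> n 3)^2)^2 = 3 * (4 * (n 2 \<bullet> n 3)^2) - 1)" by (rule gr) (use ords m in auto)
  have "\<exists>\<tau>. \<tau>^2 = 3 * \<tau> - 1 \<and> 4 * (n 0 \<bullet> n 1)^2 = bond \<tau> p \<and> 4 * (n 1 \<bullet> n 2)^2 = bond \<tau> q \<and> 4 * (n 2 \<bullet> n 3)^2 = bond \<tau> r"
  proof -
    define \<tau> where "\<tau> = (if p = 5 then 4 * (n 0 \<bullet> n 1)^2 else if r = 5 then 4 * (n 2 \<bullet> n 3)^2 else (3 + sqrt 5) / 2)"
    have "((3 + sqrt 5) / 2)^2 = 3 * ((3 + sqrt 5) / 2) - 1" by (simp add: power2_eq_square field_simps)
    then have "\<tau>^2 = 3 * \<tau> - 1" using g1 g3 unfolding \<tau>_def by simp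
    moreover have "4 * (n 0 \<bullet> n 1)^2 = bond \<tau> p" "4 * (n 1 \<bullet> n 2)^2 = bond \<tau> q" "4 * (n 2 \<bullet> n 3)^2 = bond \<tau> r"
      using g1 g2 g3 pqr unfolding \<tau>_def bond_def by auto
    ultimately show ?thesis by blast
  qed
  then obtain \<tau> where \<tau>: "\<tau>^2 = 3 * \<tau> - 1" "4 * (n 0 \<bullet> n 1)^2 = bond \<tau> p" "4 * (n 1 \<bullet> n 2)^2 = bond \<tau> q" "4 * (n 2 \<bullet> n 3)^2 = bond \<tau> r"
    by blast
  have "card (gen (set K)) = chain_order p q r K"
    using card_gen_chain[OF \<tau>(1) _ _ _ \<tau>(2-4) K] g1 g2 g3 by blast
  moreover have "card (face_map ` gen (set K)) = card (gen (set K))"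
    by (rule card_image) (use face_map_inj gen_Iso[OF K(2)] in \<open>auto simp: inj_on_def\<close>)
  ultimately show ?thesis using generate_lat[OF K(2)] by simp
qed

end

section \<open>The rotation subgroup of a product\<close>

text \<open>
  The six polytopes are numbered 1 to 6 as \<open>{3,3,3}\<close>, \<open>{3,3,4}\<close>, \<open>{3,3,5}\<close>, \<open>{3,4,3}\<close>, \<open>{4,3,3}\<close>, \<open>{5,3,3}\<close>. Besides their Schlaefli
  symbols, the following functions give the orders of the rotation groups of the polytope, of its facets and of its vertex
  figures.
\<close>

definition first_entry :: "nat \<Rightarrow> nat" where "first_entry r = (if r = 5 then 4 else if r = 6 then 5 else 3)"
definition second_entry :: "nat \<Rightarrow> nat" where "second_entry r = (if r = 4 then 4 else 3)"
definition third_entry :: "nat \<Rightarrow> nat" where "third_entry r = (if r = 2 then 4 else if r = 3 then 5 else 3)"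
definition rot_order :: "nat \<Rightarrow> nat" where
  "rot_order r = (if r = 1 then 60 else if r = 4 then 576 else if r = 2 \<or> r = 5 then 192 else 7200)"
definition facet_rot_order :: "nat \<Rightarrow> nat" where "facet_rot_order r = (if r \<le> 3 then 12 else if r = 6 then 60 else 24)"
definition vfig_rot_order :: "nat \<Rightarrow> nat" where "vfig_rot_order r = (if r = 3 then 60 else if r = 2 \<or> r = 4 then 24 else 12)"

declare carrier_product_group [simp del] one_product_group [simp del] mult_product_group [simp del]
  inv_product_group [simp del]

text \<open>
  What the argument about the product uses of each factor: a string group with the intersection property for the end subgroups,
  and the orders of its generators and of three of its rotation subgroups.
\<close>

locale mixed =
  fixes I :: "nat set" and A :: "nat \<Rightarrow> 'a monoid" and \<rho> S sg
  assumes I: "I \<subseteq> {1..6}" "I \<noteq> {}"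
    and sgp: "\<And>r. r \<in> I \<Longrightarrow> string_group (A r) (\<rho> r) (S r) (sg r)"
    and ords: "\<And>r. r \<in> I \<Longrightarrow> group.ord (A r) (string_group.\<beta> (A r) (\<rho> r) 1) = first_entry r"
      "\<And>r. r \<in> I \<Longrightarrow> group.ord (A r) (string_group.\<beta> (A r) (\<rho> r) 2) = second_entry r"
      "\<And>r. r \<in> I \<Longrightarrow> group.ord (A r) (string_group.\<beta> (A r) (\<rho> r) 3) = third_entry r"
    and inter: "\<And>r. r \<in> I \<Longrightarrow> string_group.par (A r) (\<rho> r) ({..<4} - {0}) \<inter> string_group.par (A r) (\<rho> r) ({..<4} - {3})
        \<subseteq> string_group.par (A r) (\<rho> r) {1,2}"
    and cards: "\<And>r. r \<in> I \<Longrightarrow> card (string_group.ev (A r) (\<rho> r) {0..3}) = rot_order r"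
      "\<And>r. r \<in> I \<Longrightarrow> card (string_group.ev (A r) (\<rho> r) {0..2}) = facet_rot_order r"
      "\<And>r. r \<in> I \<Longrightarrow> card (string_group.ev (A r) (\<rho> r) {1..3}) = vfig_rot_order r"
begin

text \<open>
  The component from which the sign of an element of the product is read off; on the generated group all components give the same sign.
\<close>

definition r0 :: nat where "r0 = (SOME r. r \<in> I)"

lemma r0: "r0 \<in> I" unfolding r0_def using I(2) by (meson ex_in_conv someI)

lemma finI: "finite I" using I(1) finite_subset by blast

abbreviation "B \<equiv> product_group I A"
definition R :: "nat \<Rightarrow> nat \<Rightarrow> 'a" where "R i = (\<lambda>r\<in>I. \<rho> r i)"
definition SS :: "nat \<Rightarrow> (nat \<Rightarrow> 'a) set" where "SS i = {x \<in> carrier (product_group I A). \<forall>r\<in>I. x r \<in> S r i}"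
definition sgB :: "(nat \<Rightarrow> 'a) \<Rightarrow> int" where "sgB x = sg r0 (x r0)"

sublocale B: string_group B R SS sgB
  unfolding R_def SS_def sgB_def by (rule product_string_group[OF finI r0 sgp])

abbreviation ev where "ev r J \<equiv> string_group.ev (A r) (\<rho> r) J"
abbreviation par where "par r J \<equiv> string_group.par (A r) (\<rho> r) J"
abbreviation bt where "bt r k \<equiv> string_group.\<beta> (A r) (\<rho> r) k"

lemma grp: "r \<in> I \<Longrightarrow> group (A r)" using sgp string_group.axioms(1) by blast

lemma ev_car: "r \<in> I \<Longrightarrow> J \<subseteq> {..<4} \<Longrightarrow> x \<in> ev r J \<Longrightarrow> x \<in> carrier (A r)"
  using string_group.ev_closed[OF sgp] by blast

lemma B_car: "J \<subseteq> {..<4} \<Longrightarrow> x \<in> B.ev J \<Longrightarrow> x \<in> carrier B" by (rule B.ev_closed)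

lemma B_comp: "x \<in> carrier B \<Longrightarrow> r \<in> I \<Longrightarrow> x r \<in> carrier (A r)" by (auto simp: carrier_product_group)

lemma B_eqI: assumes "x \<in> carrier B" "y \<in> carrier B" "\<And>r. r \<in> I \<Longrightarrow> x r = y r" shows "x = y"
  using assms unfolding carrier_product_group by (rule PiE_ext)

lemma B_mult [simp]: "r \<in> I \<Longrightarrow> (x \<otimes>\<^bsub>B\<^esub> y) r = x r \<otimes>\<^bsub>A r\<^esub> y r" by (simp add: mult_product_group)
lemma B_one [simp]: "r \<in> I \<Longrightarrow> \<one>\<^bsub>B\<^esub> r = \<one>\<^bsub>A r\<^esub>" by (simp add: one_product_group)
lemma B_inv: "x \<in> carrier B \<Longrightarrow> r \<in> I \<Longrightarrow> (inv\<^bsub>B\<^esub> x) r = inv\<^bsub>A r\<^esub> (x r)"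
  using inv_product_group[of x I A] grp by (simp add: carrier_product_group)

lemma B_pow: "x \<in> carrier B \<Longrightarrow> r \<in> I \<Longrightarrow> (x [^]\<^bsub>B\<^esub> (k::nat)) r = x r [^]\<^bsub>A r\<^esub> k"
  by (induction k) (auto simp: nat_pow_def)

lemma R_comp: "r \<in> I \<Longrightarrow> R i r = \<rho> r i" unfolding R_def by simp

lemma bt_def: "r \<in> I \<Longrightarrow> bt r k = \<rho> r (k - 1) \<otimes>\<^bsub>A r\<^esub> \<rho> r k"
  using string_group.\<beta>_def[OF sgp] by blast

lemma beta_comp: "r \<in> I \<Longrightarrow> B.\<beta> k r = bt r k"
  using bt_def by (simp add: B.\<beta>_def R_def)

lemma proj_hom: "r \<in> I \<Longrightarrow> group_hom B (A r) (\<lambda>x. x r)"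
  unfolding group_hom_def group_hom_axioms_def using grp B.is_group B_comp by (auto simp: hom_def)

lemma proj_ev: assumes r: "r \<in> I" and J: "J \<subseteq> {..<4}" shows "(\<lambda>x. x r) ` B.ev J = ev r J"
proof -
  interpret h: group_hom B "A r" "\<lambda>x. x r" by (rule proj_hom[OF r])
  let ?X = "{R i \<otimes>\<^bsub>B\<^esub> R j | i j. i \<in> J \<and> j \<in> J}"
  have "?X \<subseteq> carrier B" using B.rho_closed J by auto
  then have "(\<lambda>x. x r) ` generate B ?X = generate (A r) ((\<lambda>x. x r) ` ?X)" by (rule h.generate_img[symmetric])
  moreover have "(\<lambda>x. x r) ` ?X = {\<rho> r i \<otimes>\<^bsub>A r\<^esub> \<rho> r j | i j. i \<in> J \<and> j \<in> J}"
  proof (intro equalityI subsetI)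
    fix y assume "y \<in> {\<rho> r i \<otimes>\<^bsub>A r\<^esub> \<rho> r j | i j. i \<in> J \<and> j \<in> J}"
    then obtain i j where ij: "i \<in> J" "j \<in> J" "y = \<rho> r i \<otimes>\<^bsub>A r\<^esub> \<rho> r j" by blast
    then have "y = (R i \<otimes>\<^bsub>B\<^esub> R j) r" using r R_comp by simp
    then show "y \<in> (\<lambda>x. x r) ` ?X" using ij by blast
  next
    fix y assume "y \<in> (\<lambda>x. x r) ` ?X"
    then obtain i j where "i \<in> J" "j \<in> J" "y = (R i \<otimes>\<^bsub>B\<^esub> R j) r" by blast
    then show "y \<in> {\<rho> r i \<otimes>\<^bsub>A r\<^esub> \<rho> r j | i j. i \<in> J \<and> j \<in> J}" using r R_comp by auto
  qed
  ultimately show ?thesis unfolding B.ev_def string_group.ev_def[OF sgp[OF r]] by simp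
qed

lemma ev_comp: "r \<in> I \<Longrightarrow> J \<subseteq> {..<4} \<Longrightarrow> x \<in> B.ev J \<Longrightarrow> x r \<in> ev r J" using proj_ev by blast

lemma ev_surj: assumes "r \<in> I" "J \<subseteq> {..<4}" "y \<in> ev r J" shows "\<exists>x\<in>B.ev J. x r = y"
proof -
  have "y \<in> (\<lambda>x. x r) ` B.ev J" using proj_ev[OF assms(1,2)] assms(3) by simp
  then show ?thesis by (elim imageE) auto
qed

definition emb :: "nat \<Rightarrow> 'a \<Rightarrow> nat \<Rightarrow> 'a" where "emb r x = (\<lambda>s\<in>I. if s = r then x else \<one>\<^bsub>A s\<^esub>)"

text \<open>
  The \<open>r\<close>-th factor of the parabolic rotation subgroup is contained in the subgroup of the product.
\<close>

definition splits :: "nat set \<Rightarrow> nat \<Rightarrow> bool" where "splits J r \<longleftrightarrow> (\<forall>y \<in> ev r J. emb r y \<in> B.ev J)"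

lemma emb_car: "r \<in> I \<Longrightarrow> x \<in> carrier (A r) \<Longrightarrow> emb r x \<in> carrier B"
  unfolding emb_def using grp group.is_monoid monoid.one_closed by (auto simp: PiE_iff carrier_product_group)

lemma emb_mult: assumes "r \<in> I" "x \<in> carrier (A r)" "y \<in> carrier (A r)"
  shows "emb r x \<otimes>\<^bsub>B\<^esub> emb r y = emb r (x \<otimes>\<^bsub>A r\<^esub> y)"
proof -
  have "\<one>\<^bsub>A s\<^esub> \<otimes>\<^bsub>A s\<^esub> \<one>\<^bsub>A s\<^esub> = \<one>\<^bsub>A s\<^esub>" if "s \<in> I" for s
  proof -
    interpret group "A s" by (rule grp[OF that])
    show ?thesis by simp
  qed
  then show ?thesis unfolding emb_def mult_product_group by (auto intro!: restrict_ext)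
qed

lemma emb_one: "emb r \<one>\<^bsub>A r\<^esub> = \<one>\<^bsub>B\<^esub>" unfolding emb_def one_product_group by (auto intro!: restrict_ext)

lemma emb_inv: assumes r: "r \<in> I" and x: "x \<in> carrier (A r)" shows "inv\<^bsub>B\<^esub> (emb r x) = emb r (inv\<^bsub>A r\<^esub> x)"
proof (rule B.inv_equality)
  interpret Ar: group "A r" by (rule grp[OF r])
  show "emb r (inv\<^bsub>A r\<^esub> x) \<otimes>\<^bsub>B\<^esub> emb r x = \<one>\<^bsub>B\<^esub>" using emb_mult[OF r, of "inv\<^bsub>A r\<^esub> x" x] x emb_one by simp
  show "emb r x \<in> carrier B" "emb r (inv\<^bsub>A r\<^esub> x) \<in> carrier B" using emb_car[OF r] x by auto
qed

lemma B_ev_inv: "J \<subseteq> {..<4} \<Longrightarrow> x \<in> B.ev J \<Longrightarrow> inv\<^bsub>B\<^esub> x \<in> B.ev J"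
  using B.ev_subgroup subgroup.m_inv_closed by metis

lemma B_ev_one: "J \<subseteq> {..<4} \<Longrightarrow> \<one>\<^bsub>B\<^esub> \<in> B.ev J"
  using B.ev_subgroup subgroup.one_closed by metis

lemma B_ev_pow: assumes "J \<subseteq> {..<4}" "x \<in> B.ev J" shows "x [^]\<^bsub>B\<^esub> (k::nat) \<in> B.ev J"
  by (induction k) (use assms B_ev_one B.ev_mult in auto)

lemma emb_subgroup: assumes r: "r \<in> I" and J: "J \<subseteq> {..<4}"
  shows "subgroup {x \<in> carrier (A r). emb r x \<in> B.ev J} (A r)"
proof -
  interpret Ar: group "A r" by (rule grp[OF r])
  show ?thesis
  proof (rule Ar.subgroupI)
    show "{x \<in> carrier (A r). emb r x \<in> B.ev J} \<noteq> {}" using emb_one B_ev_one[OF J] by (intro ex_in_conv[THEN iffD1] exI[of _ "\<one>\<^bsub>A r\<^esub>"]) simp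
    fix x assume x: "x \<in> {x \<in> carrier (A r). emb r x \<in> B.ev J}"
    then show "inv\<^bsub>A r\<^esub> x \<in> {x \<in> carrier (A r). emb r x \<in> B.ev J}"
      using emb_inv[OF r, of x] B_ev_inv[OF J, of "emb r x"] by simp
    fix y assume "y \<in> {x \<in> carrier (A r). emb r x \<in> B.ev J}"
    then show "x \<otimes>\<^bsub>A r\<^esub> y \<in> {x \<in> carrier (A r). emb r x \<in> B.ev J}"
      using x emb_mult[OF r, of x y] B.ev_mult[OF J, of "emb r x" "emb r y"] by simp
  qed blast
qed

lemma splitsI: assumes r: "r \<in> I" and b: "b < 4" and gen: "\<And>k. k \<in> {Suc a..b} \<Longrightarrow> emb r (bt r k) \<in> B.ev {a..b}"
  shows "splits {a..b} r"
proof -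
  interpret Ar: string_group "A r" "\<rho> r" "S r" "sg r" by (rule sgp[OF r])
  have J: "{a..b} \<subseteq> {..<4}" using b by auto
  have "ev r {a..b} \<subseteq> {x \<in> carrier (A r). emb r x \<in> B.ev {a..b}}"
    unfolding Ar.ev_interval[OF b]
    by (rule Ar.generate_subgroup_incl[OF _ emb_subgroup[OF r J]]) (use gen Ar.\<beta>_closed b in auto)
  then show ?thesis unfolding splits_def by blast
qed

text \<open>
  From \<open>(xy)\<^sup>2 = 1\<close> one gets \<open>yxy = x\<^sup>-\<^sup>1\<close>, so \<open>y\<^sup>2\<close> is the product of the inverse of the conjugate \<open>y x y\<^sup>-\<^sup>1\<close> and \<open>x\<^sup>-\<^sup>1\<close>. Both
  are supported on the component \<open>r\<close>: conjugation by an element of the product with component \<open>y\<close> acts only there. Finally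
  \<open>y = y\<^sup>4\<close> is the square of \<open>y\<^sup>2\<close>.
\<close>

lemma emb_propagate:
  assumes r: "r \<in> I" and J: "J \<subseteq> {..<4}" and x: "emb r x \<in> B.ev J" "x \<in> carrier (A r)" and y: "y \<in> ev r J"
    and xy: "(x \<otimes>\<^bsub>A r\<^esub> y) \<otimes>\<^bsub>A r\<^esub> (x \<otimes>\<^bsub>A r\<^esub> y) = \<one>\<^bsub>A r\<^esub>" and y3: "y [^]\<^bsub>A r\<^esub> (3::nat) = \<one>\<^bsub>A r\<^esub>"
  shows "emb r y \<in> B.ev J"
proof -
  interpret Ar: group "A r" by (rule grp[OF r])
  have yc: "y \<in> carrier (A r)" using ev_car[OF r J y] .
  let ?K = "{x \<in> carrier (A r). emb r x \<in> B.ev J}"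
  note K_mult = subgroup.m_closed[OF emb_subgroup[OF r J]] and K_inv = subgroup.m_inv_closed[OF emb_subgroup[OF r J]]
  obtain z where z: "z \<in> B.ev J" "z r = y" using ev_surj[OF r J y] by (elim bexE)
  have zc: "z \<in> carrier B" using B_car[OF J] z by auto
  have "z \<otimes>\<^bsub>B\<^esub> emb r x \<otimes>\<^bsub>B\<^esub> inv\<^bsub>B\<^esub> z \<in> B.ev J" using z x B.ev_mult[OF J] B_ev_inv[OF J] by metis
  moreover have "z \<otimes>\<^bsub>B\<^esub> emb r x \<otimes>\<^bsub>B\<^esub> inv\<^bsub>B\<^esub> z = emb r (y \<otimes>\<^bsub>A r\<^esub> x \<otimes>\<^bsub>A r\<^esub> inv\<^bsub>A r\<^esub> y)"
  proof (rule B_eqI)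
    show "z \<otimes>\<^bsub>B\<^esub> emb r x \<otimes>\<^bsub>B\<^esub> inv\<^bsub>B\<^esub> z \<in> carrier B"
      by (intro B.m_closed B.inv_closed zc emb_car[OF r] x(2))
    show "emb r (y \<otimes>\<^bsub>A r\<^esub> x \<otimes>\<^bsub>A r\<^esub> inv\<^bsub>A r\<^esub> y) \<in> carrier B" by (intro emb_car[OF r] Ar.m_closed Ar.inv_closed x(2) yc)
    fix s assume s: "s \<in> I"
    interpret As: group "A s" by (rule grp[OF s])
    have "z s \<in> carrier (A s)" using B_comp[OF zc s] .
    then show "(z \<otimes>\<^bsub>B\<^esub> emb r x \<otimes>\<^bsub>B\<^esub> inv\<^bsub>B\<^esub> z) s = emb r (y \<otimes>\<^bsub>A r\<^esub> x \<otimes>\<^bsub>A r\<^esub> inv\<^bsub>A r\<^esub> y) s"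
      unfolding B_mult[OF s] B_inv[OF zc s] using s z(2) by (simp add: emb_def)
  qed
  ultimately have c: "y \<otimes>\<^bsub>A r\<^esub> x \<otimes>\<^bsub>A r\<^esub> inv\<^bsub>A r\<^esub> y \<in> ?K" using x yc by simp
  have xK: "x \<in> ?K" using x by simp
  have "x \<otimes>\<^bsub>A r\<^esub> (y \<otimes>\<^bsub>A r\<^esub> (x \<otimes>\<^bsub>A r\<^esub> y)) = \<one>\<^bsub>A r\<^esub>" using xy x(2) yc by (simp add: Ar.m_assoc)
  then have yxy: "y \<otimes>\<^bsub>A r\<^esub> (x \<otimes>\<^bsub>A r\<^esub> y) = inv\<^bsub>A r\<^esub> x" using x(2) yc by (metis Ar.inv_equality Ar.inv_inv Ar.m_closed Ar.inv_closed)
  have "inv\<^bsub>A r\<^esub> (y \<otimes>\<^bsub>A r\<^esub> x \<otimes>\<^bsub>A r\<^esub> inv\<^bsub>A r\<^esub> y) \<otimes>\<^bsub>A r\<^esub> inv\<^bsub>A r\<^esub> x = y \<otimes>\<^bsub>A r\<^esub> y"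
    unfolding yxy[symmetric] using x(2) yc by (simp add: Ar.inv_mult_group Ar.m_assoc[symmetric]) (simp add: Ar.m_assoc)
  then have yy: "y \<otimes>\<^bsub>A r\<^esub> y \<in> ?K" using K_mult[OF K_inv[OF c] K_inv[OF xK]] by simp
  have "(y \<otimes>\<^bsub>A r\<^esub> y) \<otimes>\<^bsub>A r\<^esub> (y \<otimes>\<^bsub>A r\<^esub> y) = y \<otimes>\<^bsub>A r\<^esub> (y [^]\<^bsub>A r\<^esub> (3::nat))"
    using yc by (simp add: numeral_3_eq_3 Ar.m_assoc)
  then have "(y \<otimes>\<^bsub>A r\<^esub> y) \<otimes>\<^bsub>A r\<^esub> (y \<otimes>\<^bsub>A r\<^esub> y) = y" using y3 yc by simp
  then show ?thesis using K_mult[OF yy yy] by simp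
qed

text \<open>Multiply by embedded elements, one component after the other.\<close>

lemma modify:
  assumes J: "J \<subseteq> {..<4}" and D: "D \<subseteq> I" "\<And>r. r \<in> D \<Longrightarrow> splits J r" "\<And>r. r \<in> D \<Longrightarrow> y r \<in> ev r J"
    and z: "z \<in> B.ev J"
  shows "(\<lambda>r\<in>I. if r \<in> D then y r else z r) \<in> B.ev J"
proof -
  have "finite D" using D(1) finI finite_subset by blast
  then show ?thesis using D
  proof (induction D rule: finite_induct)
    case empty
    have "(\<lambda>r\<in>I. if r \<in> {} then y r else z r) = z" using B_car[OF J z] unfolding carrier_product_group by (auto simp: PiE_iff extensional_def fun_eq_iff)
    then show ?case using z by simp
  next
    case (insert d D)
    let ?w = "\<lambda>r\<in>I. if r \<in> D then y r else z r" and ?t = "\<lambda>r\<in>I. if r \<in> insert d D then y r else z r"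
    have w: "?w \<in> B.ev J" by (rule insert.IH) (use insert.prems in auto)
    have d: "d \<in> I" "splits J d" "y d \<in> ev d J" using insert by auto
    interpret Ad: string_group "A d" "\<rho> d" "S d" "sg d" by (rule sgp[OF d(1)])
    have zd: "z d \<in> ev d J" using ev_comp[OF d(1) J z] .
    have c: "y d \<in> carrier (A d)" "z d \<in> carrier (A d)" using ev_car[OF d(1) J] d zd by auto
    have "y d \<otimes>\<^bsub>A d\<^esub> inv\<^bsub>A d\<^esub> (z d) \<in> ev d J"
      using d zd Ad.ev_mult[OF J] Ad.ev_subgroup[OF J] subgroup.m_inv_closed by metis
    then have e: "emb d (y d \<otimes>\<^bsub>A d\<^esub> inv\<^bsub>A d\<^esub> (z d)) \<in> B.ev J" using d(2) unfolding splits_def by blast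
    then have ew: "emb d (y d \<otimes>\<^bsub>A d\<^esub> inv\<^bsub>A d\<^esub> (z d)) \<otimes>\<^bsub>B\<^esub> ?w \<in> B.ev J" using w B.ev_mult[OF J] by blast
    have "?t = emb d (y d \<otimes>\<^bsub>A d\<^esub> inv\<^bsub>A d\<^esub> (z d)) \<otimes>\<^bsub>B\<^esub> ?w"
    proof
      fix s
      show "?t s = (emb d (y d \<otimes>\<^bsub>A d\<^esub> inv\<^bsub>A d\<^esub> (z d)) \<otimes>\<^bsub>B\<^esub> ?w) s"
      proof (cases "s \<in> I")
        case s: True
        interpret As: group "A s" by (rule grp[OF s])
        have "?w s \<in> carrier (A s)" using B_comp[OF B_car[OF J w] s] .
        then have ws: "(if s \<in> D then y s else z s) \<in> carrier (A s)" using s by simp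
        show ?thesis
        proof (cases "s = d")
          case True
          then show ?thesis using s insert(2) c by (simp add: emb_def Ad.m_assoc)
        next
          case False
          then show ?thesis using s ws by (auto simp: emb_def)
        qed
      qed (simp add: mult_product_group)
    qed
    then show ?case using ew by simp
  qed
qed

text \<open>
  If the components outside \<open>D\<close> are determined by the one at \<open>r1\<close>, then an element is the same as a choice of its components in
  \<open>insert r1 D\<close>, and every choice occurs.
\<close>

lemma card_split:
  assumes J: "J \<subseteq> {..<4}" and r1: "r1 \<in> I" and D: "D \<subseteq> I - {r1}" "\<And>r. r \<in> D \<Longrightarrow> splits J r"
    and det: "\<And>x s. x \<in> B.ev J \<Longrightarrow> x r1 = \<one>\<^bsub>A r1\<^esub> \<Longrightarrow> s \<in> I - D \<Longrightarrow> x s = \<one>\<^bsub>A s\<^esub>"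
  shows "card (B.ev J) = (\<Prod>r\<in>insert r1 D. card (ev r J))"
proof -
  let ?D = "insert r1 D"
  have DI: "?D \<subseteq> I" using r1 D by auto
  have "bij_betw (\<lambda>x. restrict x ?D) (B.ev J) (\<Pi>\<^sub>E r\<in>?D. ev r J)"
  proof (rule bij_betwI')
    fix x y assume xy: "x \<in> B.ev J" "y \<in> B.ev J"
    have c: "x \<in> carrier B" "y \<in> carrier B" using xy B_car[OF J] by auto
    show "(restrict x ?D = restrict y ?D) = (x = y)"
    proof
      assume eq: "restrict x ?D = restrict y ?D"
      then have eq': "x r = y r" if "r \<in> ?D" for r using that by (metis restrict_apply')
      let ?z = "x \<otimes>\<^bsub>B\<^esub> inv\<^bsub>B\<^esub> y"
      have z: "?z \<in> B.ev J" using xy B.ev_mult[OF J] B_ev_inv[OF J] by blast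
      have zs: "?z s = x s \<otimes>\<^bsub>A s\<^esub> inv\<^bsub>A s\<^esub> (y s)" if "s \<in> I" for s using B_mult[OF that] B_inv[OF c(2) that] by simp
      have "?z r1 = \<one>\<^bsub>A r1\<^esub>"
        using zs[OF r1] eq'[of r1] B_comp[OF c(2) r1] group.r_inv[OF grp[OF r1]] by simp
      then have "?z s = \<one>\<^bsub>A s\<^esub>" if "s \<in> I - D" for s using det[OF z _ that] by simp
      then have "x s = y s" if "s \<in> I - D" for s
        using zs[of s] that B_comp[OF c(1), of s] B_comp[OF c(2), of s] grp[of s]
        by (metis DiffD1 group.inv_closed group.inv_equality group.inv_inv)
      then show "x = y" using eq' by (intro B_eqI c) blast
    qed simp
  next
    fix x assume "x \<in> B.ev J"
    then show "restrict x ?D \<in> (\<Pi>\<^sub>E r\<in>?D. ev r J)" using ev_comp[OF _ J] DI by auto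
  next
    fix y assume y: "y \<in> (\<Pi>\<^sub>E r\<in>?D. ev r J)"
    then have "y r1 \<in> ev r1 J" by auto
    from ev_surj[OF r1 J this] obtain z where z: "z \<in> B.ev J" "z r1 = y r1" by (elim bexE)
    let ?x = "\<lambda>r\<in>I. if r \<in> D then y r else z r"
    have x: "?x \<in> B.ev J" by (rule modify[OF J]) (use D y z in auto)
    have "y = restrict ?x ?D"
    proof
      fix s show "y s = restrict ?x ?D s"
        using y z(2) DI r1 D(1) by (cases "s \<in> ?D") (auto simp: PiE_iff extensional_def)
    qed
    then show "\<exists>x\<in>B.ev J. y = restrict x ?D" using x by blast
  qed
  then have "card (B.ev J) = card (\<Pi>\<^sub>E r\<in>?D. ev r J)" by (rule bij_betw_same_card)
  also have "\<dots> = (\<Prod>r\<in>?D. card (ev r J))" using finite_subset[OF DI finI] by (rule card_PiE)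
  finally show ?thesis .
qed

lemma bt_car: "r \<in> I \<Longrightarrow> 0 < k \<Longrightarrow> k < 4 \<Longrightarrow> bt r k \<in> carrier (A r)"
  using string_group.\<beta>_closed[OF sgp] by blast

text \<open>
  Every element is given, in all components from \<open>E\<close>, by one and the same normal form. In the component \<open>r1\<close> the 12 normal
  forms are distinct, so an element that is trivial there has the normal form of \<open>\<one>\<close>, and is trivial in all of \<open>E\<close>.
\<close>

lemma det_tetra:
  assumes k: "k = 1 \<or> k = 2" and E: "E \<subseteq> I" "r1 \<in> E"
    and o3: "\<And>s. s \<in> E \<Longrightarrow> group.ord (A s) (bt s k) = 3" "\<And>s. s \<in> E \<Longrightarrow> group.ord (A s) (bt s (Suc k)) = 3"
    and c12: "card (ev r1 {k - 1..Suc k}) = 12"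
    and x: "x \<in> B.ev {k - 1..Suc k}" "x r1 = \<one>\<^bsub>A r1\<^esub>" and s: "s \<in> E"
  shows "x s = \<one>\<^bsub>A s\<^esub>"
proof -
  let ?J = "{k - 1..Suc k}" and ?W = "{..<3} \<times> {..<4} :: (nat \<times> nat) set"
  let ?w = "\<lambda>s. group.tword (A s) (bt s k) (bt s (Suc k))"
  have J: "?J \<subseteq> {..<4}" "Suc k < 4" "0 < k" using k by auto
  have "{Suc (k - 1)..Suc k} = {k, Suc k}" using k by auto
  then have ev: "B.ev ?J = generate B {B.\<beta> k, B.\<beta> (Suc k)}" using B.ev_interval[OF J(2), of "k - 1"] by simp
  define \<alpha> where "\<alpha> w = (if snd w = 3 then (0, fst w) else if fst w = 0 then (1, (snd w + 1) mod 3)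
       else if fst w = 1 then ((snd w + 2) mod 3, 3) else (2, (snd w + 2) mod 3))" for w :: "nat \<times> nat"
  define \<gamma> where "\<gamma> w = ((fst w + 1) mod 3, snd w)" for w :: "nat \<times> nat"
  have \<alpha>W: "\<alpha> w \<in> ?W" "\<gamma> w \<in> ?W" if "w \<in> ?W" for w using that unfolding \<alpha>_def \<gamma>_def by auto
  have comp: "bt s k \<in> carrier (A s) \<and> bt s (Suc k) \<in> carrier (A s) \<and>
      (\<forall>w\<in>?W. bt s k \<otimes>\<^bsub>A s\<^esub> ?w s w = ?w s (\<alpha> w) \<and> bt s (Suc k) \<otimes>\<^bsub>A s\<^esub> ?w s w = ?w s (\<gamma> w)) \<and>
      inv\<^bsub>A s\<^esub> (bt s k) = bt s k \<otimes>\<^bsub>A s\<^esub> bt s k \<and> inv\<^bsub>A s\<^esub> (bt s (Suc k)) = bt s (Suc k) \<otimes>\<^bsub>A s\<^esub> bt s (Suc k) \<and>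
      (\<forall>w\<in>?W. ?w s w \<in> carrier (A s))"
    if s: "s \<in> E" for s
  proof -
    have sI: "s \<in> I" using s E by auto
    interpret As: string_group "A s" "\<rho> s" "S s" "sg s" by (rule sgp[OF sI])
    let ?a = "bt s k" and ?b = "bt s (Suc k)"
    have c: "?a \<in> carrier (A s)" "?b \<in> carrier (A s)" using As.\<beta>_closed J by auto
    have "?a [^]\<^bsub>A s\<^esub> (3::nat) = \<one>\<^bsub>A s\<^esub>" "?b [^]\<^bsub>A s\<^esub> (3::nat) = \<one>\<^bsub>A s\<^esub>"
      using As.pow_ord_eq_1 c o3[OF s] by metis+
    then have 3: "?a \<otimes>\<^bsub>A s\<^esub> ?a \<otimes>\<^bsub>A s\<^esub> ?a = \<one>\<^bsub>A s\<^esub>" "?b \<otimes>\<^bsub>A s\<^esub> ?b \<otimes>\<^bsub>A s\<^esub> ?b = \<one>\<^bsub>A s\<^esub>"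
      using c by (simp_all add: numeral_3_eq_3)
    have m: "?a \<otimes>\<^bsub>A s\<^esub> ?w s w = ?w s (\<alpha> w)" "?b \<otimes>\<^bsub>A s\<^esub> ?w s w = ?w s (\<gamma> w)" if "w \<in> ?W" for w
      using As.tword_mult[OF c 3 As.beta_beta_sq(1)[OF J(3,2)] that] unfolding \<alpha>_def \<gamma>_def by auto
    have pow: "(((\<otimes>\<^bsub>A s\<^esub>) ?b) ^^ i) y \<in> carrier (A s)" if "y \<in> carrier (A s)" for i y
      by (induction i) (use that c in auto)
    have "?w s w \<in> carrier (A s)" for w
      unfolding As.tword_def by (cases w) (auto intro!: pow As.m_closed c As.one_closed)
    then show ?thesis using c 3 m As.inv_equality by auto
  qed
  have cA: "bt s k \<otimes>\<^bsub>A s\<^esub> ?w s w = ?w s (\<alpha> w)" "bt s (Suc k) \<otimes>\<^bsub>A s\<^esub> ?w s w = ?w s (\<gamma> w)" "?w s w \<in> carrier (A s)"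
    if "s \<in> E" "w \<in> ?W" for s w
    using comp[OF that(1)] that(2) by blast+
  have cB: "bt s k \<in> carrier (A s)" "bt s (Suc k) \<in> carrier (A s)"
    "inv\<^bsub>A s\<^esub> (bt s k) = bt s k \<otimes>\<^bsub>A s\<^esub> bt s k" "inv\<^bsub>A s\<^esub> (bt s (Suc k)) = bt s (Suc k) \<otimes>\<^bsub>A s\<^esub> bt s (Suc k)"
    if "s \<in> E" for s
    using comp[OF that] by blast+
  have X: "{B.\<beta> k, B.\<beta> (Suc k)} \<subseteq> carrier B" using B.\<beta>_closed[of k] B.\<beta>_closed[of "Suc k"] J by simp
  have Q: "\<exists>w\<in>?W. \<forall>s\<in>E. x s = ?w s w" if "x \<in> B.ev ?J" for x
    using X that[unfolded ev]
  proof (induction rule: B.generate_left_induct)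
    case one
    have "\<forall>s\<in>E. \<one>\<^bsub>B\<^esub> s = ?w s (0, 3)" using E group.tword_def[OF grp] by auto
    then show ?case by (intro bexI[of _ "(0, 3)"]) auto
  next
    case (step h y)
    then obtain w where w: "w \<in> ?W" "\<forall>s\<in>E. y s = ?w s w" by blast
    from step(1) have "h = B.\<beta> k \<or> h = B.\<beta> (Suc k)" by blast
    then show ?case
    proof
      assume h: "h = B.\<beta> k"
      have "(h \<otimes>\<^bsub>B\<^esub> y) s = ?w s (\<alpha> w)" if "s \<in> E" for s
        using cA(1)[OF that w(1)] w(2) that E(1) beta_comp[of s k] unfolding h by (simp add: subset_iff)
      then show ?thesis by (intro bexI[OF _ \<alpha>W(1)[OF w(1)]] ballI)
    next
      assume h: "h = B.\<beta> (Suc k)"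
      have "(h \<otimes>\<^bsub>B\<^esub> y) s = ?w s (\<gamma> w)" if "s \<in> E" for s
        using cA(2)[OF that w(1)] w(2) that E(1) beta_comp[of s "Suc k"] unfolding h by (simp add: subset_iff)
      then show ?thesis by (intro bexI[OF _ \<alpha>W(2)[OF w(1)]] ballI)
    qed
  next
    case (inv_step h y)
    then obtain w where w: "w \<in> ?W" "\<forall>s\<in>E. y s = ?w s w" by blast
    from inv_step(1) have "h = B.\<beta> k \<or> h = B.\<beta> (Suc k)" by blast
    then show ?case
    proof
      assume h: "h = B.\<beta> k"
      have "(inv\<^bsub>B\<^esub> h \<otimes>\<^bsub>B\<^esub> y) s = ?w s (\<alpha> (\<alpha> w))" if s: "s \<in> E" for s
      proof -
        have sI: "s \<in> I" using s E by auto
        interpret As: group "A s" by (rule grp[OF sI])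
        have "(inv\<^bsub>B\<^esub> h \<otimes>\<^bsub>B\<^esub> y) s = inv\<^bsub>A s\<^esub> (bt s k) \<otimes>\<^bsub>A s\<^esub> ?w s w"
          using B_inv[of h s] sI w(2) s beta_comp[OF sI, of k] B.\<beta>_closed[of k] J unfolding h by simp
        also have "\<dots> = bt s k \<otimes>\<^bsub>A s\<^esub> (bt s k \<otimes>\<^bsub>A s\<^esub> ?w s w)" using cB[OF s] cA(3)[OF s w(1)] As.m_assoc by simp
        also have "\<dots> = ?w s (\<alpha> (\<alpha> w))" using cA(1)[OF s w(1)] cA(1)[OF s \<alpha>W(1)[OF w(1)]] by simp
        finally show ?thesis .
      qed
      then show ?thesis by (intro bexI[OF _ \<alpha>W(1)[OF \<alpha>W(1)[OF w(1)]]] ballI)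
    next
      assume h: "h = B.\<beta> (Suc k)"
      have "(inv\<^bsub>B\<^esub> h \<otimes>\<^bsub>B\<^esub> y) s = ?w s (\<gamma> (\<gamma> w))" if s: "s \<in> E" for s
      proof -
        have sI: "s \<in> I" using s E by auto
        interpret As: group "A s" by (rule grp[OF sI])
        have "(inv\<^bsub>B\<^esub> h \<otimes>\<^bsub>B\<^esub> y) s = inv\<^bsub>A s\<^esub> (bt s (Suc k)) \<otimes>\<^bsub>A s\<^esub> ?w s w"
          using B_inv[of h s] sI w(2) s beta_comp[OF sI, of "Suc k"] B.\<beta>_closed[of "Suc k"] J unfolding h by simp
        also have "\<dots> = bt s (Suc k) \<otimes>\<^bsub>A s\<^esub> (bt s (Suc k) \<otimes>\<^bsub>A s\<^esub> ?w s w)" using cB[OF s] cA(3)[OF s w(1)] As.m_assoc by simp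
        also have "\<dots> = ?w s (\<gamma> (\<gamma> w))" using cA(2)[OF s w(1)] cA(2)[OF s \<alpha>W(2)[OF w(1)]] by simp
        finally show ?thesis .
      qed
      then show ?thesis by (intro bexI[OF _ \<alpha>W(2)[OF \<alpha>W(2)[OF w(1)]]] ballI)
    qed
  qed
  have r1I: "r1 \<in> I" using E by auto
  have "ev r1 ?J \<subseteq> ?w r1 ` ?W"
  proof
    fix y assume "y \<in> ev r1 ?J"
    from ev_surj[OF r1I J(1) this] obtain z where "z \<in> B.ev ?J" "z r1 = y" by (elim bexE)
    then obtain w where "w \<in> ?W" "\<forall>s\<in>E. z s = ?w s w" by (elim bexE[OF Q])
    then show "y \<in> ?w r1 ` ?W" using E(2) \<open>z r1 = y\<close> by (intro image_eqI[of _ _ w]) auto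
  qed
  then have "12 \<le> card (?w r1 ` ?W)" using card_mono[of "?w r1 ` ?W" "ev r1 ?J"] c12 by simp
  moreover have cW: "card ?W = 12" by simp
  ultimately have "card (?w r1 ` ?W) = card ?W" using card_image_le[of ?W "?w r1"] by simp
  then have inj: "inj_on (?w r1) ?W" by (intro eq_card_imp_inj_on) auto
  obtain w where w: "w \<in> ?W" "\<forall>s\<in>E. x s = ?w s w" using Q[OF x(1)] by (elim bexE)
  have "?w r1 w = ?w r1 (0, 3)" using w(2) E(2) x(2) group.tword_def[OF grp[OF r1I]] by simp
  then have "w = (0, 3)" using inj w(1) by (auto dest!: inj_onD)
  then show ?thesis using w(2) s E group.tword_def[OF grp[of s]] by auto
qed

end

section \<open>Splitting of the product and orders of the subgroups\<close>

definition schlafli_entry :: "nat \<Rightarrow> nat \<Rightarrow> nat" where "schlafli_entry r k = (if k = 1 then first_entry r else if k = 2 then second_entry r else third_entry r)"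

context mixed
begin

lemma ord_bt: assumes "r \<in> I" "0 < k" "k < 4" shows "group.ord (A r) (bt r k) = schlafli_entry r k"
proof -
  have "k = 1 \<or> k = 2 \<or> k = 3" using assms by linarith
  then show ?thesis using ords[OF assms(1)] unfolding schlafli_entry_def by (elim disjE) simp_all
qed

lemma bt_pow: assumes "r \<in> I" "0 < k" "k < 4" shows "bt r k [^]\<^bsub>A r\<^esub> (n::nat) = \<one>\<^bsub>A r\<^esub> \<longleftrightarrow> schlafli_entry r k dvd n"
  using group.pow_eq_id[OF grp[OF assms(1)] bt_car[OF assms]] ord_bt[OF assms] by simp

text \<open>
  The power \<open>Suc n\<close> kills the components of the other factors and fixes the component of \<open>r\<close>.
\<close>

lemma emb_start:
  assumes r: "r \<in> I" and k: "0 < k" "k < 4" and J: "J \<subseteq> {..<4}" "B.\<beta> k \<in> B.ev J"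
    and n: "\<And>s. s \<in> I \<Longrightarrow> s \<noteq> r \<Longrightarrow> schlafli_entry s k dvd Suc n" "schlafli_entry r k dvd n"
  shows "emb r (bt r k) \<in> B.ev J"
proof -
  have bc: "B.\<beta> k \<in> carrier B" using B.\<beta>_closed k by simp
  have "B.\<beta> k [^]\<^bsub>B\<^esub> Suc n = emb r (bt r k)"
  proof (rule B_eqI)
    show "B.\<beta> k [^]\<^bsub>B\<^esub> Suc n \<in> carrier B" using bc by (rule B.nat_pow_closed)
    show "emb r (bt r k) \<in> carrier B" by (rule emb_car[OF r bt_car[OF r k]])
    fix s assume s: "s \<in> I"
    interpret As: group "A s" by (rule grp[OF s])
    show "(B.\<beta> k [^]\<^bsub>B\<^esub> Suc n) s = emb r (bt r k) s"
    proof (cases "s = r")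
      case True
      then have "bt s k [^]\<^bsub>A s\<^esub> n = \<one>\<^bsub>A s\<^esub>" using bt_pow[OF s k] n(2) by simp
      then show ?thesis using True s B_pow[OF bc s, of "Suc n"] beta_comp[OF s, of k] As.l_one[OF bt_car[OF s k]]
        by (simp add: emb_def)
    next
      case False
      then have "bt s k [^]\<^bsub>A s\<^esub> Suc n = \<one>\<^bsub>A s\<^esub>" using bt_pow[OF s k, of "Suc n"] n(1)[OF s] by simp
      then show ?thesis using False s B_pow[OF bc s, of "Suc n"] beta_comp[OF s, of k]
        by (simp add: emb_def)
    qed
  qed
  then show ?thesis using B_ev_pow[OF J, of "Suc n"] by simp
qed

lemma beta_ev: assumes "b < 4" "k \<in> {Suc a..b}" shows "B.\<beta> k \<in> B.ev {a..b}"
  using B.ev_interval[OF assms(1)] assms(2) by (auto intro: generate.incl)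

lemma emb_neighbour:
  assumes r: "r \<in> I" and b: "b < 4" and k: "k \<in> {Suc a..b}" "l \<in> {Suc a..b}" "l = Suc k \<or> k = Suc l"
    and e: "emb r (bt r k) \<in> B.ev {a..b}" and o: "schlafli_entry r l = 3"
  shows "emb r (bt r l) \<in> B.ev {a..b}"
proof -
  interpret Ar: string_group "A r" "\<rho> r" "S r" "sg r" by (rule sgp[OF r])
  have J: "{a..b} \<subseteq> {..<4}" using b by auto
  have kl: "0 < k" "k < 4" "0 < l" "l < 4" using k b by auto
  have y: "bt r l \<in> ev r {a..b}"
    using ev_comp[OF r J beta_ev[OF b k(2)]] beta_comp[OF r] by simp
  have "(bt r k \<otimes>\<^bsub>A r\<^esub> bt r l) \<otimes>\<^bsub>A r\<^esub> (bt r k \<otimes>\<^bsub>A r\<^esub> bt r l) = \<one>\<^bsub>A r\<^esub>"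
    using k(3) Ar.beta_beta_sq(1)[of k] Ar.beta_beta_sq(2)[of l] kl by auto
  moreover have "bt r l [^]\<^bsub>A r\<^esub> (3::nat) = \<one>\<^bsub>A r\<^esub>" using bt_pow[OF r kl(3,4)] o by simp
  ultimately show ?thesis using emb_propagate[OF r J e bt_car[OF r kl(1,2)] y] by blast
qed

text \<open>
  The position at which the Schlaefli symbol has the entry that distinguishes the polytope from the simplex.
\<close>

definition odd_node :: "nat \<Rightarrow> nat" where "odd_node r = (if r = 4 then 2 else if r \<le> 3 then 3 else 1)"

lemma I6: assumes "s \<in> I" shows "s = 1 \<or> s = 2 \<or> s = 3 \<or> s = 4 \<or> s = 5 \<or> s = 6"
proof -
  have "1 \<le> s \<and> s \<le> 6" using I(1) assms by auto
  then show ?thesis by linarith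
qed

lemma emb_start': assumes r: "r \<in> I" "r \<noteq> 1" and b: "b < 4" "odd_node r \<in> {Suc a..b}"
  shows "emb r (bt r (odd_node r)) \<in> B.ev {a..b}"
proof -
  \<comment> \<open>the exponents 45, 9 and 36 are 1 modulo the distinguished entry and multiples of the other entries at this position\<close>
  define n :: nat where "n = (if r = 2 \<or> r = 5 then 44 else if r = 4 then 8 else 35)"
  have "schlafli_entry s (odd_node r) dvd Suc n" if "s \<in> I" "s \<noteq> r" for s
    using I6[OF r(1)] I6[OF that(1)] that(2) r(2) unfolding schlafli_entry_def odd_node_def first_entry_def second_entry_def third_entry_def n_def
    by (elim disjE) simp_all
  moreover have "schlafli_entry r (odd_node r) dvd n"
    using I6[OF r(1)] r(2) unfolding schlafli_entry_def odd_node_def first_entry_def second_entry_def third_entry_def n_def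
    by (elim disjE) simp_all
  moreover have "0 < odd_node r" "odd_node r < 4" using b by auto
  moreover have "{a..b} \<subseteq> {..<4}" using b by auto
  ultimately show ?thesis using emb_start[OF r(1)] beta_ev[OF b] by blast
qed

text \<open>
  Start at the distinguished generator and move along the diagram; all other generators of this factor have order 3.
\<close>

lemma splits_all: assumes r: "r \<in> I" "r \<noteq> 1" and b: "b < 4" "odd_node r \<in> {Suc a..b}"
  shows "splits {a..b} r"
proof (rule splitsI[OF r(1) b(1)])
  fix l assume l: "l \<in> {Suc a..b}"
  note st = emb_start'[OF r b]
  have o: "schlafli_entry r k = 3" if "0 < k" "k < 4" "k \<noteq> odd_node r" for k
  proof -
    have "k = 1 \<or> k = 2 \<or> k = 3" using that by linarith
    then show ?thesis using that(3) unfolding schlafli_entry_def first_entry_def second_entry_def third_entry_def odd_node_def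
      by (elim disjE) (auto split: if_splits)
  qed
  have adj_flag: "emb r (bt r k) \<in> B.ev {a..b}" if "k \<in> {Suc a..b}" "k = Suc (odd_node r) \<or> odd_node r = Suc k" for k
    by (rule emb_neighbour[OF r(1) b(1) b(2) that(1) _ st o]) (use that b in auto)
  consider "l = odd_node r" | "l = Suc (odd_node r) \<or> odd_node r = Suc l" | "l = 3" "odd_node r = 1" | "l = 1" "odd_node r = 3"
    using l b(1) unfolding odd_node_def by fastforce
  then show "emb r (bt r l) \<in> B.ev {a..b}"
  proof cases
    case 1 then show ?thesis using st by simp
  next
    case 2 then show ?thesis using adj_flag[OF l] by simp
  next
    case 3
    then have 2: "2 \<in> {Suc a..b}" using b l by auto
    have "emb r (bt r 2) \<in> B.ev {a..b}" by (rule adj_flag[OF 2]) (use 3 in simp)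
    then show ?thesis by (intro emb_neighbour[OF r(1) b(1) 2 l _ _ o]) (use 3 in simp_all)
  next
    case 4
    then have 2: "2 \<in> {Suc a..b}" using b l by auto
    have "emb r (bt r 2) \<in> B.ev {a..b}" by (rule adj_flag[OF 2]) (use 4 in simp)
    then show ?thesis by (intro emb_neighbour[OF r(1) b(1) 2 l _ _ o]) (use 4 in simp_all)
  qed
qed

lemma splits_03: "r \<in> I \<Longrightarrow> r \<noteq> 1 \<Longrightarrow> splits {0..3} r"
  by (rule splits_all) (auto simp: odd_node_def)
lemma splits_02: "r \<in> I \<Longrightarrow> r \<ge> 4 \<Longrightarrow> splits {0..2} r"
  by (rule splits_all) (auto simp: odd_node_def)
lemma splits_13: "r \<in> I \<Longrightarrow> r \<in> {2,3,4} \<Longrightarrow> splits {1..3} r"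
  by (rule splits_all) (auto simp: odd_node_def)

lemma card_all: "card (B.ev {0..3}) = (\<Prod>r\<in>I. rot_order r)"
proof -
  define r1 where "r1 = (if 1 \<in> I then 1 else r0)"
  have r1: "r1 \<in> I" unfolding r1_def using r0 by auto
  have "card (B.ev {0..3}) = (\<Prod>r\<in>insert r1 (I - {r1}). card (ev r {0..3}))"
  proof (rule card_split[OF _ r1])
    fix r assume "r \<in> I - {r1}"
    then show "splits {0..3} r" using splits_03[of r] unfolding r1_def by (auto split: if_splits)
  qed auto
  also have "insert r1 (I - {r1}) = I" using r1 by auto
  also have "(\<Prod>r\<in>I. card (ev r {0..3})) = (\<Prod>r\<in>I. rot_order r)" by (rule prod.cong) (auto simp: cards)
  finally show ?thesis .
qed

lemma det_02: assumes "x \<in> B.ev {0..2}" "r1 \<in> I \<inter> {1,2,3}" "x r1 = \<one>\<^bsub>A r1\<^esub>" "s \<in> I \<inter> {1,2,3}" shows "x s = \<one>\<^bsub>A s\<^esub>"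
proof -
  have "facet_rot_order r1 = 12" using assms(2) by (auto simp: facet_rot_order_def)
  then show ?thesis
    by (intro det_tetra[of 1 "I \<inter> {1,2,3}" r1 x s]) (use assms ord_bt cards in \<open>auto simp: schlafli_entry_def first_entry_def second_entry_def numeral_2_eq_2\<close>)
qed

lemma det_13: assumes "x \<in> B.ev {1..3}" "r1 \<in> I \<inter> {1,5,6}" "x r1 = \<one>\<^bsub>A r1\<^esub>" "s \<in> I \<inter> {1,5,6}" shows "x s = \<one>\<^bsub>A s\<^esub>"
proof -
  have "vfig_rot_order r1 = 12" using assms(2) by (auto simp: vfig_rot_order_def)
  then show ?thesis
    by (intro det_tetra[of 2 "I \<inter> {1,5,6}" r1 x s]) (use assms ord_bt cards in \<open>auto simp: schlafli_entry_def third_entry_def second_entry_def\<close>)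
qed

lemma card_02: "card (B.ev {0..2}) = (if I \<inter> {1,2,3} = {} then 1 else 12) * (\<Prod>r\<in>I \<inter> {4,5,6}. facet_rot_order r)"
proof (cases "I \<inter> {1,2,3} = {}")
  case True
  have I4': "4 \<le> r" if "r \<in> I" for r using I6[OF that] True that by auto
  have "card (B.ev {0..2}) = (\<Prod>r\<in>insert r0 (I - {r0}). card (ev r {0..2}))"
    by (rule card_split[OF _ r0]) (use splits_02 I4' in auto)
  also have "insert r0 (I - {r0}) = I" using r0 by auto
  also have "(\<Prod>r\<in>I. card (ev r {0..2})) = (\<Prod>r\<in>I. facet_rot_order r)" by (rule prod.cong) (simp_all add: cards del: One_nat_def)
  finally have "card (B.ev {0..2}) = (\<Prod>r\<in>I. facet_rot_order r)" .
  moreover have "I \<inter> {4,5,6} = I" using I6 True by auto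
  ultimately show ?thesis using True by simp
next
  case False
  then obtain r1 where r1: "r1 \<in> I \<inter> {1,2,3}" by blast
  have "card (B.ev {0..2}) = (\<Prod>r\<in>insert r1 (I \<inter> {4,5,6}). card (ev r {0..2}))"
  proof (rule card_split)
    show "x s = \<one>\<^bsub>A s\<^esub>" if "x \<in> B.ev {0..2}" "x r1 = \<one>\<^bsub>A r1\<^esub>" "s \<in> I - I \<inter> {4,5,6}" for x s
      by (rule det_02[OF that(1) r1 that(2)]) (use that(3) I6 in auto)
  qed (use r1 splits_02 in auto)
  also have "\<dots> = (\<Prod>r\<in>insert r1 (I \<inter> {4,5,6}). facet_rot_order r)" by (rule prod.cong) (use r1 in \<open>auto simp: cards simp del: One_nat_def\<close>)
  also have "\<dots> = facet_rot_order r1 * (\<Prod>r\<in>I \<inter> {4,5,6}. facet_rot_order r)" using r1 by (intro prod.insert) auto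
  also have "facet_rot_order r1 = 12" using r1 by (auto simp: facet_rot_order_def)
  finally show ?thesis unfolding if_not_P[OF False] .
qed

lemma card_13: "card (B.ev {1..3}) = (if I \<inter> {1,5,6} = {} then 1 else 12) * (\<Prod>r\<in>I \<inter> {2,3,4}. vfig_rot_order r)"
proof (cases "I \<inter> {1,5,6} = {}")
  case True
  then have I4: "I \<inter> {2,3,4} = I" using I6 by auto
  have "card (B.ev {1..3}) = (\<Prod>r\<in>insert r0 (I - {r0}). card (ev r {1..3}))"
    by (rule card_split[OF _ r0]) (use splits_13 I4 in auto)
  also have "insert r0 (I - {r0}) = I" using r0 by auto
  also have "(\<Prod>r\<in>I. card (ev r {1..3})) = (\<Prod>r\<in>I. vfig_rot_order r)" by (rule prod.cong) (simp_all add: cards del: One_nat_def)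
  finally show ?thesis using True I4 by simp
next
  case False
  then obtain r1 where r1: "r1 \<in> I \<inter> {1,5,6}" by blast
  have "card (B.ev {1..3}) = (\<Prod>r\<in>insert r1 (I \<inter> {2,3,4}). card (ev r {1..3}))"
  proof (rule card_split)
    show "x s = \<one>\<^bsub>A s\<^esub>" if "x \<in> B.ev {1..3}" "x r1 = \<one>\<^bsub>A r1\<^esub>" "s \<in> I - I \<inter> {2,3,4}" for x s
      by (rule det_13[OF that(1) r1 that(2)]) (use that(3) I6 in auto)
  qed (use r1 splits_13 in auto)
  also have "\<dots> = (\<Prod>r\<in>insert r1 (I \<inter> {2,3,4}). vfig_rot_order r)" by (rule prod.cong) (use r1 in \<open>auto simp: cards simp del: One_nat_def\<close>)
  also have "\<dots> = vfig_rot_order r1 * (\<Prod>r\<in>I \<inter> {2,3,4}. vfig_rot_order r)" using r1 by (intro prod.insert) auto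
  also have "vfig_rot_order r1 = 12" using r1 by (auto simp: vfig_rot_order_def)
  finally show ?thesis unfolding if_not_P[OF False] .
qed

lemma ord_B: assumes k: "0 < k" "k < 4" shows "B.ord (B.\<beta> k) = Lcm ((\<lambda>r. schlafli_entry r k) ` I)"
proof -
  have bc: "B.\<beta> k \<in> carrier B" using B.\<beta>_closed k by simp
  have "B.ord (B.\<beta> k) dvd n \<longleftrightarrow> Lcm ((\<lambda>r. schlafli_entry r k) ` I) dvd n" for n
  proof -
    have "B.ord (B.\<beta> k) dvd n \<longleftrightarrow> B.\<beta> k [^]\<^bsub>B\<^esub> n = \<one>\<^bsub>B\<^esub>" using B.pow_eq_id[OF bc] by simp
    also have "\<dots> \<longleftrightarrow> (\<forall>r\<in>I. (B.\<beta> k [^]\<^bsub>B\<^esub> n) r = \<one>\<^bsub>A r\<^esub>)"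
      using B_eqI[OF B.nat_pow_closed[OF bc] B.one_closed] B_one by metis
    also have "\<dots> \<longleftrightarrow> (\<forall>r\<in>I. schlafli_entry r k dvd n)"
      using B_pow[OF bc] beta_comp bt_pow[OF _ k] by auto
    also have "\<dots> \<longleftrightarrow> Lcm ((\<lambda>r. schlafli_entry r k) ` I) dvd n" by (auto simp: Lcm_dvd_iff)
    finally show ?thesis .
  qed
  then show ?thesis by (metis dvd_antisym dvd_refl)
qed

text \<open>
  The subgroup is a cyclic group with a factor of order 2 split off; the order of a tuple is the least common multiple.
\<close>

lemma card_023: "card (B.ev {0,2,3}) = 2 * Lcm (third_entry ` I)"
proof -
  have "insert 0 {2..Suc 2} = {0,2,3::nat}" by auto
  then show ?thesis using B.card_ev_insert[of 0 2] ord_B[of 3] by (simp add: schlafli_entry_def)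
qed

lemma card_013: "card (B.ev {0,1,3}) = 2 * Lcm (first_entry ` I)"
proof -
  have "insert 3 {0..Suc 0} = {0,1,3::nat}" by auto
  then show ?thesis using B.card_ev_insert[of 3 0] ord_B[of 1] by (simp add: schlafli_entry_def)
qed

end

section \<open>Polytopality, and the mix as a coset poset\<close>

context mixed
begin

lemma U: "{..<4} - {0} = {1..3::nat}" "{..<4} - {3} = {0..2::nat}" "{1, 2} = {1..2::nat}"
  "{..<4} - {1} = {0, 2, 3::nat}" "{..<4} - {2} = {0, 1, 3::nat}" by auto

lemma U4: "{..<4} = {0..3::nat}" by auto

lemma J4: "{1..3} \<subseteq> {..<4::nat}" "{0..2} \<subseteq> {..<4::nat}" "{1..2} \<subseteq> {..<4::nat}" by auto

text \<open>
  Odd elements can be made even by \<open>\<rho>\<^sub>1\<close>, which belongs to all three subgroups.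
\<close>

lemma inter_even:
  "B.P 0 \<inter> B.P 3 \<subseteq> B.par {1,2} \<longleftrightarrow> B.ev {1..3} \<inter> B.ev {0..2} \<subseteq> B.ev {1..2}"
proof
  assume H: "B.P 0 \<inter> B.P 3 \<subseteq> B.par {1,2}"
  show "B.ev {1..3} \<inter> B.ev {0..2} \<subseteq> B.ev {1..2}"
  proof
    fix x assume "x \<in> B.ev {1..3} \<inter> B.ev {0..2}"
    then have "x \<in> B.par {1..3}" "x \<in> B.par {0..2}" "sgB x = 1"
      using B.ev_iff[OF J4(1), of x] B.ev_iff[OF J4(2), of x] by auto
    then show "x \<in> B.ev {1..2}" using H B.ev_iff[OF J4(3), of x] unfolding U by auto
  qed
next
  assume H: "B.ev {1..3} \<inter> B.ev {0..2} \<subseteq> B.ev {1..2}"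
  show "B.P 0 \<inter> B.P 3 \<subseteq> B.par {1,2}"
  proof
    fix x assume x: "x \<in> B.P 0 \<inter> B.P 3"
    have red: "y \<in> B.par {1..2}" if "y \<in> B.par {1..3}" "y \<in> B.par {0..2}" "sgB y = 1" for y
      using that H B.ev_iff[OF J4(1), of y] B.ev_iff[OF J4(2), of y] B.ev_iff[OF J4(3), of y] by auto
    have x': "x \<in> B.par {1..3}" "x \<in> B.par {0..2}" using x unfolding U by auto
    have xc: "x \<in> carrier B" by (rule B.par_closed[OF J4(1) x'(1)])
    show "x \<in> B.par {1,2}"
    proof (cases "sgB x = 1")
      case True
      then show ?thesis using red[OF x'] unfolding U by blast
    next
      case False
      then have "sgB x = -1" using B.sg_par[OF J4(1) x'(1)] by auto
      then have s: "sgB (R 1 \<otimes>\<^bsub>B\<^esub> x) = 1" using B.sg_mult[OF B.rho_closed[of 1] xc] B.sg_rho[of 1] by simp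
      have "R 1 \<in> B.par {1..3}" "R 1 \<in> B.par {0..2}" "R 1 \<in> B.par {1..2}" by (rule B.rho_par, simp)+
      note R1 = this
      have "R 1 \<otimes>\<^bsub>B\<^esub> x \<in> B.par {1..2}"
        by (rule red[OF _ _ s]) (use x' R1 B.par_mult[OF J4(1)] B.par_mult[OF J4(2)] in blast)+
      then have "R 1 \<otimes>\<^bsub>B\<^esub> (R 1 \<otimes>\<^bsub>B\<^esub> x) \<in> B.par {1..2}" using R1(3) B.par_mult[OF J4(3)] by blast
      then show ?thesis using B.rho_rho[of 1 x] xc unfolding U by simp
    qed
  qed
qed

lemma beta2_powers: "x \<in> B.ev {1..2} \<longleftrightarrow> (\<exists>k::nat. x = B.\<beta> 2 [^]\<^bsub>B\<^esub> k)"
proof -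
  have "{Suc 1..2} = {2::nat}" by auto
  then have "B.ev {1..2} = generate B {B.\<beta> 2}" using B.ev_interval[of 2 1] by (simp del: One_nat_def)
  moreover have "schlafli_entry r 2 \<noteq> 0" for r by (simp add: schlafli_entry_def second_entry_def)
  then have "B.ord (B.\<beta> 2) \<noteq> 0" using ord_B[of 2] finI by (auto simp: Lcm_0_iff image_iff)
  then have "generate B {B.\<beta> 2} = {B.\<beta> 2 [^]\<^bsub>B\<^esub> k | k. k \<in> (UNIV :: nat set)}"
    using B.generate_pow_nat B.\<beta>_closed[of 2] by simp
  ultimately show ?thesis by auto
qed

lemma comp_powers: assumes "r \<in> I" "x \<in> ev r {1..2}" shows "\<exists>k::nat. x = bt r 2 [^]\<^bsub>A r\<^esub> k"
proof -
  from ev_surj[OF assms(1) J4(3) assms(2)] obtain z where z: "z \<in> B.ev {1..2}" "z r = x" by (elim bexE)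
  then obtain k :: nat where "z = B.\<beta> 2 [^]\<^bsub>B\<^esub> k" using beta2_powers by blast
  then show ?thesis using z(2) B_pow[of "B.\<beta> 2" r k] B.\<beta>_closed[of 2] assms(1) beta_comp[OF assms(1)] by auto
qed

text \<open>The intersection property of each single factor.\<close>

lemma comp_inter: assumes r: "r \<in> I" and x: "x \<in> B.ev {1..3}" "x \<in> B.ev {0..2}" shows "x r \<in> ev r {1..2}"
proof -
  interpret Ar: string_group "A r" "\<rho> r" "S r" "sg r" by (rule sgp[OF r])
  have e: "x r \<in> ev r {1..3}" "x r \<in> ev r {0..2}" using ev_comp[OF r J4(1) x(1)] ev_comp[OF r J4(2) x(2)] .
  then have "x r \<in> par r {1..3} \<inter> par r {0..2}" using Ar.ev_sub_par[OF J4(1)] Ar.ev_sub_par[OF J4(2)] by blast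
  then have "x r \<in> par r {1..2}" using inter[OF r] unfolding U by blast
  moreover have "sg r (x r) = 1" using Ar.sg_ev[OF J4(1) e(1)] .
  ultimately show ?thesis using Ar.ev_iff[OF J4(3)] by blast
qed

text \<open>
  Divide by the \<open>k\<close>-th power of the middle generator: the quotient is trivial at \<open>r1\<close>, so by the diagonal parts it is
  trivial at all factors with the same facets \<open>{3,3}\<close> or the same vertex figures \<open>{3,3}\<close>.
\<close>

lemma common_power:
  assumes x: "x \<in> B.ev {1..3}" "x \<in> B.ev {0..2}" and r1: "r1 \<in> I" "x r1 = bt r1 2 [^]\<^bsub>A r1\<^esub> (k::nat)"
    and s: "s \<in> I" "r1 \<in> {1,2,3} \<and> s \<in> {1,2,3} \<or> r1 \<in> {1,5,6} \<and> s \<in> {1,5,6}"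
  shows "x s = bt s 2 [^]\<^bsub>A s\<^esub> k"
proof -
  let ?b = "B.\<beta> 2 [^]\<^bsub>B\<^esub> k" and ?z = "x \<otimes>\<^bsub>B\<^esub> inv\<^bsub>B\<^esub> (B.\<beta> 2 [^]\<^bsub>B\<^esub> k)"
  have bc: "B.\<beta> 2 \<in> carrier B" "?b \<in> carrier B" using B.\<beta>_closed[of 2] by auto
  have xc: "x \<in> carrier B" using B_car[OF J4(1) x(1)] .
  have be: "?b \<in> B.ev {1..3}" "?b \<in> B.ev {0..2}" by (rule B_ev_pow[OF J4(1) beta_ev], simp_all) (rule B_ev_pow[OF J4(2) beta_ev], simp_all)
  have z: "?z \<in> B.ev {1..3}" "?z \<in> B.ev {0..2}"
    using x be B.ev_mult[OF J4(1)] B.ev_mult[OF J4(2)] B_ev_inv[OF J4(1)] B_ev_inv[OF J4(2)] by blast+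
  have zc: "?z t = x t \<otimes>\<^bsub>A t\<^esub> inv\<^bsub>A t\<^esub> (bt t 2 [^]\<^bsub>A t\<^esub> k)" if "t \<in> I" for t
    using that B_inv[OF bc(2) that] B_pow[OF bc(1) that] beta_comp[OF that] by simp
  have cc: "bt t 2 [^]\<^bsub>A t\<^esub> k \<in> carrier (A t)" if "t \<in> I" for t
    using group.is_monoid[OF grp[OF that]] monoid.nat_pow_closed bt_car[OF that] by fastforce
  have "?z r1 = \<one>\<^bsub>A r1\<^esub>" using zc[OF r1(1)] r1(2) group.r_inv[OF grp[OF r1(1)] cc[OF r1(1)]] by simp
  then have "?z s = \<one>\<^bsub>A s\<^esub>" using s r1(1) det_02[OF z(2), of r1 s] det_13[OF z(1), of r1 s] by auto
  then show ?thesis using zc[OF s(1)] cc[OF s(1)] B_comp[OF xc s(1)] grp[OF s(1)]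
    by (metis group.inv_closed group.inv_equality group.inv_inv)
qed

text \<open>
  The exponents of the factors other than \<open>{3,4,3}\<close> agree: the simplex has both tetrahedral facets and tetrahedral vertex
  figures, and without it only one of the two classes is present.
\<close>

lemma inter_yes:
  assumes cond: "1 \<in> I \<or> I \<inter> {2,3} = {} \<or> I \<inter> {5,6} = {}"
  shows "B.ev {1..3} \<inter> B.ev {0..2} \<subseteq> B.ev {1..2}"
proof
  fix x assume "x \<in> B.ev {1..3} \<inter> B.ev {0..2}"
  then have x: "x \<in> B.ev {1..3}" "x \<in> B.ev {0..2}" by auto
  have pw: "\<exists>k::nat. x r = bt r 2 [^]\<^bsub>A r\<^esub> k" if "r \<in> I" for r
    using comp_powers[OF that comp_inter[OF that x]] .
  have "\<exists>k::nat. \<forall>s\<in>I - {4}. x s = bt s 2 [^]\<^bsub>A s\<^esub> k"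
  proof (cases "I - {4} = {}")
    case False
    define r1 where "r1 = (if 1 \<in> I then 1 else (SOME r. r \<in> I - {4}))"
    have r1: "r1 \<in> I - {4}" unfolding r1_def using False some_in_eq[of "I - {4}"] by auto
    then obtain k :: nat where k: "x r1 = bt r1 2 [^]\<^bsub>A r1\<^esub> k" using pw by blast
    have "x s = bt s 2 [^]\<^bsub>A s\<^esub> k" if s: "s \<in> I - {4}" for s
    proof (rule common_power[OF x _ k])
      show "r1 \<in> I" "s \<in> I" using r1 s by auto
      have 6: "r1 = 1 \<or> r1 = 2 \<or> r1 = 3 \<or> r1 = 5 \<or> r1 = 6" "s = 1 \<or> s = 2 \<or> s = 3 \<or> s = 5 \<or> s = 6"
        using I6[of r1] I6[of s] r1 s by auto
      have 1: "1 \<in> I \<Longrightarrow> r1 = 1" unfolding r1_def by simp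
      show "r1 \<in> {1,2,3} \<and> s \<in> {1,2,3} \<or> r1 \<in> {1,5,6} \<and> s \<in> {1,5,6}"
      proof (cases "1 \<in> I")
        case True
        then show ?thesis using 1 6(2) by auto
      next
        case False
        then have "r1 \<noteq> 1" "s \<noteq> 1" using r1 s by auto
        moreover have "I \<inter> {2,3} = {} \<or> I \<inter> {5,6} = {}" using cond False by blast
        ultimately show ?thesis using 6 r1 s by auto
      qed
    qed
    then show ?thesis by blast
  qed auto
  then obtain k :: nat where k: "\<forall>s\<in>I - {4}. x s = bt s 2 [^]\<^bsub>A s\<^esub> k" by blast
  have "\<exists>l::nat. 4 \<in> I \<longrightarrow> x 4 = bt 4 2 [^]\<^bsub>A 4\<^esub> l" using pw[of 4] by blast
  then obtain l :: nat where l: "4 \<in> I \<Longrightarrow> x 4 = bt 4 2 [^]\<^bsub>A 4\<^esub> l" by blast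
  have xc: "x \<in> carrier B" using B_car[OF J4(1) x(1)] .
  have bc: "B.\<beta> 2 \<in> carrier B" using B.\<beta>_closed[of 2] by auto
  \<comment> \<open>Chinese remainder: 4 is 1 modulo 3, and 9 is 1 modulo 4 and 0 modulo 3\<close>
  have "x = B.\<beta> 2 [^]\<^bsub>B\<^esub> (4 * k + 9 * l)"
  proof (rule B_eqI[OF xc B.nat_pow_closed[OF bc]])
    fix r assume r: "r \<in> I"
    interpret Ar: group "A r" by (rule grp[OF r])
    have b: "bt r 2 \<in> carrier (A r)" using bt_car[OF r] by simp
    have p: "bt r 2 [^]\<^bsub>A r\<^esub> (c + schlafli_entry r 2 * n) = bt r 2 [^]\<^bsub>A r\<^esub> c" for c n :: nat
      using b bt_pow[OF r, of 2 "schlafli_entry r 2"] Ar.nat_pow_mult[OF b, of c "schlafli_entry r 2 * n", symmetric]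
        Ar.nat_pow_pow[OF b, of "schlafli_entry r 2" n, symmetric] by simp
    have "x r = bt r 2 [^]\<^bsub>A r\<^esub> (4 * k + 9 * l)"
    proof (cases "r = 4")
      case True
      then have "4 * k + 9 * l = l + schlafli_entry r 2 * (k + 2 * l)" by (simp add: schlafli_entry_def second_entry_def algebra_simps)
      then have "bt r 2 [^]\<^bsub>A r\<^esub> (4 * k + 9 * l) = bt r 2 [^]\<^bsub>A r\<^esub> l" using p[of l "k + 2 * l"] by metis
      then show ?thesis using l True r by simp
    next
      case False
      then have "4 * k + 9 * l = k + schlafli_entry r 2 * (k + 3 * l)" by (simp add: schlafli_entry_def second_entry_def algebra_simps)
      then have "bt r 2 [^]\<^bsub>A r\<^esub> (4 * k + 9 * l) = bt r 2 [^]\<^bsub>A r\<^esub> k" using p[of k "k + 3 * l"] by metis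
      then show ?thesis using k False r by simp
    qed
    then show "x r = (B.\<beta> 2 [^]\<^bsub>B\<^esub> (4 * k + 9 * l)) r" using B_pow[OF bc r] beta_comp[OF r] by simp
  qed
  then show "x \<in> B.ev {1..2}" using beta2_powers by blast
qed

text \<open>
  The element is the middle generator on the factors with facets \<open>{3,3}\<close> and trivial on the others. It is in the
  vertex-figure subgroup, where the former can be modified independently, and in the facet subgroup, where the latter can;
  but no exponent is both 1 and 0 modulo 3.
\<close>

lemma inter_no:
  assumes cond: "1 \<notin> I" "r2 \<in> I \<inter> {2,3}" "r5 \<in> I \<inter> {5,6}"
  shows "\<not> B.ev {1..3} \<inter> B.ev {0..2} \<subseteq> B.ev {1..2}"
proof
  assume H: "B.ev {1..3} \<inter> B.ev {0..2} \<subseteq> B.ev {1..2}"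
  define x where "x = (\<lambda>r\<in>I. if r \<in> I \<inter> {2,3} then bt r 2 else \<one>\<^bsub>B\<^esub> r)"
  have b2: "B.\<beta> 2 \<in> B.ev {1..3}" "B.\<beta> 2 \<in> B.ev {0..2}" by (rule beta_ev, simp_all)+
  have bt2: "bt r 2 \<in> ev r {1..3}" if "r \<in> I" for r
    using ev_comp[OF that J4(1) b2(1)] beta_comp[OF that] by simp
  have x1: "x \<in> B.ev {1..3}" unfolding x_def
    by (rule modify[where y = "\<lambda>r. bt r 2"]) (use splits_13 bt2 B_ev_one[OF J4(1)] J4(1) in auto)
  have "(\<lambda>r\<in>I. if r \<in> I \<inter> {4,5,6} then \<one>\<^bsub>A r\<^esub> else B.\<beta> 2 r) \<in> B.ev {0..2}"
  proof (rule modify[where y = "\<lambda>r. \<one>\<^bsub>A r\<^esub>"])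
    show "\<one>\<^bsub>A r\<^esub> \<in> ev r {0..2}" if "r \<in> I \<inter> {4,5,6}" for r
      using ev_comp[OF _ J4(2) B_ev_one[OF J4(2)], of r] that by auto
  qed (use splits_02 b2 J4(2) in auto)
  moreover have "(\<lambda>r\<in>I. if r \<in> I \<inter> {4,5,6} then \<one>\<^bsub>A r\<^esub> else B.\<beta> 2 r) = x"
    unfolding x_def
  proof (rule restrict_ext)
    fix r assume r: "r \<in> I"
    then have "r \<noteq> 1" using cond by auto
    then show "(if r \<in> I \<inter> {4,5,6} then \<one>\<^bsub>A r\<^esub> else B.\<beta> 2 r) = (if r \<in> I \<inter> {2,3} then bt r 2 else \<one>\<^bsub>B\<^esub> r)"
      using I6[OF r] r beta_comp[OF r] by auto
  qed
  ultimately have "x \<in> B.ev {0..2}" by simp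
  then obtain k :: nat where k: "x = B.\<beta> 2 [^]\<^bsub>B\<^esub> k" using H x1 beta2_powers by blast
  have bc: "B.\<beta> 2 \<in> carrier B" using B.\<beta>_closed[of 2] by auto
  have comp: "x r = bt r 2 [^]\<^bsub>A r\<^esub> k" if "r \<in> I" for r
    using k B_pow[OF bc that] beta_comp[OF that] by simp
  have i: "r2 \<in> I" "r5 \<in> I" "r5 \<noteq> 4" "r2 \<noteq> 4" "r5 \<notin> {2,3}" using cond by auto
  have "bt r5 2 [^]\<^bsub>A r5\<^esub> k = \<one>\<^bsub>A r5\<^esub>" using comp[of r5] i unfolding x_def by simp
  then have "3 dvd k" using bt_pow[of r5 2] i by (simp add: schlafli_entry_def second_entry_def)
  then have "bt r2 2 [^]\<^bsub>A r2\<^esub> k = \<one>\<^bsub>A r2\<^esub>" using bt_pow[of r2 2] i by (simp add: schlafli_entry_def second_entry_def)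
  moreover have "x r2 = bt r2 2" using cond(2) unfolding x_def by auto
  ultimately have "bt r2 2 = \<one>\<^bsub>A r2\<^esub>" using comp[of r2] i by simp
  then have "bt r2 2 [^]\<^bsub>A r2\<^esub> (1::nat) = \<one>\<^bsub>A r2\<^esub>"
    using group.is_monoid[OF grp[OF i(1)]] monoid.nat_pow_one by fastforce
  then show False using bt_pow[of r2 2 1] i by (simp add: schlafli_entry_def second_entry_def)
qed

lemma polytopal: "abstract_polytope 4 B.M \<longleftrightarrow> 1 \<in> I \<or> I \<inter> {2,3} = {} \<or> I \<inter> {5,6} = {}"
  unfolding B.polytope_M inter_even using inter_yes inter_no by blast

lemma flags: "card (flags B.M) = 2 * (\<Prod>r\<in>I. rot_order r)"
  using B.card_flags_M card_all unfolding U4 by simp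

lemma numbers:
  "card (faces_of_rank B.M 0) * ((if I \<inter> {1,5,6} = {} then 1 else 12) * (\<Prod>r\<in>I \<inter> {2,3,4}. vfig_rot_order r)) = (\<Prod>r\<in>I. rot_order r)"
  "card (faces_of_rank B.M 1) * (2 * Lcm (third_entry ` I)) = (\<Prod>r\<in>I. rot_order r)"
  "card (faces_of_rank B.M 2) * (2 * Lcm (first_entry ` I)) = (\<Prod>r\<in>I. rot_order r)"
  "card (faces_of_rank B.M 3) * ((if I \<inter> {1,2,3} = {} then 1 else 12) * (\<Prod>r\<in>I \<inter> {4,5,6}. facet_rot_order r)) = (\<Prod>r\<in>I. rot_order r)"
  using B.card_faces_M[of 0, unfolded U, unfolded U4 card_13 card_all] B.card_faces_M[of 1, unfolded U, unfolded U4 card_023 card_all]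
    B.card_faces_M[of 2, unfolded U, unfolded U4 card_013 card_all] B.card_faces_M[of 3, unfolded U, unfolded U4 card_02 card_all]
  by simp_all

end

text \<open>
  The mix is built from words in the rotation generators, and the products telescope: \<open>\<beta>\<^sub>i \<cdots> \<beta>\<^sub>j = \<rho>\<^sub>i\<^sub>-\<^sub>1 \<rho>\<^sub>j\<close>. So its subgroups are
  the rotation subgroups of the parabolic subgroups of the product.
\<close>

lemma mix_eq:
  fixes Q :: "nat \<Rightarrow> ('a, 'm) ranked_poset_scheme"
  assumes "mixed I (\<lambda>r. aut_group (Q r)) (\<lambda>r. rho (Q r) (\<Phi> r)) S sg"
  shows "mix 4 I Q \<Phi> = string_group.M (product_group I (\<lambda>r. aut_group (Q r))) (mixed.R I (\<lambda>r. rho (Q r) (\<Phi> r)))"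
proof -
  interpret mixed I "\<lambda>r. aut_group (Q r)" "\<lambda>r. rho (Q r) (\<Phi> r)" S sg by (rule assms)
  have beta: "mix_beta I Q \<Phi> k = B.\<beta> k" for k
    unfolding mix_beta_def B.\<beta>_def mult_product_group R_def sigma_def by (auto intro!: restrict_ext)
  let ?H = "\<Pi>\<^sub>E r\<in>I. carrier (rotation_group 4 (Q r) (\<Phi> r))"
  have rot: "product_group I (\<lambda>r. rotation_group 4 (Q r) (\<Phi> r)) = B\<lparr>carrier := ?H\<rparr>"
    unfolding product_group_def rotation_group_def subgroup_generated_def by simp
  have sg_sub: "sigma (Q r) (\<Phi> r) ` {1..4 - 1} \<subseteq> carrier (aut_group (Q r))" if "r \<in> I" for r
  proof
    fix y assume "y \<in> sigma (Q r) (\<Phi> r) ` {1..4 - 1}"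
    then obtain k where k: "k \<in> {1..3}" "y = sigma (Q r) (\<Phi> r) k" by auto
    then have "y = bt r k" using bt_def[OF that] unfolding sigma_def by simp
    then show "y \<in> carrier (aut_group (Q r))" using bt_car[OF that, of k] k(1) by auto
  qed
  have car_rot: "carrier (rotation_group 4 (Q r) (\<Phi> r)) = generate (aut_group (Q r)) (sigma (Q r) (\<Phi> r) ` {1..4 - 1})" if "r \<in> I" for r
    using sg_sub[OF that] unfolding rotation_group_def carrier_subgroup_generated by (simp add: Int_absorb1)
  have "subgroup (carrier (rotation_group 4 (Q r) (\<Phi> r))) (aut_group (Q r))" if "r \<in> I" for r
    unfolding car_rot[OF that] by (rule group.generate_is_subgroup[OF grp[OF that] sg_sub[OF that]])
  then have H: "subgroup ?H B" using PiE_subgroup_product_group[of I "\<lambda>r. aut_group (Q r)"] grp by blast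
  have bH: "B.\<beta> ` {1..3} \<subseteq> ?H"
  proof
    fix y assume "y \<in> B.\<beta> ` {1..3}"
    then obtain k where k: "k \<in> {1..3}" "y = mix_beta I Q \<Phi> k" using beta by auto
    have "sigma (Q r) (\<Phi> r) k \<in> carrier (rotation_group 4 (Q r) (\<Phi> r))" if "r \<in> I" for r
      unfolding car_rot[OF that] by (rule generate.incl) (use k(1) in auto)
    then show "y \<in> ?H" unfolding k(2) mix_beta_def by auto
  qed
  have gen: "B.Gp = generate B (B.\<beta> ` {1..3})" using B.ev_interval[of 3 0] unfolding U4 by simp
  have mg: "mix_group 4 I Q \<Phi> = B\<lparr>carrier := B.Gp\<rparr>"
  proof -
    have "mix_beta I Q \<Phi> ` {1..4 - 1} = B.\<beta> ` {1..3}" using beta by simp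
    then have "mix_group 4 I Q \<Phi> = B\<lparr>carrier := generate (B\<lparr>carrier := ?H\<rparr>) (?H \<inter> B.\<beta> ` {1..3})\<rparr>"
      unfolding mix_group_def rot subgroup_generated_def by simp
    also have "?H \<inter> B.\<beta> ` {1..3} = B.\<beta> ` {1..3}" using bH by blast
    also have "generate (B\<lparr>carrier := ?H\<rparr>) (B.\<beta> ` {1..3}) = B.Gp"
      unfolding gen by (rule B.generate_consistent[OF bH H])
    finally show ?thesis .
  qed
  have word: "mix_word 4 I Q \<Phi> i j = R (i - 1) \<otimes>\<^bsub>B\<^esub> R j" if "1 \<le> i" "i \<le> j" "j \<le> 3" for i j
    using B.word[of i j] that unfolding mix_word_def mg beta by simp
  have sub: "mix_subgroup 4 I Q \<Phi> J = B.ev J" if J: "J \<subseteq> {..<4}" for J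
  proof -
    have X: "{mix_word 4 I Q \<Phi> i j | i j. 1 \<le> i \<and> i \<le> j \<and> j \<le> 4 - 1 \<and> i - 1 \<in> J \<and> j \<in> J}
        = {R a \<otimes>\<^bsub>B\<^esub> R b | a b. a \<in> J \<and> b \<in> J \<and> a < b}" (is "?X = ?Y")
    proof (intro equalityI subsetI)
      fix y assume "y \<in> ?X"
      then obtain i j where ij: "1 \<le> i" "i \<le> j" "j \<le> 3" "i - 1 \<in> J" "j \<in> J" "y = mix_word 4 I Q \<Phi> i j" by auto
      then have "y = R (i - 1) \<otimes>\<^bsub>B\<^esub> R j" using word by simp
      moreover have "i - 1 < j" using ij by linarith
      ultimately show "y \<in> ?Y" using ij by blast
    next
      fix y assume "y \<in> ?Y"
      then obtain a b where ab: "a \<in> J" "b \<in> J" "a < b" "y = R a \<otimes>\<^bsub>B\<^esub> R b" by blast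
      then have "b < 4" using J by auto
      then have "y = mix_word 4 I Q \<Phi> (Suc a) b" using ab word[of "Suc a" b] by simp
      then show "y \<in> ?X" using ab \<open>b < 4\<close> by (intro CollectI exI[of _ "Suc a"] exI[of _ b]) auto
    qed
    have Y: "?Y \<subseteq> B.Gp" using J B.rho_rho_ev[of _ "{..<4}"] by blast
    have "B.ev J = generate (B\<lparr>carrier := B.Gp\<rparr>) ?Y"
      unfolding B.ev_less[OF J] by (rule B.generate_consistent[symmetric, OF Y B.ev_subgroup]) simp
    then show ?thesis unfolding mix_subgroup_def mg X by simp
  qed
  have "{Coset_Face j C | j C. j < 4 \<and> C \<in> rcosets\<^bsub>mix_group 4 I Q \<Phi>\<^esub> (mix_subgroup 4 I Q \<Phi> ({..<4} - {j}))}
      = {B.face i g | i g. i < 4 \<and> g \<in> B.G}" (is "?L = ?R")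
  proof -
    have "?L = (\<Union>j<4. Coset_Face j ` (rcosets\<^bsub>B\<lparr>carrier := B.Gp\<rparr>\<^esub> (B.ev ({..<4} - {j}))))"
      unfolding mg using sub by auto
    also have "\<dots> = (\<Union>j<4. B.face j ` B.G)" using B.faces_eq_cosets by simp
    also have "\<dots> = ?R" by auto
    finally show ?thesis .
  qed
  then show ?thesis unfolding mix_def B.M_def by simp
qed

section \<open>The table\<close>

text \<open>
  For the last two polytopes the nodes are removed from the other end, so that the first orbit consists of facets,
  of which there are fewer than vertices.
\<close>

lemma chain_order_full:
  "chain_order 3 3 3 [0,1,2,3] = 120" "chain_order 3 3 4 [0,1,2,3] = 384" "chain_order 3 4 3 [0,1,2,3] = 1152" "chain_order 4 3 3 [3,2,1,0] = 384"
  by code_simp+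

lemma chain_order_600: "chain_order 3 3 5 [0,1,2,3] = 14400" by code_simp

lemma chain_order_120: "chain_order 5 3 3 [3,2,1,0] = 14400" by code_simp

lemma chain_order_facets:
  "chain_order 3 3 3 [0,1,2] = 24" "chain_order 3 3 4 [0,1,2] = 24" "chain_order 3 3 5 [0,1,2] = 24"
  "chain_order 3 4 3 [0,1,2] = 48" "chain_order 4 3 3 [2,1,0] = 48" "chain_order 5 3 3 [2,1,0] = 120"
  by code_simp+

lemma chain_order_vertex_figures:
  "chain_order 3 3 3 [1,2,3] = 24" "chain_order 3 3 4 [1,2,3] = 48" "chain_order 3 3 5 [1,2,3] = 120"
  "chain_order 3 4 3 [1,2,3] = 48" "chain_order 4 3 3 [1,2,3] = 24" "chain_order 5 3 3 [1,2,3] = 24"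
  by code_simp+

context flagged_4polytope
begin

lemma card_ev:
  assumes r: "r \<in> {1..6}" and sch: "schlafli_symbol 4 L \<Phi> = [first_entry r, second_entry r, third_entry r]"
  shows "card (string_group.ev AG (rho L \<Phi>) {0..3}) = rot_order r"
    "card (string_group.ev AG (rho L \<Phi>) {0..2}) = facet_rot_order r"
    "card (string_group.ev AG (rho L \<Phi>) {1..3}) = vfig_rot_order r"
proof -
  interpret AG: string_group AG "rho L \<Phi>" SA sgA by (rule string_group_AG)
  have r6: "r = 1 \<or> r = 2 \<or> r = 3 \<or> r = 4 \<or> r = 5 \<or> r = 6"
  proof -
    have "1 \<le> r \<and> r \<le> 6" using r by simp
    then show ?thesis by linarith
  qed
  have pqr: "(first_entry r, second_entry r, third_entry r) \<in> {(3,3,3), (3,3,4), (3,3,5), (3,4,3), (4,3,3), (5,3,3)}"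
    using r6 by (elim disjE) (simp_all add: first_entry_def second_entry_def third_entry_def)
  have gen: "card (AG.ev (set K)) = n" if "distinct K" "set K \<subseteq> {..<4}" "K \<noteq> []" "chain_order (first_entry r) (second_entry r) (third_entry r) K = 2 * n" "n \<noteq> 0" for K n
  proof -
    have "card (AG.par (set K)) = 2 * n"
      unfolding AG.par_def using card_generate[OF sch pqr that(1,2)] that(4,5) by simp
    then show ?thesis using AG.card_par[OF that(2)] that(3) by simp
  qed
  have s: "{0..3} = set [0,1,2,3::nat]" "{0..3} = set [3,2,1,0::nat]" "{0..2} = set [0,1,2::nat]"
    "{0..2} = set [2,1,0::nat]" "{1..3} = set [1,2,3::nat]" by auto
  have dist: "distinct [0,1,2,3::nat]" "distinct [3,2,1,0::nat]" "distinct [0,1,2::nat]" "distinct [2,1,0::nat]" "distinct [1,2,3::nat]"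
    by simp_all
  have l4: "set [0,1,2,3] \<subseteq> {..<4::nat}" "set [3,2,1,0] \<subseteq> {..<4::nat}" "set [0,1,2] \<subseteq> {..<4::nat}" "set [2,1,0] \<subseteq> {..<4::nat}" "set [1,2,3] \<subseteq> {..<4::nat}"
    by simp_all
  have "chain_order (first_entry r) (second_entry r) (third_entry r) [0,1,2,3] = 2 * rot_order r \<or> chain_order (first_entry r) (second_entry r) (third_entry r) [3,2,1,0] = 2 * rot_order r"
    using r6 by (elim disjE) (simp_all add: first_entry_def second_entry_def third_entry_def rot_order_def chain_order_full chain_order_600 chain_order_120 del: One_nat_def chain_order.simps)
  moreover have "rot_order r \<noteq> 0" "facet_rot_order r \<noteq> 0" "vfig_rot_order r \<noteq> 0" by (simp_all add: rot_order_def facet_rot_order_def vfig_rot_order_def)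
  note nz = this
  ultimately show "card (AG.ev {0..3}) = rot_order r"
    using gen[OF dist(1) l4(1), of "rot_order r"] gen[OF dist(2) l4(2), of "rot_order r"] unfolding s(1,2)[symmetric] by auto
  have "chain_order (first_entry r) (second_entry r) (third_entry r) [0,1,2] = 2 * facet_rot_order r \<or> chain_order (first_entry r) (second_entry r) (third_entry r) [2,1,0] = 2 * facet_rot_order r"
    using r6 by (elim disjE) (simp_all add: first_entry_def second_entry_def third_entry_def facet_rot_order_def chain_order_facets del: One_nat_def chain_order.simps)
  then show "card (AG.ev {0..2}) = facet_rot_order r"
    using gen[OF dist(3) l4(3), of "facet_rot_order r"] gen[OF dist(4) l4(4), of "facet_rot_order r"] nz unfolding s(3,4)[symmetric] by auto
  have "chain_order (first_entry r) (second_entry r) (third_entry r) [1,2,3] = 2 * vfig_rot_order r"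
    using r6 by (elim disjE) (simp_all add: first_entry_def second_entry_def third_entry_def vfig_rot_order_def chain_order_vertex_figures del: One_nat_def chain_order.simps)
  then show "card (AG.ev {1..3}) = vfig_rot_order r"
    using gen[OF dist(5) l4(5), of "vfig_rot_order r"] nz unfolding s(5)[symmetric] by auto
qed

lemma ord_beta:
  assumes sch: "schlafli_symbol 4 L \<Phi> = [p, q, r]"
  shows "group.ord AG (string_group.\<beta> AG (rho L \<Phi>) 1) = p" "group.ord AG (string_group.\<beta> AG (rho L \<Phi>) 2) = q"
    "group.ord AG (string_group.\<beta> AG (rho L \<Phi>) 3) = r"
proof -
  have "[1..<4] = [1,2,3::nat]" by (simp add: upt_rec)
  moreover have "sigma L \<Phi> k = string_group.\<beta> AG (rho L \<Phi>) k" for k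
    unfolding string_group.\<beta>_def[OF string_group_AG] sigma_def by simp
  ultimately show "group.ord AG (string_group.\<beta> AG (rho L \<Phi>) 1) = p" "group.ord AG (string_group.\<beta> AG (rho L \<Phi>) 2) = q"
    "group.ord AG (string_group.\<beta> AG (rho L \<Phi>) 3) = r"
    using sch unfolding schlafli_symbol_def by auto
qed

end

text \<open>
  The face numbers are checked in multiplied form, which avoids division: the number of faces times the order of the
  stabiliser of a face is the order of \<open>\<Gamma>\<^sup>+\<close>.
\<close>

fun row_ok :: "nat set \<times> nat list \<times> nat \<times> bool \<Rightarrow> bool" where
  "row_ok (I, f, g, t) \<longleftrightarrow> I \<subseteq> {1..6} \<and> I \<noteq> {} \<and>
     (let N = (\<Prod>r\<in>I. rot_order r) in
       map2 (*) f [(if I \<inter> {1,5,6} = {} then 1 else 12) * (\<Prod>r\<in>I \<inter> {2,3,4}. vfig_rot_order r), 2 * Lcm (third_entry ` I),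
           2 * Lcm (first_entry ` I), (if I \<inter> {1,2,3} = {} then 1 else 12) * (\<Prod>r\<in>I \<inter> {4,5,6}. facet_rot_order r)] = [N, N, N, N] \<and>
       length f = 4 \<and> g = 2 * N \<and> t = (1 \<in> I \<or> I \<inter> {2,3} = {} \<or> I \<inter> {5,6} = {}))"

lemma lcm_values: "lcm 3 4 = (12::nat)" "lcm 4 3 = (12::nat)" "lcm 3 5 = (15::nat)" "lcm 5 3 = (15::nat)" "lcm 4 5 = (20::nat)" "lcm 5 4 = (20::nat)"
  "lcm 3 20 = (60::nat)" "lcm 4 15 = (60::nat)" "lcm 5 12 = (60::nat)" "lcm 3 12 = (12::nat)" "lcm 3 15 = (15::nat)" "lcm 4 12 = (12::nat)" "lcm 5 15 = (15::nat)"
  by (simp_all add: lcm_nat_def gcd_non_0_nat)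
lemma row:
  fixes P :: "nat \<Rightarrow> (real ^ 4) set" and \<Phi> :: "nat \<Rightarrow> (real ^ 4) set set"
  assumes P: "\<And>r. r \<in> {1..6} \<Longrightarrow> flagged_4polytope (P r) (\<Phi> r)"
    and sch: "\<And>r. r \<in> {1..6} \<Longrightarrow> schlafli_symbol 4 (face_lattice (P r)) (\<Phi> r) = [first_entry r, second_entry r, third_entry r]"
    and ok: "row_ok (I, f, g, t)"
  shows "let M = mix 4 I (\<lambda>r. face_lattice (P r)) \<Phi> in
      map (\<lambda>j. card (faces_of_rank M j)) [0, 1, 2, 3] = f \<and> card (flags M) = g \<and> (abstract_polytope 4 M \<longleftrightarrow> t)"
proof -
  have I: "I \<subseteq> {1..6}" "I \<noteq> {}" using ok by auto
  note F = P[OF subsetD[OF I(1)]] and sc = sch[OF subsetD[OF I(1)]]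
  have mixed: "mixed I (\<lambda>r. aut_group (face_lattice (P r))) (\<lambda>r. rho (face_lattice (P r)) (\<Phi> r))
      (\<lambda>r. flagged_4polytope.SA (P r) (\<Phi> r)) (\<lambda>r. flagged_4polytope.sgA (P r))"
  proof (rule mixed.intro[OF I])
    fix r assume r: "r \<in> I"
    show "string_group (aut_group (face_lattice (P r))) (rho (face_lattice (P r)) (\<Phi> r))
        (flagged_4polytope.SA (P r) (\<Phi> r)) (flagged_4polytope.sgA (P r))"
      by (rule flagged_4polytope.string_group_AG[OF F[OF r]])
    note o = flagged_4polytope.ord_beta[OF F[OF r] sc[OF r]]
    show "group.ord (aut_group (face_lattice (P r))) (string_group.\<beta> (aut_group (face_lattice (P r))) (rho (face_lattice (P r)) (\<Phi> r)) 1) = first_entry r"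
      "group.ord (aut_group (face_lattice (P r))) (string_group.\<beta> (aut_group (face_lattice (P r))) (rho (face_lattice (P r)) (\<Phi> r)) 2) = second_entry r"
      "group.ord (aut_group (face_lattice (P r))) (string_group.\<beta> (aut_group (face_lattice (P r))) (rho (face_lattice (P r)) (\<Phi> r)) 3) = third_entry r"
      by (rule o)+
    show "string_group.par (aut_group (face_lattice (P r))) (rho (face_lattice (P r)) (\<Phi> r)) ({..<4} - {0}) \<inter>
        string_group.par (aut_group (face_lattice (P r))) (rho (face_lattice (P r)) (\<Phi> r)) ({..<4} - {3})
        \<subseteq> string_group.par (aut_group (face_lattice (P r))) (rho (face_lattice (P r)) (\<Phi> r)) {1, 2}"
      unfolding string_group.par_def[OF flagged_4polytope.string_group_AG[OF F[OF r]]]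
      by (rule flagged_4polytope.inter_03[OF F[OF r]])
    have "r \<in> {1..6}" using I(1) r by auto
    note c = flagged_4polytope.card_ev[OF F[OF r] this sc[OF r]]
    show "card (string_group.ev (aut_group (face_lattice (P r))) (rho (face_lattice (P r)) (\<Phi> r)) {0..3}) = rot_order r"
      "card (string_group.ev (aut_group (face_lattice (P r))) (rho (face_lattice (P r)) (\<Phi> r)) {0..2}) = facet_rot_order r"
      "card (string_group.ev (aut_group (face_lattice (P r))) (rho (face_lattice (P r)) (\<Phi> r)) {1..3}) = vfig_rot_order r"
      by (rule c)+
  qed
  have len: "length f = 4" using ok by (simp add: Let_def)
  then obtain f0 f1 f2 f3 where f: "f = [f0, f1, f2, f3]"
    by (auto simp: numeral_eq_Suc length_Suc_conv)
  have nz: "rot_order r \<noteq> 0" "third_entry r \<noteq> 0" for r by (simp_all add: rot_order_def third_entry_def)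
  have N0: "(\<Prod>r\<in>I. rot_order r) \<noteq> 0" using nz I finite_subset[OF I(1)] by simp
  let ?M = "mix 4 I (\<lambda>r. face_lattice (P r)) \<Phi>" and ?N = "\<Prod>r\<in>I. rot_order r"
  have eq: "x = y" if "x * c = ?N" "y * c = ?N" for x y c
  proof -
    have "x * c = y * c" using that by simp
    moreover have "c \<noteq> 0" using that(1) N0 by (metis mult_0_right)
    ultimately show ?thesis by simp
  qed
  have o: "f0 * ((if I \<inter> {1,5,6} = {} then 1 else 12) * (\<Prod>r\<in>I \<inter> {2,3,4}. vfig_rot_order r)) = ?N"
    "f1 * (2 * Lcm (third_entry ` I)) = ?N" "f2 * (2 * Lcm (first_entry ` I)) = ?N"
    "f3 * ((if I \<inter> {1,2,3} = {} then 1 else 12) * (\<Prod>r\<in>I \<inter> {4,5,6}. facet_rot_order r)) = ?N"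
    "g = 2 * ?N" "t \<longleftrightarrow> 1 \<in> I \<or> I \<inter> {2,3} = {} \<or> I \<inter> {5,6} = {}"
    using ok unfolding f row_ok.simps Let_def by (simp_all only: zip_Cons_Cons zip.simps(1) list.map prod.case list.inject simp_thms)
  note n = mixed.numbers[OF mixed, folded mix_eq[OF mixed]]
  have "card (faces_of_rank ?M 0) = f0" "card (faces_of_rank ?M 1) = f1" "card (faces_of_rank ?M 2) = f2" "card (faces_of_rank ?M 3) = f3"
    by (rule eq[OF n(1) o(1)] eq[OF n(2) o(2)] eq[OF n(3) o(3)] eq[OF n(4) o(4)])+
  moreover have "card (flags ?M) = g" "abstract_polytope 4 ?M \<longleftrightarrow> t"
    unfolding o(5,6) using mixed.flags[OF mixed] mixed.polytopal[OF mixed] unfolding mix_eq[OF mixed] by simp_all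
  ultimately show ?thesis unfolding f Let_def by simp
qed

theorem mainTheorem8:
  fixes P :: "nat \<Rightarrow> (real ^ 4) set" and \<Phi> :: "nat \<Rightarrow> (real ^ 4) set set"
  assumes "\<And>r. r \<in> {1..6} \<Longrightarrow> regular_convex_polytope 4 (P r)"
    and "\<And>r. r \<in> {1..6} \<Longrightarrow> \<Phi> r \<in> flags (face_lattice (P r))"
    and "schlafli_symbol 4 (face_lattice (P 1)) (\<Phi> 1) = [3, 3, 3]"
    and "schlafli_symbol 4 (face_lattice (P 2)) (\<Phi> 2) = [3, 3, 4]"
    and "schlafli_symbol 4 (face_lattice (P 3)) (\<Phi> 3) = [3, 3, 5]"
    and "schlafli_symbol 4 (face_lattice (P 4)) (\<Phi> 4) = [3, 4, 3]"
    and "schlafli_symbol 4 (face_lattice (P 5)) (\<Phi> 5) = [4, 3, 3]"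
    and "schlafli_symbol 4 (face_lattice (P 6)) (\<Phi> 6) = [5, 3, 3]"
  shows "\<forall>(I, f, g, polytopal) \<in> set
     [({1, 2}, [40, 480, 1920, 960], 23040, True),
      ({1, 3}, [600, 14400, 72000, 36000], 864000, True),
      ({1, 4}, [120, 5760, 5760, 120], 69120, True),
      ({1, 5}, [960, 1920, 480, 40], 23040, True),
      ({1, 6}, [36000, 72000, 14400, 600], 864000, True),
      ({2, 3}, [960, 34560, 230400, 115200], 2764800, True),
      ({2, 4}, [192, 4608, 18432, 384], 221184, True),
      ({2, 5}, [128, 1536, 1536, 128], 73728, False),
      ({2, 6}, [4800, 57600, 46080, 1920], 2764800, False),
      ({3, 4}, [2880, 138240, 691200, 14400], 8294400, True),
      ({3, 5}, [1920, 46080, 57600, 4800], 2764800, False),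
      ({3, 6}, [72000, 1728000, 1728000, 72000], 103680000, False),
      ({4, 5}, [384, 18432, 4608, 192], 221184, True),
      ({4, 6}, [14400, 691200, 138240, 2880], 8294400, True),
      ({5, 6}, [115200, 230400, 34560, 960], 2764800, True),
      ({1, 2, 3}, [4800, 691200, 13824000, 6912000], 165888000, True),
      ({1, 2, 4}, [960, 276480, 1105920, 23040], 13271040, True),
      ({1, 2, 5}, [7680, 92160, 92160, 7680], 4423680, True),
      ({1, 2, 6}, [288000, 3456000, 2764800, 115200], 165888000, True),
      ({1, 3, 4}, [14400, 8294400, 41472000, 864000], 497664000, True),
      ({1, 3, 5}, [115200, 2764800, 3456000, 288000], 165888000, True),
      ({1, 3, 6}, [4320000, 103680000, 103680000, 4320000], 6220800000, True),
      ({1, 4, 5}, [23040, 1105920, 276480, 960], 13271040, True),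
      ({1, 4, 6}, [864000, 41472000, 8294400, 14400], 497664000, True),
      ({1, 5, 6}, [6912000, 13824000, 691200, 4800], 165888000, True),
      ({2, 3, 4}, [23040, 6635520, 132710400, 2764800], 1592524800, True),
      ({2, 3, 5}, [15360, 2211840, 11059200, 921600], 530841600, False),
      ({2, 3, 6}, [576000, 82944000, 331776000, 13824000], 19906560000, False),
      ({2, 4, 5}, [3072, 884736, 884736, 3072], 42467328, False),
      ({2, 4, 6}, [115200, 33177600, 26542080, 46080], 1592524800, False),
      ({2, 5, 6}, [921600, 11059200, 2211840, 15360], 530841600, False),
      ({3, 4, 5}, [46080, 26542080, 33177600, 115200], 1592524800, False),
      ({3, 4, 6}, [1728000, 995328000, 995328000, 1728000], 59719680000, False),
      ({3, 5, 6}, [13824000, 331776000, 82944000, 576000], 19906560000, False),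
      ({4, 5, 6}, [2764800, 132710400, 6635520, 23040], 1592524800, True)].
     let M = mix 4 I (\<lambda>r. face_lattice (P r)) \<Phi> in
       map (\<lambda>j. card (faces_of_rank M j)) [0, 1, 2, 3] = f \<and>
       card (flags M) = g \<and>
       (abstract_polytope 4 M \<longleftrightarrow> polytopal)"
proof -
  have F: "flagged_4polytope (P r) (\<Phi> r)" if "r \<in> {1..6}" for r
    using assms(1,2)[OF that] by (intro flagged_4polytope.intro flagged_4polytope_axioms.intro regular_4polytope.intro)
  have sch: "schlafli_symbol 4 (face_lattice (P r)) (\<Phi> r) = [first_entry r, second_entry r, third_entry r]" if r: "r \<in> {1..6}" for r
  proof -
    have "1 \<le> r \<and> r \<le> 6" using r by simp
    then have "r = 1 \<or> r = 2 \<or> r = 3 \<or> r = 4 \<or> r = 5 \<or> r = 6" by linarith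
    then show ?thesis using assms(3-8) by (elim disjE) (simp_all add: first_entry_def second_entry_def third_entry_def del: One_nat_def)
  qed
  show ?thesis (is "\<forall>x\<in>set ?rows. ?Q x")
  proof
    have "list_all row_ok ?rows"
      by (simp add: rot_order_def vfig_rot_order_def facet_rot_order_def third_entry_def first_entry_def lcm_values Lcm_insert del: One_nat_def)
    fix x assume "x \<in> set ?rows"
    with \<open>list_all row_ok ?rows\<close> have "row_ok x" unfolding list_all_iff by (rule bspec)
    then show "?Q x" using row[OF F sch] by (cases x) simp
  qed
qed

end
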